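(* Let $X$ be a scheme and let $\mathrm{cl}$ be an openly persistent preclosure operation on modules over $X$. Let $\mathcal{M}$ be a quasi-coherent $\mathcal{O}_X$-module and let $\mathcal{L}\subseteq\mathcal{M}$ be a sheaf of $\mathcal{O}_X$-submodules (not assumed quasi-coherent). For $U\subseteq X$ open, let $\mathcal{L}^{\mathrm{cl}}_{\mathcal{M}}(U)$ be the set of all $s\in\mathcal{M}(U)$ such that for every $x\in U$ there is an affine open set $V$ with $x\in V\subseteq U$ and $s|_V\in\mathcal{L}(V)^{\mathrm{cl}}_{\mathcal{M}(V)}$ (closure taken over the ring $\mathcal{O}_X(V)$). Then: (1) For $U\subseteq X$ open and $s\in\mathcal{M}(U)$, we have $s\in\mathcal{L}^{\mathrm{cl}}_{\mathcal{M}}(U)$ if and only if there is a collection $\{U_\alpha\}_{\alpha\in A}$ of affine open subsets of $U$ with $U=\bigcup_{\alpha\in A}U_\alpha$ such that $s|_{U_\alpha}\in\mathcal{L}(U_\alpha)^{\mathrm{cl}}_{\mathcal{M}(U_\alpha)}$ for all $\alpha\in A$. (2) $\mathcal{L}^{\mathrm{cl}}_{\mathcal{M}}$ is a subsheaf of $\mathcal{O}_X$-modules of $\mathcal{M}$. (3) The assignment $\mathcal{L}\mapsto\mathcal{L}^{\mathrm{cl}}_{\mathcal{M}}$ is a preclosure operation on sheaves of submodules of $\mathcal{M}$: for every sheaf of submodules $\mathcal{L}$ of $\mathcal{M}$ we have $\mathcal{L}\subseteq\mathcal{L}^{\mathrm{cl}}_{\mathcal{M}}$, and whenever $\mathcal{K}\subseteq\mathcal{L}\subseteq\mathcal{M}$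 are inclusions of sheaves of submodules, $\mathcal{K}^{\mathrm{cl}}_{\mathcal{M}}$ is a subsheaf of $\mathcal{L}^{\mathrm{cl}}_{\mathcal{M}}$. (4) If moreover $X$ is Noetherian, $\mathcal{M}$ is coherent, and $\mathrm{cl}$ is a closure operation (i.e. idempotent), then $\left(\mathcal{L}^{\mathrm{cl}}_{\mathcal{M}}\right)^{\mathrm{cl}}_{\mathcal{M}}=\mathcal{L}^{\mathrm{cl}}_{\mathcal{M}}$ for every sheaf of submodules $\mathcal{L}$ of $\mathcal{M}$.
   Context: All rings are commutative with $1$. A preclosure operation on a poset $(S,\le)$ is a map $s\mapsto s^{\mathrm{cl}}$ that is extensive ($s\le s^{\mathrm{cl}}$) and order-preserving ($s\le t\Rightarrow s^{\mathrm{cl}}\le t^{\mathrm{cl}}$); it is a closure operation if also idempotent ($(s^{\mathrm{cl}})^{\mathrm{cl}}=s^{\mathrm{cl}}$). A preclosure (resp. closure) operation $\mathrm{cl}$ on modules over a scheme $X$ gives, for every affine open $U\subseteq X$ and every module $M$ over $S=\mathcal{O}_X(U)$, a preclosure (resp. closure) operation $L\mapsto L^{\mathrm{cl}}_M$ on the poset of $S$-submodules of $M$. Canonically isomorphic modules are identified, so the operation is understood to be compatible with module isomorphisms. For modules $L\subseteq M$ over $R$ and a ring map $R\to S$, $LS$ denotes the image of $L\otimes_RS\to M\otimes_RS$. The operation $\mathrm{cl}$ is openly persistent on modules over $X$ if for all affine opens $V\subseteq U\subseteq X$, with $R=\mathcal{O}_X(U)$ and $S=\mathcal{O}_X(V)$,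 all $R$-modules $L\subseteq M$ and all $x\in L^{\mathrm{cl}}_M$, we have $x\otimes1\in(LS)^{\mathrm{cl}}_{M\otimes_RS}$. *)

theory Defs
  imports
    "HOL-Analysis.Abstract_Topology"
    "HOL-Algebra.QuotRing"
    "HOL-Algebra.Module"
    "HOL-Algebra.Ring_Divisibility"
    "HOL-Algebra.Free_Abelian_Groups"
begin

text \<open>
  Rings are commutative rings \<^const>\<open>cring\<close> with one; the zero ring is allowed, as it is the
  ring of sections over the empty set. Modules are those of \<open>HOL-Algebra.Module\<close>, whose
  record type also carries the two ring fields for multiplication and one. These have no meaning
  for a module, and \<open>linear_iso\<close> below ignores them.
\<close>

section \<open>Modules: isomorphisms, finite generation, base change\<close>

text \<open>Bijections that are additive and semilinear along a map \<open>\<phi>\<close> of the scalars.\<close>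

definition semilinear_iso ::
    "('r, 'k) ring_scheme \<Rightarrow> ('r \<Rightarrow> 's) \<Rightarrow> ('r, 'a) module \<Rightarrow> ('s, 'b) module \<Rightarrow> ('a \<Rightarrow> 'b) set" where
  "semilinear_iso R \<phi> M N =
    {h. bij_betw h (carrier M) (carrier N) \<and>
        (\<forall>x\<in>carrier M. \<forall>y\<in>carrier M. h (x \<oplus>\<^bsub>M\<^esub> y) = h x \<oplus>\<^bsub>N\<^esub> h y) \<and>
        (\<forall>r\<in>carrier R. \<forall>x\<in>carrier M. h (r \<odot>\<^bsub>M\<^esub> x) = \<phi> r \<odot>\<^bsub>N\<^esub> h x)}"

definition linear_iso ::
    "('r, 'k) ring_scheme \<Rightarrow> ('r, 'a) module \<Rightarrow> ('r, 'b) module \<Rightarrow> ('a \<Rightarrow> 'b) set" where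
  "linear_iso R M N = semilinear_iso R (\<lambda>r. r) M N"

definition finitely_generated_module :: "('r, 'k) ring_scheme \<Rightarrow> ('r, 'm) module \<Rightarrow> bool" where
  "finitely_generated_module R M \<longleftrightarrow>
    (\<exists>F. finite F \<and> F \<subseteq> carrier M \<and>
      (\<forall>m\<in>carrier M. \<exists>c\<in>F \<rightarrow> carrier R. m = (\<Oplus>\<^bsub>M\<^esub>x\<in>F. c x \<odot>\<^bsub>M\<^esub> x)))"

text \<open>
  The tensor product of an \<open>R\<close>-module \<open>M\<close> with \<open>S\<close> along \<open>\<phi> : R \<rightarrow> S\<close>: the free abelian group on
  \<open>M \<times> S\<close> modulo the subgroup generated by the bilinearity relations; its elements are cosets.
\<close>

definition tensor_relators ::
    "'r ring \<Rightarrow> ('r, 'm) module \<Rightarrow> 's ring \<Rightarrow> ('r \<Rightarrow> 's) \<Rightarrow> (('m \<times> 's) \<Rightarrow>\<^sub>0 int) set" where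
  "tensor_relators R M S \<phi> =
    {frag_of (m \<oplus>\<^bsub>M\<^esub> m', s) - frag_of (m, s) - frag_of (m', s) | m m' s.
       m \<in> carrier M \<and> m' \<in> carrier M \<and> s \<in> carrier S} \<union>
    {frag_of (m, s \<oplus>\<^bsub>S\<^esub> s') - frag_of (m, s) - frag_of (m, s') | m s s'.
       m \<in> carrier M \<and> s \<in> carrier S \<and> s' \<in> carrier S} \<union>
    {frag_of (r \<odot>\<^bsub>M\<^esub> m, s) - frag_of (m, \<phi> r \<otimes>\<^bsub>S\<^esub> s) | r m s.
       r \<in> carrier R \<and> m \<in> carrier M \<and> s \<in> carrier S}"

definition tensor_free ::
    "('r, 'm) module \<Rightarrow> 's ring \<Rightarrow> (('m \<times> 's) \<Rightarrow>\<^sub>0 int) monoid" where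
  "tensor_free M S = free_Abelian_group (carrier M \<times> carrier S)"

definition tensor_kernel ::
    "'r ring \<Rightarrow> ('r, 'm) module \<Rightarrow> 's ring \<Rightarrow> ('r \<Rightarrow> 's) \<Rightarrow> (('m \<times> 's) \<Rightarrow>\<^sub>0 int) set" where
  "tensor_kernel R M S \<phi> = generate (tensor_free M S) (tensor_relators R M S \<phi>)"

definition tensor_class ::
    "'r ring \<Rightarrow> ('r, 'm) module \<Rightarrow> 's ring \<Rightarrow> ('r \<Rightarrow> 's) \<Rightarrow> (('m \<times> 's) \<Rightarrow>\<^sub>0 int) \<Rightarrow>
      (('m \<times> 's) \<Rightarrow>\<^sub>0 int) set" where
  "tensor_class R M S \<phi> c = tensor_kernel R M S \<phi> #>\<^bsub>tensor_free M S\<^esub> c"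

definition pure_tensor ::
    "'r ring \<Rightarrow> ('r, 'm) module \<Rightarrow> 's ring \<Rightarrow> ('r \<Rightarrow> 's) \<Rightarrow> 'm \<Rightarrow> 's \<Rightarrow>
      (('m \<times> 's) \<Rightarrow>\<^sub>0 int) set" where
  "pure_tensor R M S \<phi> m s = tensor_class R M S \<phi> (frag_of (m, s))"

definition base_change ::
    "'r ring \<Rightarrow> ('r, 'm) module \<Rightarrow> 's ring \<Rightarrow> ('r \<Rightarrow> 's) \<Rightarrow>
      ('s, (('m \<times> 's) \<Rightarrow>\<^sub>0 int) set) module" where
  "base_change R M S \<phi> =
    (let Q = tensor_free M S Mod tensor_kernel R M S \<phi> in
     \<lparr>carrier = carrier Q, mult = undefined, one = undefined,
      ring.zero = \<one>\<^bsub>Q\<^esub>, add = monoid.mult Q,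
      smult = (\<lambda>a C. \<Union>c\<in>C. tensor_class R M S \<phi>
                 (frag_extend (\<lambda>(m, s). frag_of (m, a \<otimes>\<^bsub>S\<^esub> s)) c))\<rparr>)"

text \<open>\<open>LS\<close>, the image of the canonical map from the tensor product of \<open>L\<close> with \<open>S\<close>: it sends
  the class of a formal sum over \<open>L \<times> S\<close> to the class of the same formal sum over \<open>M \<times> S\<close>.\<close>

definition extended_submodule ::
    "'r ring \<Rightarrow> ('r, 'm) module \<Rightarrow> 's ring \<Rightarrow> ('r \<Rightarrow> 's) \<Rightarrow> 'm set \<Rightarrow>
      (('m \<times> 's) \<Rightarrow>\<^sub>0 int) set set" where
  "extended_submodule R M S \<phi> L =
    tensor_class R M S \<phi> ` carrier (free_Abelian_group (L \<times> carrier S))"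

section \<open>Localization\<close>

text \<open>A fraction is the set of all pairs (numerator, denominator) representing it.\<close>

definition ring_frac :: "'a ring \<Rightarrow> 'a set \<Rightarrow> 'a \<Rightarrow> 'a \<Rightarrow> ('a \<times> 'a) set" where
  "ring_frac A D a s =
    {(b, t). b \<in> carrier A \<and> t \<in> D \<and>
      (\<exists>u\<in>D. u \<otimes>\<^bsub>A\<^esub> (t \<otimes>\<^bsub>A\<^esub> a) = u \<otimes>\<^bsub>A\<^esub> (s \<otimes>\<^bsub>A\<^esub> b))}"

definition ring_loc :: "'a ring \<Rightarrow> 'a set \<Rightarrow> ('a \<times> 'a) set ring" where
  "ring_loc A D =
    \<lparr>carrier = {ring_frac A D a s | a s. a \<in> carrier A \<and> s \<in> D},
     mult = (\<lambda>x y. \<Union>(a, s)\<in>x. \<Union>(b, t)\<in>y. ring_frac A D (a \<otimes>\<^bsub>A\<^esub> b) (s \<otimes>\<^bsub>A\<^esub> t)),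
     one = ring_frac A D \<one>\<^bsub>A\<^esub> \<one>\<^bsub>A\<^esub>,
     ring.zero = ring_frac A D \<zero>\<^bsub>A\<^esub> \<one>\<^bsub>A\<^esub>,
     add = (\<lambda>x y. \<Union>(a, s)\<in>x. \<Union>(b, t)\<in>y.
              ring_frac A D (t \<otimes>\<^bsub>A\<^esub> a \<oplus>\<^bsub>A\<^esub> s \<otimes>\<^bsub>A\<^esub> b) (s \<otimes>\<^bsub>A\<^esub> t))\<rparr>"

definition module_frac ::
    "'a ring \<Rightarrow> ('a, 'm) module \<Rightarrow> 'a set \<Rightarrow> 'm \<Rightarrow> 'a \<Rightarrow> ('m \<times> 'a) set" where
  "module_frac A N D m s =
    {(n, t). n \<in> carrier N \<and> t \<in> D \<and>
      (\<exists>u\<in>D. u \<odot>\<^bsub>N\<^esub> (t \<odot>\<^bsub>N\<^esub> m) = u \<odot>\<^bsub>N\<^esub> (s \<odot>\<^bsub>N\<^esub> n))}"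

definition module_loc ::
    "'a ring \<Rightarrow> ('a, 'm) module \<Rightarrow> 'a set \<Rightarrow> (('a \<times> 'a) set, ('m \<times> 'a) set) module" where
  "module_loc A N D =
    \<lparr>carrier = {module_frac A N D m s | m s. m \<in> carrier N \<and> s \<in> D},
     mult = undefined, one = undefined,
     ring.zero = module_frac A N D \<zero>\<^bsub>N\<^esub> \<one>\<^bsub>A\<^esub>,
     add = (\<lambda>x y. \<Union>(m, s)\<in>x. \<Union>(n, t)\<in>y.
              module_frac A N D (t \<odot>\<^bsub>N\<^esub> m \<oplus>\<^bsub>N\<^esub> s \<odot>\<^bsub>N\<^esub> n) (s \<otimes>\<^bsub>A\<^esub> t)),
     smult = (\<lambda>x y. \<Union>(a, s)\<in>x. \<Union>(n, t)\<in>y. module_frac A N D (a \<odot>\<^bsub>N\<^esub> n) (s \<otimes>\<^bsub>A\<^esub> t))\<rparr>"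

section \<open>Sheaves and ringed spaces\<close>

text \<open>\<open>sec\<close> gives the sets of sections over the open sets and \<open>res U V\<close> the restriction from
  \<open>U\<close> to \<open>V\<close>; values at sets that are not open are irrelevant.\<close>

definition presheaf_on ::
    "'x topology \<Rightarrow> ('x set \<Rightarrow> 's set) \<Rightarrow> ('x set \<Rightarrow> 'x set \<Rightarrow> 's \<Rightarrow> 's) \<Rightarrow> bool" where
  "presheaf_on T sec res \<longleftrightarrow>
    (\<forall>U V. openin T U \<and> openin T V \<and> V \<subseteq> U \<longrightarrow> res U V \<in> sec U \<rightarrow> sec V) \<and>
    (\<forall>U. openin T U \<longrightarrow> (\<forall>s\<in>sec U. res U U s = s)) \<and>
    (\<forall>U V W. openin T U \<and> openin T V \<and> openin T W \<and> W \<subseteq> V \<and> V \<subseteq> U \<longrightarrow>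
      (\<forall>s\<in>sec U. res V W (res U V s) = res U W s))"

definition sheaf_on ::
    "'x topology \<Rightarrow> ('x set \<Rightarrow> 's set) \<Rightarrow> ('x set \<Rightarrow> 'x set \<Rightarrow> 's \<Rightarrow> 's) \<Rightarrow> bool" where
  "sheaf_on T sec res \<longleftrightarrow> presheaf_on T sec res \<and>
    (\<forall>\<C>. (\<forall>V\<in>\<C>. openin T V) \<longrightarrow>
      (\<forall>s\<in>sec (\<Union>\<C>). \<forall>t\<in>sec (\<Union>\<C>). (\<forall>V\<in>\<C>. res (\<Union>\<C>) V s = res (\<Union>\<C>) V t) \<longrightarrow> s = t) \<and>
      (\<forall>s. (\<forall>V\<in>\<C>. s V \<in> sec V) \<and>
           (\<forall>V\<in>\<C>. \<forall>W\<in>\<C>. res V (V \<inter> W) (s V) = res W (V \<inter> W) (s W)) \<longrightarrow>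
           (\<exists>t\<in>sec (\<Union>\<C>). \<forall>V\<in>\<C>. res (\<Union>\<C>) V t = s V)))"

record ('x, 'r) ringed_space =
  space_top :: "'x topology"
  rsec :: "'x set \<Rightarrow> 'r ring"
  rres :: "'x set \<Rightarrow> 'x set \<Rightarrow> 'r \<Rightarrow> 'r"

definition ringed_space :: "('x, 'r) ringed_space \<Rightarrow> bool" where
  "ringed_space X \<longleftrightarrow>
    (\<forall>U. openin (space_top X) U \<longrightarrow> cring (rsec X U)) \<and>
    (\<forall>U V. openin (space_top X) U \<and> openin (space_top X) V \<and> V \<subseteq> U \<longrightarrow>
      rres X U V \<in> ring_hom (rsec X U) (rsec X V)) \<and>
    sheaf_on (space_top X) (\<lambda>U. carrier (rsec X U)) (rres X)"

definition germ :: "('x, 'r) ringed_space \<Rightarrow> 'x \<Rightarrow> 'x set \<Rightarrow> 'r \<Rightarrow> ('x set \<times> 'r) set" where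
  "germ X x U s =
    {(V, t). openin (space_top X) V \<and> x \<in> V \<and> t \<in> carrier (rsec X V) \<and>
      (\<exists>W. openin (space_top X) W \<and> x \<in> W \<and> W \<subseteq> U \<inter> V \<and> rres X U W s = rres X V W t)}"

definition stalk :: "('x, 'r) ringed_space \<Rightarrow> 'x \<Rightarrow> ('x set \<times> 'r) set ring" where
  "stalk X x =
    \<lparr>carrier = {germ X x U s | U s. openin (space_top X) U \<and> x \<in> U \<and> s \<in> carrier (rsec X U)},
     mult = (\<lambda>g h. \<Union>(U, s)\<in>g. \<Union>(V, t)\<in>h. germ X x (U \<inter> V)
              (rres X U (U \<inter> V) s \<otimes>\<^bsub>rsec X (U \<inter> V)\<^esub> rres X V (U \<inter> V) t)),
     one = germ X x (topspace (space_top X)) \<one>\<^bsub>rsec X (topspace (space_top X))\<^esub>,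
     ring.zero = germ X x (topspace (space_top X)) \<zero>\<^bsub>rsec X (topspace (space_top X))\<^esub>,
     add = (\<lambda>g h. \<Union>(U, s)\<in>g. \<Union>(V, t)\<in>h. germ X x (U \<inter> V)
              (rres X U (U \<inter> V) s \<oplus>\<^bsub>rsec X (U \<inter> V)\<^esub> rres X V (U \<inter> V) t))\<rparr>"

definition locally_ringed_space :: "('x, 'r) ringed_space \<Rightarrow> bool" where
  "locally_ringed_space X \<longleftrightarrow> ringed_space X \<and>
    (\<forall>x\<in>topspace (space_top X). \<exists>!\<mm>. maximalideal \<mm> (stalk X x))"

definition open_subspace :: "('x, 'r) ringed_space \<Rightarrow> 'x set \<Rightarrow> ('x, 'r) ringed_space" where
  "open_subspace X U = X\<lparr>space_top := subtopology (space_top X) U\<rparr>"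

definition inv_img :: "('x, 'r) ringed_space \<Rightarrow> ('x \<Rightarrow> 'y) \<Rightarrow> 'y set \<Rightarrow> 'x set" where
  "inv_img X f V = {x \<in> topspace (space_top X). f x \<in> V}"

text \<open>An isomorphism of ringed spaces consists of a homeomorphism \<open>f\<close> and compatible ring
  isomorphisms \<open>\<phi> V\<close> from the sections over \<open>V\<close> to those over the preimage of \<open>V\<close>. Between
  locally ringed spaces it induces isomorphisms of stalks, which are automatically local.\<close>

definition ringed_space_iso ::
    "('x, 'r) ringed_space \<Rightarrow> ('y, 'q) ringed_space \<Rightarrow> ('x \<Rightarrow> 'y) \<Rightarrow> ('y set \<Rightarrow> 'q \<Rightarrow> 'r) \<Rightarrow> bool" where
  "ringed_space_iso X Y f \<phi> \<longleftrightarrow>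
    homeomorphic_map (space_top X) (space_top Y) f \<and>
    (\<forall>V. openin (space_top Y) V \<longrightarrow> \<phi> V \<in> ring_iso (rsec Y V) (rsec X (inv_img X f V))) \<and>
    (\<forall>V W. openin (space_top Y) V \<and> openin (space_top Y) W \<and> W \<subseteq> V \<longrightarrow>
      (\<forall>s\<in>carrier (rsec Y V).
        rres X (inv_img X f V) (inv_img X f W) (\<phi> V s) = \<phi> W (rres Y V W s)))"

section \<open>Affine schemes and schemes\<close>

definition zariski_open :: "'a ring \<Rightarrow> 'a set \<Rightarrow> 'a set set" where
  "zariski_open A E = {\<pp>. primeideal \<pp> A \<and> \<not> E \<subseteq> \<pp>}"

definition zariski :: "'a ring \<Rightarrow> 'a set topology" where
  "zariski A = topology (\<lambda>U. \<exists>E\<subseteq>carrier A. U = zariski_open A E)"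

lemma openin_zariski: "openin (zariski A) U \<longleftrightarrow> (\<exists>E\<subseteq>carrier A. U = zariski_open A E)"
proof -
  have "istopology (\<lambda>U. \<exists>E\<subseteq>carrier A. U = zariski_open A E)"
    unfolding istopology_def
  proof (intro conjI allI impI)
    fix U V
    assume "\<exists>E\<subseteq>carrier A. U = zariski_open A E" "\<exists>E\<subseteq>carrier A. V = zariski_open A E"
    then obtain E F where E: "E \<subseteq> carrier A" "U = zariski_open A E"
      and F: "F \<subseteq> carrier A" "V = zariski_open A F" by auto
    let ?G = "{a \<otimes>\<^bsub>A\<^esub> b | a b. a \<in> E \<and> b \<in> F}"
    have iff: "\<not> ?G \<subseteq> \<pp> \<longleftrightarrow> \<not> E \<subseteq> \<pp> \<and> \<not> F \<subseteq> \<pp>" if p: "primeideal \<pp> A" for \<pp>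
    proof
      interpret primeideal \<pp> A by (rule p)
      show "\<not> E \<subseteq> \<pp> \<and> \<not> F \<subseteq> \<pp>" if "\<not> ?G \<subseteq> \<pp>"
        using that E(1) F(1) I_l_closed I_r_closed by blast
      show "\<not> ?G \<subseteq> \<pp>" if nt: "\<not> E \<subseteq> \<pp> \<and> \<not> F \<subseteq> \<pp>"
      proof -
        obtain a b where ab: "a \<in> E" "a \<notin> \<pp>" "b \<in> F" "b \<notin> \<pp>" using nt by auto
        then have "a \<otimes>\<^bsub>A\<^esub> b \<notin> \<pp>" using I_prime E(1) F(1) by blast
        then show ?thesis using ab by blast
      qed
    qed
    have sub: "?G \<subseteq> carrier A" if ne: "U \<inter> V \<noteq> {}"
    proof -
      obtain \<pp> where "primeideal \<pp> A" using ne E(2) by (auto simp: zariski_open_def)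
      then interpret primeideal \<pp> A .
      show ?thesis using E(1) F(1) by auto
    qed
    have eq: "U \<inter> V = zariski_open A ?G"
      unfolding E(2) F(2) zariski_open_def Int_def mem_Collect_eq using iff by blast
    show "\<exists>G\<subseteq>carrier A. U \<inter> V = zariski_open A G"
    proof (cases "U \<inter> V = {}")
      case True
      then show ?thesis by (intro exI[of _ "{}"]) (auto simp: zariski_open_def)
    next
      case False
      then show ?thesis using sub eq by blast
    qed
  next
    fix \<U> :: "'a set set set"
    assume "\<forall>U\<in>\<U>. \<exists>E\<subseteq>carrier A. U = zariski_open A E"
    then obtain E where E: "\<And>U. U \<in> \<U> \<Longrightarrow> E U \<subseteq> carrier A \<and> U = zariski_open A (E U)"
      by metis
    have "\<Union>\<U> = zariski_open A (\<Union>(E ` \<U>))"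
    proof (rule Set.set_eqI)
      fix \<pp>
      have "\<pp> \<in> \<Union>\<U> \<longleftrightarrow> (\<exists>U\<in>\<U>. \<pp> \<in> zariski_open A (E U))" using E by blast
      also have "\<dots> \<longleftrightarrow> \<pp> \<in> zariski_open A (\<Union>(E ` \<U>))" by (auto simp: zariski_open_def)
      finally show "\<pp> \<in> \<Union>\<U> \<longleftrightarrow> \<pp> \<in> zariski_open A (\<Union>(E ` \<U>))" .
    qed
    moreover have "\<Union>(E ` \<U>) \<subseteq> carrier A" using E by blast
    ultimately show "\<exists>F\<subseteq>carrier A. \<Union>\<U> = zariski_open A F" by blast
  qed
  then show ?thesis by (simp add: zariski_def topology_inverse')
qed

text \<open>Sections of the structure sheaf are functions, undefined outside their domain, with values
  in the localizations at the points, that are locally given by a fixed fraction.\<close>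

definition spec_sections :: "'a ring \<Rightarrow> 'a set set \<Rightarrow> ('a set \<Rightarrow> ('a \<times> 'a) set) set" where
  "spec_sections A U =
    {s \<in> extensional U. \<forall>\<pp>\<in>U. \<exists>V. openin (zariski A) V \<and> \<pp> \<in> V \<and> V \<subseteq> U \<and>
      (\<exists>a\<in>carrier A. \<exists>f\<in>carrier A. \<forall>\<qq>\<in>V. f \<notin> \<qq> \<and>
        s \<qq> = ring_frac A (carrier A - \<qq>) a f)}"

definition Spec :: "'a ring \<Rightarrow> ('a set, 'a set \<Rightarrow> ('a \<times> 'a) set) ringed_space" where
  "Spec A =
    \<lparr>space_top = zariski A,
     rsec = (\<lambda>U.
      \<lparr>carrier = spec_sections A U,
       mult = (\<lambda>s t. \<lambda>\<pp>\<in>U. s \<pp> \<otimes>\<^bsub>ring_loc A (carrier A - \<pp>)\<^esub> t \<pp>),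
       one = (\<lambda>\<pp>\<in>U. \<one>\<^bsub>ring_loc A (carrier A - \<pp>)\<^esub>),
       ring.zero = (\<lambda>\<pp>\<in>U. \<zero>\<^bsub>ring_loc A (carrier A - \<pp>)\<^esub>),
       add = (\<lambda>s t. \<lambda>\<pp>\<in>U. s \<pp> \<oplus>\<^bsub>ring_loc A (carrier A - \<pp>)\<^esub> t \<pp>)\<rparr>),
     rres = (\<lambda>U V s. restrict s V)\<rparr>"

text \<open>\<open>(f, \<phi>)\<close> identifies the open subspace \<open>U\<close> with \<open>Spec A\<close>. Requiring the elements of \<open>A\<close> to
  have the type of the sections is no restriction: \<open>A\<close> is isomorphic to the sections over \<open>U\<close>.\<close>

definition affine_chart ::
    "('x, 'r) ringed_space \<Rightarrow> 'x set \<Rightarrow> 'r ring \<Rightarrow> ('x \<Rightarrow> 'r set) \<Rightarrow>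
      ('r set set \<Rightarrow> ('r set \<Rightarrow> ('r \<times> 'r) set) \<Rightarrow> 'r) \<Rightarrow> bool" where
  "affine_chart X U A f \<phi> \<longleftrightarrow> openin (space_top X) U \<and> cring A \<and>
    ringed_space_iso (open_subspace X U) (Spec A) f \<phi>"

definition affine_open :: "('x, 'r) ringed_space \<Rightarrow> 'x set \<Rightarrow> bool" where
  "affine_open X U \<longleftrightarrow> (\<exists>A f \<phi>. affine_chart X U A f \<phi>)"

definition scheme :: "('x, 'r) ringed_space \<Rightarrow> bool" where
  "scheme X \<longleftrightarrow> locally_ringed_space X \<and>
    (\<forall>x\<in>topspace (space_top X). \<exists>U. affine_open X U \<and> x \<in> U)"

definition noetherian_scheme :: "('x, 'r) ringed_space \<Rightarrow> bool" where
  "noetherian_scheme X \<longleftrightarrow> scheme X \<and> compact_space (space_top X) \<and>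
    (\<forall>x\<in>topspace (space_top X). \<exists>U A f \<phi>. affine_chart X U A f \<phi> \<and> x \<in> U \<and> noetherian_ring A)"

section \<open>Sheaves of modules\<close>

record ('x, 'r, 'm) sheaf_module =
  msec :: "'x set \<Rightarrow> ('r, 'm) module"
  mres :: "'x set \<Rightarrow> 'x set \<Rightarrow> 'm \<Rightarrow> 'm"

definition O_module :: "('x, 'r) ringed_space \<Rightarrow> ('x, 'r, 'm) sheaf_module \<Rightarrow> bool" where
  "O_module X M \<longleftrightarrow>
    (\<forall>U. openin (space_top X) U \<longrightarrow> Module.module (rsec X U) (msec M U)) \<and>
    (\<forall>U V. openin (space_top X) U \<and> openin (space_top X) V \<and> V \<subseteq> U \<longrightarrow>
      (\<forall>s\<in>carrier (msec M U). \<forall>t\<in>carrier (msec M U).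
        mres M U V (s \<oplus>\<^bsub>msec M U\<^esub> t) = mres M U V s \<oplus>\<^bsub>msec M V\<^esub> mres M U V t) \<and>
      (\<forall>r\<in>carrier (rsec X U). \<forall>s\<in>carrier (msec M U).
        mres M U V (r \<odot>\<^bsub>msec M U\<^esub> s) = rres X U V r \<odot>\<^bsub>msec M V\<^esub> mres M U V s)) \<and>
    sheaf_on (space_top X) (\<lambda>U. carrier (msec M U)) (mres M)"

definition tilde_sections ::
    "'a ring \<Rightarrow> ('a, 'm) module \<Rightarrow> 'a set set \<Rightarrow> ('a set \<Rightarrow> ('m \<times> 'a) set) set" where
  "tilde_sections A N U =
    {s \<in> extensional U. \<forall>\<pp>\<in>U. \<exists>V. openin (zariski A) V \<and> \<pp> \<in> V \<and> V \<subseteq> U \<and>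
      (\<exists>n\<in>carrier N. \<exists>f\<in>carrier A. \<forall>\<qq>\<in>V. f \<notin> \<qq> \<and>
        s \<qq> = module_frac A N (carrier A - \<qq>) n f)}"

definition tilde ::
    "'a ring \<Rightarrow> ('a, 'm) module \<Rightarrow>
      ('a set, 'a set \<Rightarrow> ('a \<times> 'a) set, 'a set \<Rightarrow> ('m \<times> 'a) set) sheaf_module" where
  "tilde A N =
    \<lparr>msec = (\<lambda>U.
      \<lparr>carrier = tilde_sections A N U, mult = undefined, one = undefined,
       ring.zero = (\<lambda>\<pp>\<in>U. \<zero>\<^bsub>module_loc A N (carrier A - \<pp>)\<^esub>),
       add = (\<lambda>s t. \<lambda>\<pp>\<in>U. s \<pp> \<oplus>\<^bsub>module_loc A N (carrier A - \<pp>)\<^esub> t \<pp>),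
       smult = (\<lambda>r s. \<lambda>\<pp>\<in>U. r \<pp> \<odot>\<^bsub>module_loc A N (carrier A - \<pp>)\<^esub> s \<pp>)\<rparr>),
     mres = (\<lambda>U V s. restrict s V)\<rparr>"

text \<open>\<open>M\<close> restricted to \<open>U\<close> is isomorphic to the sheaf associated with \<open>N\<close>, under the
  identification of \<open>U\<close> with \<open>Spec A\<close>.\<close>

definition tilde_on_chart ::
    "('x, 'r) ringed_space \<Rightarrow> ('x, 'r, 'm) sheaf_module \<Rightarrow> 'x set \<Rightarrow> 'r ring \<Rightarrow> ('x \<Rightarrow> 'r set) \<Rightarrow>
      ('r set set \<Rightarrow> ('r set \<Rightarrow> ('r \<times> 'r) set) \<Rightarrow> 'r) \<Rightarrow> ('r, 'm) module \<Rightarrow> bool" where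
  "tilde_on_chart X M U A f \<phi> N \<longleftrightarrow> Module.module A N \<and>
    (let pre = inv_img (open_subspace X U) f in
     \<exists>\<psi>. (\<forall>V. openin (zariski A) V \<longrightarrow>
             \<psi> V \<in> semilinear_iso (rsec (Spec A) V) (\<phi> V) (msec (tilde A N) V) (msec M (pre V))) \<and>
         (\<forall>V W. openin (zariski A) V \<and> openin (zariski A) W \<and> W \<subseteq> V \<longrightarrow>
           (\<forall>s\<in>carrier (msec (tilde A N) V).
             mres M (pre V) (pre W) (\<psi> V s) = \<psi> W (mres (tilde A N) V W s))))"

definition quasi_coherent :: "('x, 'r) ringed_space \<Rightarrow> ('x, 'r, 'm) sheaf_module \<Rightarrow> bool" where
  "quasi_coherent X M \<longleftrightarrow> O_module X M \<and>
    (\<forall>x\<in>topspace (space_top X). \<exists>U A f \<phi> N.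
      affine_chart X U A f \<phi> \<and> x \<in> U \<and> tilde_on_chart X M U A f \<phi> N)"

text \<open>Coherence in the sense usual over Noetherian schemes, the only ones it is used for.\<close>

definition coherent :: "('x, 'r) ringed_space \<Rightarrow> ('x, 'r, 'm) sheaf_module \<Rightarrow> bool" where
  "coherent X M \<longleftrightarrow> O_module X M \<and>
    (\<forall>x\<in>topspace (space_top X). \<exists>U A f \<phi> N.
      affine_chart X U A f \<phi> \<and> x \<in> U \<and> tilde_on_chart X M U A f \<phi> N \<and>
      finitely_generated_module A N)"

definition submodule_sheaf ::
    "('x, 'r) ringed_space \<Rightarrow> ('x, 'r, 'm) sheaf_module \<Rightarrow> ('x set \<Rightarrow> 'm set) \<Rightarrow> bool" where
  "submodule_sheaf X M L \<longleftrightarrow>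
    (\<forall>U. openin (space_top X) U \<longrightarrow> submodule (L U) (rsec X U) (msec M U)) \<and>
    sheaf_on (space_top X) L (mres M)"

section \<open>Closure operations\<close>

definition preclosure_operation :: "'s set \<Rightarrow> ('s \<Rightarrow> 's \<Rightarrow> bool) \<Rightarrow> ('s \<Rightarrow> 's) \<Rightarrow> bool" where
  "preclosure_operation P leq c \<longleftrightarrow> c \<in> P \<rightarrow> P \<and> (\<forall>s\<in>P. leq s (c s)) \<and>
    (\<forall>s\<in>P. \<forall>t\<in>P. leq s t \<longrightarrow> leq (c s) (c t))"

definition closure_operation :: "'s set \<Rightarrow> ('s \<Rightarrow> 's \<Rightarrow> bool) \<Rightarrow> ('s \<Rightarrow> 's) \<Rightarrow> bool" where
  "closure_operation P leq c \<longleftrightarrow> preclosure_operation P leq c \<and> (\<forall>s\<in>P. c (c s) = c s)"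

text \<open>\<open>cl U M L\<close> is the closure of \<open>L\<close> in the module \<open>M\<close> over the sections of \<open>U\<close>. All modules
  with elements in a given type \<open>'m\<close>, an arbitrary one, are considered: \<open>'m\<close> plays the role of
  the universe, and an operation on a larger class of modules can be restricted to these.\<close>

type_synonym ('x, 'r, 'm) module_operation = "'x set \<Rightarrow> ('r, 'm) module \<Rightarrow> 'm set \<Rightarrow> 'm set"

definition compatible_with_isos ::
    "('x, 'r) ringed_space \<Rightarrow> ('x, 'r, 'm) module_operation \<Rightarrow> bool" where
  "compatible_with_isos X cl \<longleftrightarrow>
    (\<forall>U M N h L. affine_open X U \<and> Module.module (rsec X U) M \<and> Module.module (rsec X U) N \<and>
       h \<in> linear_iso (rsec X U) M N \<and> submodule L (rsec X U) M \<longrightarrow>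
       h ` cl U M L = cl U N (h ` L))"

definition preclosure_on_modules ::
    "('x, 'r) ringed_space \<Rightarrow> ('x, 'r, 'm) module_operation \<Rightarrow> bool" where
  "preclosure_on_modules X cl \<longleftrightarrow> compatible_with_isos X cl \<and>
    (\<forall>U M. affine_open X U \<and> Module.module (rsec X U) M \<longrightarrow>
      preclosure_operation {L. submodule L (rsec X U) M} (\<subseteq>) (cl U M))"

definition closure_on_modules ::
    "('x, 'r) ringed_space \<Rightarrow> ('x, 'r, 'm) module_operation \<Rightarrow> bool" where
  "closure_on_modules X cl \<longleftrightarrow> compatible_with_isos X cl \<and>
    (\<forall>U M. affine_open X U \<and> Module.module (rsec X U) M \<longrightarrow>
      closure_operation {L. submodule L (rsec X U) M} (\<subseteq>) (cl U M))"

text \<open>The base change has elements of another type than \<open>'m\<close>, so its closure is taken in a module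
  \<open>N\<close> isomorphic to it through \<open>h\<close>; by compatibility with isomorphisms the choice is immaterial.
  If \<open>'m\<close> is too small to contain such an \<open>N\<close>, the condition on this base change is void,
  which only makes the assumption of open persistence weaker.\<close>

definition openly_persistent ::
    "('x, 'r) ringed_space \<Rightarrow> ('x, 'r, 'm) module_operation \<Rightarrow> bool" where
  "openly_persistent X cl \<longleftrightarrow>
    (\<forall>U V. affine_open X U \<and> affine_open X V \<and> V \<subseteq> U \<longrightarrow>
      (let R = rsec X U; S = rsec X V; \<rho> = rres X U V in
       \<forall>M L. Module.module R M \<and> submodule L R M \<longrightarrow>
         (\<forall>x\<in>cl U M L. \<forall>N h. Module.module S N \<and> h \<in> linear_iso S (base_change R M S \<rho>) N \<longrightarrow>
           h (pure_tensor R M S \<rho> x \<one>\<^bsub>S\<^esub>) \<in> cl V N (h ` extended_submodule R M S \<rho> L))))"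

definition sheaf_closure ::
    "('x, 'r) ringed_space \<Rightarrow> ('x, 'r, 'm) module_operation \<Rightarrow> ('x, 'r, 'm) sheaf_module \<Rightarrow>
      ('x set \<Rightarrow> 'm set) \<Rightarrow> 'x set \<Rightarrow> 'm set" where
  "sheaf_closure X cl M L U =
    {s \<in> carrier (msec M U). \<forall>x\<in>U. \<exists>V. affine_open X V \<and> x \<in> V \<and> V \<subseteq> U \<and>
      mres M U V s \<in> cl V (msec M V) (L V)}"

end

(* For a section g over an open set U let D U g be the largest open subset of U on which g is
   invertible. An open set U is affine iff these sets form a basis of U, sections over D U g are
   fractions of sections over U with denominator a power of g, and x |-> {g. x not in D U g} is a
   bijection from U onto the primes of O(U); hence D U g is affine if U is. For quasi-coherent M
   and any affine U, M(D U g) is the localization of M(U) at g, that is, the base change of M(U)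
   to O(D U g), so open persistence carries s in L(U)^cl to s|_D in L(D)^cl for D = D U g. Any two
   affine neighbourhoods of a point contain a common neighbourhood that is basic in both, and
   (1)-(3) follow. For (4), a point has arbitrarily small affine neighbourhoods E with M(E)
   Noetherian; finitely many sections generate L^cl(E), they all lie in L(D)^cl for one basic
   open D of E, hence so does the image of L^cl(E), and idempotence over O(D) concludes. *)

theory Submission
  imports Defs
begin

text \<open>Two features of the statement shape the proof. \<open>affine_open\<close> asks for some
  isomorphism with a spectrum, and quasi-coherence supplies a module only on some charts, whereas
  the closure refers to all affine open sets. Transport of charts to \<open>D U g\<close> is avoided
  by conditions on the rings of sections alone; these pass to \<open>D U g\<close> by clearing
  denominators, and a chart can be rebuilt from them. That M localizes over every affine V is then
  forced from the charts by a principle used three times: a property of ring elements that is stable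
  under sums and multiples and holds for some element outside each prime avoiding \<open>a\<close>
  holds for a power of \<open>a\<close>. X is not assumed separated, so an intersection of affine
  open sets need not be affine, and only common basic open sets are available. Finally, neither L
  nor its closure is quasi-coherent: L(D) can be larger than the submodule generated by the image of
  L(E). Hence persistence is combined with monotonicity, for an arbitrary submodule over D that
  contains this image.\<close>

section \<open>Localizations of modules at primes and sections over basic opens\<close>

text \<open>Zorn's lemma: an ideal maximal among those that contain \<open>J\<close> and miss every
  power of \<open>a\<close> is prime.\<close>

lemma (in cring) exists_primeideal_avoiding_powers:
  assumes J: "ideal J R" and a: "a \<in> carrier R" and pow: "\<And>k::nat. a [^] k \<notin> J"
  obtains P where "primeideal P R" "J \<subseteq> P" "a \<notin> P"
proof -
  let ?S = "{I. ideal I R \<and> J \<subseteq> I \<and> (\<forall>k::nat. a [^] k \<notin> I)}"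
  have "\<exists>P\<in>?S. \<forall>X\<in>?S. P \<subseteq> X \<longrightarrow> X = P"
  proof (rule subset_Zorn_nonempty)
    show "?S \<noteq> {}" using J pow by blast
    fix C assume C: "C \<noteq> {}" "subset.chain ?S C"
    have "subset.chain {I. ideal I R} C"
      using C(2) unfolding pred_on.chain_def by blast
    then have "ideal (\<Union>C) R"
      using chain_Union_is_ideal[of C] C(1) by simp
    then show "\<Union>C \<in> ?S"
      using C unfolding pred_on.chain_def by blast
  qed
  then obtain P where PS: "P \<in> ?S" and max': "\<forall>X\<in>?S. P \<subseteq> X \<longrightarrow> X = P" by (rule bexE)
  note max = max'[rule_format]
  have P: "ideal P R" "J \<subseteq> P" "\<And>k::nat. a [^] k \<notin> P" using PS by auto
  interpret P: ideal P R by (rule P(1))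
  \<comment> \<open>By maximality, adjoining \<open>x\<close> to \<open>P\<close> must bring in a
    power of \<open>a\<close>.\<close>
  have grow: "\<exists>k::nat. \<exists>p\<in>P. \<exists>r\<in>carrier R. a [^] k = p \<oplus> r \<otimes> x" if x: "x \<in> carrier R" "x \<notin> P" for x
  proof -
    let ?Q = "P <+>\<^bsub>R\<^esub> PIdl x"
    have Q: "ideal ?Q R" using add_ideals[OF P(1) cgenideal_ideal[OF x(1)]] .
    have mem: "y \<in> ?Q \<longleftrightarrow> (\<exists>p\<in>P. \<exists>r\<in>carrier R. y = p \<oplus> r \<otimes> x)" for y
      unfolding set_add_def' cgenideal_def by blast
    have PQ: "P \<subseteq> ?Q"
    proof
      fix y assume "y \<in> P"
      then show "y \<in> ?Q" unfolding mem using x(1) P.a_Hcarr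
        by (intro bexI[of _ y] bexI[of _ \<zero>]) auto
    qed
    have "x \<in> ?Q" unfolding mem using x(1)
      by (intro bexI[of _ \<zero>] bexI[of _ \<one>]) (auto simp: additive_subgroup.zero_closed[OF P.is_additive_subgroup])
    then have "?Q \<notin> ?S" using max[OF _ PQ] x(2) by blast
    then show ?thesis using Q P(2) PQ mem by blast
  qed
  have "primeideal P R"
  proof (rule primeidealI[OF P(1) is_cring])
    \<comment> \<open>The zeroth power is \<open>\<one>\<close>, so \<open>P\<close> is
      proper.\<close>
    show "carrier R \<noteq> P" using P(3)[of 0] by auto
    fix x y assume xy: "x \<in> carrier R" "y \<in> carrier R" "x \<otimes> y \<in> P"
    show "x \<in> P \<or> y \<in> P"
    proof (rule ccontr)
      assume "\<not> (x \<in> P \<or> y \<in> P)"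
      then obtain k l :: nat and p q r s where
        k: "p \<in> P" "r \<in> carrier R" "a [^] k = p \<oplus> r \<otimes> x" and
        l: "q \<in> P" "s \<in> carrier R" "a [^] l = q \<oplus> s \<otimes> y"
        using grow xy(1,2) by meson
      have pq: "p \<in> carrier R" "q \<in> carrier R" using k l P.a_Hcarr by auto
      \<comment> \<open>Every term of the expanded product has a factor \<open>p\<close>,
        \<open>q\<close> or \<open>x \<otimes> y\<close>, all in \<open>P\<close>, so a power of
        \<open>a\<close> would lie in \<open>P\<close>.\<close>
      have "a [^] (k + l) = (p \<oplus> r \<otimes> x) \<otimes> (q \<oplus> s \<otimes> y)"
        using k l a by (simp add: nat_pow_mult[symmetric])
      also have "\<dots> = (q \<oplus> s \<otimes> y) \<otimes> p \<oplus> (r \<otimes> x \<otimes> q \<oplus> r \<otimes> s \<otimes> (x \<otimes> y))"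
        using k(2) l(2) xy(1,2) pq by (simp add: r_distr l_distr m_ac a_ac)
      also have "\<dots> \<in> P"
        using k l xy pq by (simp add: P.I_l_closed P.a_closed)
      finally show False using P(3) by blast
    qed
  qed
  moreover have "a \<notin> P" using P(3)[of 1] a by simp
  ultimately show ?thesis using P(2) that by blast
qed

text \<open>The elements with \<open>Q\<close> form an ideal. If it contained no power of
  \<open>a\<close>, it would lie in a prime avoiding \<open>a\<close>, against \<open>local\<close>.
  It serves for annihilators, for denominators of a section, and with \<open>a = \<one>\<close> for
  spreading a property over an affine open set.\<close>

lemma (in cring) local_imp_power_mem:
  assumes zero: "Q \<zero>"
    and add: "\<And>x y. \<lbrakk>x \<in> carrier R; y \<in> carrier R; Q x; Q y\<rbrakk> \<Longrightarrow> Q (x \<oplus> y)"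
    and mult: "\<And>c x. \<lbrakk>c \<in> carrier R; x \<in> carrier R; Q x\<rbrakk> \<Longrightarrow> Q (c \<otimes> x)"
    and a: "a \<in> carrier R"
    and local: "\<And>P. primeideal P R \<Longrightarrow> a \<notin> P \<Longrightarrow> \<exists>h\<in>carrier R. h \<notin> P \<and> Q h"
  obtains k :: nat where "Q (a [^] k)"
proof -
  let ?J = "{h \<in> carrier R. Q h}"
  have neg: "Q (\<ominus> x)" if "x \<in> carrier R" "Q x" for x
    using mult[OF _ that, of "\<ominus> \<one>"] that by (simp add: l_minus)
  have J: "ideal ?J R"
  proof (rule idealI[OF ring_axioms])
    show "subgroup ?J (add_monoid R)"
      by (rule group.subgroupI[OF add.group_axioms])
        (use zero add neg in \<open>auto simp: a_inv_def[symmetric]\<close>)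
  next
    fix a x assume ax: "a \<in> ?J" "x \<in> carrier R"
    then show "x \<otimes> a \<in> ?J" using mult by simp
    with ax show "a \<otimes> x \<in> ?J" using m_comm by simp
  qed
  have "\<exists>k::nat. a [^] k \<in> ?J"
  proof (rule ccontr)
    assume "\<not> ?thesis"
    then have "a [^] k \<notin> ?J" for k :: nat by blast
    then obtain P where "primeideal P R" "?J \<subseteq> P" "a \<notin> P"
      using exists_primeideal_avoiding_powers[OF J a] by metis
    then show False using local by blast
  qed
  then show ?thesis using that by blast
qed

text \<open>In the binomial expansion every monomial contains either the \<open>m\<close>-th power
  of \<open>x\<close> or the \<open>n\<close>-th power of \<open>y\<close>. The induction replaces
  binomial coefficients.\<close>

lemma (in cring) pow_sum_in_span_pows:
  fixes m n :: nat
  assumes xy: "x \<in> carrier R" "y \<in> carrier R"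
  shows "\<exists>c\<in>carrier R. \<exists>d\<in>carrier R. (x \<oplus> y) [^] (m + n) = c \<otimes> x [^] m \<oplus> d \<otimes> y [^] n"
proof (induction "m + n" arbitrary: m n)
  case 0
  then show ?case using xy by (intro bexI[of _ \<one>] bexI[of _ \<zero>]) auto
next
  case (Suc N)
  show ?case
  proof (cases "m = 0 \<or> n = 0")
    case True
    then show ?thesis
    proof
      assume "m = 0"
      then show ?thesis using xy by (intro bexI[of _ "(x \<oplus> y) [^] n"] bexI[of _ \<zero>]) auto
    next
      assume "n = 0"
      then show ?thesis using xy by (intro bexI[of _ \<zero>] bexI[of _ "(x \<oplus> y) [^] m"]) auto
    qed
  next
    case False
    then obtain m' n' where mn: "m = Suc m'" "n = Suc n'" by (meson not0_implies_Suc)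
    have "N = m' + n" "N = m + n'" using Suc.hyps(2) mn by auto
    obtain c d where c: "c \<in> carrier R" "d \<in> carrier R" "(x \<oplus> y) [^] N = c \<otimes> x [^] m' \<oplus> d \<otimes> y [^] n"
      using Suc.hyps(1)[OF \<open>N = m' + n\<close>] \<open>N = m' + n\<close> by blast
    obtain c' d' where c': "c' \<in> carrier R" "d' \<in> carrier R" "(x \<oplus> y) [^] N = c' \<otimes> x [^] m \<oplus> d' \<otimes> y [^] n'"
      using Suc.hyps(1)[OF \<open>N = m + n'\<close>] \<open>N = m + n'\<close> by blast
    have pows: "x [^] m' \<in> carrier R" "y [^] n' \<in> carrier R" using xy by auto
    have "(x \<oplus> y) [^] (m + n) = (x \<oplus> y) [^] N \<otimes> (x \<oplus> y)"
      unfolding Suc.hyps(2)[symmetric] by simp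
    also have "\<dots> = (x \<oplus> y) [^] N \<otimes> x \<oplus> (x \<oplus> y) [^] N \<otimes> y"
      using xy by (simp add: r_distr)
    \<comment> \<open>The expression with the smaller exponent of \<open>x\<close> is multiplied by
      \<open>x\<close>, the one with the smaller exponent of \<open>y\<close> by
      \<open>y\<close>.\<close>
    also have "\<dots> = (c \<otimes> x [^] m' \<oplus> d \<otimes> y [^] n) \<otimes> x \<oplus> (c' \<otimes> x [^] m \<oplus> d' \<otimes> y [^] n') \<otimes> y"
      using c(3) c'(3) by simp
    also have "\<dots> = (c \<oplus> c' \<otimes> y) \<otimes> x [^] m \<oplus> (d \<otimes> x \<oplus> d') \<otimes> y [^] n"
      unfolding mn nat_pow_Suc using xy c(1,2) c'(1,2) pows
      by (simp add: r_distr l_distr m_ac a_ac)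
    finally show ?thesis using xy c(1,2) c'(1,2) by blast
  qed
qed

text \<open>Operations on fractions are unions over all representatives; this turns independence of
  the representatives into a value.\<close>

lemma UN_pairs_constant:
  assumes "(a, b) \<in> X" "(c, d) \<in> Y"
    and "\<And>a b c d. (a, b) \<in> X \<Longrightarrow> (c, d) \<in> Y \<Longrightarrow> F a b c d = C"
  shows "(\<Union>(a, b)\<in>X. \<Union>(c, d)\<in>Y. F a b c d) = C"
proof -
  have "(\<Union>(a, b)\<in>X. \<Union>(c, d)\<in>Y. F a b c d) = (\<Union>p\<in>X. \<Union>q\<in>Y. C)"
    using assms(3) by (intro SUP_cong refl) auto
  then show ?thesis using assms(1,2) by auto
qed

section \<open>Fractions of a module with respect to a multiplicative set\<close>

locale multiplicative_subset = module R M for R :: "'r ring" (structure) and M :: "('r, 'm) module" (structure) +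
  fixes S :: "'r set"
  assumes S_carrier: "S \<subseteq> carrier R"
    and S_one: "\<one> \<in> S"
    and S_mult: "\<lbrakk>s \<in> S; t \<in> S\<rbrakk> \<Longrightarrow> s \<otimes> t \<in> S"
begin

lemma S_closed [simp]: "s \<in> S \<Longrightarrow> s \<in> carrier R"
  using S_carrier by blast

lemma frac_self: "\<lbrakk>m \<in> carrier M; s \<in> S\<rbrakk> \<Longrightarrow> (m, s) \<in> module_frac R M S m s"
  unfolding module_frac_def using S_one by auto

lemma smult_comm: "\<lbrakk>a \<in> carrier R; b \<in> carrier R; x \<in> carrier M\<rbrakk> \<Longrightarrow>
    a \<odot>\<^bsub>M\<^esub> (b \<odot>\<^bsub>M\<^esub> x) = b \<odot>\<^bsub>M\<^esub> (a \<odot>\<^bsub>M\<^esub> x)"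
  by (metis smult_assoc1 R.m_comm)

lemma frac_rel_trans:
  assumes car: "m \<in> carrier M" "n \<in> carrier M" "l \<in> carrier M" "s \<in> S" "t \<in> S" "r \<in> S"
    and u: "u \<in> S" "u \<odot>\<^bsub>M\<^esub> (t \<odot>\<^bsub>M\<^esub> m) = u \<odot>\<^bsub>M\<^esub> (s \<odot>\<^bsub>M\<^esub> n)"
    and v: "v \<in> S" "v \<odot>\<^bsub>M\<^esub> (r \<odot>\<^bsub>M\<^esub> n) = v \<odot>\<^bsub>M\<^esub> (t \<odot>\<^bsub>M\<^esub> l)"
  shows "\<exists>w\<in>S. w \<odot>\<^bsub>M\<^esub> (r \<odot>\<^bsub>M\<^esub> m) = w \<odot>\<^bsub>M\<^esub> (s \<odot>\<^bsub>M\<^esub> l)"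
proof (intro bexI)
  \<comment> \<open>The middle denominator \<open>t\<close> enters the witness, which lets the two
    given equations be chained.\<close>
  show "t \<otimes> (u \<otimes> v) \<in> S" using car u v S_mult by auto
  have "(t \<otimes> (u \<otimes> v)) \<odot>\<^bsub>M\<^esub> (r \<odot>\<^bsub>M\<^esub> m) = (v \<otimes> r) \<odot>\<^bsub>M\<^esub> (u \<odot>\<^bsub>M\<^esub> (t \<odot>\<^bsub>M\<^esub> m))"
    using car u(1) v(1) by (simp add: smult_assoc1[symmetric] R.m_ac)
  also have "\<dots> = (v \<otimes> r) \<odot>\<^bsub>M\<^esub> (u \<odot>\<^bsub>M\<^esub> (s \<odot>\<^bsub>M\<^esub> n))" using u by simp
  also have "\<dots> = (u \<otimes> s) \<odot>\<^bsub>M\<^esub> (v \<odot>\<^bsub>M\<^esub> (r \<odot>\<^bsub>M\<^esub> n))"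
    using car u(1) v(1) by (simp add: smult_assoc1[symmetric] R.m_ac)
  also have "\<dots> = (u \<otimes> s) \<odot>\<^bsub>M\<^esub> (v \<odot>\<^bsub>M\<^esub> (t \<odot>\<^bsub>M\<^esub> l))" using v by simp
  also have "\<dots> = (t \<otimes> (u \<otimes> v)) \<odot>\<^bsub>M\<^esub> (s \<odot>\<^bsub>M\<^esub> l)"
    using car u(1) v(1) by (simp add: smult_assoc1[symmetric] R.m_ac)
  finally show "(t \<otimes> (u \<otimes> v)) \<odot>\<^bsub>M\<^esub> (r \<odot>\<^bsub>M\<^esub> m) = (t \<otimes> (u \<otimes> v)) \<odot>\<^bsub>M\<^esub> (s \<odot>\<^bsub>M\<^esub> l)" .
qed

text \<open>A fraction is the whole class of its representatives, so one direction is membership by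
  \<open>frac_self\<close> and the other is transitivity of the relation.\<close>

lemma module_frac_eq_iff:
  assumes car: "m \<in> carrier M" "n \<in> carrier M" "s \<in> S" "t \<in> S"
  shows "module_frac R M S m s = module_frac R M S n t \<longleftrightarrow>
    (\<exists>u\<in>S. u \<odot>\<^bsub>M\<^esub> (t \<odot>\<^bsub>M\<^esub> m) = u \<odot>\<^bsub>M\<^esub> (s \<odot>\<^bsub>M\<^esub> n))" (is "?L = ?R")
proof
  assume ?L
  then have "(n, t) \<in> module_frac R M S m s" using frac_self car by simp
  then show ?R unfolding module_frac_def by auto
next
  have sub: "module_frac R M S n t \<subseteq> module_frac R M S m s"
    if car: "m \<in> carrier M" "n \<in> carrier M" "s \<in> S" "t \<in> S"
      and "\<exists>u\<in>S. u \<odot>\<^bsub>M\<^esub> (t \<odot>\<^bsub>M\<^esub> m) = u \<odot>\<^bsub>M\<^esub> (s \<odot>\<^bsub>M\<^esub> n)" for m n s t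
    using that frac_rel_trans[OF car(1,2) _ car(3,4)] unfolding module_frac_def by clarsimp
  assume R: ?R
  then have "\<exists>u\<in>S. u \<odot>\<^bsub>M\<^esub> (s \<odot>\<^bsub>M\<^esub> n) = u \<odot>\<^bsub>M\<^esub> (t \<odot>\<^bsub>M\<^esub> m)" by metis
  then show ?L using sub[OF car R] sub[OF car(2,1,4,3)] by blast
qed

lemma module_frac_mem:
  assumes "(n, t) \<in> module_frac R M S m s" "m \<in> carrier M" "s \<in> S"
  shows "n \<in> carrier M" "t \<in> S" "module_frac R M S m s = module_frac R M S n t"
  using assms module_frac_eq_iff[of m n s t] unfolding module_frac_def by auto

lemma module_loc_add:
  assumes car: "m \<in> carrier M" "n \<in> carrier M" "s \<in> S" "t \<in> S"
  shows "module_frac R M S m s \<oplus>\<^bsub>module_loc R M S\<^esub> module_frac R M S n t =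
    module_frac R M S (t \<odot>\<^bsub>M\<^esub> m \<oplus>\<^bsub>M\<^esub> s \<odot>\<^bsub>M\<^esub> n) (s \<otimes> t)"
proof -
  have "module_frac R M S (t' \<odot>\<^bsub>M\<^esub> m' \<oplus>\<^bsub>M\<^esub> s' \<odot>\<^bsub>M\<^esub> n') (s' \<otimes> t') =
      module_frac R M S (t \<odot>\<^bsub>M\<^esub> m \<oplus>\<^bsub>M\<^esub> s \<odot>\<^bsub>M\<^esub> n) (s \<otimes> t)"
    if a: "(m', s') \<in> module_frac R M S m s" "(n', t') \<in> module_frac R M S n t" for m' s' n' t'
  proof -
    note m' = module_frac_mem[OF a(1) car(1,3)] and n' = module_frac_mem[OF a(2) car(2,4)]
    obtain u v where u: "u \<in> S" "u \<odot>\<^bsub>M\<^esub> (s \<odot>\<^bsub>M\<^esub> m') = u \<odot>\<^bsub>M\<^esub> (s' \<odot>\<^bsub>M\<^esub> m)"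
      and v: "v \<in> S" "v \<odot>\<^bsub>M\<^esub> (t \<odot>\<^bsub>M\<^esub> n') = v \<odot>\<^bsub>M\<^esub> (t' \<odot>\<^bsub>M\<^esub> n)"
      using a unfolding module_frac_def by auto
    \<comment> \<open>The product of the two witnesses clears both changes of representative at
      once.\<close>
    have "(u \<otimes> v) \<odot>\<^bsub>M\<^esub> ((s \<otimes> t) \<odot>\<^bsub>M\<^esub> (t' \<odot>\<^bsub>M\<^esub> m' \<oplus>\<^bsub>M\<^esub> s' \<odot>\<^bsub>M\<^esub> n'))
      = (v \<otimes> t \<otimes> t') \<odot>\<^bsub>M\<^esub> (u \<odot>\<^bsub>M\<^esub> (s \<odot>\<^bsub>M\<^esub> m')) \<oplus>\<^bsub>M\<^esub> (u \<otimes> s \<otimes> s') \<odot>\<^bsub>M\<^esub> (v \<odot>\<^bsub>M\<^esub> (t \<odot>\<^bsub>M\<^esub> n'))"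
      using car m'(1,2) n'(1,2) u(1) v(1) by (simp add: smult_r_distr smult_assoc1[symmetric] R.m_ac)
    also have "\<dots> = (v \<otimes> t \<otimes> t') \<odot>\<^bsub>M\<^esub> (u \<odot>\<^bsub>M\<^esub> (s' \<odot>\<^bsub>M\<^esub> m)) \<oplus>\<^bsub>M\<^esub> (u \<otimes> s \<otimes> s') \<odot>\<^bsub>M\<^esub> (v \<odot>\<^bsub>M\<^esub> (t' \<odot>\<^bsub>M\<^esub> n))"
      using u v by simp
    also have "\<dots> = (u \<otimes> v) \<odot>\<^bsub>M\<^esub> ((s' \<otimes> t') \<odot>\<^bsub>M\<^esub> (t \<odot>\<^bsub>M\<^esub> m \<oplus>\<^bsub>M\<^esub> s \<odot>\<^bsub>M\<^esub> n))"
      using car m'(1,2) n'(1,2) u(1) v(1) by (simp add: smult_r_distr smult_assoc1[symmetric] R.m_ac)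
    finally show ?thesis
      using car m'(1,2) n'(1,2) u(1) v(1) S_mult by (subst module_frac_eq_iff) auto
  qed
  then show ?thesis
    unfolding module_loc_def ring.simps
    by (rule UN_pairs_constant[OF frac_self[OF car(1,3)] frac_self[OF car(2,4)]])
qed

lemma module_loc_smult:
  assumes car: "a \<in> carrier R" "n \<in> carrier M" "s \<in> S" "t \<in> S"
  shows "ring_frac R S a s \<odot>\<^bsub>module_loc R M S\<^esub> module_frac R M S n t =
    module_frac R M S (a \<odot>\<^bsub>M\<^esub> n) (s \<otimes> t)"
proof -
  have eq: "module_frac R M S (a' \<odot>\<^bsub>M\<^esub> n') (s' \<otimes> t') = module_frac R M S (a \<odot>\<^bsub>M\<^esub> n) (s \<otimes> t)"
    if a: "(a', s') \<in> ring_frac R S a s" "(n', t') \<in> module_frac R M S n t" for a' s' n' t'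
  proof -
    note n' = module_frac_mem[OF a(2) car(2,4)]
    obtain u v where u: "u \<in> S" "u \<otimes> (s' \<otimes> a) = u \<otimes> (s \<otimes> a')" "a' \<in> carrier R" "s' \<in> S"
      and v: "v \<in> S" "v \<odot>\<^bsub>M\<^esub> (t \<odot>\<^bsub>M\<^esub> n') = v \<odot>\<^bsub>M\<^esub> (t' \<odot>\<^bsub>M\<^esub> n)"
      using a unfolding module_frac_def ring_frac_def by auto
    have "(u \<otimes> v) \<odot>\<^bsub>M\<^esub> ((s \<otimes> t) \<odot>\<^bsub>M\<^esub> (a' \<odot>\<^bsub>M\<^esub> n'))
      = (u \<otimes> (s \<otimes> a')) \<odot>\<^bsub>M\<^esub> (v \<odot>\<^bsub>M\<^esub> (t \<odot>\<^bsub>M\<^esub> n'))"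
      using car n'(1,2) u(1,3,4) v(1) by (simp add: smult_assoc1[symmetric] R.m_ac)
    also have "\<dots> = (u \<otimes> (s' \<otimes> a)) \<odot>\<^bsub>M\<^esub> (v \<odot>\<^bsub>M\<^esub> (t' \<odot>\<^bsub>M\<^esub> n))"
      using u v by simp
    also have "\<dots> = (u \<otimes> v) \<odot>\<^bsub>M\<^esub> ((s' \<otimes> t') \<odot>\<^bsub>M\<^esub> (a \<odot>\<^bsub>M\<^esub> n))"
      using car n'(1,2) u(1,3,4) v(1) by (simp add: smult_assoc1[symmetric] R.m_ac)
    finally show ?thesis
      using car n'(1,2) u(1,3,4) v(1) S_mult by (subst module_frac_eq_iff) auto
  qed
  have mem: "(a, s) \<in> ring_frac R S a s"
    using car S_one unfolding ring_frac_def by auto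
  show ?thesis
    unfolding module_loc_def module.simps
    by (rule UN_pairs_constant[OF mem frac_self[OF car(2,4)] eq])
qed

end


lemma (in abelian_group) diff_eq_zero_iff:
  "\<lbrakk>x \<in> carrier G; y \<in> carrier G\<rbrakk> \<Longrightarrow> x \<ominus> y = \<zero> \<longleftrightarrow> x = y"
  by (metis a_minus_def add.inv_closed minus_equality minus_minus r_neg)

lemma (in module) smult_r_diff:
  "\<lbrakk>u \<in> carrier R; x \<in> carrier M; y \<in> carrier M\<rbrakk> \<Longrightarrow>
    u \<odot>\<^bsub>M\<^esub> (x \<ominus>\<^bsub>M\<^esub> y) = u \<odot>\<^bsub>M\<^esub> x \<ominus>\<^bsub>M\<^esub> u \<odot>\<^bsub>M\<^esub> y"
  by (simp add: M.minus_eq smult_r_distr smult_r_minus)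

section \<open>Sections over a basic open set of the sheaf associated with a module\<close>

locale plain_module = module R M for R :: "'r ring" (structure) and M :: "('r, 'm) module" (structure)
begin

lemma prime_complement:
  assumes "primeideal P R"
  shows "multiplicative_subset R M (carrier R - P)"
proof -
  interpret P: primeideal P R by fact
  have "\<one> \<notin> P"
    using P.I_notcarr P.one_imp_carrier by blast
  then show ?thesis
    by unfold_locales (use P.I_prime in auto)
qed

lemma mem_zariski_open_singleton:
  "a \<in> carrier R \<Longrightarrow> P \<in> zariski_open R {a} \<longleftrightarrow> primeideal P R \<and> a \<notin> P"
  by (auto simp: zariski_open_def)

text \<open>Vanishing of \<open>n\<close> in the localization at \<open>P\<close> puts an
  annihilator of \<open>n\<close> outside \<open>P\<close>; the annihilator is an ideal, so it
  contains a power of \<open>a\<close>.\<close>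

lemma fraction_zero_on_basic_open:
  assumes a: "a \<in> carrier R" and n: "n \<in> carrier M"
    and zero: "\<And>P. primeideal P R \<Longrightarrow> a \<notin> P \<Longrightarrow>
      module_frac R M (carrier R - P) n \<one> = module_frac R M (carrier R - P) \<zero>\<^bsub>M\<^esub> \<one>"
  obtains k :: nat where "a [^] k \<odot>\<^bsub>M\<^esub> n = \<zero>\<^bsub>M\<^esub>"
proof (rule local_imp_power_mem[where Q = "\<lambda>h. h \<odot>\<^bsub>M\<^esub> n = \<zero>\<^bsub>M\<^esub>" and a = a])
  fix P assume P: "primeideal P R" "a \<notin> P"
  interpret multiplicative_subset R M "carrier R - P" by (rule prime_complement[OF P(1)])
  obtain u where "u \<in> carrier R - P" "u \<odot>\<^bsub>M\<^esub> (\<one> \<odot>\<^bsub>M\<^esub> n) = u \<odot>\<^bsub>M\<^esub> (\<one> \<odot>\<^bsub>M\<^esub> \<zero>\<^bsub>M\<^esub>)"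
    using zero[OF P] module_frac_eq_iff[of n "\<zero>\<^bsub>M\<^esub>" \<one> \<one>] n S_one by auto
  then show "\<exists>h\<in>carrier R. h \<notin> P \<and> h \<odot>\<^bsub>M\<^esub> n = \<zero>\<^bsub>M\<^esub>" using n by (intro bexI[of _ u]) auto
qed (use a n in \<open>auto simp: smult_l_distr smult_assoc1\<close>)

text \<open>The exponent is left free so that the elements \<open>x\<close> admitting some
  \<open>n\<close> and \<open>k\<close> are closed under sums and multiples.\<close>

definition is_fraction_on :: "('r set \<Rightarrow> ('m \<times> 'r) set) \<Rightarrow> 'r \<Rightarrow> 'm \<Rightarrow> nat \<Rightarrow> bool" where
  "is_fraction_on s x n k \<longleftrightarrow> n \<in> carrier M \<and>
    (\<forall>P. primeideal P R \<and> x \<notin> P \<longrightarrow> s P = module_frac R M (carrier R - P) n (x [^] k))"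

lemma pow_notin_prime:
  fixes k :: nat
  assumes "primeideal P R" "x \<in> carrier R" "x \<notin> P"
  shows "x [^] k \<in> carrier R - P"
  proof -
    interpret multiplicative_subset R M "carrier R - P" by (rule prime_complement[OF assms(1)])
    show ?thesis
    proof (induction k)
      case (Suc k)
      then show ?case using S_mult[of "x [^] k" x] assms by simp
    qed (use S_one in auto)
  qed

lemma frac_eqI:
  assumes P: "primeideal P R" and z: "z \<in> carrier R - P" and w: "w \<in> carrier R - P"
    and l: "l \<in> carrier M" and m: "m \<in> carrier M" and eq: "w \<odot>\<^bsub>M\<^esub> l = z \<odot>\<^bsub>M\<^esub> m"
  shows "module_frac R M (carrier R - P) l z = module_frac R M (carrier R - P) m w"
proof -
  interpret multiplicative_subset R M "carrier R - P" by (rule prime_complement[OF P])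
  show ?thesis unfolding module_frac_eq_iff[OF l m z w] eq using S_one by blast
qed

text \<open>The cross-multiplied identity is available only after multiplication by
  \<open>z [^] K\<close>, which is harmless because no power of \<open>z\<close> lies in
  \<open>P\<close>.\<close>

lemma frac_eqI_pow:
  fixes i K :: nat
  assumes P: "primeideal P R" and z: "z \<in> carrier R" "z \<notin> P" and w: "w \<in> carrier R" "w \<notin> P"
    and l: "l \<in> carrier M" and m: "m \<in> carrier M"
    and eq: "w \<odot>\<^bsub>M\<^esub> (z [^] K \<odot>\<^bsub>M\<^esub> l) = z [^] (i + K) \<odot>\<^bsub>M\<^esub> m"
  shows "module_frac R M (carrier R - P) l (z [^] i) = module_frac R M (carrier R - P) m w"
proof -
  interpret multiplicative_subset R M "carrier R - P" by (rule prime_complement[OF P])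
  have zc: "z [^] j \<in> carrier R" for j :: nat using z(1) by (rule R.nat_pow_closed)
  have "z [^] K \<odot>\<^bsub>M\<^esub> (w \<odot>\<^bsub>M\<^esub> l) = z [^] (i + K) \<odot>\<^bsub>M\<^esub> m"
    unfolding eq[symmetric] using zc w(1) l by (rule smult_comm)
  also have "\<dots> = (z [^] K \<otimes> z [^] i) \<odot>\<^bsub>M\<^esub> m"
    unfolding R.nat_pow_mult[OF z(1)] add.commute[of K i] ..
  also have "\<dots> = z [^] K \<odot>\<^bsub>M\<^esub> (z [^] i \<odot>\<^bsub>M\<^esub> m)"
    using zc zc m by (rule smult_assoc1)
  finally have "\<exists>u\<in>carrier R - P. u \<odot>\<^bsub>M\<^esub> (w \<odot>\<^bsub>M\<^esub> l) = u \<odot>\<^bsub>M\<^esub> (z [^] i \<odot>\<^bsub>M\<^esub> m)"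
    using pow_notin_prime[OF P z] by blast
  then show ?thesis
    using module_frac_eq_iff[OF l m pow_notin_prime[OF P z]] w by blast
qed

text \<open>Two fractions that represent \<open>s\<close> on two basic open sets are glued to one on
  the basic open set of the sum, with the coefficients of a power of \<open>x \<oplus> y\<close> in
  the role of a partition of unity.\<close>

lemma is_fraction_on_add:
  assumes x: "x \<in> carrier R" "is_fraction_on s x n k" and y: "y \<in> carrier R" "is_fraction_on s y n' k'"
  shows "\<exists>m k. is_fraction_on s (x \<oplus> y) m k"
  proof -
    have n: "n \<in> carrier M" "n' \<in> carrier M" using x y by (auto simp: is_fraction_on_def)
    have car: "x [^] i \<in> carrier R" "y [^] i \<in> carrier R" for i :: nat using x y by auto
    let ?d = "y [^] k' \<odot>\<^bsub>M\<^esub> n \<ominus>\<^bsub>M\<^esub> x [^] k \<odot>\<^bsub>M\<^esub> n'"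
    \<comment> \<open>At primes missing \<open>x \<otimes> y\<close> both fractions equal
      \<open>s\<close>, so the cross difference \<open>?d\<close> vanishes there and one power kills
      it.\<close>
    obtain K :: nat where K: "(x \<otimes> y) [^] K \<odot>\<^bsub>M\<^esub> ?d = \<zero>\<^bsub>M\<^esub>"
    proof (rule fraction_zero_on_basic_open)
      show "x \<otimes> y \<in> carrier R" "?d \<in> carrier M" using x y n car by auto
      fix P assume P: "primeideal P R" "x \<otimes> y \<notin> P"
      interpret P: primeideal P R by (rule P(1))
      interpret multiplicative_subset R M "carrier R - P" by (rule prime_complement[OF P(1)])
      have xy: "x \<notin> P" "y \<notin> P" using P x y by (auto simp: P.I_l_closed P.I_r_closed)
      have "module_frac R M (carrier R - P) n (x [^] k) = module_frac R M (carrier R - P) n' (y [^] k')"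
        using x(2) y(2) P(1) xy unfolding is_fraction_on_def by metis
      then obtain u where u: "u \<in> carrier R - P"
          "u \<odot>\<^bsub>M\<^esub> (y [^] k' \<odot>\<^bsub>M\<^esub> n) = u \<odot>\<^bsub>M\<^esub> (x [^] k \<odot>\<^bsub>M\<^esub> n')"
        using module_frac_eq_iff[OF n] pow_notin_prime[OF P(1)] x(1) y(1) xy by auto
      have "u \<odot>\<^bsub>M\<^esub> ?d = \<zero>\<^bsub>M\<^esub>"
        using u n car by (simp add: smult_r_diff M.diff_eq_zero_iff)
      then show "module_frac R M (carrier R - P) ?d \<one> = module_frac R M (carrier R - P) \<zero>\<^bsub>M\<^esub> \<one>"
        using module_frac_eq_iff[of ?d "\<zero>\<^bsub>M\<^esub>" \<one> \<one>] n car u(1) S_one by auto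
    qed
    \<comment> \<open>With \<open>K\<close> absorbed into numerators and denominators the cross
      equation becomes exact.\<close>
    let ?e = "k + K" and ?e' = "k' + K"
    let ?n = "x [^] K \<odot>\<^bsub>M\<^esub> n" and ?n' = "y [^] K \<odot>\<^bsub>M\<^esub> n'"
    have N: "?n \<in> carrier M" "?n' \<in> carrier M" using n car by auto
    have "(x \<otimes> y) [^] K \<odot>\<^bsub>M\<^esub> (y [^] k' \<odot>\<^bsub>M\<^esub> n) = (x \<otimes> y) [^] K \<odot>\<^bsub>M\<^esub> (x [^] k \<odot>\<^bsub>M\<^esub> n')"
      using K n car x(1) y(1) by (simp add: smult_r_diff M.diff_eq_zero_iff)
    then have cross: "y [^] ?e' \<odot>\<^bsub>M\<^esub> ?n = x [^] ?e \<odot>\<^bsub>M\<^esub> ?n'"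
      using n car x(1) y(1)
      by (simp add: R.nat_pow_distrib smult_assoc1[symmetric] R.nat_pow_mult[symmetric] R.m_ac)
    obtain c d where cd: "c \<in> carrier R" "d \<in> carrier R"
        "(x \<oplus> y) [^] (?e + ?e') = c \<otimes> x [^] ?e \<oplus> d \<otimes> y [^] ?e'"
      using pow_sum_in_span_pows[OF x(1) y(1)] by blast
    \<comment> \<open>The new numerator combines the old ones with the same coefficients that
      express the power of the sum; by \<open>cross\<close> it is compatible with both.\<close>
    let ?m = "c \<odot>\<^bsub>M\<^esub> ?n \<oplus>\<^bsub>M\<^esub> d \<odot>\<^bsub>M\<^esub> ?n'"
    have m: "?m \<in> carrier M" using N cd by auto
    have mx: "(x \<oplus> y) [^] (?e + ?e') \<odot>\<^bsub>M\<^esub> ?n = x [^] ?e \<odot>\<^bsub>M\<^esub> ?m"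
    proof -
      have "(x \<oplus> y) [^] (?e + ?e') \<odot>\<^bsub>M\<^esub> ?n =
          c \<odot>\<^bsub>M\<^esub> (x [^] ?e \<odot>\<^bsub>M\<^esub> ?n) \<oplus>\<^bsub>M\<^esub> d \<odot>\<^bsub>M\<^esub> (y [^] ?e' \<odot>\<^bsub>M\<^esub> ?n)"
        unfolding cd(3) using cd(1,2) N car by (simp add: smult_l_distr smult_assoc1)
      also have "\<dots> = x [^] ?e \<odot>\<^bsub>M\<^esub> ?m"
        unfolding cross using cd(1,2) N car
        by (simp only: smult_r_distr smult_closed smult_assoc1[symmetric] R.m_comm)
      finally show ?thesis .
    qed
    have my: "(x \<oplus> y) [^] (?e + ?e') \<odot>\<^bsub>M\<^esub> ?n' = y [^] ?e' \<odot>\<^bsub>M\<^esub> ?m"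
    proof -
      have "(x \<oplus> y) [^] (?e + ?e') \<odot>\<^bsub>M\<^esub> ?n' =
          c \<odot>\<^bsub>M\<^esub> (x [^] ?e \<odot>\<^bsub>M\<^esub> ?n') \<oplus>\<^bsub>M\<^esub> d \<odot>\<^bsub>M\<^esub> (y [^] ?e' \<odot>\<^bsub>M\<^esub> ?n')"
        unfolding cd(3) using cd(1,2) N car by (simp add: smult_l_distr smult_assoc1)
      also have "\<dots> = y [^] ?e' \<odot>\<^bsub>M\<^esub> ?m"
        unfolding cross[symmetric] using cd(1,2) N car
        by (simp only: smult_r_distr smult_closed smult_assoc1[symmetric] R.m_comm)
      finally show ?thesis .
    qed
    have "is_fraction_on s (x \<oplus> y) ?m (?e + ?e')"
      unfolding is_fraction_on_def
    proof (intro conjI allI impI m)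
      fix P assume P: "primeideal P R \<and> x \<oplus> y \<notin> P"
      interpret P: primeideal P R using P by blast
      interpret multiplicative_subset R M "carrier R - P" using prime_complement P by blast
      have S: "(x \<oplus> y) [^] (?e + ?e') \<in> carrier R - P" using pow_notin_prime P x(1) y(1) by auto
      \<comment> \<open>A prime missing the sum misses \<open>x\<close> or \<open>y\<close>; the new
        fraction is compared with whichever old one is defined there.\<close>
      have half: "s P = module_frac R M (carrier R - P) ?m ((x \<oplus> y) [^] (?e + ?e'))"
        if z: "z \<in> carrier R" "z \<notin> P" "is_fraction_on s z l i" "l \<in> carrier M"
          and eq: "(x \<oplus> y) [^] (?e + ?e') \<odot>\<^bsub>M\<^esub> (z [^] K \<odot>\<^bsub>M\<^esub> l) = z [^] (i + K) \<odot>\<^bsub>M\<^esub> ?m" for z l i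
      proof -
        have "s P = module_frac R M (carrier R - P) l (z [^] i)"
          using z P unfolding is_fraction_on_def by blast
        also have "\<dots> = module_frac R M (carrier R - P) ?m ((x \<oplus> y) [^] (?e + ?e'))"
          using S by (intro frac_eqI_pow[OF P.primeideal z(1,2) _ _ z(4) m eq]) blast+
        finally show ?thesis .
      qed
      have "x \<notin> P \<or> y \<notin> P" using P P.a_closed by blast
      then show "s P = module_frac R M (carrier R - P) ?m ((x \<oplus> y) [^] (?e + ?e'))"
        using half[OF x(1) _ x(2) n(1) mx] half[OF y(1) _ y(2) n(2) my] by blast
    qed
    then show ?thesis by blast
  qed

lemma is_fraction_on_mult:
  assumes x: "x \<in> carrier R" "is_fraction_on s x n k" and c: "c \<in> carrier R"
  shows "is_fraction_on s (c \<otimes> x) (c [^] k \<odot>\<^bsub>M\<^esub> n) k"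
  unfolding is_fraction_on_def
proof (intro conjI allI impI)
  have n: "n \<in> carrier M" using x(2) by (simp add: is_fraction_on_def)
  then show "c [^] k \<odot>\<^bsub>M\<^esub> n \<in> carrier M" using c by simp
  fix P assume P: "primeideal P R \<and> c \<otimes> x \<notin> P"
  interpret P: primeideal P R using P by blast
  have xP: "x \<notin> P" using P x c P.I_l_closed by auto
  have "s P = module_frac R M (carrier R - P) n (x [^] k)"
    using x xP P unfolding is_fraction_on_def by blast
  also have "\<dots> = module_frac R M (carrier R - P) (c [^] k \<odot>\<^bsub>M\<^esub> n) ((c \<otimes> x) [^] k)"
  proof (rule frac_eqI[OF P.primeideal _ _ n])
    show "x [^] k \<in> carrier R - P" using pow_notin_prime[OF P.primeideal x(1) xP] .
    show "(c \<otimes> x) [^] k \<in> carrier R - P" using P c x(1) by (intro pow_notin_prime) auto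
    show "c [^] k \<odot>\<^bsub>M\<^esub> n \<in> carrier M" using n c by simp
    show "(c \<otimes> x) [^] k \<odot>\<^bsub>M\<^esub> n = x [^] k \<odot>\<^bsub>M\<^esub> (c [^] k \<odot>\<^bsub>M\<^esub> n)"
      using x(1) c n by (simp add: R.nat_pow_distrib smult_assoc1[symmetric] R.m_comm)
  qed
  finally show "s P = \<dots>" .
qed

text \<open>Being a single fraction on a basic open set is stable under sums and multiples of the
  defining element and holds near every prime by definition of a section;
  \<open>local_imp_power_mem\<close> makes it global.\<close>

lemma tilde_section_on_basic_open:
  assumes a: "a \<in> carrier R" and s: "s \<in> tilde_sections R M (zariski_open R {a})"
  obtains n and k :: nat where "n \<in> carrier M"
    "\<And>P. primeideal P R \<Longrightarrow> a \<notin> P \<Longrightarrow> s P = module_frac R M (carrier R - P) n (a [^] k)"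
proof -
  \<comment> \<open>The factor \<open>a\<close> keeps every basic open set in question inside the
    domain of \<open>s\<close>.\<close>
  obtain N :: nat where "\<exists>n k. is_fraction_on s (a \<otimes> a [^] N) n k"
  proof (rule local_imp_power_mem[where Q = "\<lambda>h. \<exists>n k. is_fraction_on s (a \<otimes> h) n k" and a = a])
    show "\<exists>n k. is_fraction_on s (a \<otimes> \<zero>) n k"
    proof (intro exI)
      \<comment> \<open>Vacuous: every prime contains zero.\<close>
      show "is_fraction_on s (a \<otimes> \<zero>) \<zero>\<^bsub>M\<^esub> 0"
        unfolding is_fraction_on_def r_null[OF a]
        using additive_subgroup.zero_closed ideal.axioms(1) primeideal.axioms(1) M.zero_closed by blast
    qed
    show "\<exists>n k. is_fraction_on s (a \<otimes> (x \<oplus> y)) n k"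
      if "x \<in> carrier R" "y \<in> carrier R" "\<exists>n k. is_fraction_on s (a \<otimes> x) n k" "\<exists>n k. is_fraction_on s (a \<otimes> y) n k" for x y
      unfolding r_distr[OF that(1,2) a] using that a is_fraction_on_add[of "a \<otimes> x" _ _ _ "a \<otimes> y"] by blast
    show "\<exists>n k. is_fraction_on s (a \<otimes> (c \<otimes> x)) n k"
      if c: "c \<in> carrier R" "x \<in> carrier R" "\<exists>n k. is_fraction_on s (a \<otimes> x) n k" for c x
    proof -
      have acx: "a \<otimes> (c \<otimes> x) = c \<otimes> (a \<otimes> x)" using a c by (simp add: R.m_lcomm)
      show ?thesis using c a is_fraction_on_mult[of "a \<otimes> x"] unfolding acx by blast
    qed
    fix P assume P: "primeideal P R" "a \<notin> P"
    then have "P \<in> zariski_open R {a}" using a by (simp add: mem_zariski_open_singleton)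
    with s have "\<exists>V. openin (zariski R) V \<and> P \<in> V \<and> V \<subseteq> zariski_open R {a} \<and>
        (\<exists>n\<in>carrier M. \<exists>f\<in>carrier R. \<forall>Q\<in>V. f \<notin> Q \<and> s Q = module_frac R M (carrier R - Q) n f)"
      unfolding tilde_sections_def by blast
    then obtain V n f where V: "openin (zariski R) V" "P \<in> V" "V \<subseteq> zariski_open R {a}"
      and n: "n \<in> carrier M" and f: "f \<in> carrier R"
      and nf': "\<forall>Q\<in>V. f \<notin> Q \<and> s Q = module_frac R M (carrier R - Q) n f"
      by (elim exE conjE bexE)
    note nf = nf'[rule_format]
    obtain E where E: "E \<subseteq> carrier R" "V = zariski_open R E" using V(1) unfolding openin_zariski by blast
    obtain e where e: "e \<in> E" "e \<notin> P" using V(2) E by (auto simp: zariski_open_def)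
    have ec: "e \<in> carrier R" using e E by blast
    interpret P: primeideal P R by (rule P(1))
    have "f \<otimes> e \<notin> P" using P.I_prime f ec nf[OF V(2)] e by blast
    \<comment> \<open>Near \<open>P\<close> the section is \<open>n / f\<close>, valid at all primes
      missing \<open>e\<close>. Expanding this fraction by \<open>a\<close> and \<open>e\<close>
      gives the denominator \<open>a \<otimes> (f \<otimes> e)\<close>.\<close>
    moreover have "is_fraction_on s (a \<otimes> (f \<otimes> e)) (a \<odot>\<^bsub>M\<^esub> (e \<odot>\<^bsub>M\<^esub> n)) 1"
      unfolding is_fraction_on_def
    proof (intro conjI allI impI)
      show "a \<odot>\<^bsub>M\<^esub> (e \<odot>\<^bsub>M\<^esub> n) \<in> carrier M" using a ec n by auto
      fix Q assume Q: "primeideal Q R \<and> a \<otimes> (f \<otimes> e) \<notin> Q"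
      interpret Q: primeideal Q R using Q by blast
      have "e \<notin> Q" using Q Q.I_l_closed a f ec by auto
      then have "Q \<in> V" using E e Q.primeideal unfolding zariski_open_def by blast
      then have fQ: "f \<notin> Q" and "s Q = module_frac R M (carrier R - Q) n f" using nf by auto
      note this(2)
      also have "module_frac R M (carrier R - Q) n f =
          module_frac R M (carrier R - Q) (a \<odot>\<^bsub>M\<^esub> (e \<odot>\<^bsub>M\<^esub> n)) ((a \<otimes> (f \<otimes> e)) [^] (1::nat))"
      proof (rule frac_eqI[OF Q.primeideal _ _ n])
        show "a \<odot>\<^bsub>M\<^esub> (e \<odot>\<^bsub>M\<^esub> n) \<in> carrier M" "f \<in> carrier R - Q" using a ec n f fQ by auto
        show "(a \<otimes> (f \<otimes> e)) [^] (1::nat) \<in> carrier R - Q" using a f ec Q by auto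
        show "(a \<otimes> (f \<otimes> e)) [^] (1::nat) \<odot>\<^bsub>M\<^esub> n = f \<odot>\<^bsub>M\<^esub> (a \<odot>\<^bsub>M\<^esub> (e \<odot>\<^bsub>M\<^esub> n))"
          using a f ec n by (simp add: smult_assoc1[symmetric] R.m_lcomm)
      qed
      finally show "s Q = \<dots>" .
    qed
    ultimately show "\<exists>h\<in>carrier R. h \<notin> P \<and> (\<exists>n k. is_fraction_on s (a \<otimes> h) n k)" using f ec by blast
  qed (rule a)
  then obtain n k where G: "is_fraction_on s (a \<otimes> a [^] N) n k" by blast
  \<comment> \<open>A prime missing \<open>a\<close> also misses this power, so the fraction is
    valid on the whole basic open set, with denominator exponent \<open>Suc N * k\<close>.\<close>
  have "a \<otimes> a [^] N = a [^] Suc N" using a by (simp add: R.m_comm)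
  then have "(a \<otimes> a [^] N) [^] k = a [^] (Suc N * k)" using a by (simp only: R.nat_pow_pow)
  moreover have "a \<otimes> a [^] N \<notin> P" if "primeideal P R" "a \<notin> P" for P
    using pow_notin_prime[OF that(1) a that(2), of "Suc N"] \<open>a \<otimes> a [^] N = a [^] Suc N\<close> by simp
  ultimately show ?thesis using G that[of n "Suc N * k"] unfolding is_fraction_on_def by simp
qed

end

section \<open>Sheaves on a ringed space and basic open sets\<close>

lemma sheaf_on_presheaf_on: "sheaf_on T sec res \<Longrightarrow> presheaf_on T sec res"
  unfolding sheaf_on_def by (rule conjunct1)

lemma sheaf_on_restrict:
  assumes "sheaf_on T sec res"
  shows "\<lbrakk>openin T U; openin T V; V \<subseteq> U; s \<in> sec U\<rbrakk> \<Longrightarrow> res U V s \<in> sec V"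
  using conjunct1[OF sheaf_on_presheaf_on[OF assms, unfolded presheaf_on_def]] funcset_mem by metis

lemma sheaf_on_restrict_id:
  assumes "sheaf_on T sec res"
  shows "\<lbrakk>openin T U; s \<in> sec U\<rbrakk> \<Longrightarrow> res U U s = s"
  using sheaf_on_presheaf_on[OF assms] unfolding presheaf_on_def by blast

lemma sheaf_on_restrict_trans:
  assumes "sheaf_on T sec res"
  shows "\<lbrakk>openin T U; openin T V; openin T W; W \<subseteq> V; V \<subseteq> U; s \<in> sec U\<rbrakk> \<Longrightarrow>
    res V W (res U V s) = res U W s"
  using sheaf_on_presheaf_on[OF assms] unfolding presheaf_on_def by blast

text \<open>The cover consists of all open subsets on which \<open>s\<close> and \<open>t\<close>
  agree.\<close>

lemma sheaf_on_eqI: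
  assumes sh: "sheaf_on T sec res" and s: "s \<in> sec U" "t \<in> sec U"
    and loc: "\<And>x. x \<in> U \<Longrightarrow> \<exists>V. openin T V \<and> x \<in> V \<and> V \<subseteq> U \<and> res U V s = res U V t"
  shows "s = t"
proof -
  let ?C = "{V. openin T V \<and> V \<subseteq> U \<and> res U V s = res U V t}"
  have U: "\<Union>?C = U" using loc by blast
  have C: "\<forall>V\<in>?C. openin T V" by blast
  have "\<forall>s\<in>sec (\<Union>?C). \<forall>t\<in>sec (\<Union>?C). (\<forall>V\<in>?C. res (\<Union>?C) V s = res (\<Union>?C) V t) \<longrightarrow> s = t"
    by (rule conjunct2[OF sh[unfolded sheaf_on_def], THEN spec, THEN mp, OF C, THEN conjunct1])
  then show ?thesis unfolding U using s by simp
qed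

text \<open>\<open>sheaf_on\<close> indexes local sections by open sets; local constructions choose
  them for each point. Points with the same neighbourhood have the same section, by
  \<open>comp\<close> on that neighbourhood, so the data can be re-indexed.\<close>

lemma sheaf_on_glue:
  assumes sh: "sheaf_on T sec res"
    and V: "\<And>x. x \<in> U \<Longrightarrow> openin T (V x) \<and> x \<in> V x \<and> V x \<subseteq> U"
    and s: "\<And>x. x \<in> U \<Longrightarrow> s x \<in> sec (V x)"
    and comp: "\<And>x y. x \<in> U \<Longrightarrow> y \<in> U \<Longrightarrow>
      res (V x) (V x \<inter> V y) (s x) = res (V y) (V x \<inter> V y) (s y)"
  shows "\<exists>t\<in>sec U. \<forall>x\<in>U. res U (V x) t = s x"
proof -
  let ?C = "V ` U"
  have U: "\<Union>?C = U" using V by blast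
  define r where "r W = s (SOME x. x \<in> U \<and> V x = W)" for W
  have r: "r (V x) = s x" if x: "x \<in> U" for x
  proof -
    let ?y = "SOME y. y \<in> U \<and> V y = V x"
    have y: "?y \<in> U" "V ?y = V x" using someI[of "\<lambda>y. y \<in> U \<and> V y = V x" x] x by auto
    have "res (V x) (V x) (s ?y) = res (V x) (V x) (s x)"
      using comp[OF y(1) x] unfolding y(2) Int_absorb .
    then show ?thesis
      unfolding r_def using sheaf_on_restrict_id[OF sh] V[OF x] s[OF x] s[OF y(1)] y(2) by metis
  qed
  have "res W (W \<inter> W') (r W) = res W' (W \<inter> W') (r W')" if W: "W \<in> ?C" "W' \<in> ?C" for W W'
  proof -
    obtain x y where "x \<in> U" "W = V x" "y \<in> U" "W' = V y" using W by blast
    then show ?thesis using comp[of x y] r by simp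
  qed
  moreover have "\<forall>W\<in>?C. r W \<in> sec W" using r s by simp
  ultimately have rr: "(\<forall>W\<in>?C. r W \<in> sec W) \<and>
      (\<forall>W\<in>?C. \<forall>W'\<in>?C. res W (W \<inter> W') (r W) = res W' (W \<inter> W') (r W'))" by blast
  have C: "\<forall>W\<in>?C. openin T W" using V by blast
  have "\<exists>t\<in>sec (\<Union>?C). \<forall>W\<in>?C. res (\<Union>?C) W t = r W"
    by (rule conjunct2[OF sh[unfolded sheaf_on_def], THEN spec, THEN mp, OF C, THEN conjunct2,
          THEN spec, THEN mp, OF rr])
  then obtain t where "t \<in> sec U" "\<forall>x\<in>U. res U (V x) t = r (V x)" unfolding U by blast
  then show ?thesis using r by auto
qed

section \<open>Restriction of ring sections and basic open sets in a ringed space\<close>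

locale ringed =
  fixes X :: "('x, 'r) ringed_space"
  assumes ringed: "ringed_space X"
begin

abbreviation opn :: "'x set \<Rightarrow> bool" where "opn \<equiv> openin (space_top X)"
abbreviation \<O> :: "'x set \<Rightarrow> 'r ring" where "\<O> \<equiv> rsec X"
abbreviation \<rho> :: "'x set \<Rightarrow> 'x set \<Rightarrow> 'r \<Rightarrow> 'r" where "\<rho> \<equiv> rres X"

lemma cring_O: "opn U \<Longrightarrow> cring (\<O> U)"
  by (rule conjunct1[OF ringed[unfolded ringed_space_def], rule_format])

lemma rho_hom: "\<lbrakk>opn U; opn V; V \<subseteq> U\<rbrakk> \<Longrightarrow> \<rho> U V \<in> ring_hom (\<O> U) (\<O> V)"
  by (rule conjunct1[OF conjunct2[OF ringed[unfolded ringed_space_def]], rule_format]) blast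

lemma rho_hom_cring: "\<lbrakk>opn U; opn V; V \<subseteq> U\<rbrakk> \<Longrightarrow> ring_hom_cring (\<O> U) (\<O> V) (\<rho> U V)"
  by (intro ring_hom_cring.intro ring_hom_cring_axioms.intro cring_O rho_hom)

lemma sheaf_O: "sheaf_on (space_top X) (\<lambda>U. carrier (\<O> U)) \<rho>"
  using conjunct2[OF conjunct2[OF ringed[unfolded ringed_space_def]]] .

lemma rho_closed [simp]:
  "\<lbrakk>opn U; opn V; V \<subseteq> U; r \<in> carrier (\<O> U)\<rbrakk> \<Longrightarrow> \<rho> U V r \<in> carrier (\<O> V)"
  by (rule ring_hom_closed[OF rho_hom])

lemma rho_add [simp]:
  "\<lbrakk>opn U; opn V; V \<subseteq> U; r \<in> carrier (\<O> U); s \<in> carrier (\<O> U)\<rbrakk> \<Longrightarrow>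
    \<rho> U V (r \<oplus>\<^bsub>\<O> U\<^esub> s) = \<rho> U V r \<oplus>\<^bsub>\<O> V\<^esub> \<rho> U V s"
  by (rule ring_hom_add[OF rho_hom])

lemma rho_mult [simp]:
  "\<lbrakk>opn U; opn V; V \<subseteq> U; r \<in> carrier (\<O> U); s \<in> carrier (\<O> U)\<rbrakk> \<Longrightarrow>
    \<rho> U V (r \<otimes>\<^bsub>\<O> U\<^esub> s) = \<rho> U V r \<otimes>\<^bsub>\<O> V\<^esub> \<rho> U V s"
  by (rule ring_hom_mult[OF rho_hom])

lemma rho_one [simp]: "\<lbrakk>opn U; opn V; V \<subseteq> U\<rbrakk> \<Longrightarrow> \<rho> U V \<one>\<^bsub>\<O> U\<^esub> = \<one>\<^bsub>\<O> V\<^esub>"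
  by (rule ring_hom_one[OF rho_hom])

lemma rho_zero [simp]: "\<lbrakk>opn U; opn V; V \<subseteq> U\<rbrakk> \<Longrightarrow> \<rho> U V \<zero>\<^bsub>\<O> U\<^esub> = \<zero>\<^bsub>\<O> V\<^esub>"
  using rho_hom_cring ring_hom_cring.hom_zero by metis

lemma rho_pow [simp]:
  assumes "opn U" "opn V" "V \<subseteq> U" "r \<in> carrier (\<O> U)"
  shows "\<rho> U V (r [^]\<^bsub>\<O> U\<^esub> (k::nat)) = \<rho> U V r [^]\<^bsub>\<O> V\<^esub> k"
proof -
  interpret ring_hom_cring "\<O> U" "\<O> V" "\<rho> U V" by (rule rho_hom_cring[OF assms(1-3)])
  show ?thesis
    by (induction k) (simp_all only: R.nat_pow_0 S.nat_pow_0 R.nat_pow_Suc S.nat_pow_Suc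
        hom_one hom_mult R.nat_pow_closed assms(4))
qed

lemma rho_id [simp]: "\<lbrakk>opn U; r \<in> carrier (\<O> U)\<rbrakk> \<Longrightarrow> \<rho> U U r = r"
  using sheaf_on_restrict_id[OF sheaf_O] by blast

lemma rho_trans [simp]:
  "\<lbrakk>opn U; opn V; opn W; W \<subseteq> V; V \<subseteq> U; r \<in> carrier (\<O> U)\<rbrakk> \<Longrightarrow> \<rho> V W (\<rho> U V r) = \<rho> U W r"
  using sheaf_on_restrict_trans[OF sheaf_O] by blast

lemmas O_eqI = sheaf_on_eqI[OF sheaf_O]
lemmas O_glue = sheaf_on_glue[OF sheaf_O]

lemma rho_Units:
  assumes "opn U" "opn V" "V \<subseteq> U" "r \<in> Units (\<O> U)"
  shows "\<rho> U V r \<in> Units (\<O> V)"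
proof -
  interpret ring_hom_cring "\<O> U" "\<O> V" "\<rho> U V" by (rule rho_hom_cring[OF assms(1-3)])
  obtain s where s: "s \<in> carrier (\<O> U)" "s \<otimes>\<^bsub>\<O> U\<^esub> r = \<one>\<^bsub>\<O> U\<^esub>" and r: "r \<in> carrier (\<O> U)"
    using assms(4) unfolding Units_def by blast
  have "\<rho> U V s \<otimes>\<^bsub>\<O> V\<^esub> \<rho> U V r = \<one>\<^bsub>\<O> V\<^esub>" using s r assms(1-3) by (simp flip: rho_mult)
  then show ?thesis
    using s r S.m_comm unfolding Units_def by (auto intro!: bexI[of _ "\<rho> U V s"])
qed

text \<open>These are the points where the germ of \<open>g\<close> is a unit, phrased without
  stalks. In a chart it becomes the usual basic open set, by \<open>D_sigma\<close>.\<close>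

definition D :: "'x set \<Rightarrow> 'r \<Rightarrow> 'x set" where
  "D U g = \<Union>{W. opn W \<and> W \<subseteq> U \<and> \<rho> U W g \<in> Units (\<O> W)}"

lemma D_open [simp]: "opn (D U g)"
  unfolding D_def by (rule openin_Union) blast

lemma D_subset [simp]: "D U g \<subseteq> U"
  unfolding D_def by blast

lemma mem_D_iff: "x \<in> D U g \<longleftrightarrow> (\<exists>W. opn W \<and> x \<in> W \<and> W \<subseteq> U \<and> \<rho> U W g \<in> Units (\<O> W))"
  unfolding D_def by blast

lemma D_maximal: "\<lbrakk>opn W; W \<subseteq> U; \<rho> U W g \<in> Units (\<O> W)\<rbrakk> \<Longrightarrow> W \<subseteq> D U g"
  unfolding D_def by blast

lemma D_restrict:
  assumes "opn U" "opn V" "V \<subseteq> U" "g \<in> carrier (\<O> U)"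
  shows "D V (\<rho> U V g) = D U g \<inter> V"
proof (intro equalityI subsetI)
  fix x assume "x \<in> D V (\<rho> U V g)"
  then obtain W where W: "opn W" "x \<in> W" "W \<subseteq> V" "\<rho> V W (\<rho> U V g) \<in> Units (\<O> W)"
    unfolding mem_D_iff by blast
  then have "\<rho> U W g \<in> Units (\<O> W)" using assms by simp
  then have "W \<subseteq> D U g" using W(1,3) assms(3) by (intro D_maximal) auto
  then show "x \<in> D U g \<inter> V" using W(2,3) by blast
next
  fix x assume x: "x \<in> D U g \<inter> V"
  then obtain W where W: "opn W" "x \<in> W" "W \<subseteq> U" "\<rho> U W g \<in> Units (\<O> W)"
    unfolding Int_iff mem_D_iff by blast
  have WV: "opn (W \<inter> V)" using W assms by (intro openin_Int)
  have "\<rho> W (W \<inter> V) (\<rho> U W g) \<in> Units (\<O> (W \<inter> V))"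
    by (rule rho_Units) (use W WV in auto)
  then have "\<rho> V (W \<inter> V) (\<rho> U V g) \<in> Units (\<O> (W \<inter> V))" using W WV assms by simp
  then show "x \<in> D V (\<rho> U V g)" using W WV x unfolding mem_D_iff by blast
qed

text \<open>Inverses are unique, so the local ones agree on overlaps and glue.\<close>

lemma D_unit:
  assumes U: "opn U" and g: "g \<in> carrier (\<O> U)"
  shows "\<rho> U (D U g) g \<in> Units (\<O> (D U g))"
proof -
  let ?D = "D U g"
  have "\<forall>x\<in>?D. \<exists>W i. opn W \<and> x \<in> W \<and> W \<subseteq> ?D \<and> i \<in> carrier (\<O> W) \<and>
      i \<otimes>\<^bsub>\<O> W\<^esub> \<rho> U W g = \<one>\<^bsub>\<O> W\<^esub>"
  proof
    fix x assume "x \<in> ?D"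
    then obtain W where W: "opn W" "x \<in> W" "W \<subseteq> U" "\<rho> U W g \<in> Units (\<O> W)"
      unfolding mem_D_iff by blast
    then show "\<exists>W i. opn W \<and> x \<in> W \<and> W \<subseteq> ?D \<and> i \<in> carrier (\<O> W) \<and> i \<otimes>\<^bsub>\<O> W\<^esub> \<rho> U W g = \<one>\<^bsub>\<O> W\<^esub>"
      using D_maximal[OF W(1,3,4)] unfolding Units_def by blast
  qed
  then obtain W i where W: "\<And>x. x \<in> ?D \<Longrightarrow> opn (W x) \<and> x \<in> W x \<and> W x \<subseteq> ?D"
    and i: "\<And>x. x \<in> ?D \<Longrightarrow> i x \<in> carrier (\<O> (W x))"
    and inv: "\<And>x. x \<in> ?D \<Longrightarrow> i x \<otimes>\<^bsub>\<O> (W x)\<^esub> \<rho> U (W x) g = \<one>\<^bsub>\<O> (W x)\<^esub>"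
    by metis
  have WU: "W x \<subseteq> U" if "x \<in> ?D" for x using W[OF that] D_subset by blast
  have "\<exists>t\<in>carrier (\<O> ?D). \<forall>x\<in>?D. \<rho> ?D (W x) t = i x"
  proof (rule O_glue[OF W i])
    fix x y assume xy: "x \<in> ?D" "y \<in> ?D"
    let ?V = "W x \<inter> W y"
    have V: "opn ?V" using W xy by blast
    interpret cring "\<O> ?V" by (rule cring_O[OF V])
    have gV: "\<rho> U ?V g \<in> carrier (\<O> ?V)" using U V g WU[OF xy(1)] by (intro rho_closed) auto
    have ix: "\<rho> (W z) ?V (i z) \<otimes>\<^bsub>\<O> ?V\<^esub> \<rho> U ?V g = \<one>\<^bsub>\<O> ?V\<^esub>" "\<rho> (W z) ?V (i z) \<in> carrier (\<O> ?V)"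
      if "z = x \<or> z = y" for z
    proof -
      have z: "z \<in> ?D" "?V \<subseteq> W z" using that xy by auto
      have "\<rho> (W z) ?V (i z \<otimes>\<^bsub>\<O> (W z)\<^esub> \<rho> U (W z) g) = \<one>\<^bsub>\<O> ?V\<^esub>"
        using inv[OF z(1)] W[OF z(1)] V z by simp
      then show "\<rho> (W z) ?V (i z) \<otimes>\<^bsub>\<O> ?V\<^esub> \<rho> U ?V g = \<one>\<^bsub>\<O> ?V\<^esub>"
        using W[OF z(1)] V z i[OF z(1)] WU[OF z(1)] U g by simp
      show "\<rho> (W z) ?V (i z) \<in> carrier (\<O> ?V)" using W[OF z(1)] V z i[OF z(1)] by simp
    qed
    have "\<rho> U ?V g \<otimes>\<^bsub>\<O> ?V\<^esub> \<rho> (W y) ?V (i y) = \<one>\<^bsub>\<O> ?V\<^esub>"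
      using ix[of y] gV m_comm by simp
    then show "\<rho> (W x) ?V (i x) = \<rho> (W y) ?V (i y)"
      using ix[of x] ix[of y] gV inv_unique by blast
  qed
  then obtain t where t: "t \<in> carrier (\<O> ?D)" "\<And>x. x \<in> ?D \<Longrightarrow> \<rho> ?D (W x) t = i x" by blast
  interpret cring "\<O> ?D" by (rule cring_O) simp
  have gD: "\<rho> U ?D g \<in> carrier (\<O> ?D)" using U g by simp
  have "t \<otimes>\<^bsub>\<O> ?D\<^esub> \<rho> U ?D g = \<one>\<^bsub>\<O> ?D\<^esub>"
  proof (rule O_eqI)
    fix x assume x: "x \<in> ?D"
    have "\<rho> ?D (W x) (t \<otimes>\<^bsub>\<O> ?D\<^esub> \<rho> U ?D g) = \<rho> ?D (W x) \<one>\<^bsub>\<O> ?D\<^esub>"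
      using t gD W[OF x] U g x inv by simp
    then show "\<exists>V. opn V \<and> x \<in> V \<and> V \<subseteq> ?D \<and> \<rho> ?D V (t \<otimes>\<^bsub>\<O> ?D\<^esub> \<rho> U ?D g) = \<rho> ?D V \<one>\<^bsub>\<O> ?D\<^esub>"
      using W[OF x] by blast
  qed (use t gD in simp_all)
  then show ?thesis using t(1) gD m_comm unfolding Units_def by (auto intro!: bexI[of _ t])
qed

text \<open>In a commutative ring a product is a unit exactly when both factors are.\<close>

lemma D_mult:
  assumes U: "opn U" and g: "g \<in> carrier (\<O> U)" and h: "h \<in> carrier (\<O> U)"
  shows "D U (g \<otimes>\<^bsub>\<O> U\<^esub> h) = D U g \<inter> D U h"
proof (intro equalityI subsetI)
  fix x assume "x \<in> D U (g \<otimes>\<^bsub>\<O> U\<^esub> h)"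
  then obtain W where W: "opn W" "x \<in> W" "W \<subseteq> U" "\<rho> U W (g \<otimes>\<^bsub>\<O> U\<^esub> h) \<in> Units (\<O> W)"
    unfolding mem_D_iff by blast
  interpret cring "\<O> W" by (rule cring_O[OF W(1)])
  have c: "\<rho> U W g \<in> carrier (\<O> W)" "\<rho> U W h \<in> carrier (\<O> W)" using U W g h by auto
  have *: "\<rho> U W g \<otimes>\<^bsub>\<O> W\<^esub> \<rho> U W h \<in> Units (\<O> W)" using W U g h by simp
  then have "\<rho> U W h \<otimes>\<^bsub>\<O> W\<^esub> \<rho> U W g \<in> Units (\<O> W)" using c m_comm by simp
  then have "\<rho> U W g \<in> Units (\<O> W)" "\<rho> U W h \<in> Units (\<O> W)" using * c unit_factor by blast+
  then show "x \<in> D U g \<inter> D U h" using W unfolding Int_iff mem_D_iff by blast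
next
  fix x assume x: "x \<in> D U g \<inter> D U h"
  let ?W = "D U g \<inter> D U h"
  have W: "opn ?W" by (intro openin_Int D_open)
  interpret cring "\<O> ?W" by (rule cring_O[OF W])
  have "\<rho> (D U g) ?W (\<rho> U (D U g) g) \<in> Units (\<O> ?W)" "\<rho> (D U h) ?W (\<rho> U (D U h) h) \<in> Units (\<O> ?W)"
    using W by (intro rho_Units D_unit U g h D_open; blast)+
  moreover have WU: "?W \<subseteq> U" using D_subset[of U g] by blast
  ultimately have "\<rho> U ?W (g \<otimes>\<^bsub>\<O> U\<^esub> h) \<in> Units (\<O> ?W)" using W U g h by simp
  then show "x \<in> D U (g \<otimes>\<^bsub>\<O> U\<^esub> h)" using W WU x unfolding mem_D_iff by blast
qed

lemma D_Units: "\<lbrakk>opn U; g \<in> Units (\<O> U)\<rbrakk> \<Longrightarrow> D U g = U"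
proof -
  assume a: "opn U" "g \<in> Units (\<O> U)"
  then have "g \<in> carrier (\<O> U)" by (simp add: Units_def)
  then have "U \<subseteq> D U g" using a by (intro D_maximal) auto
  then show ?thesis using D_subset by blast
qed

lemma D_one: "opn U \<Longrightarrow> D U \<one>\<^bsub>\<O> U\<^esub> = U"
  by (rule D_Units) (simp_all add: monoid.Units_one_closed cring_O[THEN cring.axioms(1), THEN ring.is_monoid])

text \<open>The exponent must be positive: the zeroth power is a unit everywhere on
  \<open>U\<close>.\<close>

lemma D_pow:
  assumes U: "opn U" and g: "g \<in> carrier (\<O> U)"
  shows "D U (g [^]\<^bsub>\<O> U\<^esub> (Suc k)) = D U g"
proof -
  interpret cring "\<O> U" by (rule cring_O[OF U])
  show ?thesis by (induction k) (use g U in \<open>auto simp: D_mult\<close>)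
qed

end

section \<open>Modules whose sections over basic opens are localizations\<close>

lemma (in module) unit_smult_cancel:
  assumes u: "u \<in> Units R" and x: "x \<in> carrier M" and y: "y \<in> carrier M"
    and eq: "u \<odot>\<^bsub>M\<^esub> x = u \<odot>\<^bsub>M\<^esub> y"
  shows "x = y"
proof -
  have c: "u \<in> carrier R" "inv u \<in> carrier R" using u R.Units_inv_closed by (auto simp: Units_def)
  have "(inv u \<otimes> u) \<odot>\<^bsub>M\<^esub> x = (inv u \<otimes> u) \<odot>\<^bsub>M\<^esub> y"
    using eq c x y by (simp only: smult_assoc1)
  then show ?thesis using u x y by simp
qed

text \<open>The ring as a module over itself: with it, statements about the structure sheaf become
  instances of those about sheaves of modules.\<close>

definition self_module :: "'r ring \<Rightarrow> ('r, 'r) module" where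
  "self_module R = \<lparr>carrier = carrier R, mult = undefined, one = undefined,
    ring.zero = \<zero>\<^bsub>R\<^esub>, add = add R, smult = monoid.mult R\<rparr>"

lemma self_module_simps [simp]:
  "carrier (self_module R) = carrier R"
  "\<zero>\<^bsub>self_module R\<^esub> = \<zero>\<^bsub>R\<^esub>"
  "add (self_module R) = add R"
  "smult (self_module R) = monoid.mult R"
  by (simp_all add: self_module_def)

lemma module_self:
  assumes "cring R"
  shows "Module.module R (self_module R)"
proof -
  interpret cring R by (rule assms)
  show ?thesis
  proof (rule moduleI)
    show "abelian_group (self_module R)"
      by (rule abelian_groupI) (auto simp: a_ac intro!: bexI[of _ "\<ominus>\<^bsub>R\<^esub> _"] l_neg)
  qed (auto simp: assms l_distr r_distr m_assoc)
qed

definition self_sheaf :: "('x, 'r) ringed_space \<Rightarrow> ('x, 'r, 'r) sheaf_module" where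
  "self_sheaf X = \<lparr>msec = \<lambda>U. self_module (rsec X U), mres = rres X\<rparr>"

lemma self_sheaf_simps [simp]:
  "msec (self_sheaf X) U = self_module (rsec X U)"
  "mres (self_sheaf X) = rres X"
  by (simp_all add: self_sheaf_def)

lemma (in ringed) O_module_self: "O_module X (self_sheaf X)"
  unfolding O_module_def by (simp add: sheaf_O module_self cring_O)

locale sheaf_of_modules = ringed X for X :: "('x, 'r) ringed_space" +
  fixes M :: "('x, 'r, 'm) sheaf_module"
  assumes O_module: "O_module X M"
begin

abbreviation \<M> :: "'x set \<Rightarrow> ('r, 'm) module" where "\<M> \<equiv> msec M"
abbreviation \<mu> :: "'x set \<Rightarrow> 'x set \<Rightarrow> 'm \<Rightarrow> 'm" where "\<mu> \<equiv> mres M"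

lemma module_M: "opn U \<Longrightarrow> Module.module (\<O> U) (\<M> U)"
  by (rule conjunct1[OF O_module[unfolded O_module_def], rule_format])

lemma sheaf_M: "sheaf_on (space_top X) (\<lambda>U. carrier (\<M> U)) \<mu>"
  by (rule conjunct2[OF conjunct2[OF O_module[unfolded O_module_def]]])

lemma mu_closed [simp]:
  "\<lbrakk>opn U; opn V; V \<subseteq> U; s \<in> carrier (\<M> U)\<rbrakk> \<Longrightarrow> \<mu> U V s \<in> carrier (\<M> V)"
  by (rule sheaf_on_restrict[OF sheaf_M])

lemma mu_id [simp]: "\<lbrakk>opn U; s \<in> carrier (\<M> U)\<rbrakk> \<Longrightarrow> \<mu> U U s = s"
  by (rule sheaf_on_restrict_id[OF sheaf_M])

lemma mu_trans [simp]:
  "\<lbrakk>opn U; opn V; opn W; W \<subseteq> V; V \<subseteq> U; s \<in> carrier (\<M> U)\<rbrakk> \<Longrightarrow> \<mu> V W (\<mu> U V s) = \<mu> U W s"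
  by (rule sheaf_on_restrict_trans[OF sheaf_M])

lemma mu_add [simp]:
  "\<lbrakk>opn U; opn V; V \<subseteq> U; s \<in> carrier (\<M> U); t \<in> carrier (\<M> U)\<rbrakk> \<Longrightarrow>
    \<mu> U V (s \<oplus>\<^bsub>\<M> U\<^esub> t) = \<mu> U V s \<oplus>\<^bsub>\<M> V\<^esub> \<mu> U V t"
  using conjunct1[OF conjunct2[OF O_module[unfolded O_module_def]]] by simp

lemma mu_smult [simp]:
  "\<lbrakk>opn U; opn V; V \<subseteq> U; r \<in> carrier (\<O> U); s \<in> carrier (\<M> U)\<rbrakk> \<Longrightarrow>
    \<mu> U V (r \<odot>\<^bsub>\<M> U\<^esub> s) = \<rho> U V r \<odot>\<^bsub>\<M> V\<^esub> \<mu> U V s"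
  using conjunct1[OF conjunct2[OF O_module[unfolded O_module_def]]] by simp

lemma mu_zero [simp]:
  assumes "opn U" "opn V" "V \<subseteq> U"
  shows "\<mu> U V \<zero>\<^bsub>\<M> U\<^esub> = \<zero>\<^bsub>\<M> V\<^esub>"
proof -
  interpret U: module "\<O> U" "\<M> U" by (rule module_M[OF assms(1)])
  interpret V: module "\<O> V" "\<M> V" by (rule module_M[OF assms(2)])
  have "\<mu> U V (\<zero>\<^bsub>\<O> U\<^esub> \<odot>\<^bsub>\<M> U\<^esub> \<zero>\<^bsub>\<M> U\<^esub>) = \<zero>\<^bsub>\<O> V\<^esub> \<odot>\<^bsub>\<M> V\<^esub> \<mu> U V \<zero>\<^bsub>\<M> U\<^esub>"
    using assms by (subst mu_smult) auto
  moreover have "\<mu> U V \<zero>\<^bsub>\<M> U\<^esub> \<in> carrier (\<M> V)" using assms by simp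
  ultimately show ?thesis by simp
qed

lemma mu_minus [simp]:
  assumes "opn U" "opn V" "V \<subseteq> U" "s \<in> carrier (\<M> U)"
  shows "\<mu> U V (\<ominus>\<^bsub>\<M> U\<^esub> s) = \<ominus>\<^bsub>\<M> V\<^esub> \<mu> U V s"
proof -
  interpret U: module "\<O> U" "\<M> U" by (rule module_M[OF assms(1)])
  interpret V: module "\<O> V" "\<M> V" by (rule module_M[OF assms(2)])
  have "\<mu> U V (\<ominus>\<^bsub>\<M> U\<^esub> s) \<oplus>\<^bsub>\<M> V\<^esub> \<mu> U V s = \<mu> U V (\<ominus>\<^bsub>\<M> U\<^esub> s \<oplus>\<^bsub>\<M> U\<^esub> s)"
    using assms by (subst mu_add) auto
  also have "\<dots> = \<zero>\<^bsub>\<M> V\<^esub>" using assms by (simp add: U.M.l_neg)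
  finally have "\<mu> U V (\<ominus>\<^bsub>\<M> U\<^esub> s) \<oplus>\<^bsub>\<M> V\<^esub> \<mu> U V s = \<zero>\<^bsub>\<M> V\<^esub>" .
  moreover have "\<mu> U V s \<in> carrier (\<M> V)" "\<mu> U V (\<ominus>\<^bsub>\<M> U\<^esub> s) \<in> carrier (\<M> V)" using assms by auto
  ultimately show ?thesis by (rule V.M.minus_equality[symmetric])
qed

lemma mu_diff [simp]:
  assumes "opn U" "opn V" "V \<subseteq> U" "s \<in> carrier (\<M> U)" "t \<in> carrier (\<M> U)"
  shows "\<mu> U V (s \<ominus>\<^bsub>\<M> U\<^esub> t) = \<mu> U V s \<ominus>\<^bsub>\<M> V\<^esub> \<mu> U V t"
proof -
  interpret U: module "\<O> U" "\<M> U" by (rule module_M[OF assms(1)])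
  show ?thesis unfolding a_minus_def using assms by simp
qed

lemmas M_eqI = sheaf_on_eqI[OF sheaf_M]
lemmas M_glue = sheaf_on_glue[OF sheaf_M]

lemma M_eq_two:
  assumes W: "opn W" and A: "opn A" "A \<subseteq> W" and B: "opn B" "B \<subseteq> W" and cov: "W \<subseteq> A \<union> B"
    and s: "s \<in> carrier (\<M> W)" "t \<in> carrier (\<M> W)"
    and eq: "\<mu> W A s = \<mu> W A t" "\<mu> W B s = \<mu> W B t"
  shows "s = t"
  by (rule M_eqI[OF s]) (use A B cov eq in blast)

lemma M_glue_two:
  assumes W: "opn W" and A: "opn A" "A \<subseteq> W" and B: "opn B" "B \<subseteq> W" and cov: "W \<subseteq> A \<union> B"
    and s: "s \<in> carrier (\<M> A)" "t \<in> carrier (\<M> B)"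
    and eq: "\<mu> A (A \<inter> B) s = \<mu> B (A \<inter> B) t"
  obtains m where "m \<in> carrier (\<M> W)" "\<mu> W A m = s" "\<mu> W B m = t"
proof -
  let ?V = "\<lambda>x. if x \<in> A then A else B" and ?s = "\<lambda>x. if x \<in> A then s else t"
  have "\<exists>m\<in>carrier (\<M> W). \<forall>x\<in>W. \<mu> W (?V x) m = ?s x"
    by (rule M_glue) (use A B cov s eq in \<open>auto simp: Int_commute\<close>)
  then obtain m where m: "m \<in> carrier (\<M> W)" "\<And>x. x \<in> W \<Longrightarrow> \<mu> W (?V x) m = ?s x" by blast
  have mA: "\<mu> W A m = s"
  proof (rule M_eqI[OF _ s(1)])
    show "\<mu> W A m \<in> carrier (\<M> A)" using W A m(1) by simp
    show "\<exists>V. opn V \<and> x \<in> V \<and> V \<subseteq> A \<and> \<mu> A V (\<mu> W A m) = \<mu> A V s" if "x \<in> A" for x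
      using m(2)[of x] that A by auto
  qed
  \<comment> \<open>Points of the overlap were assigned to \<open>A\<close>, so there the agreement
    with \<open>t\<close> has to be recovered from \<open>eq\<close>.\<close>
  have mB: "\<mu> W B m = t"
  proof (rule M_eqI[OF _ s(2)])
    show "\<mu> W B m \<in> carrier (\<M> B)" using W B m(1) by simp
    show "\<exists>V. opn V \<and> x \<in> V \<and> V \<subseteq> B \<and> \<mu> B V (\<mu> W B m) = \<mu> B V t" if x: "x \<in> B" for x
    proof (cases "x \<in> A")
      case True
      have AB: "opn (A \<inter> B)" using A B by blast
      have "\<mu> B (A \<inter> B) (\<mu> W B m) = \<mu> A (A \<inter> B) (\<mu> W A m)"
        using W A B AB m(1) by simp
      also have "\<dots> = \<mu> B (A \<inter> B) t" using mA eq by simp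
      finally show ?thesis using True x AB by blast
    next
      case False
      then show ?thesis using m(2)[of x] x B by auto
    qed
  qed
  show ?thesis using that m(1) mA mB by blast
qed

end

text \<open>Sections over \<open>D U g\<close> are the localization at \<open>g\<close> of the
  sections over \<open>U\<close>. As \<open>g\<close> is invertible on \<open>D U g\<close>, two
  conditions suffice: every section there is of the form \<open>m / g^k\<close>, and the kernel of
  restriction is torsion for powers of \<open>g\<close>.\<close>

definition localizes :: "('x, 'r) ringed_space \<Rightarrow> ('x, 'r, 'm) sheaf_module \<Rightarrow> 'x set \<Rightarrow> bool" where
  "localizes X M U \<longleftrightarrow> (\<forall>g\<in>carrier (rsec X U).
    (\<forall>t\<in>carrier (msec M (ringed.D X U g)). \<exists>k::nat. \<exists>m\<in>carrier (msec M U).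
      mres M U (ringed.D X U g) m =
        rres X U (ringed.D X U g) g [^]\<^bsub>rsec X (ringed.D X U g)\<^esub> k \<odot>\<^bsub>msec M (ringed.D X U g)\<^esub> t) \<and>
    (\<forall>m\<in>carrier (msec M U). mres M U (ringed.D X U g) m = \<zero>\<^bsub>msec M (ringed.D X U g)\<^esub> \<longrightarrow>
      (\<exists>k::nat. g [^]\<^bsub>rsec X U\<^esub> k \<odot>\<^bsub>msec M U\<^esub> m = \<zero>\<^bsub>msec M U\<^esub>)))"

context sheaf_of_modules
begin

lemma localizes_lift:
  assumes "localizes X M U" "g \<in> carrier (\<O> U)" "t \<in> carrier (\<M> (D U g))"
  obtains k :: nat and m where "m \<in> carrier (\<M> U)"
    "\<mu> U (D U g) m = \<rho> U (D U g) g [^]\<^bsub>\<O> (D U g)\<^esub> k \<odot>\<^bsub>\<M> (D U g)\<^esub> t"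
  using assms unfolding localizes_def by blast

lemma localizes_kill:
  assumes "localizes X M U" "g \<in> carrier (\<O> U)" "m \<in> carrier (\<M> U)"
    "\<mu> U (D U g) m = \<zero>\<^bsub>\<M> (D U g)\<^esub>"
  obtains k :: nat where "g [^]\<^bsub>\<O> U\<^esub> k \<odot>\<^bsub>\<M> U\<^esub> m = \<zero>\<^bsub>\<M> U\<^esub>"
  using assms unfolding localizes_def by blast

lemma localizesI:
  assumes "\<And>g t. \<lbrakk>g \<in> carrier (\<O> U); t \<in> carrier (\<M> (D U g))\<rbrakk> \<Longrightarrow> \<exists>k::nat. \<exists>m\<in>carrier (\<M> U).
      \<mu> U (D U g) m = \<rho> U (D U g) g [^]\<^bsub>\<O> (D U g)\<^esub> k \<odot>\<^bsub>\<M> (D U g)\<^esub> t"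
    and "\<And>g m. \<lbrakk>g \<in> carrier (\<O> U); m \<in> carrier (\<M> U); \<mu> U (D U g) m = \<zero>\<^bsub>\<M> (D U g)\<^esub>\<rbrakk> \<Longrightarrow>
      \<exists>k::nat. g [^]\<^bsub>\<O> U\<^esub> k \<odot>\<^bsub>\<M> U\<^esub> m = \<zero>\<^bsub>\<M> U\<^esub>"
  shows "localizes X M U"
  using assms unfolding localizes_def by blast

end

context ringed
begin

interpretation self: sheaf_of_modules X "self_sheaf X"
  by (unfold_locales) (rule O_module_self)

lemma localizes_self_lift:
  assumes "localizes X (self_sheaf X) U" "g \<in> carrier (\<O> U)" "t \<in> carrier (\<O> (D U g))"
  obtains k :: nat and h where "h \<in> carrier (\<O> U)"
    "\<rho> U (D U g) h = \<rho> U (D U g) g [^]\<^bsub>\<O> (D U g)\<^esub> k \<otimes>\<^bsub>\<O> (D U g)\<^esub> t"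
proof -
  have "t \<in> carrier (msec (self_sheaf X) (D U g))" using assms(3) by simp
  then obtain k :: nat and h where "h \<in> carrier (msec (self_sheaf X) U)" "mres (self_sheaf X) U (D U g) h =
      \<rho> U (D U g) g [^]\<^bsub>\<O> (D U g)\<^esub> k \<odot>\<^bsub>msec (self_sheaf X) (D U g)\<^esub> t"
    using self.localizes_lift[OF assms(1,2)] by metis
  then show ?thesis using that by simp
qed

lemma localizes_self_kill:
  assumes "localizes X (self_sheaf X) U" "g \<in> carrier (\<O> U)" "h \<in> carrier (\<O> U)"
    "\<rho> U (D U g) h = \<zero>\<^bsub>\<O> (D U g)\<^esub>"
  obtains k :: nat where "g [^]\<^bsub>\<O> U\<^esub> k \<otimes>\<^bsub>\<O> U\<^esub> h = \<zero>\<^bsub>\<O> U\<^esub>"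
proof -
  have "h \<in> carrier (msec (self_sheaf X) U)"
    "mres (self_sheaf X) U (D U g) h = \<zero>\<^bsub>msec (self_sheaf X) (D U g)\<^esub>" using assms(3,4) by simp_all
  then obtain k :: nat where
    "g [^]\<^bsub>\<O> U\<^esub> k \<odot>\<^bsub>msec (self_sheaf X) U\<^esub> h = \<zero>\<^bsub>msec (self_sheaf X) U\<^esub>"
    using self.localizes_kill[OF assms(1,2)] by metis
  then show ?thesis using that by simp
qed

text \<open>Some \<open>g^k h\<close> lifts to \<open>h'\<close> over \<open>U\<close>, and
  \<open>w\<close> is \<open>g \<otimes> h'\<close>: the extra factor \<open>g\<close> forces
  \<open>D U w\<close> into \<open>D U g\<close>. Hence a basic open set of a basic open set is
  basic.\<close>

lemma D_shrink:
  assumes U: "opn U" and loc: "localizes X (self_sheaf X) U"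
    and g: "g \<in> carrier (\<O> U)" and h: "h \<in> carrier (\<O> (D U g))"
  obtains w v where "w \<in> carrier (\<O> U)" "v \<in> Units (\<O> (D U g))"
    "\<rho> U (D U g) w = v \<otimes>\<^bsub>\<O> (D U g)\<^esub> h" "D U w = D (D U g) h"
proof -
  let ?W = "D U g"
  interpret U: cring "\<O> U" by (rule cring_O[OF U])
  interpret W: cring "\<O> ?W" by (rule cring_O[OF D_open])
  obtain k :: nat and h' where h': "h' \<in> carrier (\<O> U)"
    "\<rho> U ?W h' = \<rho> U ?W g [^]\<^bsub>\<O> ?W\<^esub> k \<otimes>\<^bsub>\<O> ?W\<^esub> h"
    using localizes_self_lift[OF loc g h] .
  let ?g = "\<rho> U ?W g"
  let ?v = "?g \<otimes>\<^bsub>\<O> ?W\<^esub> ?g [^]\<^bsub>\<O> ?W\<^esub> k"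
  have gW: "?g \<in> Units (\<O> ?W)" by (rule D_unit[OF U g])
  then have gc: "?g \<in> carrier (\<O> ?W)" by (rule W.Units_closed)
  have v: "?v \<in> Units (\<O> ?W)" using gW by (intro W.Units_m_closed W.Units_pow_closed)
  let ?w = "g \<otimes>\<^bsub>\<O> U\<^esub> h'"
  have w: "?w \<in> carrier (\<O> U)" using g h' by simp
  have eq: "\<rho> U ?W ?w = ?v \<otimes>\<^bsub>\<O> ?W\<^esub> h"
    using U g h' h gc by (simp add: W.m_assoc)
  have "D U ?w = D U ?w \<inter> ?W" using D_mult[OF U g h'(1)] by blast
  also have "\<dots> = D ?W (\<rho> U ?W ?w)" using D_restrict[OF U _ _ w] by simp
  also have "\<dots> = D ?W ?v \<inter> D ?W h" unfolding eq using v h W.Units_closed by (intro D_mult) auto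
  also have "\<dots> = D ?W h" using D_Units[OF D_open v] D_subset by blast
  finally show ?thesis using that[OF w v eq] by blast
qed

end

context sheaf_of_modules
begin

text \<open>By \<open>D_shrink\<close> the basic open set of \<open>h\<close> in
  \<open>D U g\<close> is the basic open set of some \<open>w\<close> in \<open>U\<close>, where
  \<open>w\<close> restricts to a unit times \<open>h\<close>. Both conditions are transferred from
  \<open>w\<close> to \<open>h\<close> by cancelling units.\<close>

lemma localizes_D:
  assumes U: "opn U" and self: "localizes X (self_sheaf X) U" and loc: "localizes X M U"
    and g: "g \<in> carrier (\<O> U)"
  shows "localizes X M (D U g)"
proof (rule localizesI)
  let ?W = "D U g"
  interpret MU: module "\<O> U" "\<M> U" by (rule module_M[OF U])
  interpret MW: module "\<O> ?W" "\<M> ?W" by (rule module_M[OF D_open])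
  fix h assume h: "h \<in> carrier (\<O> ?W)"
  obtain w v where w: "w \<in> carrier (\<O> U)" and v: "v \<in> Units (\<O> ?W)"
    and wv: "\<rho> U ?W w = v \<otimes>\<^bsub>\<O> ?W\<^esub> h" and Dw: "D U w = D ?W h"
    using D_shrink[OF U self g h] .
  have vc: "v \<in> carrier (\<O> ?W)" "inv\<^bsub>\<O> ?W\<^esub> v \<in> carrier (\<O> ?W)" using v by auto
  have vk: "v [^]\<^bsub>\<O> ?W\<^esub> k \<in> Units (\<O> ?W)" for k :: nat using v by (rule MW.R.Units_pow_closed)
  have wk: "\<rho> U ?W w [^]\<^bsub>\<O> ?W\<^esub> k = v [^]\<^bsub>\<O> ?W\<^esub> k \<otimes>\<^bsub>\<O> ?W\<^esub> h [^]\<^bsub>\<O> ?W\<^esub> k" for k :: nat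
    unfolding wv using vc h by (intro MW.R.nat_pow_distrib)
  let ?E = "D ?W h"
  have E: "opn ?E" "?E \<subseteq> ?W" "?E \<subseteq> U" using subset_trans[OF D_subset D_subset] by auto
  interpret ME: module "\<O> ?E" "\<M> ?E" by (rule module_M[OF E(1)])
  { fix t assume t: "t \<in> carrier (\<M> ?E)"
    obtain k :: nat and m where m: "m \<in> carrier (\<M> U)"
      "\<mu> U ?E m = \<rho> U ?E w [^]\<^bsub>\<O> ?E\<^esub> k \<odot>\<^bsub>\<M> ?E\<^esub> t"
      using localizes_lift[OF loc w] t unfolding Dw by blast
    \<comment> \<open>This inverse turns the power of \<open>w\<close> into the same power of
      \<open>h\<close>.\<close>
    let ?i = "inv\<^bsub>\<O> ?W\<^esub> (v [^]\<^bsub>\<O> ?W\<^esub> k)"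
    have i: "?i \<in> carrier (\<O> ?W)" using vk by auto
    have hk: "h [^]\<^bsub>\<O> ?W\<^esub> k \<in> carrier (\<O> ?W)" using h by simp
    have ic: "?i \<otimes>\<^bsub>\<O> ?W\<^esub> \<rho> U ?W w [^]\<^bsub>\<O> ?W\<^esub> k = h [^]\<^bsub>\<O> ?W\<^esub> k"
      unfolding wk using vk[of k] i hk by (simp add: MW.R.m_assoc[symmetric] MW.R.Units_closed)
    have "\<mu> ?W ?E (?i \<odot>\<^bsub>\<M> ?W\<^esub> \<mu> U ?W m) = \<rho> ?W ?E ?i \<odot>\<^bsub>\<M> ?E\<^esub> (\<rho> U ?E w [^]\<^bsub>\<O> ?E\<^esub> k \<odot>\<^bsub>\<M> ?E\<^esub> t)"
      using U E i m by simp
    also have "\<dots> = \<rho> ?W ?E (?i \<otimes>\<^bsub>\<O> ?W\<^esub> \<rho> U ?W w [^]\<^bsub>\<O> ?W\<^esub> k) \<odot>\<^bsub>\<M> ?E\<^esub> t"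
      using U E i w t by (simp add: ME.smult_assoc1)
    also have "\<dots> = \<rho> ?W ?E h [^]\<^bsub>\<O> ?E\<^esub> k \<odot>\<^bsub>\<M> ?E\<^esub> t"
      unfolding ic using E h by simp
    finally show "\<exists>k::nat. \<exists>m\<in>carrier (\<M> ?W). \<mu> ?W ?E m = \<rho> ?W ?E h [^]\<^bsub>\<O> ?E\<^esub> k \<odot>\<^bsub>\<M> ?E\<^esub> t"
      using U i m(1) by (intro exI[of _ k] bexI[of _ "?i \<odot>\<^bsub>\<M> ?W\<^esub> \<mu> U ?W m"]) auto
  }
  { fix m assume m: "m \<in> carrier (\<M> ?W)" "\<mu> ?W ?E m = \<zero>\<^bsub>\<M> ?E\<^esub>"
    \<comment> \<open>A multiple of \<open>m\<close> by a power of \<open>g\<close> extends to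
      \<open>U\<close> as \<open>m1\<close>; it vanishes on \<open>D U w\<close>, so a power of
      \<open>w\<close> kills it. Over \<open>?W\<close> all factors except the power of
      \<open>h\<close> are units.\<close>
    obtain j :: nat and m1 where m1: "m1 \<in> carrier (\<M> U)"
      "\<mu> U ?W m1 = \<rho> U ?W g [^]\<^bsub>\<O> ?W\<^esub> j \<odot>\<^bsub>\<M> ?W\<^esub> m"
      using localizes_lift[OF loc g m(1)] .
    have gW: "\<rho> U ?W g \<in> Units (\<O> ?W)" by (rule D_unit[OF U g])
    have gj: "\<rho> U ?W g [^]\<^bsub>\<O> ?W\<^esub> j \<in> Units (\<O> ?W)" by (rule MW.R.Units_pow_closed[OF gW])
    then have gjc: "\<rho> U ?W g [^]\<^bsub>\<O> ?W\<^esub> j \<in> carrier (\<O> ?W)" by (rule MW.R.Units_closed)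
    have "\<mu> U ?E m1 = \<mu> ?W ?E (\<mu> U ?W m1)" using U E m1(1) by simp
    also have "\<dots> = \<zero>\<^bsub>\<M> ?E\<^esub>" unfolding m1(2) using E gjc m by simp
    finally obtain k :: nat where k: "w [^]\<^bsub>\<O> U\<^esub> k \<odot>\<^bsub>\<M> U\<^esub> m1 = \<zero>\<^bsub>\<M> U\<^esub>"
      using localizes_kill[OF loc w m1(1)] unfolding Dw by blast
    let ?u = "\<rho> U ?W g [^]\<^bsub>\<O> ?W\<^esub> j \<otimes>\<^bsub>\<O> ?W\<^esub> v [^]\<^bsub>\<O> ?W\<^esub> k"
    have u: "?u \<in> Units (\<O> ?W)" using gj vk by (rule MW.R.Units_m_closed)
    have hk: "h [^]\<^bsub>\<O> ?W\<^esub> k \<in> carrier (\<O> ?W)" using h by simp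
    have "?u \<odot>\<^bsub>\<M> ?W\<^esub> (h [^]\<^bsub>\<O> ?W\<^esub> k \<odot>\<^bsub>\<M> ?W\<^esub> m) = \<rho> U ?W w [^]\<^bsub>\<O> ?W\<^esub> k \<odot>\<^bsub>\<M> ?W\<^esub> \<mu> U ?W m1"
      unfolding wk m1(2) using gjc vk[of k, THEN MW.R.Units_closed] hk m(1)
      by (simp add: MW.smult_assoc1[symmetric] MW.R.m_ac)
    also have "\<dots> = \<mu> U ?W (w [^]\<^bsub>\<O> U\<^esub> k \<odot>\<^bsub>\<M> U\<^esub> m1)" using U w m1(1) by simp
    also have "\<dots> = ?u \<odot>\<^bsub>\<M> ?W\<^esub> \<zero>\<^bsub>\<M> ?W\<^esub>" unfolding k using U u MW.R.Units_closed by simp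
    finally have "h [^]\<^bsub>\<O> ?W\<^esub> k \<odot>\<^bsub>\<M> ?W\<^esub> m = \<zero>\<^bsub>\<M> ?W\<^esub>"
      using MW.unit_smult_cancel[OF u] hk m(1) by simp
    then show "\<exists>k::nat. h [^]\<^bsub>\<O> ?W\<^esub> k \<odot>\<^bsub>\<M> ?W\<^esub> m = \<zero>\<^bsub>\<M> ?W\<^esub>" by blast
  }
qed

text \<open>The two-set case of extending sections up to powers of \<open>g\<close>: lift on both
  pieces, multiply by a power of \<open>g\<close> that kills the discrepancy on the overlap, and
  glue.\<close>

lemma localizes_glue:
  assumes W: "opn W" and x: "x \<in> carrier (\<O> W)" and y: "y \<in> carrier (\<O> W)"
    and cov: "W \<subseteq> D W x \<union> D W y"
    and lx: "localizes X M (D W x)" and ly: "localizes X M (D W y)"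
    and self: "localizes X (self_sheaf X) (D W x)"
  shows "localizes X M W"
proof (rule localizesI)
  let ?A = "D W x" and ?B = "D W y"
  let ?Z = "?A \<inter> ?B"
  have sub: "?A \<subseteq> W" "?B \<subseteq> W" "?Z \<subseteq> W" using D_subset by blast+
  have Zo: "opn ?Z" by (intro openin_Int D_open)
  interpret MW: module "\<O> W" "\<M> W" by (rule module_M[OF W])
  interpret MA: module "\<O> ?A" "\<M> ?A" by (rule module_M[OF D_open])
  interpret MB: module "\<O> ?B" "\<M> ?B" by (rule module_M[OF D_open])
  interpret MZ: module "\<O> ?Z" "\<M> ?Z" by (rule module_M[OF Zo])
  \<comment> \<open>The overlap is basic in \<open>?A\<close>, so \<open>M\<close> localizes over it
    too; this is what kills the discrepancy of two lifts.\<close>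
  have Z: "?Z = D ?A (\<rho> W ?A y)" using D_restrict[OF W D_open sub(1) y] by blast
  have lZ: "localizes X M ?Z"
    unfolding Z by (rule localizes_D[OF D_open self lx]) (use W y in simp)
  fix g assume g: "g \<in> carrier (\<O> W)"
  let ?E = "D W g"
  interpret ME: module "\<O> ?E" "\<M> ?E" by (rule module_M[OF D_open])
  have EV: "D V (\<rho> W V g) = ?E \<inter> V" "\<rho> W V g \<in> carrier (\<O> V)" if "opn V" "V \<subseteq> W" for V
    using D_restrict[OF W that g] W that g by auto
  have EVo: "opn (?E \<inter> V)" if "opn V" for V using that by (intro openin_Int D_open)
  { fix m assume m: "m \<in> carrier (\<M> W)" "\<mu> W ?E m = \<zero>\<^bsub>\<M> ?E\<^esub>"
    have kill: "\<exists>k::nat. \<rho> W V g [^]\<^bsub>\<O> V\<^esub> k \<odot>\<^bsub>\<M> V\<^esub> \<mu> W V m = \<zero>\<^bsub>\<M> V\<^esub>"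
      if V: "opn V" "V \<subseteq> W" and l: "localizes X M V" for V
    proof -
      have "\<mu> V (?E \<inter> V) (\<mu> W V m) = \<mu> ?E (?E \<inter> V) (\<mu> W ?E m)"
        using W V m(1) EVo[OF V(1)] by simp
      also have "\<dots> = \<zero>\<^bsub>\<M> (?E \<inter> V)\<^esub>" unfolding m(2) using EVo[OF V(1)] by simp
      finally show ?thesis
        using localizes_kill[OF l EV(2)[OF V]] V W m(1) unfolding EV(1)[OF V] by (metis mu_closed)
    qed
    obtain a b :: nat where a: "\<rho> W ?A g [^]\<^bsub>\<O> ?A\<^esub> a \<odot>\<^bsub>\<M> ?A\<^esub> \<mu> W ?A m = \<zero>\<^bsub>\<M> ?A\<^esub>"
      and b: "\<rho> W ?B g [^]\<^bsub>\<O> ?B\<^esub> b \<odot>\<^bsub>\<M> ?B\<^esub> \<mu> W ?B m = \<zero>\<^bsub>\<M> ?B\<^esub>"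
      using kill[OF D_open sub(1) lx] kill[OF D_open sub(2) ly] by blast
    \<comment> \<open>The sum of the two exponents serves on both pieces.\<close>
    have "g [^]\<^bsub>\<O> W\<^esub> (a + b) \<odot>\<^bsub>\<M> W\<^esub> m = \<zero>\<^bsub>\<M> W\<^esub>"
    proof (rule M_eq_two[OF W D_open sub(1) D_open sub(2) cov])
      have gA: "\<rho> W ?A g \<in> carrier (\<O> ?A)" and mA: "\<mu> W ?A m \<in> carrier (\<M> ?A)" using W g m by auto
      have "\<rho> W ?A g [^]\<^bsub>\<O> ?A\<^esub> (b + a) \<odot>\<^bsub>\<M> ?A\<^esub> \<mu> W ?A m = \<zero>\<^bsub>\<M> ?A\<^esub>"
        using gA mA a by (simp add: MA.R.nat_pow_mult[symmetric] MA.smult_assoc1)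
      then show "\<mu> W ?A (g [^]\<^bsub>\<O> W\<^esub> (a + b) \<odot>\<^bsub>\<M> W\<^esub> m) = \<mu> W ?A \<zero>\<^bsub>\<M> W\<^esub>"
        using W g m(1) by (simp add: add.commute)
      have gB: "\<rho> W ?B g \<in> carrier (\<O> ?B)" and mB: "\<mu> W ?B m \<in> carrier (\<M> ?B)" using W g m by auto
      have "\<rho> W ?B g [^]\<^bsub>\<O> ?B\<^esub> (a + b) \<odot>\<^bsub>\<M> ?B\<^esub> \<mu> W ?B m = \<zero>\<^bsub>\<M> ?B\<^esub>"
        using gB mB b by (simp add: MB.R.nat_pow_mult[symmetric] MB.smult_assoc1)
      then show "\<mu> W ?B (g [^]\<^bsub>\<O> W\<^esub> (a + b) \<odot>\<^bsub>\<M> W\<^esub> m) = \<mu> W ?B \<zero>\<^bsub>\<M> W\<^esub>"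
        using W g m(1) by simp
    qed (use g m(1) in auto)
    then show "\<exists>k::nat. g [^]\<^bsub>\<O> W\<^esub> k \<odot>\<^bsub>\<M> W\<^esub> m = \<zero>\<^bsub>\<M> W\<^esub>" by blast
  }
  { fix t assume t: "t \<in> carrier (\<M> ?E)"
    have lift: "\<exists>k::nat. \<exists>m\<in>carrier (\<M> V). \<mu> V (?E \<inter> V) m =
        \<rho> W (?E \<inter> V) g [^]\<^bsub>\<O> (?E \<inter> V)\<^esub> k \<odot>\<^bsub>\<M> (?E \<inter> V)\<^esub> \<mu> ?E (?E \<inter> V) t"
      if V: "opn V" "V \<subseteq> W" and l: "localizes X M V" for V
    proof -
      have "\<mu> ?E (?E \<inter> V) t \<in> carrier (\<M> (?E \<inter> V))" using EVo[OF V(1)] t by simp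
      moreover have "\<rho> V (?E \<inter> V) (\<rho> W V g) = \<rho> W (?E \<inter> V) g" using W V g EVo[OF V(1)] by simp
      ultimately show ?thesis
        using localizes_lift[OF l EV(2)[OF V], of "\<mu> ?E (?E \<inter> V) t"] unfolding EV(1)[OF V] by metis
    qed
    obtain a :: nat and m1 where m1: "m1 \<in> carrier (\<M> ?A)" "\<mu> ?A (?E \<inter> ?A) m1 =
        \<rho> W (?E \<inter> ?A) g [^]\<^bsub>\<O> (?E \<inter> ?A)\<^esub> a \<odot>\<^bsub>\<M> (?E \<inter> ?A)\<^esub> \<mu> ?E (?E \<inter> ?A) t"
      using lift[OF D_open sub(1) lx] by blast
    obtain b :: nat and m2 where m2: "m2 \<in> carrier (\<M> ?B)" "\<mu> ?B (?E \<inter> ?B) m2 =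
        \<rho> W (?E \<inter> ?B) g [^]\<^bsub>\<O> (?E \<inter> ?B)\<^esub> b \<odot>\<^bsub>\<M> (?E \<inter> ?B)\<^esub> \<mu> ?E (?E \<inter> ?B) t"
      using lift[OF D_open sub(2) ly] by blast
    have raise: "\<mu> V (?E \<inter> V) (\<rho> W V g [^]\<^bsub>\<O> V\<^esub> l \<odot>\<^bsub>\<M> V\<^esub> m) =
        \<rho> W (?E \<inter> V) g [^]\<^bsub>\<O> (?E \<inter> V)\<^esub> (l + k) \<odot>\<^bsub>\<M> (?E \<inter> V)\<^esub> \<mu> ?E (?E \<inter> V) t"
      if V: "opn V" "V \<subseteq> W" and m: "m \<in> carrier (\<M> V)" "\<mu> V (?E \<inter> V) m =
        \<rho> W (?E \<inter> V) g [^]\<^bsub>\<O> (?E \<inter> V)\<^esub> k \<odot>\<^bsub>\<M> (?E \<inter> V)\<^esub> \<mu> ?E (?E \<inter> V) t" for V m and k l :: nat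
    proof -
      note EV' = EVo[OF V(1)]
      interpret N: module "\<O> (?E \<inter> V)" "\<M> (?E \<inter> V)" by (rule module_M[OF EV'])
      interpret NV: module "\<O> V" "\<M> V" by (rule module_M[OF V(1)])
      have EW: "?E \<inter> V \<subseteq> W" using V by blast
      have gE: "\<rho> W (?E \<inter> V) g \<in> carrier (\<O> (?E \<inter> V))" using W EV' EW g by simp
      have tE: "\<mu> ?E (?E \<inter> V) t \<in> carrier (\<M> (?E \<inter> V))" using EV' t by simp
      have "\<mu> V (?E \<inter> V) (\<rho> W V g [^]\<^bsub>\<O> V\<^esub> l \<odot>\<^bsub>\<M> V\<^esub> m) =
          \<rho> W (?E \<inter> V) g [^]\<^bsub>\<O> (?E \<inter> V)\<^esub> l \<odot>\<^bsub>\<M> (?E \<inter> V)\<^esub> \<mu> V (?E \<inter> V) m"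
        using W V EV' EW g m(1) by simp
      also have "\<dots> = \<rho> W (?E \<inter> V) g [^]\<^bsub>\<O> (?E \<inter> V)\<^esub> (l + k) \<odot>\<^bsub>\<M> (?E \<inter> V)\<^esub> \<mu> ?E (?E \<inter> V) t"
        unfolding m(2) using gE tE by (simp add: N.R.nat_pow_mult[symmetric] N.smult_assoc1)
      finally show ?thesis .
    qed
    \<comment> \<open>A common exponent for the two lifts, so that they restrict to the same
      multiple of \<open>t\<close>.\<close>
    define n where "n = a + b"
    obtain m1' where m1': "m1' \<in> carrier (\<M> ?A)" "\<mu> ?A (?E \<inter> ?A) m1' =
        \<rho> W (?E \<inter> ?A) g [^]\<^bsub>\<O> (?E \<inter> ?A)\<^esub> n \<odot>\<^bsub>\<M> (?E \<inter> ?A)\<^esub> \<mu> ?E (?E \<inter> ?A) t"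
      using raise[OF D_open sub(1) m1, of b] m1(1) EV(2)[OF D_open sub(1)]
      unfolding n_def add.commute[of a b] by (meson MA.smult_closed MA.R.nat_pow_closed)
    obtain m2' where m2': "m2' \<in> carrier (\<M> ?B)" "\<mu> ?B (?E \<inter> ?B) m2' =
        \<rho> W (?E \<inter> ?B) g [^]\<^bsub>\<O> (?E \<inter> ?B)\<^esub> n \<odot>\<^bsub>\<M> (?E \<inter> ?B)\<^esub> \<mu> ?E (?E \<inter> ?B) t"
      using raise[OF D_open sub(2) m2, of a] m2(1) EV(2)[OF D_open sub(2)]
      unfolding n_def by (meson MB.smult_closed MB.R.nat_pow_closed)
    let ?d = "\<mu> ?A ?Z m1' \<ominus>\<^bsub>\<M> ?Z\<^esub> \<mu> ?B ?Z m2'"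
    have z1: "\<mu> ?A ?Z m1' \<in> carrier (\<M> ?Z)" and z2: "\<mu> ?B ?Z m2' \<in> carrier (\<M> ?Z)"
      using m1'(1) m2'(1) Zo by auto
    have res: "\<mu> ?Z (?E \<inter> ?Z) (\<mu> V ?Z m) =
        \<rho> W (?E \<inter> ?Z) g [^]\<^bsub>\<O> (?E \<inter> ?Z)\<^esub> n \<odot>\<^bsub>\<M> (?E \<inter> ?Z)\<^esub> \<mu> ?E (?E \<inter> ?Z) t"
      if V: "opn V" "V \<subseteq> W" "?Z \<subseteq> V" and m: "m \<in> carrier (\<M> V)" "\<mu> V (?E \<inter> V) m =
        \<rho> W (?E \<inter> V) g [^]\<^bsub>\<O> (?E \<inter> V)\<^esub> n \<odot>\<^bsub>\<M> (?E \<inter> V)\<^esub> \<mu> ?E (?E \<inter> V) t" for V m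
    proof -
      have s: "?E \<inter> ?Z \<subseteq> ?E \<inter> V" "?E \<inter> V \<subseteq> W" "?E \<inter> ?Z \<subseteq> W" "?E \<inter> ?Z \<subseteq> V" using V by blast+
      note o = EVo[OF V(1)] EVo[OF Zo]
      interpret N: module "\<O> (?E \<inter> V)" "\<M> (?E \<inter> V)" by (rule module_M[OF o(1)])
      have "\<mu> ?Z (?E \<inter> ?Z) (\<mu> V ?Z m) = \<mu> (?E \<inter> V) (?E \<inter> ?Z) (\<mu> V (?E \<inter> V) m)"
        using mu_trans[OF V(1) Zo o(2) Int_lower2 V(3) m(1)]
          mu_trans[OF V(1) o(1,2) s(1) Int_lower2 m(1)] by simp
      also have "\<dots> = \<rho> W (?E \<inter> ?Z) g [^]\<^bsub>\<O> (?E \<inter> ?Z)\<^esub> n \<odot>\<^bsub>\<M> (?E \<inter> ?Z)\<^esub> \<mu> ?E (?E \<inter> ?Z) t"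
        unfolding m(2) using V o s W g t by simp
      finally show ?thesis .
    qed
    interpret MEZ: module "\<O> (?E \<inter> ?Z)" "\<M> (?E \<inter> ?Z)" by (rule module_M[OF EVo[OF Zo]])
    have dc: "?d \<in> carrier (\<M> ?Z)" using z1 z2 by simp
    have "\<mu> ?Z (?E \<inter> ?Z) ?d = \<mu> ?Z (?E \<inter> ?Z) (\<mu> ?A ?Z m1') \<ominus>\<^bsub>\<M> (?E \<inter> ?Z)\<^esub> \<mu> ?Z (?E \<inter> ?Z) (\<mu> ?B ?Z m2')"
      using Zo EVo[OF Zo] z1 z2 by (intro mu_diff) auto
    also have "\<dots> = \<zero>\<^bsub>\<M> (?E \<inter> ?Z)\<^esub>"
    proof -
      have "?Z \<subseteq> ?A" "?Z \<subseteq> ?B" by blast+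
      then have "\<mu> ?Z (?E \<inter> ?Z) (\<mu> ?A ?Z m1') = \<mu> ?Z (?E \<inter> ?Z) (\<mu> ?B ?Z m2')"
        using res[OF D_open sub(1) _ m1'] res[OF D_open sub(2) _ m2'] by simp
      moreover have "\<mu> ?Z (?E \<inter> ?Z) (\<mu> ?B ?Z m2') \<in> carrier (\<M> (?E \<inter> ?Z))"
        using Zo EVo[OF Zo] z2 by (intro mu_closed[OF Zo]) auto
      ultimately show ?thesis using MEZ.M.diff_eq_zero_iff by simp
    qed
    \<comment> \<open>The lifts agree on \<open>?E \<inter> ?Z\<close> only; over \<open>?Z\<close>
      their difference is killed by a power of \<open>g\<close>, and after multiplication by it they
      glue.\<close>
    finally obtain c :: nat where c: "\<rho> W ?Z g [^]\<^bsub>\<O> ?Z\<^esub> c \<odot>\<^bsub>\<M> ?Z\<^esub> ?d = \<zero>\<^bsub>\<M> ?Z\<^esub>"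
      using localizes_kill[OF lZ EV(2)[OF Zo sub(3)] dc] unfolding EV(1)[OF Zo sub(3)] by blast
    let ?n1 = "\<rho> W ?A g [^]\<^bsub>\<O> ?A\<^esub> c \<odot>\<^bsub>\<M> ?A\<^esub> m1'" and ?n2 = "\<rho> W ?B g [^]\<^bsub>\<O> ?B\<^esub> c \<odot>\<^bsub>\<M> ?B\<^esub> m2'"
    have n1: "?n1 \<in> carrier (\<M> ?A)" and n2: "?n2 \<in> carrier (\<M> ?B)"
      using m1'(1) m2'(1) EV(2)[OF D_open sub(1)] EV(2)[OF D_open sub(2)] by auto
    have agree: "\<mu> ?A ?Z ?n1 = \<mu> ?B ?Z ?n2"
    proof -
      have gZ: "\<rho> W ?Z g [^]\<^bsub>\<O> ?Z\<^esub> c \<in> carrier (\<O> ?Z)" using EV(2)[OF Zo sub(3)] by simp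
      have "\<rho> W ?Z g [^]\<^bsub>\<O> ?Z\<^esub> c \<odot>\<^bsub>\<M> ?Z\<^esub> \<mu> ?A ?Z m1' = \<rho> W ?Z g [^]\<^bsub>\<O> ?Z\<^esub> c \<odot>\<^bsub>\<M> ?Z\<^esub> \<mu> ?B ?Z m2'"
        using c gZ z1 z2 by (simp add: MZ.smult_r_diff MZ.M.diff_eq_zero_iff)
      then show ?thesis
        using W Zo g sub m1'(1) m2'(1) EV(2)[OF D_open sub(1)] EV(2)[OF D_open sub(2)] by simp
    qed
    obtain m where m: "m \<in> carrier (\<M> W)" "\<mu> W ?A m = ?n1" "\<mu> W ?B m = ?n2"
      using M_glue_two[OF W D_open sub(1) D_open sub(2) cov n1 n2 agree] .
    let ?r = "\<rho> W ?E g [^]\<^bsub>\<O> ?E\<^esub> (c + n) \<odot>\<^bsub>\<M> ?E\<^esub> t"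
    have ge: "\<rho> W ?E g \<in> carrier (\<O> ?E)" using W g by simp
    have part: "\<mu> ?E (?E \<inter> V) (\<mu> W ?E m) = \<mu> ?E (?E \<inter> V) ?r"
      if V: "opn V" "V \<subseteq> W" and mV: "\<mu> W V m = \<rho> W V g [^]\<^bsub>\<O> V\<^esub> c \<odot>\<^bsub>\<M> V\<^esub> m'"
        and m': "m' \<in> carrier (\<M> V)" "\<mu> V (?E \<inter> V) m' =
        \<rho> W (?E \<inter> V) g [^]\<^bsub>\<O> (?E \<inter> V)\<^esub> n \<odot>\<^bsub>\<M> (?E \<inter> V)\<^esub> \<mu> ?E (?E \<inter> V) t" for V m'
    proof -
      note o = EVo[OF V(1)]
      have s: "?E \<inter> V \<subseteq> W" using V by blast
      have "\<mu> ?E (?E \<inter> V) (\<mu> W ?E m) = \<mu> V (?E \<inter> V) (\<mu> W V m)" using W V o m(1) by simp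
      also have "\<dots> = \<rho> W (?E \<inter> V) g [^]\<^bsub>\<O> (?E \<inter> V)\<^esub> (c + n) \<odot>\<^bsub>\<M> (?E \<inter> V)\<^esub> \<mu> ?E (?E \<inter> V) t"
        unfolding mV by (rule raise[OF V m'])
      also have "\<dots> = \<mu> ?E (?E \<inter> V) ?r" using W V o s g ge t by simp
      finally show ?thesis .
    qed
    have "\<mu> W ?E m = ?r"
    proof (rule M_eq_two[of ?E "?E \<inter> ?A" "?E \<inter> ?B"])
      show "?E \<subseteq> ?E \<inter> ?A \<union> ?E \<inter> ?B" using cov D_subset[of W g] by blast
      show "\<mu> W ?E m \<in> carrier (\<M> ?E)" "?r \<in> carrier (\<M> ?E)" using W m(1) ge t by auto
      show "\<mu> ?E (?E \<inter> ?A) (\<mu> W ?E m) = \<mu> ?E (?E \<inter> ?A) ?r"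
        by (rule part[OF D_open sub(1) m(2) m1'])
      show "\<mu> ?E (?E \<inter> ?B) (\<mu> W ?E m) = \<mu> ?E (?E \<inter> ?B) ?r"
        by (rule part[OF D_open sub(2) m(3) m2'])
    qed (auto simp: EVo)
    then show "\<exists>k::nat. \<exists>m\<in>carrier (\<M> W). \<mu> W ?E m = \<rho> W ?E g [^]\<^bsub>\<O> ?E\<^esub> k \<odot>\<^bsub>\<M> ?E\<^esub> t"
      using m(1) by blast
  }
qed

end

section \<open>Charts\<close>

lemma primeideal_preimage:
  assumes h: "h \<in> ring_hom R S" and R: "cring R" and Q: "primeideal Q S"
  shows "primeideal {r \<in> carrier R. h r \<in> Q} R"
proof -
  interpret R: cring R by (rule R)
  interpret Q: primeideal Q S by (rule Q)
  interpret ring_hom_cring R S h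
    by (intro ring_hom_cring.intro ring_hom_cring_axioms.intro R Q.is_cring h)
  show ?thesis
  proof (rule primeidealI[OF ring.ideal_vimage[OF Q.is_ideal] R])
    have "\<one>\<^bsub>S\<^esub> \<notin> Q" using Q.I_notcarr Q.one_imp_carrier by blast
    then have "\<one>\<^bsub>R\<^esub> \<notin> {r \<in> carrier R. h r \<in> Q}" by simp
    then show "carrier R \<noteq> {r \<in> carrier R. h r \<in> Q}" using R.one_closed by blast
  qed (use Q.I_prime in auto)
qed

lemma ring_frac_eq_module_frac: "ring_frac A S a s = module_frac A (self_module A) S a s"
  by (simp add: ring_frac_def module_frac_def)

lemma ring_loc_mult_eq: "x \<otimes>\<^bsub>ring_loc A S\<^esub> y = x \<odot>\<^bsub>module_loc A (self_module A) S\<^esub> y"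
  by (simp add: ring_loc_def module_loc_def ring_frac_eq_module_frac)

lemma ring_loc_add_eq: "x \<oplus>\<^bsub>ring_loc A S\<^esub> y = x \<oplus>\<^bsub>module_loc A (self_module A) S\<^esub> y"
  by (simp add: ring_loc_def module_loc_def ring_frac_eq_module_frac)

lemma spec_sections_eq_tilde_sections: "spec_sections A U = tilde_sections A (self_module A) U"
  by (simp add: spec_sections_def tilde_sections_def ring_frac_eq_module_frac)

lemma topspace_zariski: "cring A \<Longrightarrow> topspace (zariski A) = {P. primeideal P A}"
proof -
  assume A: "cring A"
  interpret cring A by (rule A)
  have "P \<in> zariski_open A {\<one>\<^bsub>A\<^esub>}" if "primeideal P A" for P
  proof -
    interpret P: primeideal P A by (rule that)
    show ?thesis using that P.I_notcarr P.one_imp_carrier by (auto simp: zariski_open_def)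
  qed
  then show ?thesis
    using openin_subset[of "zariski A" "zariski_open A {\<one>\<^bsub>A\<^esub>}"] openin_topspace[of "zariski A"]
    unfolding openin_zariski by (auto simp: zariski_open_def)
qed

context ringed
begin

text \<open>The prime of \<open>x\<close> among the sections over \<open>U\<close>, namely the
  sections that are not invertible at \<open>x\<close>, obtained without a chart.\<close>

definition pt :: "'x set \<Rightarrow> 'x \<Rightarrow> 'r set" where
  "pt U x = {g \<in> carrier (\<O> U). x \<notin> D U g}"

text \<open>All three conditions after openness concern \<open>U\<close>, its ring of sections and
  restriction maps only; so they can be verified on a basic open set directly.
  \<open>affine_open_iff_aff\<close> shows equivalence with the definition by charts.\<close>

definition aff :: "'x set \<Rightarrow> bool" where
  "aff U \<longleftrightarrow> opn U \<and>
    (\<forall>W x. opn W \<and> W \<subseteq> U \<and> x \<in> W \<longrightarrow> (\<exists>g\<in>carrier (\<O> U). x \<in> D U g \<and> D U g \<subseteq> W)) \<and>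
    localizes X (self_sheaf X) U \<and>
    bij_betw (pt U) U {P. primeideal P (\<O> U)}"

end

text \<open>\<open>tilde_on_chart\<close> with the isomorphism \<open>\<psi>\<close> fixed. The
  structure sheaf is the instance with \<open>self_module A\<close> and \<open>\<phi>\<close>
  itself, so ring facts follow from module facts.\<close>

locale tilde_chart = sheaf_of_modules X M
  for X :: "('x, 'r) ringed_space" and M :: "('x, 'r, 'm) sheaf_module" +
  fixes U :: "'x set" and A :: "'r ring" and f :: "'x \<Rightarrow> 'r set"
    and \<phi> :: "'r set set \<Rightarrow> ('r set \<Rightarrow> ('r \<times> 'r) set) \<Rightarrow> 'r" and N :: "('r, 'm) module"
    and \<psi> :: "'r set set \<Rightarrow> ('r set \<Rightarrow> ('m \<times> 'r) set) \<Rightarrow> 'm"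
  assumes chart: "affine_chart X U A f \<phi>"
    and module_N: "Module.module A N"
    and psi: "openin (zariski A) V \<Longrightarrow>
      \<psi> V \<in> semilinear_iso (rsec (Spec A) V) (\<phi> V) (msec (tilde A N) V) (msec M (inv_img (open_subspace X U) f V))"
    and psi_res: "\<lbrakk>openin (zariski A) V; openin (zariski A) W; W \<subseteq> V; s \<in> tilde_sections A N V\<rbrakk> \<Longrightarrow>
      mres M (inv_img (open_subspace X U) f V) (inv_img (open_subspace X U) f W) (\<psi> V s) = \<psi> W (restrict s W)"
begin

sublocale N: plain_module A N
  by (intro plain_module.intro module_N)

abbreviation pre :: "'r set set \<Rightarrow> 'x set" where "pre V \<equiv> inv_img (open_subspace X U) f V"
abbreviation zopen :: "'r set set \<Rightarrow> bool" where "zopen \<equiv> openin (zariski A)"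
abbreviation Z :: "'r set set" where "Z \<equiv> {P. primeideal P A}"

lemma U_open: "opn U" and cring_A: "cring A" and iso: "ringed_space_iso (open_subspace X U) (Spec A) f \<phi>"
  using chart unfolding affine_chart_def by auto

lemma U_sub: "U \<subseteq> topspace (space_top X)"
  using U_open by (rule openin_subset)

lemma pre_eq: "pre V = {x \<in> U. f x \<in> V}"
  using U_sub by (auto simp: inv_img_def open_subspace_def)

lemma homeo: "homeomorphic_map (subtopology (space_top X) U) (zariski A) f"
  using iso by (simp add: ringed_space_iso_def open_subspace_def Spec_def)

lemma topspace_U: "topspace (subtopology (space_top X) U) = U"
  using U_sub by auto

lemma f_bij: "bij_betw f U Z"
proof -
  have "f ` U = Z" "inj_on f U"
    using homeomorphic_imp_surjective_map[OF homeo] homeomorphic_imp_injective_map[OF homeo]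
    unfolding topspace_U topspace_zariski[OF cring_A] by auto
  then show ?thesis unfolding bij_betw_def by blast
qed

lemma f_prime: "x \<in> U \<Longrightarrow> primeideal (f x) A"
  using f_bij bij_betwE by blast

lemma zopen_sub: "zopen V \<Longrightarrow> V \<subseteq> Z"
  using openin_subset topspace_zariski[OF cring_A] by metis

lemma zopen_Z: "zopen Z"
  using openin_topspace[of "zariski A"] unfolding topspace_zariski[OF cring_A] .

lemma zopen_basic: "a \<in> carrier A \<Longrightarrow> zopen (zariski_open A {a})"
  unfolding openin_zariski by blast

lemma pre_open: "zopen V \<Longrightarrow> opn (pre V)"
proof -
  assume V: "zopen V"
  have "openin (subtopology (space_top X) U) {x \<in> topspace (subtopology (space_top X) U). f x \<in> V}"
    using homeomorphic_imp_continuous_map[OF homeo] V by (rule openin_continuous_map_preimage)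
  then show ?thesis unfolding topspace_U pre_eq openin_open_subtopology[OF U_open] by blast
qed

lemma pre_Z: "pre Z = U"
  unfolding pre_eq using f_prime by blast

lemma pre_sub: "pre V \<subseteq> U"
  unfolding pre_eq by blast

lemma image_zopen: "\<lbrakk>opn W; W \<subseteq> U\<rbrakk> \<Longrightarrow> zopen (f ` W)"
  using homeomorphic_imp_open_map[OF homeo] openin_open_subtopology[OF U_open]
  unfolding open_map_def by blast

lemma pre_image: "W \<subseteq> U \<Longrightarrow> pre (f ` W) = W"
  unfolding pre_eq using bij_betw_imp_inj_on[OF f_bij] by (auto dest: inj_onD)

lemma phi_iso: "zopen V \<Longrightarrow> \<phi> V \<in> ring_iso (rsec (Spec A) V) (\<O> (pre V))"
  using iso unfolding ringed_space_iso_def by (simp add: Spec_def open_subspace_def)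

lemma phi_res: "\<lbrakk>zopen V; zopen W; W \<subseteq> V; s \<in> spec_sections A V\<rbrakk> \<Longrightarrow>
    \<rho> (pre V) (pre W) (\<phi> V s) = \<phi> W (restrict s W)"
  using iso unfolding ringed_space_iso_def by (simp add: Spec_def open_subspace_def)

definition sn :: "'r set set \<Rightarrow> 'm \<Rightarrow> 'r set \<Rightarrow> ('m \<times> 'r) set" where
  "sn V n = (\<lambda>P\<in>V. module_frac A N (carrier A - P) n \<one>\<^bsub>A\<^esub>)"

definition sr :: "'r set set \<Rightarrow> 'r \<Rightarrow> 'r set \<Rightarrow> ('r \<times> 'r) set" where
  "sr V a = (\<lambda>P\<in>V. ring_frac A (carrier A - P) a \<one>\<^bsub>A\<^esub>)"

text \<open>The canonical maps to sections over \<open>U\<close>: an element becomes the global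
  fraction with denominator one, transported along the chart.\<close>

definition \<tau> :: "'m \<Rightarrow> 'm" where "\<tau> n = \<psi> Z (sn Z n)"
definition \<sigma> :: "'r \<Rightarrow> 'r" where "\<sigma> a = \<phi> Z (sr Z a)"

lemma one_notin: "P \<in> V \<Longrightarrow> zopen V \<Longrightarrow> \<one>\<^bsub>A\<^esub> \<notin> P"
  using zopen_sub N.pow_notin_prime[of P _ 0] multiplicative_subset.S_one[OF N.prime_complement, of P] by blast

lemma global_fraction_section:
  assumes V: "zopen V" and n: "n \<in> carrier N" and a: "a \<in> carrier A" "\<And>P. P \<in> V \<Longrightarrow> a \<notin> P"
  shows "(\<lambda>P\<in>V. module_frac A N (carrier A - P) n a) \<in> tilde_sections A N V"
  unfolding tilde_sections_def using V n a by (auto intro!: exI[of _ V] bexI[of _ n] bexI[of _ a])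

lemma sn_section: "\<lbrakk>zopen V; n \<in> carrier N\<rbrakk> \<Longrightarrow> sn V n \<in> tilde_sections A N V"
  unfolding sn_def by (rule global_fraction_section) (auto simp: one_notin)

lemma global_ring_fraction_section:
  assumes V: "zopen V" and n: "n \<in> carrier A" and a: "a \<in> carrier A" "\<And>P. P \<in> V \<Longrightarrow> a \<notin> P"
  shows "(\<lambda>P\<in>V. ring_frac A (carrier A - P) n a) \<in> spec_sections A V"
proof -
  have "\<exists>n'\<in>carrier A. \<exists>a'\<in>carrier A. \<forall>Q\<in>V. a' \<notin> Q \<and>
      (\<lambda>P\<in>V. ring_frac A (carrier A - P) n a) Q = ring_frac A (carrier A - Q) n' a'"
    by (rule bexI[OF _ n], rule bexI[OF _ a(1)]) (use a(2) in simp)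
  then show ?thesis unfolding spec_sections_def using V by (auto intro!: exI[of _ V])
qed

lemma sr_section: "\<lbrakk>zopen V; a \<in> carrier A\<rbrakk> \<Longrightarrow> sr V a \<in> spec_sections A V"
  unfolding sr_def by (rule global_ring_fraction_section) (auto simp: one_notin)

lemma mu_tau: "\<lbrakk>zopen V; n \<in> carrier N\<rbrakk> \<Longrightarrow> \<mu> U (pre V) (\<tau> n) = \<psi> V (sn V n)"
  using psi_res[OF zopen_Z _ zopen_sub sn_section[OF zopen_Z], of V n] zopen_sub[of V]
  unfolding pre_Z \<tau>_def sn_def by (simp add: restrict_restrict Int_absorb1)

lemma rho_sigma: "\<lbrakk>zopen V; a \<in> carrier A\<rbrakk> \<Longrightarrow> \<rho> U (pre V) (\<sigma> a) = \<phi> V (sr V a)"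
  using phi_res[OF zopen_Z _ zopen_sub sr_section[OF zopen_Z], of V a] zopen_sub[of V]
  unfolding pre_Z \<sigma>_def sr_def by (simp add: restrict_restrict Int_absorb1)

lemma psi_bij: "zopen V \<Longrightarrow> bij_betw (\<psi> V) (tilde_sections A N V) (carrier (\<M> (pre V)))"
  using psi unfolding semilinear_iso_def by (simp add: tilde_def)

lemma psi_add: "\<lbrakk>zopen V; s \<in> tilde_sections A N V; t \<in> tilde_sections A N V\<rbrakk> \<Longrightarrow>
    \<psi> V (\<lambda>P\<in>V. s P \<oplus>\<^bsub>module_loc A N (carrier A - P)\<^esub> t P) = \<psi> V s \<oplus>\<^bsub>\<M> (pre V)\<^esub> \<psi> V t"
  using psi[of V] unfolding semilinear_iso_def by (simp add: tilde_def)

lemma psi_smult: "\<lbrakk>zopen V; r \<in> spec_sections A V; t \<in> tilde_sections A N V\<rbrakk> \<Longrightarrow>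
    \<psi> V (\<lambda>P\<in>V. r P \<odot>\<^bsub>module_loc A N (carrier A - P)\<^esub> t P) = \<phi> V r \<odot>\<^bsub>\<M> (pre V)\<^esub> \<psi> V t"
  using psi[of V] unfolding semilinear_iso_def by (simp add: tilde_def Spec_def)

lemma psi_closed: "\<lbrakk>zopen V; s \<in> tilde_sections A N V\<rbrakk> \<Longrightarrow> \<psi> V s \<in> carrier (\<M> (pre V))"
  using psi_bij bij_betwE by blast

lemma phi_bij: "zopen V \<Longrightarrow> bij_betw (\<phi> V) (spec_sections A V) (carrier (\<O> (pre V)))"
  using phi_iso unfolding ring_iso_def by (simp add: Spec_def)

lemma phi_mult: "\<lbrakk>zopen V; s \<in> spec_sections A V; t \<in> spec_sections A V\<rbrakk> \<Longrightarrow>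
    \<phi> V (\<lambda>P\<in>V. s P \<otimes>\<^bsub>ring_loc A (carrier A - P)\<^esub> t P) = \<phi> V s \<otimes>\<^bsub>\<O> (pre V)\<^esub> \<phi> V t"
  using ring_iso_memE(2)[OF phi_iso, of V s t] by (simp add: Spec_def)

lemma phi_one: "zopen V \<Longrightarrow> \<phi> V (sr V \<one>\<^bsub>A\<^esub>) = \<one>\<^bsub>\<O> (pre V)\<^esub>"
  using ring_iso_memE(4)[OF phi_iso, of V] unfolding sr_def by (simp add: Spec_def ring_loc_def cong: restrict_cong)

lemma phi_closed: "\<lbrakk>zopen V; s \<in> spec_sections A V\<rbrakk> \<Longrightarrow> \<phi> V s \<in> carrier (\<O> (pre V))"
  using phi_bij bij_betwE by blast

lemma tau_closed: "n \<in> carrier N \<Longrightarrow> \<tau> n \<in> carrier (\<M> U)"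
  using psi_closed[OF zopen_Z sn_section[OF zopen_Z]] unfolding pre_Z \<tau>_def .

lemma sigma_closed: "a \<in> carrier A \<Longrightarrow> \<sigma> a \<in> carrier (\<O> U)"
  using phi_closed[OF zopen_Z sr_section[OF zopen_Z]] unfolding pre_Z \<sigma>_def .

lemma sn_add:
  assumes V: "zopen V" and n: "n \<in> carrier N" "m \<in> carrier N"
  shows "(\<lambda>P\<in>V. sn V n P \<oplus>\<^bsub>module_loc A N (carrier A - P)\<^esub> sn V m P) = sn V (n \<oplus>\<^bsub>N\<^esub> m)"
proof (rule ext)
  fix P
  show "(\<lambda>P\<in>V. sn V n P \<oplus>\<^bsub>module_loc A N (carrier A - P)\<^esub> sn V m P) P = sn V (n \<oplus>\<^bsub>N\<^esub> m) P"
  proof (cases "P \<in> V")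
    case True
    then interpret multiplicative_subset A N "carrier A - P"
      using zopen_sub[OF V] N.prime_complement by blast
    show ?thesis using True n S_one module_loc_add[OF n S_one S_one] by (simp add: sn_def)
  qed (simp add: sn_def)
qed

lemma tau_add:
  assumes n: "n \<in> carrier N" "m \<in> carrier N"
  shows "\<tau> (n \<oplus>\<^bsub>N\<^esub> m) = \<tau> n \<oplus>\<^bsub>\<M> U\<^esub> \<tau> m"
  using psi_add[OF zopen_Z sn_section[OF zopen_Z n(1)] sn_section[OF zopen_Z n(2)]]
  unfolding sn_add[OF zopen_Z n] pre_Z \<tau>_def .

lemma sn_smult:
  assumes V: "zopen V" and a: "a \<in> carrier A" and n: "n \<in> carrier N"
  shows "(\<lambda>P\<in>V. sr V a P \<odot>\<^bsub>module_loc A N (carrier A - P)\<^esub> sn V n P) = sn V (a \<odot>\<^bsub>N\<^esub> n)"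
proof (rule ext)
  fix P
  show "(\<lambda>P\<in>V. sr V a P \<odot>\<^bsub>module_loc A N (carrier A - P)\<^esub> sn V n P) P = sn V (a \<odot>\<^bsub>N\<^esub> n) P"
  proof (cases "P \<in> V")
    case True
    then interpret multiplicative_subset A N "carrier A - P"
      using zopen_sub[OF V] N.prime_complement by blast
    show ?thesis using True a n S_one module_loc_smult[OF a n S_one S_one] by (simp add: sn_def sr_def)
  qed (simp add: sn_def)
qed

lemma tau_smult:
  assumes a: "a \<in> carrier A" and n: "n \<in> carrier N"
  shows "\<tau> (a \<odot>\<^bsub>N\<^esub> n) = \<sigma> a \<odot>\<^bsub>\<M> U\<^esub> \<tau> n"
  using psi_smult[OF zopen_Z sr_section[OF zopen_Z a] sn_section[OF zopen_Z n]]
  unfolding sn_smult[OF zopen_Z a n] pre_Z \<tau>_def \<sigma>_def .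

text \<open>\<open>semilinear_iso\<close> demands additivity only; the image of zero is zero because
  it is additively idempotent.\<close>

lemma psi_zero:
  assumes V: "zopen V"
  shows "\<psi> V (sn V \<zero>\<^bsub>N\<^esub>) = \<zero>\<^bsub>\<M> (pre V)\<^esub>"
proof -
  interpret MV: module "\<O> (pre V)" "\<M> (pre V)" by (rule module_M[OF pre_open[OF V]])
  have z: "\<zero>\<^bsub>N\<^esub> \<in> carrier N" by simp
  have "\<psi> V (sn V \<zero>\<^bsub>N\<^esub>) \<oplus>\<^bsub>\<M> (pre V)\<^esub> \<psi> V (sn V \<zero>\<^bsub>N\<^esub>) = \<psi> V (sn V \<zero>\<^bsub>N\<^esub>)"
    using psi_add[OF V sn_section[OF V z] sn_section[OF V z]] unfolding sn_add[OF V z z] by simp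
  then show ?thesis using psi_closed[OF V sn_section[OF V z]] by (metis MV.M.add.r_cancel_one')
qed

text \<open>Injectivity of \<open>\<psi>\<close> over the basic open set turns vanishing there into
  vanishing of \<open>n\<close> at every prime that misses \<open>a\<close>.\<close>

lemma tau_kill:
  assumes a: "a \<in> carrier A" and n: "n \<in> carrier N"
    and zero: "\<mu> U (pre (zariski_open A {a})) (\<tau> n) = \<zero>\<^bsub>\<M> (pre (zariski_open A {a}))\<^esub>"
  obtains k :: nat where "a [^]\<^bsub>A\<^esub> k \<odot>\<^bsub>N\<^esub> n = \<zero>\<^bsub>N\<^esub>"
proof (rule N.fraction_zero_on_basic_open[OF a n])
  let ?V = "zariski_open A {a}"
  note V = zopen_basic[OF a]
  have "\<psi> ?V (sn ?V n) = \<psi> ?V (sn ?V \<zero>\<^bsub>N\<^esub>)"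
    using zero mu_tau[OF V n] psi_zero[OF V] by simp
  then have eq: "sn ?V n = sn ?V \<zero>\<^bsub>N\<^esub>"
    using bij_betw_imp_inj_on[OF psi_bij[OF V]] sn_section[OF V] n by (auto dest: inj_onD)
  fix P assume "primeideal P A" "a \<notin> P"
  then have "P \<in> ?V" using a by (simp add: N.mem_zariski_open_singleton)
  then show "module_frac A N (carrier A - P) n \<one>\<^bsub>A\<^esub> = module_frac A N (carrier A - P) \<zero>\<^bsub>N\<^esub> \<one>\<^bsub>A\<^esub>"
    using fun_cong[OF eq, of P] by (simp add: sn_def)
qed

text \<open>Over the basic open set of \<open>a\<close>, the section \<open>t\<close> is one
  fraction \<open>n / a^k\<close>; multiplication by \<open>a^k\<close> leaves
  \<open>n / \<one>\<close>, which is the restriction of \<open>\<tau> n\<close>.\<close>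

lemma phi_pow_tau:
  assumes a: "a \<in> carrier A" and t: "t \<in> carrier (\<M> (pre (zariski_open A {a})))"
  obtains n and k :: nat where "n \<in> carrier N"
    "\<mu> U (pre (zariski_open A {a})) (\<tau> n) =
      \<rho> U (pre (zariski_open A {a})) (\<sigma> (a [^]\<^bsub>A\<^esub> k)) \<odot>\<^bsub>\<M> (pre (zariski_open A {a}))\<^esub> t"
proof -
  let ?V = "zariski_open A {a}"
  note V = zopen_basic[OF a]
  have "t \<in> \<psi> ?V ` tilde_sections A N ?V"
    using t bij_betw_imp_surj_on[OF psi_bij[OF V]] by simp
  then obtain s where s: "s \<in> tilde_sections A N ?V" "t = \<psi> ?V s" by blast
  obtain n and k :: nat where n: "n \<in> carrier N" and
    frac: "\<And>P. primeideal P A \<Longrightarrow> a \<notin> P \<Longrightarrow> s P = module_frac A N (carrier A - P) n (a [^]\<^bsub>A\<^esub> k)"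
    using N.tilde_section_on_basic_open[OF a s(1)] by blast
  have ak: "a [^]\<^bsub>A\<^esub> k \<in> carrier A" using a by simp
  have "(\<lambda>P\<in>?V. sr ?V (a [^]\<^bsub>A\<^esub> k) P \<odot>\<^bsub>module_loc A N (carrier A - P)\<^esub> s P) = sn ?V n"
  proof (rule ext)
    fix P
    show "(\<lambda>P\<in>?V. sr ?V (a [^]\<^bsub>A\<^esub> k) P \<odot>\<^bsub>module_loc A N (carrier A - P)\<^esub> s P) P = sn ?V n P"
    proof (cases "P \<in> ?V")
      case True
      then have P: "primeideal P A" "a \<notin> P" using a by (auto simp: N.mem_zariski_open_singleton)
      interpret multiplicative_subset A N "carrier A - P" by (rule N.prime_complement[OF P(1)])
      have akP: "a [^]\<^bsub>A\<^esub> k \<in> carrier A - P" by (rule N.pow_notin_prime[OF P(1) a P(2)])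
      have "ring_frac A (carrier A - P) (a [^]\<^bsub>A\<^esub> k) \<one>\<^bsub>A\<^esub> \<odot>\<^bsub>module_loc A N (carrier A - P)\<^esub> s P =
          module_frac A N (carrier A - P) (a [^]\<^bsub>A\<^esub> k \<odot>\<^bsub>N\<^esub> n) (\<one>\<^bsub>A\<^esub> \<otimes>\<^bsub>A\<^esub> a [^]\<^bsub>A\<^esub> k)"
        unfolding frac[OF P] by (rule module_loc_smult[OF ak n S_one akP])
      also have "\<dots> = module_frac A N (carrier A - P) n \<one>\<^bsub>A\<^esub>"
        using ak n akP S_one by (intro N.frac_eqI[OF P(1)]) auto
      finally show ?thesis using True by (simp add: sr_def sn_def)
    qed (simp add: sn_def)
  qed
  then have "\<psi> ?V (sn ?V n) = \<phi> ?V (sr ?V (a [^]\<^bsub>A\<^esub> k)) \<odot>\<^bsub>\<M> (pre ?V)\<^esub> \<psi> ?V s"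
    using psi_smult[OF V sr_section[OF V ak] s(1)] by simp
  then show ?thesis
    using that[OF n, of k] unfolding mu_tau[OF V n] rho_sigma[OF V ak] s(2) by blast
qed

text \<open>Needed in \<open>D_sigma\<close>: injectivity of \<open>\<phi>\<close> can be applied
  only to functions known to be sections.\<close>

lemma sr_mult_section:
  assumes V: "zopen V" and a: "a \<in> carrier A" and s: "s \<in> spec_sections A V"
  shows "(\<lambda>P\<in>V. sr V a P \<otimes>\<^bsub>ring_loc A (carrier A - P)\<^esub> s P) \<in> spec_sections A V"
proof -
  interpret self: plain_module A "self_module A"
    by (intro plain_module.intro module_self cring_A)
  have "\<exists>W. zopen W \<and> P \<in> W \<and> W \<subseteq> V \<and> (\<exists>b\<in>carrier A. \<exists>t\<in>carrier A. \<forall>Q\<in>W. t \<notin> Q \<and>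
      (\<lambda>P\<in>V. sr V a P \<otimes>\<^bsub>ring_loc A (carrier A - P)\<^esub> s P) Q = ring_frac A (carrier A - Q) b t)"
    if P: "P \<in> V" for P
  proof -
    have "\<exists>W. zopen W \<and> P \<in> W \<and> W \<subseteq> V \<and> (\<exists>b\<in>carrier A. \<exists>t\<in>carrier A. \<forall>Q\<in>W. t \<notin> Q \<and>
        s Q = ring_frac A (carrier A - Q) b t)"
      using s P unfolding spec_sections_def by blast
    then obtain W b t where W: "zopen W" "P \<in> W" "W \<subseteq> V" and b: "b \<in> carrier A" and t: "t \<in> carrier A"
      and eq: "\<forall>Q\<in>W. t \<notin> Q \<and> s Q = ring_frac A (carrier A - Q) b t"
      by (elim exE conjE bexE)
    have "(\<lambda>P\<in>V. sr V a P \<otimes>\<^bsub>ring_loc A (carrier A - P)\<^esub> s P) Q = ring_frac A (carrier A - Q) (a \<otimes>\<^bsub>A\<^esub> b) t"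
      if Q: "Q \<in> W" for Q
    proof -
      interpret multiplicative_subset A "self_module A" "carrier A - Q"
        using zopen_sub[OF W(1)] Q self.prime_complement by blast
      have QV: "Q \<in> V" and tQ: "t \<in> carrier A - Q" using Q W(3) eq t by auto
      show ?thesis
        using QV eq[rule_format, OF Q] module_loc_smult[OF a _ S_one tQ, of b] b t
        by (simp add: sr_def ring_loc_mult_eq ring_frac_eq_module_frac)
    qed
    then have "\<forall>Q\<in>W. t \<notin> Q \<and> (\<lambda>P\<in>V. sr V a P \<otimes>\<^bsub>ring_loc A (carrier A - P)\<^esub> s P) Q =
        ring_frac A (carrier A - Q) (a \<otimes>\<^bsub>A\<^esub> b) t"
      using eq by blast
    moreover have "a \<otimes>\<^bsub>A\<^esub> b \<in> carrier A" using a b by simp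
    ultimately show ?thesis using W t by blast
  qed
  then show ?thesis unfolding spec_sections_def by simp
qed

lemma basic_one: "zariski_open A {\<one>\<^bsub>A\<^esub>} = Z"
  using one_notin[OF _ zopen_Z] by (auto simp: N.mem_zariski_open_singleton)

end

text \<open>The ring fractions are the module fractions of \<open>self_module A\<close>, so a ring
  isomorphism is in particular a semilinear one.\<close>

lemma (in ringed) tilde_chart_self:
  assumes chart: "affine_chart X U A f \<phi>"
  shows "tilde_chart X (self_sheaf X) U A f \<phi> (self_module A) \<phi>"
proof -
  have A: "cring A" and iso: "ringed_space_iso (open_subspace X U) (Spec A) f \<phi>"
    using chart unfolding affine_chart_def by auto
  show ?thesis
  proof (intro tilde_chart.intro tilde_chart_axioms.intro sheaf_of_modules.intro
      sheaf_of_modules_axioms.intro ringed_axioms)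
    show "O_module X (self_sheaf X)" by (rule O_module_self)
    show "affine_chart X U A f \<phi>" by (rule chart)
    show "Module.module A (self_module A)" by (rule module_self[OF A])
    fix V assume V: "openin (zariski A) V"
    have "\<phi> V \<in> ring_iso (rsec (Spec A) V) (\<O> (inv_img (open_subspace X U) f V))"
      using iso V unfolding ringed_space_iso_def by (simp add: Spec_def open_subspace_def)
    then show "\<phi> V \<in> semilinear_iso (rsec (Spec A) V) (\<phi> V) (msec (tilde A (self_module A)) V)
        (msec (self_sheaf X) (inv_img (open_subspace X U) f V))"
      unfolding ring_iso_def ring_hom_def semilinear_iso_def
      by (auto simp: tilde_def Spec_def spec_sections_eq_tilde_sections ring_loc_mult_eq ring_loc_add_eq)
    fix W s assume "openin (zariski A) W" "W \<subseteq> V" "s \<in> tilde_sections A (self_module A) V"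
    then show "mres (self_sheaf X) (inv_img (open_subspace X U) f V) (inv_img (open_subspace X U) f W) (\<phi> V s)
        = \<phi> W (restrict s W)"
      using iso V unfolding ringed_space_iso_def
      by (simp add: Spec_def open_subspace_def spec_sections_eq_tilde_sections)
  qed
qed


context tilde_chart
begin

interpretation S: tilde_chart X "self_sheaf X" U A f \<phi> "self_module A" \<phi>
  by (rule tilde_chart_self[OF chart])

lemma self_tau: "S.\<tau> a = \<sigma> a"
  unfolding S.\<tau>_def \<sigma>_def S.sn_def sr_def ring_frac_eq_module_frac ..

lemma sigma_mult: "\<lbrakk>a \<in> carrier A; b \<in> carrier A\<rbrakk> \<Longrightarrow> \<sigma> (a \<otimes>\<^bsub>A\<^esub> b) = \<sigma> a \<otimes>\<^bsub>\<O> U\<^esub> \<sigma> b"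
  using S.tau_smult[of a b] by (simp add: self_tau)

lemma sigma_add: "\<lbrakk>a \<in> carrier A; b \<in> carrier A\<rbrakk> \<Longrightarrow> \<sigma> (a \<oplus>\<^bsub>A\<^esub> b) = \<sigma> a \<oplus>\<^bsub>\<O> U\<^esub> \<sigma> b"
  using S.tau_add[of a b] by (simp add: self_tau)

lemma sigma_one: "\<sigma> \<one>\<^bsub>A\<^esub> = \<one>\<^bsub>\<O> U\<^esub>"
  using phi_one[OF zopen_Z] unfolding \<sigma>_def pre_Z .

lemma sigma_hom: "\<sigma> \<in> ring_hom A (\<O> U)"
  by (rule ring_hom_memI) (auto simp: sigma_closed sigma_mult sigma_add sigma_one)

lemma sigma_hom_cring: "ring_hom_cring A (\<O> U) \<sigma>"
  by (intro ring_hom_cring.intro ring_hom_cring_axioms.intro cring_A cring_O[OF U_open] sigma_hom)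

lemma sigma_pow: "a \<in> carrier A \<Longrightarrow> \<sigma> (a [^]\<^bsub>A\<^esub> (k::nat)) = \<sigma> a [^]\<^bsub>\<O> U\<^esub> k"
proof -
  assume a: "a \<in> carrier A"
  interpret ring_hom_cring A "\<O> U" \<sigma> by (rule sigma_hom_cring)
  show ?thesis
    by (induction k) (simp_all only: N.R.nat_pow_0 S.nat_pow_0 N.R.nat_pow_Suc S.nat_pow_Suc
        hom_one hom_mult N.R.nat_pow_closed a)
qed

text \<open>The case \<open>a = \<one>\<close> of \<open>phi_pow_tau\<close>: the basic open set is
  the whole spectrum and the powers disappear.\<close>

lemma tau_surj:
  assumes m: "m \<in> carrier (\<M> U)"
  obtains n where "n \<in> carrier N" "m = \<tau> n"
proof -
  interpret MU: module "\<O> U" "\<M> U" by (rule module_M[OF U_open])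
  have one: "\<one>\<^bsub>A\<^esub> \<in> carrier A" by simp
  have m': "m \<in> carrier (\<M> (pre (zariski_open A {\<one>\<^bsub>A\<^esub>})))"
    unfolding basic_one pre_Z by (rule m)
  obtain n and k :: nat where n: "n \<in> carrier N"
    "\<mu> U (pre (zariski_open A {\<one>\<^bsub>A\<^esub>})) (\<tau> n) =
      \<rho> U (pre (zariski_open A {\<one>\<^bsub>A\<^esub>})) (\<sigma> (\<one>\<^bsub>A\<^esub> [^]\<^bsub>A\<^esub> k)) \<odot>\<^bsub>\<M> (pre (zariski_open A {\<one>\<^bsub>A\<^esub>}))\<^esub> m"
    using phi_pow_tau[OF one m'] .
  then have "\<tau> n = m"
    unfolding basic_one pre_Z using U_open tau_closed m by (simp add: sigma_one)
  then show ?thesis using that n(1) by blast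
qed

end

context tilde_chart
begin

interpretation S: tilde_chart X "self_sheaf X" U A f \<phi> "self_module A" \<phi>
  by (rule tilde_chart_self[OF chart])

lemma sigma_surj:
  assumes "g \<in> carrier (\<O> U)"
  obtains a where "a \<in> carrier A" "g = \<sigma> a"
proof -
  have "g \<in> carrier (msec (self_sheaf X) U)" using assms by simp
  then obtain a where "a \<in> carrier (self_module A)" "g = S.\<tau> a" using S.tau_surj by blast
  then show ?thesis using that by (simp add: self_tau)
qed

lemma tau_zero: "\<tau> \<zero>\<^bsub>N\<^esub> = \<zero>\<^bsub>\<M> U\<^esub>"
  using psi_zero[OF zopen_Z] unfolding pre_Z \<tau>_def .

lemma sigma_inj: "inj_on \<sigma> (carrier A)"
proof (rule inj_onI)
  interpret ring_hom_cring A "\<O> U" \<sigma> by (rule sigma_hom_cring)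
  fix a b assume ab: "a \<in> carrier A" "b \<in> carrier A" "\<sigma> a = \<sigma> b"
  have "\<sigma> (a \<ominus>\<^bsub>A\<^esub> b) = \<zero>\<^bsub>\<O> U\<^esub>"
    using ab unfolding a_minus_def by (simp add: S.r_neg)
  then have "mres (self_sheaf X) U (pre (zariski_open A {\<one>\<^bsub>A\<^esub>})) (S.\<tau> (a \<ominus>\<^bsub>A\<^esub> b)) =
      \<zero>\<^bsub>msec (self_sheaf X) (pre (zariski_open A {\<one>\<^bsub>A\<^esub>}))\<^esub>"
    unfolding self_tau basic_one pre_Z using U_open by simp
  then obtain k :: nat where
    "\<one>\<^bsub>A\<^esub> [^]\<^bsub>A\<^esub> k \<odot>\<^bsub>self_module A\<^esub> (a \<ominus>\<^bsub>A\<^esub> b) = \<zero>\<^bsub>self_module A\<^esub>"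
    using S.tau_kill[of "\<one>\<^bsub>A\<^esub>" "a \<ominus>\<^bsub>A\<^esub> b"] ab by auto
  then show "a = b" using ab by (simp add: N.R.diff_eq_zero_iff)
qed

lemma sigma_iso: "\<sigma> \<in> ring_iso A (\<O> U)"
  unfolding ring_iso_def bij_betw_def
  using sigma_hom sigma_inj sigma_closed sigma_surj by (auto simp: image_iff) blast

text \<open>Where the prime misses \<open>a\<close>, the section \<open>\<one> / a\<close> is an
  inverse; conversely an inverse near \<open>x\<close> shows in the local ring that \<open>a\<close>
  is outside the prime of \<open>x\<close>.\<close>

lemma D_sigma:
  assumes a: "a \<in> carrier A"
  shows "D U (\<sigma> a) = pre (zariski_open A {a})"
proof (intro equalityI subsetI)
  let ?V = "zariski_open A {a}"
  note V = zopen_basic[OF a]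
  have mem: "P \<in> ?V \<longleftrightarrow> primeideal P A \<and> a \<notin> P" for P using a by (rule N.mem_zariski_open_singleton)
  interpret OV: cring "\<O> (pre ?V)" by (rule cring_O[OF pre_open[OF V]])
  let ?i = "\<lambda>P\<in>?V. ring_frac A (carrier A - P) \<one>\<^bsub>A\<^esub> a"
  have i: "?i \<in> spec_sections A ?V"
    by (rule global_ring_fraction_section[OF V _ a]) (auto simp: mem)
  have "(\<lambda>P\<in>?V. sr ?V a P \<otimes>\<^bsub>ring_loc A (carrier A - P)\<^esub> ?i P) = sr ?V \<one>\<^bsub>A\<^esub>"
  proof (rule ext)
    fix P
    show "(\<lambda>P\<in>?V. sr ?V a P \<otimes>\<^bsub>ring_loc A (carrier A - P)\<^esub> ?i P) P = sr ?V \<one>\<^bsub>A\<^esub> P"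
    proof (cases "P \<in> ?V")
      case True
      then have P: "primeideal P A" "a \<in> carrier A - P" using mem a by auto
      interpret multiplicative_subset A "self_module A" "carrier A - P" by (rule S.N.prime_complement[OF P(1)])
      have "ring_frac A (carrier A - P) a \<one>\<^bsub>A\<^esub> \<otimes>\<^bsub>ring_loc A (carrier A - P)\<^esub> ring_frac A (carrier A - P) \<one>\<^bsub>A\<^esub> a =
          ring_frac A (carrier A - P) (a \<otimes>\<^bsub>A\<^esub> \<one>\<^bsub>A\<^esub>) (\<one>\<^bsub>A\<^esub> \<otimes>\<^bsub>A\<^esub> a)"
        using module_loc_smult[OF a _ S_one P(2), of "\<one>\<^bsub>A\<^esub>"]
        by (simp add: ring_loc_mult_eq ring_frac_eq_module_frac)
      also have "\<dots> = ring_frac A (carrier A - P) \<one>\<^bsub>A\<^esub> \<one>\<^bsub>A\<^esub>"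
        unfolding ring_frac_eq_module_frac using P(2) S_one by (intro S.N.frac_eqI[OF P(1)]) auto
      finally show ?thesis using True by (simp add: sr_def)
    qed (simp add: sr_def)
  qed
  then have "\<phi> ?V (sr ?V a) \<otimes>\<^bsub>\<O> (pre ?V)\<^esub> \<phi> ?V ?i = \<one>\<^bsub>\<O> (pre ?V)\<^esub>"
    using phi_mult[OF V sr_section[OF V a] i] phi_one[OF V] by simp
  then have "\<rho> U (pre ?V) (\<sigma> a) \<in> Units (\<O> (pre ?V))"
    unfolding rho_sigma[OF V a] Units_def
    using phi_closed[OF V i] phi_closed[OF V sr_section[OF V a]] OV.m_comm
    by (auto intro!: bexI[of _ "\<phi> ?V ?i"])
  then have "pre ?V \<subseteq> D U (\<sigma> a)" by (rule D_maximal[OF pre_open[OF V] pre_sub])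
  then show "x \<in> D U (\<sigma> a)" if "x \<in> pre ?V" for x using that by blast
  fix x assume "x \<in> D U (\<sigma> a)"
  then obtain W where W: "opn W" "x \<in> W" "W \<subseteq> U" "\<rho> U W (\<sigma> a) \<in> Units (\<O> W)"
    unfolding mem_D_iff by blast
  let ?T = "f ` W"
  have T: "zopen ?T" by (rule image_zopen[OF W(1,3)])
  have pT: "pre ?T = W" by (rule pre_image[OF W(3)])
  obtain r where r: "r \<in> carrier (\<O> W)" "\<rho> U W (\<sigma> a) \<otimes>\<^bsub>\<O> W\<^esub> r = \<one>\<^bsub>\<O> W\<^esub>"
    using W(4) unfolding Units_def by blast
  then have "r \<in> \<phi> ?T ` spec_sections A ?T"
    using bij_betw_imp_surj_on[OF phi_bij[OF T]] pT by simp
  then obtain s where s: "s \<in> spec_sections A ?T" "r = \<phi> ?T s" by blast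
  have "\<phi> ?T (\<lambda>P\<in>?T. sr ?T a P \<otimes>\<^bsub>ring_loc A (carrier A - P)\<^esub> s P) = \<phi> ?T (sr ?T \<one>\<^bsub>A\<^esub>)"
    using r(2) rho_sigma[OF T a] phi_mult[OF T sr_section[OF T a] s(1)] phi_one[OF T] s(2) pT by simp
  moreover have "(\<lambda>P\<in>?T. sr ?T a P \<otimes>\<^bsub>ring_loc A (carrier A - P)\<^esub> s P) \<in> spec_sections A ?T"
    by (rule sr_mult_section[OF T a s(1)])
  ultimately have eq: "(\<lambda>P\<in>?T. sr ?T a P \<otimes>\<^bsub>ring_loc A (carrier A - P)\<^esub> s P) = sr ?T \<one>\<^bsub>A\<^esub>"
    using bij_betw_imp_inj_on[OF phi_bij[OF T]] sr_section[OF T, of "\<one>\<^bsub>A\<^esub>"] by (auto dest: inj_onD)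
  let ?P = "f x"
  have xU: "x \<in> U" and PT: "?P \<in> ?T" using W by auto
  interpret P: primeideal ?P A by (rule f_prime[OF xU])
  interpret multiplicative_subset A "self_module A" "carrier A - ?P" by (rule S.N.prime_complement[OF P.primeideal])
  have "\<exists>V. zopen V \<and> ?P \<in> V \<and> V \<subseteq> ?T \<and> (\<exists>b\<in>carrier A. \<exists>t\<in>carrier A. \<forall>Q\<in>V. t \<notin> Q \<and>
      s Q = ring_frac A (carrier A - Q) b t)"
    using s(1) PT unfolding spec_sections_def by blast
  then obtain V b t where "?P \<in> V" and b: "b \<in> carrier A" and t: "t \<in> carrier A"
    and "\<forall>Q\<in>V. t \<notin> Q \<and> s Q = ring_frac A (carrier A - Q) b t"
    by (elim exE conjE bexE)
  then have b: "b \<in> carrier A" "t \<in> carrier A - ?P" "s ?P = ring_frac A (carrier A - ?P) b t" by auto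
  have "module_frac A (self_module A) (carrier A - ?P) (a \<otimes>\<^bsub>A\<^esub> b) (\<one>\<^bsub>A\<^esub> \<otimes>\<^bsub>A\<^esub> t) =
      module_frac A (self_module A) (carrier A - ?P) \<one>\<^bsub>A\<^esub> \<one>\<^bsub>A\<^esub>"
    using fun_cong[OF eq, of ?P] PT module_loc_smult[OF a _ S_one b(2), of b] b(1)
    by (simp add: sr_def b(3) ring_loc_mult_eq ring_frac_eq_module_frac)
  moreover have "\<one>\<^bsub>A\<^esub> \<otimes>\<^bsub>A\<^esub> t = t" "a \<otimes>\<^bsub>A\<^esub> b \<in> carrier (self_module A)" using a b by auto
  ultimately have "\<exists>u\<in>carrier A - ?P. u \<odot>\<^bsub>self_module A\<^esub> (\<one>\<^bsub>A\<^esub> \<odot>\<^bsub>self_module A\<^esub> (a \<otimes>\<^bsub>A\<^esub> b)) =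
      u \<odot>\<^bsub>self_module A\<^esub> (t \<odot>\<^bsub>self_module A\<^esub> \<one>\<^bsub>A\<^esub>)"
    using module_frac_eq_iff[of "a \<otimes>\<^bsub>A\<^esub> b" "\<one>\<^bsub>A\<^esub>" t "\<one>\<^bsub>A\<^esub>"] b(2) S_one by simp
  then obtain u where u: "u \<in> carrier A - ?P" "u \<otimes>\<^bsub>A\<^esub> (a \<otimes>\<^bsub>A\<^esub> b) = u \<otimes>\<^bsub>A\<^esub> t"
    using a b by auto
  have "u \<otimes>\<^bsub>A\<^esub> t \<notin> ?P" using u(1) b(2) P.I_prime by blast
  then have "a \<notin> ?P" using u a b(1) P.I_l_closed P.I_r_closed by (metis DiffD1 N.R.m_closed)
  then show "x \<in> pre ?V" unfolding pre_eq mem using xU P.primeideal by blast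
qed

lemma localizes_U: "localizes X M U"
proof (rule localizesI)
  fix g assume "g \<in> carrier (\<O> U)"
  then obtain a where a: "a \<in> carrier A" "g = \<sigma> a" by (rule sigma_surj)
  note Dg = D_sigma[OF a(1), folded a(2)]
  { fix t assume t: "t \<in> carrier (\<M> (D U g))"
    obtain n and k :: nat where "n \<in> carrier N"
      "\<mu> U (D U g) (\<tau> n) = \<rho> U (D U g) (\<sigma> (a [^]\<^bsub>A\<^esub> k)) \<odot>\<^bsub>\<M> (D U g)\<^esub> t"
      using phi_pow_tau[OF a(1), folded Dg, OF t] .
    then show "\<exists>k::nat. \<exists>m\<in>carrier (\<M> U). \<mu> U (D U g) m = \<rho> U (D U g) g [^]\<^bsub>\<O> (D U g)\<^esub> k \<odot>\<^bsub>\<M> (D U g)\<^esub> t"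
      using U_open sigma_closed[OF a(1)] tau_closed
      by (intro exI[of _ k] bexI[of _ "\<tau> n"]) (simp_all add: sigma_pow a) }
  { fix m assume m: "m \<in> carrier (\<M> U)" "\<mu> U (D U g) m = \<zero>\<^bsub>\<M> (D U g)\<^esub>"
    obtain n where n: "n \<in> carrier N" "m = \<tau> n" using tau_surj[OF m(1)] .
    obtain k :: nat where k: "a [^]\<^bsub>A\<^esub> k \<odot>\<^bsub>N\<^esub> n = \<zero>\<^bsub>N\<^esub>"
      using tau_kill[OF a(1) n(1)] m(2) unfolding Dg n(2) by blast
    have "g [^]\<^bsub>\<O> U\<^esub> k \<odot>\<^bsub>\<M> U\<^esub> m = \<zero>\<^bsub>\<M> U\<^esub>"
      using tau_smult[of "a [^]\<^bsub>A\<^esub> k" n] a n k by (simp add: sigma_pow tau_zero)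
    then show "\<exists>k::nat. g [^]\<^bsub>\<O> U\<^esub> k \<odot>\<^bsub>\<M> U\<^esub> m = \<zero>\<^bsub>\<M> U\<^esub>" by blast }
qed

end

context tilde_chart
begin

interpretation S: tilde_chart X "self_sheaf X" U A f \<phi> "self_module A" \<phi>
  by (rule tilde_chart_self[OF chart])

text \<open>Basic open sets and localization were computed in the chart. For the points,
  \<open>pt U\<close> is \<open>f\<close> followed by the bijection of primes induced by the ring
  isomorphism \<open>\<sigma>\<close>.\<close>

lemma aff_U: "aff U"
  unfolding aff_def
proof (intro conjI allI impI)
  show "opn U" by (rule U_open)
  show "localizes X (self_sheaf X) U" by (rule S.localizes_U)
  fix W x assume W: "opn W \<and> W \<subseteq> U \<and> x \<in> W"
  then have T: "zopen (f ` W)" using image_zopen by blast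
  then obtain E where E: "E \<subseteq> carrier A" "f ` W = zariski_open A E" unfolding openin_zariski by blast
  have "f x \<in> zariski_open A E" using W E(2) by blast
  then obtain e where e: "e \<in> E" "e \<notin> f x" by (auto simp: zariski_open_def)
  then have ec: "e \<in> carrier A" using E by blast
  have "zariski_open A {e} \<subseteq> f ` W" unfolding E(2) using e(1) by (auto simp: zariski_open_def)
  then have "pre (zariski_open A {e}) \<subseteq> pre (f ` W)" unfolding pre_eq by blast
  then have "D U (\<sigma> e) \<subseteq> W" using D_sigma[OF ec] pre_image W by simp
  moreover have "x \<in> D U (\<sigma> e)"
    unfolding D_sigma[OF ec] pre_eq using W e(2) ec f_prime by (auto simp: N.mem_zariski_open_singleton)
  ultimately show "\<exists>g\<in>carrier (\<O> U). x \<in> D U g \<and> D U g \<subseteq> W" using sigma_closed[OF ec] by blast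
next
  have pt: "pt U x = \<sigma> ` f x" if x: "x \<in> U" for x
  proof -
    interpret P: primeideal "f x" A by (rule f_prime[OF x])
    have "\<sigma> a \<in> pt U x \<longleftrightarrow> a \<in> f x" if "a \<in> carrier A" for a
      unfolding pt_def using that x f_prime[OF x] sigma_closed[OF that]
      by (auto simp: D_sigma pre_eq N.mem_zariski_open_singleton)
    moreover have "pt U x \<subseteq> carrier (\<O> U)" by (auto simp: pt_def)
    moreover have "f x \<subseteq> carrier A" using P.a_Hcarr by blast
    ultimately show ?thesis using sigma_surj by (auto simp: image_iff) (metis subsetD)+
  qed
  have inv: "inv_into (carrier A) \<sigma> \<in> ring_iso (\<O> U) A"
    by (rule ring_iso_set_sym[OF N.R.ring_axioms sigma_iso])
  then have inv_hom: "inv_into (carrier A) \<sigma> \<in> ring_hom (\<O> U) A" by (simp add: ring_iso_def)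
  \<comment> \<open>Images under \<open>\<sigma>\<close> are rewritten as preimages under its
    inverse, so that \<open>primeideal_preimage\<close> applies in both directions.\<close>
  have image: "\<sigma> ` Q = {g \<in> carrier (\<O> U). inv_into (carrier A) \<sigma> g \<in> Q}" if "Q \<subseteq> carrier A" for Q
  proof (intro equalityI subsetI)
    fix g assume "g \<in> \<sigma> ` Q"
    then obtain a where "a \<in> Q" "g = \<sigma> a" by blast
    then show "g \<in> {g \<in> carrier (\<O> U). inv_into (carrier A) \<sigma> g \<in> Q}"
      using that sigma_closed inv_into_f_f[OF sigma_inj] by auto
  next
    fix g assume g: "g \<in> {g \<in> carrier (\<O> U). inv_into (carrier A) \<sigma> g \<in> Q}"
    then obtain a where "a \<in> carrier A" "g = \<sigma> a" using sigma_surj by blast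
    then show "g \<in> \<sigma> ` Q" using g inv_into_f_f[OF sigma_inj] by auto
  qed
  have "bij_betw (\<lambda>Q. \<sigma> ` Q) Z {P. primeideal P (\<O> U)}"
  proof (rule bij_betw_imageI)
    have Zc: "Q \<subseteq> carrier A" if "Q \<in> Z" for Q
    proof -
      interpret primeideal Q A using that by simp
      show ?thesis using a_Hcarr by blast
    qed
    show "inj_on (\<lambda>Q. \<sigma> ` Q) Z"
      using inj_on_image_eq_iff[OF sigma_inj] Zc by (auto intro!: inj_onI)
    show "(\<lambda>Q. \<sigma> ` Q) ` Z = {P. primeideal P (\<O> U)}"
    proof (intro equalityI subsetI)
      fix P assume "P \<in> (\<lambda>Q. \<sigma> ` Q) ` Z"
      then obtain Q where Q: "Q \<in> Z" "P = \<sigma> ` Q" by blast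
      then show "P \<in> {P. primeideal P (\<O> U)}"
        using primeideal_preimage[OF inv_hom cring_O[OF U_open], of Q] image[OF Zc[OF Q(1)]] by simp
    next
      fix P assume "P \<in> {P. primeideal P (\<O> U)}"
      then have P: "primeideal P (\<O> U)" by simp
      interpret P: primeideal P "\<O> U" by (rule P)
      let ?Q = "{a \<in> carrier A. \<sigma> a \<in> P}"
      have "primeideal ?Q A" by (rule primeideal_preimage[OF sigma_hom cring_A P])
      moreover have "P \<subseteq> \<sigma> ` ?Q"
      proof
        fix g assume g: "g \<in> P"
        then obtain a where "a \<in> carrier A" "g = \<sigma> a" using sigma_surj P.a_Hcarr by blast
        then show "g \<in> \<sigma> ` ?Q" using g by blast
      qed
      then have "\<sigma> ` ?Q = P" by blast
      ultimately show "P \<in> (\<lambda>Q. \<sigma> ` Q) ` Z" by blast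
    qed
  qed
  then have "bij_betw ((\<lambda>Q. \<sigma> ` Q) \<circ> f) U {P. primeideal P (\<O> U)}"
    using f_bij by (rule bij_betw_trans[rotated])
  then show "bij_betw (pt U) U {P. primeideal P (\<O> U)}"
    by (rule bij_betw_cong[THEN iffD1, rotated]) (simp add: pt)
qed

end

section \<open>An intrinsic characterization of affine open sets\<close>

lemma (in cring) unit_left_cancel:
  "\<lbrakk>u \<in> Units R; a \<in> carrier R; b \<in> carrier R; u \<otimes> a = u \<otimes> b\<rbrakk> \<Longrightarrow> a = b"
  by (metis Units_l_cancel)

context ringed
begin

lemma D_subsetD: "x \<in> D U g \<Longrightarrow> x \<in> U"
  by (rule subsetD[OF D_subset])

lemma mem_pt: "g \<in> pt U x \<longleftrightarrow> g \<in> carrier (\<O> U) \<and> x \<notin> D U g"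
  by (simp add: pt_def)

lemma rho_eq_restrict:
  assumes "\<rho> U E a = \<rho> U E b" "opn U" "opn E" "E \<subseteq> U" "opn E'" "E' \<subseteq> E"
    "a \<in> carrier (\<O> U)" "b \<in> carrier (\<O> U)"
  shows "\<rho> U E' a = \<rho> U E' b"
  using rho_trans[OF assms(2,3,5,6,4,7)] rho_trans[OF assms(2,3,5,6,4,8)] assms(1) by simp

lemma affine_open_imp_aff: "affine_open X U \<Longrightarrow> aff U"
  unfolding affine_open_def using tilde_chart.aff_U[OF tilde_chart_self] by blast

lemma aff_open: "aff U \<Longrightarrow> opn U"
  by (simp add: aff_def)

lemma aff_basis:
  assumes "aff U" "opn W" "W \<subseteq> U" "x \<in> W"
  obtains g where "g \<in> carrier (\<O> U)" "x \<in> D U g" "D U g \<subseteq> W"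
  using assms unfolding aff_def by blast

lemma aff_localizes: "aff U \<Longrightarrow> localizes X (self_sheaf X) U"
  by (simp add: aff_def)

lemma aff_pt_bij: "aff U \<Longrightarrow> bij_betw (pt U) U {P. primeideal P (\<O> U)}"
  by (simp add: aff_def)

lemma aff_pt_prime: "\<lbrakk>aff U; x \<in> U\<rbrakk> \<Longrightarrow> primeideal (pt U x) (\<O> U)"
  using aff_pt_bij bij_betwE by blast

lemma D_zero_aff: "aff U \<Longrightarrow> D U \<zero>\<^bsub>\<O> U\<^esub> = {}"
proof (rule equals0I)
  fix x assume U: "aff U" and x: "x \<in> D U \<zero>\<^bsub>\<O> U\<^esub>"
  interpret P: primeideal "pt U x" "\<O> U" by (rule aff_pt_prime[OF U D_subsetD[OF x]])
  have "\<zero>\<^bsub>\<O> U\<^esub> \<in> pt U x" by (rule additive_subgroup.zero_closed[OF P.is_additive_subgroup])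
  then show False unfolding mem_pt using x by (elim conjE notE)
qed

text \<open>In a general ringed space a sum of two non-units can be a unit. Here the sections not
  invertible at \<open>x\<close> form the prime \<open>pt U x\<close>, which is closed under
  addition.\<close>

lemma D_add_aff:
  assumes U: "aff U" and g: "g \<in> carrier (\<O> U)" "h \<in> carrier (\<O> U)"
  shows "D U (g \<oplus>\<^bsub>\<O> U\<^esub> h) \<subseteq> D U g \<union> D U h"
proof (rule subsetI, rule ccontr)
  fix x assume x: "x \<in> D U (g \<oplus>\<^bsub>\<O> U\<^esub> h)" and n: "x \<notin> D U g \<union> D U h"
  have gh: "g \<in> pt U x" "h \<in> pt U x" using n g by (simp_all add: mem_pt)
  interpret P: primeideal "pt U x" "\<O> U" by (rule aff_pt_prime[OF U D_subsetD[OF x]])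
  have "g \<oplus>\<^bsub>\<O> U\<^esub> h \<in> pt U x" by (rule additive_subgroup.a_closed[OF P.is_additive_subgroup gh])
  then show False unfolding mem_pt using x by (elim conjE notE)
qed

text \<open>Absorption and primality come from \<open>D_mult\<close>, and negatives are multiples by
  \<open>\<ominus> \<one>\<close>; what remains is zero and sums.\<close>

lemma primeideal_ptI:
  assumes W: "opn W" and x: "x \<in> W" and zero: "x \<notin> D W \<zero>\<^bsub>\<O> W\<^esub>"
    and add: "\<And>a b. \<lbrakk>a \<in> carrier (\<O> W); b \<in> carrier (\<O> W)\<rbrakk> \<Longrightarrow>
      D W (a \<oplus>\<^bsub>\<O> W\<^esub> b) \<subseteq> D W a \<union> D W b"
  shows "primeideal (pt W x) (\<O> W)"
proof -
  interpret cring "\<O> W" by (rule cring_O[OF W])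
  have neg: "x \<notin> D W (\<ominus>\<^bsub>\<O> W\<^esub> a)" if a: "a \<in> carrier (\<O> W)" "x \<notin> D W a" for a
  proof -
    have "\<ominus>\<^bsub>\<O> W\<^esub> a = (\<ominus>\<^bsub>\<O> W\<^esub> \<one>\<^bsub>\<O> W\<^esub>) \<otimes>\<^bsub>\<O> W\<^esub> a" using a by (simp add: l_minus)
    then show ?thesis using D_mult[OF W _ a(1), of "\<ominus>\<^bsub>\<O> W\<^esub> \<one>\<^bsub>\<O> W\<^esub>"] a by simp
  qed
  show ?thesis
  proof (rule primeidealI2[OF _ is_cring])
    show "additive_subgroup (pt W x) (\<O> W)"
    proof (intro additive_subgroup.intro group.subgroupI[OF add.group_axioms])
      show "pt W x \<noteq> {}" using zero by (auto simp: pt_def)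
    next
      fix a assume "a \<in> pt W x"
      then have "\<ominus>\<^bsub>\<O> W\<^esub> a \<in> pt W x" using neg by (simp add: pt_def)
      then show "inv\<^bsub>add_monoid (\<O> W)\<^esub> a \<in> pt W x" unfolding a_inv_def .
    next
      fix a b assume "a \<in> pt W x" "b \<in> pt W x"
      then show "a \<otimes>\<^bsub>add_monoid (\<O> W)\<^esub> b \<in> pt W x" using add[of a b] by (auto simp: pt_def)
    qed (auto simp: pt_def)
    have "\<one>\<^bsub>\<O> W\<^esub> \<notin> pt W x" using D_one[OF W] x by (simp add: pt_def)
    then show "carrier (\<O> W) \<noteq> pt W x" using one_closed by blast
  qed (use D_mult[OF W] in \<open>auto simp: pt_def\<close>)
qed

text \<open>Every condition is pulled back to \<open>U\<close> by clearing denominators with powers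
  of \<open>g\<close>; primes are compared by contraction along the restriction map.\<close>

lemma aff_D:
  assumes U: "aff U" and g: "g \<in> carrier (\<O> U)"
  shows "aff (D U g)"
proof -
  let ?W = "D U g"
  note Uo = aff_open[OF U]
  interpret OU: cring "\<O> U" by (rule cring_O[OF Uo])
  interpret OW: cring "\<O> ?W" by (rule cring_O[OF D_open])
  interpret self: sheaf_of_modules X "self_sheaf X" by unfold_locales (rule O_module_self)
  note Dr = D_restrict[OF Uo D_open D_subset, of _ g]
  have gW: "\<rho> U ?W g \<in> Units (\<O> ?W)" by (rule D_unit[OF Uo g])
  have gWc: "\<rho> U ?W g \<in> carrier (\<O> ?W)" using gW by (rule OW.Units_closed)
  have basis: "\<exists>h\<in>carrier (\<O> ?W). x \<in> D ?W h \<and> D ?W h \<subseteq> W" if W: "opn W" "W \<subseteq> ?W" "x \<in> W" for W x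
  proof -
    have "W \<subseteq> U" using W(2) D_subset by blast
    then obtain h where h: "h \<in> carrier (\<O> U)" "x \<in> D U h" "D U h \<subseteq> W"
      using aff_basis[OF U W(1) _ W(3)] by blast
    then show ?thesis using Dr[OF h(1)] W by (intro bexI[of _ "\<rho> U ?W h"]) (auto simp: Uo)
  qed
  \<comment> \<open>Both sections are lifted to \<open>U\<close> after multiplication by one common
    unit \<open>?v\<close>, so that additivity over \<open>U\<close> can be used.\<close>
  have add: "D ?W (a \<oplus>\<^bsub>\<O> ?W\<^esub> b) \<subseteq> D ?W a \<union> D ?W b"
    if ab: "a \<in> carrier (\<O> ?W)" "b \<in> carrier (\<O> ?W)" for a b
  proof -
    obtain k :: nat and a' where a': "a' \<in> carrier (\<O> U)"
      "\<rho> U ?W a' = \<rho> U ?W g [^]\<^bsub>\<O> ?W\<^esub> k \<otimes>\<^bsub>\<O> ?W\<^esub> a"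
      using localizes_self_lift[OF aff_localizes[OF U] g ab(1)] .
    obtain l :: nat and b' where b': "b' \<in> carrier (\<O> U)"
      "\<rho> U ?W b' = \<rho> U ?W g [^]\<^bsub>\<O> ?W\<^esub> l \<otimes>\<^bsub>\<O> ?W\<^esub> b"
      using localizes_self_lift[OF aff_localizes[OF U] g ab(2)] .
    let ?a = "g [^]\<^bsub>\<O> U\<^esub> l \<otimes>\<^bsub>\<O> U\<^esub> a'" and ?b = "g [^]\<^bsub>\<O> U\<^esub> k \<otimes>\<^bsub>\<O> U\<^esub> b'"
    let ?v = "\<rho> U ?W g [^]\<^bsub>\<O> ?W\<^esub> (k + l)"
    have c: "?a \<in> carrier (\<O> U)" "?b \<in> carrier (\<O> U)" using g a' b' by auto
    have v: "?v \<in> Units (\<O> ?W)" by (rule OW.Units_pow_closed[OF gW])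
    have va: "\<rho> U ?W ?a = ?v \<otimes>\<^bsub>\<O> ?W\<^esub> a"
      using Uo g a' ab gWc by (simp add: OW.nat_pow_mult[symmetric] OW.m_ac)
    have vb: "\<rho> U ?W ?b = ?v \<otimes>\<^bsub>\<O> ?W\<^esub> b"
      using Uo g b' ab gWc by (simp add: OW.nat_pow_mult[symmetric] OW.m_ac)
    have vc: "?v \<in> carrier (\<O> ?W)" using v by (rule OW.Units_closed)
    have unit: "D ?W (?v \<otimes>\<^bsub>\<O> ?W\<^esub> c) = D ?W c" if "c \<in> carrier (\<O> ?W)" for c
      using D_mult[OF D_open vc that] D_Units[OF D_open v] D_subset[of ?W c] by blast
    have "\<rho> U ?W (?a \<oplus>\<^bsub>\<O> U\<^esub> ?b) = ?v \<otimes>\<^bsub>\<O> ?W\<^esub> (a \<oplus>\<^bsub>\<O> ?W\<^esub> b)"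
      using rho_add[OF Uo D_open D_subset c] va vb vc ab by (simp add: OW.r_distr)
    then have "D ?W (a \<oplus>\<^bsub>\<O> ?W\<^esub> b) = D U (?a \<oplus>\<^bsub>\<O> U\<^esub> ?b) \<inter> ?W"
      using Dr[of "?a \<oplus>\<^bsub>\<O> U\<^esub> ?b"] unit[of "a \<oplus>\<^bsub>\<O> ?W\<^esub> b"] c ab by simp
    also have "\<dots> \<subseteq> (D U ?a \<inter> ?W) \<union> (D U ?b \<inter> ?W)" using D_add_aff[OF U c] by blast
    also have "\<dots> = D ?W a \<union> D ?W b"
      using Dr[OF c(1)] Dr[OF c(2)] unit[OF ab(1)] unit[OF ab(2)] va vb by simp
    finally show ?thesis .
  qed
  have zero: "D ?W \<zero>\<^bsub>\<O> ?W\<^esub> = {}"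
    using Dr[of "\<zero>\<^bsub>\<O> U\<^esub>"] D_zero_aff[OF U] Uo by simp
  have prime: "primeideal (pt ?W x) (\<O> ?W)" if "x \<in> ?W" for x
    using primeideal_ptI[OF D_open that] zero add by blast
  \<comment> \<open>The prime of \<open>x\<close> over \<open>U\<close> is the contraction of the
    one over \<open>?W\<close>, hence injectivity is inherited from \<open>U\<close>.\<close>
  have pull: "pt U x = {h \<in> carrier (\<O> U). \<rho> U ?W h \<in> pt ?W x}" if "x \<in> ?W" for x
    unfolding pt_def using Dr that Uo by auto
  have "bij_betw (pt ?W) ?W {P. primeideal P (\<O> ?W)}"
  proof (rule bij_betw_imageI)
    show "inj_on (pt ?W) ?W"
    proof (rule inj_onI)
      fix x y assume xy: "x \<in> ?W" "y \<in> ?W" "pt ?W x = pt ?W y"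
      then have "pt U x = pt U y" using pull by simp
      then show "x = y" using bij_betw_imp_inj_on[OF aff_pt_bij[OF U]] xy D_subset by (meson inj_onD subsetD)
    qed
    show "pt ?W ` ?W = {P. primeideal P (\<O> ?W)}"
    proof (intro equalityI subsetI)
      \<comment> \<open>The contraction of \<open>Q\<close> is the prime of a point \<open>x\<close>
        of \<open>U\<close>; as the unit \<open>g\<close> is not in \<open>Q\<close>, this point
        lies in \<open>?W\<close>.\<close>
      fix Q assume "Q \<in> {P. primeideal P (\<O> ?W)}"
      then interpret Q: primeideal Q "\<O> ?W" by simp
      let ?P = "{h \<in> carrier (\<O> U). \<rho> U ?W h \<in> Q}"
      have "primeideal ?P (\<O> U)"
        by (rule primeideal_preimage[OF rho_hom[OF Uo D_open D_subset] OU.is_cring Q.primeideal])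
      then have "?P \<in> pt U ` U" using bij_betw_imp_surj_on[OF aff_pt_bij[OF U]] by blast
      then obtain x where x: "x \<in> U" "?P = pt U x" by blast
      have unit_notin: "v \<notin> Q" if v: "v \<in> Units (\<O> ?W)" for v
      proof
        assume "v \<in> Q"
        then have "inv\<^bsub>\<O> ?W\<^esub> v \<otimes>\<^bsub>\<O> ?W\<^esub> v \<in> Q" using v by (intro Q.I_l_closed) auto
        then have "\<one>\<^bsub>\<O> ?W\<^esub> \<in> Q" using v by simp
        then show False using Q.I_notcarr Q.one_imp_carrier by blast
      qed
      have "g \<notin> ?P" using unit_notin[OF gW] by blast
      then have xW: "x \<in> ?W" using x g unfolding pt_def by blast
      \<comment> \<open>The contraction determines the prime: by \<open>D_shrink\<close> every
        \<open>h\<close> is, up to a unit, restricted from \<open>U\<close>.\<close>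
      have "h \<in> Q \<longleftrightarrow> h \<in> pt ?W x" if h: "h \<in> carrier (\<O> ?W)" for h
      proof -
        obtain w v where w: "w \<in> carrier (\<O> U)" "v \<in> Units (\<O> ?W)"
          "\<rho> U ?W w = v \<otimes>\<^bsub>\<O> ?W\<^esub> h" "D U w = D ?W h"
          using D_shrink[OF Uo aff_localizes[OF U] g h] .
        have "h \<in> Q \<longleftrightarrow> v \<otimes>\<^bsub>\<O> ?W\<^esub> h \<in> Q"
          using Q.I_prime[OF OW.Units_closed[OF w(2)] h] unit_notin[OF w(2)]
            Q.I_l_closed[OF _ OW.Units_closed[OF w(2)]] by blast
        also have "\<dots> \<longleftrightarrow> w \<in> pt U x" unfolding x(2)[symmetric] using w by simp
        also have "\<dots> \<longleftrightarrow> h \<in> pt ?W x" unfolding pt_def using w h by simp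
        finally show ?thesis .
      qed
      moreover have "Q \<subseteq> carrier (\<O> ?W)" using Q.a_Hcarr by blast
      ultimately have "Q = pt ?W x" by (auto simp: pt_def)
      then show "Q \<in> pt ?W ` ?W" using xW by blast
    qed (use prime in auto)
  qed
  then show ?thesis
    unfolding aff_def using basis D_open self.localizes_D[OF Uo aff_localizes[OF U] aff_localizes[OF U] g]
    by blast
qed

end

section \<open>From the intrinsic conditions back to an isomorphism with a spectrum\<close>

locale affine_part = ringed X for X :: "('x, 'r) ringed_space" +
  fixes U :: "'x set"
  assumes U: "aff U"
begin

abbreviation B :: "'r ring" where "B \<equiv> \<O> U"

lemma Uo: "opn U" by (rule aff_open[OF U])

sublocale B: cring B by (rule cring_O[OF Uo])

sublocale BB: plain_module B "self_module B"
  by (intro plain_module.intro module_self B.is_cring)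

lemma U_top: "U \<subseteq> topspace (space_top X)"
  using Uo by (rule openin_subset)

lemma pt_notin: "h \<in> carrier B \<Longrightarrow> h \<notin> pt U y \<longleftrightarrow> y \<in> D U h"
  by (simp add: pt_def)

lemma pt_fractions: "y \<in> U \<Longrightarrow> multiplicative_subset B (self_module B) (carrier B - pt U y)"
  by (rule BB.prime_complement[OF aff_pt_prime[OF U]])

text \<open>Equality in the local ring at \<open>pt U y\<close> is equality of germs at
  \<open>y\<close>: a witness \<open>u\<close> is invertible on \<open>D U u\<close>, and conversely
  a difference that vanishes on \<open>D U g\<close> is killed by a power of
  \<open>g\<close>.\<close>

lemma germ_eq_iff:
  assumes b: "b \<in> carrier B" "b' \<in> carrier B" and y: "y \<in> U"
  shows "(\<exists>u\<in>carrier B - pt U y. u \<otimes>\<^bsub>B\<^esub> b = u \<otimes>\<^bsub>B\<^esub> b') \<longleftrightarrow>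
    (\<exists>E. opn E \<and> y \<in> E \<and> E \<subseteq> U \<and> \<rho> U E b = \<rho> U E b')" (is "?L \<longleftrightarrow> ?R")
proof
  assume ?L
  then obtain u where u: "u \<in> carrier B" "y \<in> D U u" "u \<otimes>\<^bsub>B\<^esub> b = u \<otimes>\<^bsub>B\<^esub> b'"
    using pt_notin by blast
  interpret E: cring "\<O> (D U u)" by (rule cring_O[OF D_open])
  have "\<rho> U (D U u) u \<otimes>\<^bsub>\<O> (D U u)\<^esub> \<rho> U (D U u) b = \<rho> U (D U u) u \<otimes>\<^bsub>\<O> (D U u)\<^esub> \<rho> U (D U u) b'"
    using u b Uo by (simp flip: rho_mult)
  then have "\<rho> U (D U u) b = \<rho> U (D U u) b'"
    by (rule E.unit_left_cancel[OF D_unit[OF Uo u(1)] rho_closed[OF Uo D_open D_subset b(1)]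
          rho_closed[OF Uo D_open D_subset b(2)]])
  then show ?R using u(2) by (intro exI[of _ "D U u"]) auto
next
  assume ?R
  then obtain E where E: "opn E" "y \<in> E" "E \<subseteq> U" "\<rho> U E b = \<rho> U E b'" by blast
  obtain g where g: "g \<in> carrier B" "y \<in> D U g" "D U g \<subseteq> E" using aff_basis[OF U E(1,3,2)] .
  interpret OD: cring "\<O> (D U g)" by (rule cring_O[OF D_open])
  have eq: "\<rho> U (D U g) b = \<rho> U (D U g) b'"
    by (rule rho_eq_restrict[OF E(4) Uo E(1,3) D_open g(3) b])
  interpret h: ring_hom_cring B "\<O> (D U g)" "\<rho> U (D U g)" by (rule rho_hom_cring[OF Uo D_open D_subset])
  have "\<rho> U (D U g) (b \<ominus>\<^bsub>B\<^esub> b') = \<zero>\<^bsub>\<O> (D U g)\<^esub>"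
    unfolding a_minus_def using b eq by (simp add: OD.r_neg)
  then obtain k :: nat where k: "g [^]\<^bsub>B\<^esub> k \<otimes>\<^bsub>B\<^esub> (b \<ominus>\<^bsub>B\<^esub> b') = \<zero>\<^bsub>B\<^esub>"
    using localizes_self_kill[OF aff_localizes[OF U] g(1), of "b \<ominus>\<^bsub>B\<^esub> b'"] b by auto
  have gk: "g [^]\<^bsub>B\<^esub> k \<in> carrier B" using g(1) by simp
  have "g [^]\<^bsub>B\<^esub> k \<otimes>\<^bsub>B\<^esub> b \<ominus>\<^bsub>B\<^esub> g [^]\<^bsub>B\<^esub> k \<otimes>\<^bsub>B\<^esub> b' = \<zero>\<^bsub>B\<^esub>"
    using k gk b by (simp add: a_minus_def B.r_distr B.r_minus)
  then have "g [^]\<^bsub>B\<^esub> k \<otimes>\<^bsub>B\<^esub> b = g [^]\<^bsub>B\<^esub> k \<otimes>\<^bsub>B\<^esub> b'"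
    using gk b by (simp add: B.diff_eq_zero_iff)
  \<comment> \<open>For \<open>k = 0\<close> the power is \<open>\<one>\<close> and its basic open
    set is all of \<open>U\<close>.\<close>
  moreover have "y \<in> D U (g [^]\<^bsub>B\<^esub> k)"
    using g(1,2) D_pow[OF Uo g(1)] D_one[OF Uo] y by (cases k) auto
  ultimately show ?L using pt_notin[of "g [^]\<^bsub>B\<^esub> k"] g(1) by blast
qed

text \<open>Expresses \<open>t = b / h\<close> near \<open>y\<close> with \<open>h\<close>
  invertible at \<open>y\<close>, written multiplicatively to avoid inverses in varying
  rings.\<close>

definition frac_near :: "'x set \<Rightarrow> 'r \<Rightarrow> 'x \<Rightarrow> 'r \<Rightarrow> 'r \<Rightarrow> bool" where
  "frac_near W t y b h \<longleftrightarrow> b \<in> carrier B \<and> h \<in> carrier B \<and> y \<in> D U h \<and>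
    (\<exists>E. opn E \<and> y \<in> E \<and> E \<subseteq> W \<and> \<rho> U E h \<otimes>\<^bsub>\<O> E\<^esub> \<rho> W E t = \<rho> U E b)"

text \<open>Intersecting with \<open>D U h\<close> makes the equation and the invertibility of
  \<open>h\<close> hold on all smaller open sets, as needed when several fractions are compared on
  an overlap.\<close>

lemma frac_near_shrink:
  assumes W: "opn W" "W \<subseteq> U" "t \<in> carrier (\<O> W)" and f: "frac_near W t y b h"
  obtains E where "opn E" "y \<in> E" "E \<subseteq> W"
    "\<forall>E'. opn E' \<longrightarrow> E' \<subseteq> E \<longrightarrow> \<rho> U E' h \<otimes>\<^bsub>\<O> E'\<^esub> \<rho> W E' t = \<rho> U E' b"
    "\<forall>E'. opn E' \<longrightarrow> E' \<subseteq> E \<longrightarrow> \<rho> U E' h \<in> Units (\<O> E')"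
proof -
  obtain E where E: "opn E" "y \<in> E" "E \<subseteq> W" "\<rho> U E h \<otimes>\<^bsub>\<O> E\<^esub> \<rho> W E t = \<rho> U E b"
    and h: "b \<in> carrier B" "h \<in> carrier B" "y \<in> D U h"
    using f unfolding frac_near_def by blast
  show ?thesis
  proof (rule that[of "E \<inter> D U h"])
    show "opn (E \<inter> D U h)" "y \<in> E \<inter> D U h" "E \<inter> D U h \<subseteq> W" using E h by auto
    { fix E' assume E': "opn E'" "E' \<subseteq> E \<inter> D U h"
    have s: "E' \<subseteq> E" "E' \<subseteq> D U h" "E \<subseteq> U" "E' \<subseteq> W" "E' \<subseteq> U" using E' E W by auto
    have "\<rho> U E' h \<otimes>\<^bsub>\<O> E'\<^esub> \<rho> W E' t = \<rho> E E' (\<rho> U E h \<otimes>\<^bsub>\<O> E\<^esub> \<rho> W E t)"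
      using s E(1-3) E'(1) W Uo h(1,2) by simp
    also have "\<dots> = \<rho> U E' b" unfolding E(4) using s E(1-3) E'(1) Uo h(1) by simp
    finally have "\<rho> U E' h \<otimes>\<^bsub>\<O> E'\<^esub> \<rho> W E' t = \<rho> U E' b" .
    note eqn = this
    have "\<rho> (D U h) E' (\<rho> U (D U h) h) \<in> Units (\<O> E')"
      by (rule rho_Units[OF D_open E'(1) s(2) D_unit[OF Uo h(2)]])
    then have "\<rho> U E' h \<in> Units (\<O> E')" using s E' Uo h by simp
    with eqn have "\<rho> U E' h \<otimes>\<^bsub>\<O> E'\<^esub> \<rho> W E' t = \<rho> U E' b \<and> \<rho> U E' h \<in> Units (\<O> E')" by (rule conjI) }
    then show "\<forall>E'. opn E' \<longrightarrow> E' \<subseteq> E \<inter> D U h \<longrightarrow> \<rho> U E' h \<otimes>\<^bsub>\<O> E'\<^esub> \<rho> W E' t = \<rho> U E' b"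
      "\<forall>E'. opn E' \<longrightarrow> E' \<subseteq> E \<inter> D U h \<longrightarrow> \<rho> U E' h \<in> Units (\<O> E')" by blast+
  qed
qed

text \<open>Some power of \<open>g\<close> times \<open>t\<close> lifts to \<open>U\<close>, and
  that power is the denominator. The same pair serves at all points of \<open>D U g\<close>, which
  is the local condition for sections of a spectrum.\<close>

lemma frac_near_exists:
  assumes W: "opn W" "W \<subseteq> U" "t \<in> carrier (\<O> W)" and y: "y \<in> W"
  obtains g b h where "g \<in> carrier B" "y \<in> D U g" "D U g \<subseteq> W"
    "\<forall>z\<in>D U g. frac_near W t z b h"
proof -
  obtain g where g: "g \<in> carrier B" "y \<in> D U g" "D U g \<subseteq> W" using aff_basis[OF U W(1,2) y] .
  have "\<rho> W (D U g) t \<in> carrier (\<O> (D U g))" using W g by simp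
  then obtain k :: nat and b where b: "b \<in> carrier B"
    "\<rho> U (D U g) b = \<rho> U (D U g) g [^]\<^bsub>\<O> (D U g)\<^esub> k \<otimes>\<^bsub>\<O> (D U g)\<^esub> \<rho> W (D U g) t"
    using localizes_self_lift[OF aff_localizes[OF U] g(1)] by blast
  have "frac_near W t z b (g [^]\<^bsub>B\<^esub> k)" if z: "z \<in> D U g" for z
    unfolding frac_near_def
  proof (intro conjI exI[of _ "D U g"])
    show "z \<in> D U (g [^]\<^bsub>B\<^esub> k)"
    proof (cases k)
      case 0
      then show ?thesis using D_one[OF Uo] D_subsetD[OF z] by simp
    next
      case (Suc l)
      then show ?thesis using D_pow[OF Uo g(1)] z by simp
    qed
    show "\<rho> U (D U g) (g [^]\<^bsub>B\<^esub> k) \<otimes>\<^bsub>\<O> (D U g)\<^esub> \<rho> W (D U g) t = \<rho> U (D U g) b"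
      using b(2) Uo g(1) by simp
  qed (use b g z in auto)
  then show ?thesis using that g by blast
qed

text \<open>The germ of \<open>t\<close> at \<open>y\<close> in the encoding used for fractions: the
  set of all pairs that represent it.\<close>

definition fr :: "'x set \<Rightarrow> 'r \<Rightarrow> 'x \<Rightarrow> ('r \<times> 'r) set" where
  "fr W t y = {(b, h). frac_near W t y b h}"

text \<open>Two pairs represent the same germ exactly when their cross products agree near
  \<open>y\<close>, which \<open>germ_eq_iff\<close> translates into the relation defining
  \<open>ring_frac\<close>. The unit \<open>h\<close> is cancelled in one direction.\<close>

lemma fr_eq:
  assumes W: "opn W" "W \<subseteq> U" "t \<in> carrier (\<O> W)" and f: "frac_near W t y b h"
  shows "fr W t y = ring_frac B (carrier B - pt U y) b h"
proof -
  have b: "b \<in> carrier B" and h: "h \<in> carrier B" and y: "y \<in> U"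
    using f W unfolding frac_near_def by auto
  obtain E where E: "opn E" "y \<in> E" "E \<subseteq> W"
    and eq_all: "\<forall>E'. opn E' \<longrightarrow> E' \<subseteq> E \<longrightarrow> \<rho> U E' h \<otimes>\<^bsub>\<O> E'\<^esub> \<rho> W E' t = \<rho> U E' b"
    and un_all: "\<forall>E'. opn E' \<longrightarrow> E' \<subseteq> E \<longrightarrow> \<rho> U E' h \<in> Units (\<O> E')"
    using frac_near_shrink[OF W f] .
  note eq = eq_all[rule_format]
  note un = un_all[rule_format]
  have key: "frac_near W t y b' h' \<longleftrightarrow> (\<exists>u\<in>carrier B - pt U y. u \<otimes>\<^bsub>B\<^esub> (h' \<otimes>\<^bsub>B\<^esub> b) = u \<otimes>\<^bsub>B\<^esub> (h \<otimes>\<^bsub>B\<^esub> b'))"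
    (is "?L \<longleftrightarrow> ?R")
    if b': "b' \<in> carrier B" and h': "h' \<in> carrier B" "y \<in> D U h'" for b' h'
  proof -
    have c: "h' \<otimes>\<^bsub>B\<^esub> b \<in> carrier B" "h \<otimes>\<^bsub>B\<^esub> b' \<in> carrier B" using b h b' h' by auto
    show ?thesis unfolding germ_eq_iff[OF c y]
    proof
      assume ?L
      obtain E1 where E1: "opn E1" "y \<in> E1" "E1 \<subseteq> W"
        and eq1_all: "\<forall>E'. opn E' \<longrightarrow> E' \<subseteq> E1 \<longrightarrow> \<rho> U E' h' \<otimes>\<^bsub>\<O> E'\<^esub> \<rho> W E' t = \<rho> U E' b'"
        and "\<forall>E'. opn E' \<longrightarrow> E' \<subseteq> E1 \<longrightarrow> \<rho> U E' h' \<in> Units (\<O> E')"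
        by (rule frac_near_shrink[OF W \<open>?L\<close>])
      note eq1 = eq1_all[rule_format]
      let ?F = "E \<inter> E1"
      have F: "opn ?F" "?F \<subseteq> U" "?F \<subseteq> W" using E E1 W by auto
      interpret F: cring "\<O> ?F" by (rule cring_O[OF F(1)])
      have cc: "\<rho> U ?F h \<in> carrier (\<O> ?F)" "\<rho> U ?F h' \<in> carrier (\<O> ?F)" "\<rho> W ?F t \<in> carrier (\<O> ?F)"
        using F Uo h h' W by auto
      have "\<rho> U ?F (h' \<otimes>\<^bsub>B\<^esub> b) = \<rho> U ?F (h \<otimes>\<^bsub>B\<^esub> b')"
        using eq[OF F(1)] eq1[OF F(1)] cc F Uo b h b' h' by (simp flip: eq eq1) (simp add: F.m_lcomm)
      then show "\<exists>E. opn E \<and> y \<in> E \<and> E \<subseteq> U \<and> \<rho> U E (h' \<otimes>\<^bsub>B\<^esub> b) = \<rho> U E (h \<otimes>\<^bsub>B\<^esub> b')"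
        using F E E1 by blast
    next
      assume "\<exists>E. opn E \<and> y \<in> E \<and> E \<subseteq> U \<and> \<rho> U E (h' \<otimes>\<^bsub>B\<^esub> b) = \<rho> U E (h \<otimes>\<^bsub>B\<^esub> b')"
      then obtain E1 where E1: "opn E1" "y \<in> E1" "E1 \<subseteq> U" "\<rho> U E1 (h' \<otimes>\<^bsub>B\<^esub> b) = \<rho> U E1 (h \<otimes>\<^bsub>B\<^esub> b')" by blast
      let ?F = "E \<inter> E1"
      have F: "opn ?F" "?F \<subseteq> U" "?F \<subseteq> W" "?F \<subseteq> E" "?F \<subseteq> E1" using E E1 W by auto
      interpret F: cring "\<O> ?F" by (rule cring_O[OF F(1)])
      have cc: "\<rho> U ?F h \<in> carrier (\<O> ?F)" "\<rho> U ?F h' \<in> carrier (\<O> ?F)" "\<rho> W ?F t \<in> carrier (\<O> ?F)"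
        "\<rho> U ?F b \<in> carrier (\<O> ?F)" "\<rho> U ?F b' \<in> carrier (\<O> ?F)"
        using F Uo h h' W b b' by auto
      have "\<rho> U ?F (h' \<otimes>\<^bsub>B\<^esub> b) = \<rho> U ?F (h \<otimes>\<^bsub>B\<^esub> b')"
        by (rule rho_eq_restrict[OF E1(4) Uo E1(1,3) F(1,5) c])
      then have k: "\<rho> U ?F h' \<otimes>\<^bsub>\<O> ?F\<^esub> \<rho> U ?F b = \<rho> U ?F h \<otimes>\<^bsub>\<O> ?F\<^esub> \<rho> U ?F b'"
        using F(1,2) Uo b h b' h'(1) by simp
      have "\<rho> U ?F h \<otimes>\<^bsub>\<O> ?F\<^esub> (\<rho> U ?F h' \<otimes>\<^bsub>\<O> ?F\<^esub> \<rho> W ?F t) = \<rho> U ?F h' \<otimes>\<^bsub>\<O> ?F\<^esub> (\<rho> U ?F h \<otimes>\<^bsub>\<O> ?F\<^esub> \<rho> W ?F t)"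
        using cc by (simp add: F.m_lcomm)
      also have "\<dots> = \<rho> U ?F h \<otimes>\<^bsub>\<O> ?F\<^esub> \<rho> U ?F b'" unfolding eq[OF F(1,4)] by (rule k)
      finally have "\<rho> U ?F h' \<otimes>\<^bsub>\<O> ?F\<^esub> \<rho> W ?F t = \<rho> U ?F b'"
        by (rule F.unit_left_cancel[OF un[OF F(1,4)] F.m_closed[OF cc(2,3)] cc(5)])
      then show ?L unfolding frac_near_def using F E E1 b' h' by (intro conjI exI[of _ ?F]) auto
    qed
  qed
  have "frac_near W t y b' h' \<longleftrightarrow> b' \<in> carrier B \<and> h' \<in> carrier B - pt U y \<and>
      (\<exists>u\<in>carrier B - pt U y. u \<otimes>\<^bsub>B\<^esub> (h' \<otimes>\<^bsub>B\<^esub> b) = u \<otimes>\<^bsub>B\<^esub> (h \<otimes>\<^bsub>B\<^esub> b'))" for b' h'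
  proof (cases "b' \<in> carrier B \<and> h' \<in> carrier B \<and> y \<in> D U h'")
    case True
    then show ?thesis using key[of b' h'] pt_notin[of h' y] by simp
  next
    case False
    then have "\<not> frac_near W t y b' h'" unfolding frac_near_def by blast
    then show ?thesis using False pt_notin[of h' y] by blast
  qed
  note near = this
  show ?thesis
  proof (rule Set.set_eqI)
    fix p
    show "p \<in> fr W t y \<longleftrightarrow> p \<in> ring_frac B (carrier B - pt U y) b h"
      unfolding fr_def ring_frac_def by (cases p) (simp only: mem_Collect_eq case_prod_conv near)
  qed
qed

abbreviation pre :: "'r set set \<Rightarrow> 'x set" where "pre V \<equiv> {x \<in> U. pt U x \<in> V}"
abbreviation zopen :: "'r set set \<Rightarrow> bool" where "zopen \<equiv> openin (zariski B)"

lemma zopen_sub: "zopen V \<Longrightarrow> V \<subseteq> {P. primeideal P B}"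
  using openin_subset topspace_zariski[OF B.is_cring] by metis

text \<open>The preimage of the primes not containing \<open>E\<close> is the union of the
  \<open>D U e\<close> over \<open>e\<close> in \<open>E\<close>.\<close>

lemma pre_open: "zopen V \<Longrightarrow> opn (pre V)"
proof -
  assume "zopen V"
  then obtain E where E: "E \<subseteq> carrier B" "V = zariski_open B E" unfolding openin_zariski by blast
  have "pre V = \<Union>(D U ` E)"
  proof (intro equalityI subsetI)
    fix x assume "x \<in> pre V"
    then show "x \<in> \<Union>(D U ` E)" using E(1) unfolding E(2) zariski_open_def pt_def by blast
  next
    fix x assume "x \<in> \<Union>(D U ` E)"
    then obtain e where e: "e \<in> E" "x \<in> D U e" by blast
    then have "x \<in> U" "e \<notin> pt U x" using D_subsetD[OF e(2)] by (auto simp: pt_def)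
    then show "x \<in> pre V" using e(1) aff_pt_prime[OF U] unfolding E(2) zariski_open_def by blast
  qed
  then show ?thesis by auto
qed

text \<open>An open \<open>W\<close> is the union of the basic open sets it contains; their defining
  sections form the set \<open>?E\<close>.\<close>

lemma image_zopen: "\<lbrakk>opn W; W \<subseteq> U\<rbrakk> \<Longrightarrow> zopen (pt U ` W)"
proof -
  assume W: "opn W" "W \<subseteq> U"
  let ?E = "{g \<in> carrier B. D U g \<subseteq> W}"
  have "pt U ` W = zariski_open B ?E"
  proof (intro equalityI subsetI)
    fix P assume "P \<in> pt U ` W"
    then obtain x where x: "x \<in> W" "P = pt U x" by blast
    obtain g where "g \<in> carrier B" "x \<in> D U g" "D U g \<subseteq> W" using aff_basis[OF U W x(1)] .
    then have "\<not> ?E \<subseteq> P" unfolding x(2) by (auto simp: pt_def)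
    then show "P \<in> zariski_open B ?E" using aff_pt_prime[OF U] x W by (auto simp: zariski_open_def)
  next
    fix P assume P: "P \<in> zariski_open B ?E"
    then have "P \<in> pt U ` U"
      using bij_betw_imp_surj_on[OF aff_pt_bij[OF U]] by (simp add: zariski_open_def)
    then obtain x where x: "x \<in> U" "P = pt U x" by blast
    then obtain g where "g \<in> carrier B" "D U g \<subseteq> W" "g \<notin> pt U x"
      using P by (auto simp: zariski_open_def)
    then show "P \<in> pt U ` W" using x by (auto simp: pt_def)
  qed
  then show ?thesis unfolding openin_zariski by (intro exI[of _ ?E]) simp
qed

lemma homeo: "homeomorphic_map (subtopology (space_top X) U) (zariski B) (pt U)"
proof (rule bijective_open_imp_homeomorphic_map)
  have top: "topspace (subtopology (space_top X) U) = U" using U_top by auto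
  have surj: "pt U ` U = {P. primeideal P B}" by (rule bij_betw_imp_surj_on[OF aff_pt_bij[OF U]])
  show "pt U ` topspace (subtopology (space_top X) U) = topspace (zariski B)"
    unfolding top topspace_zariski[OF B.is_cring] by (rule surj)
  show "inj_on (pt U) (topspace (subtopology (space_top X) U))"
    unfolding top by (rule bij_betw_imp_inj_on[OF aff_pt_bij[OF U]])
  show "open_map (subtopology (space_top X) U) (zariski B) (pt U)"
    unfolding open_map_def openin_open_subtopology[OF Uo] using image_zopen by blast
  show "continuous_map (subtopology (space_top X) U) (zariski B) (pt U)"
    unfolding continuous_map top topspace_zariski[OF B.is_cring] openin_open_subtopology[OF Uo]
    using surj pre_open by auto
qed

definition q :: "'r set \<Rightarrow> 'x" where "q = the_inv_into U (pt U)"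

lemma q_pt: "x \<in> U \<Longrightarrow> q (pt U x) = x"
  unfolding q_def by (rule the_inv_into_f_f[OF bij_betw_imp_inj_on[OF aff_pt_bij[OF U]]])

lemma zopen_point:
  assumes "zopen V" "P \<in> V"
  obtains y where "y \<in> pre V" "P = pt U y"
proof -
  have "P \<in> pt U ` U" using assms zopen_sub bij_betw_imp_surj_on[OF aff_pt_bij[OF U]] by blast
  then show ?thesis using assms(2) that by blast
qed

text \<open>A section goes to the function of its germs, indexed by primes through the inverse
  \<open>q\<close> of \<open>pt U\<close>.\<close>

definition \<psi> :: "'r set set \<Rightarrow> 'r \<Rightarrow> 'r set \<Rightarrow> ('r \<times> 'r) set" where
  "\<psi> V t = (\<lambda>P\<in>V. fr (pre V) t (q P))"

lemma psi_at: "y \<in> pre V \<Longrightarrow> \<psi> V t (pt U y) = fr (pre V) t y"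
  by (simp add: \<psi>_def q_pt)

lemma psi_eq:
  assumes V: "zopen V" and t: "t \<in> carrier (\<O> (pre V))" and y: "y \<in> pre V"
    and f: "frac_near (pre V) t y b h"
  shows "\<psi> V t (pt U y) = ring_frac B (carrier B - pt U y) b h"
  unfolding psi_at[OF y] by (rule fr_eq[OF pre_open[OF V] _ t f]) blast

lemma frac_near_at:
  assumes V: "zopen V" and t: "t \<in> carrier (\<O> (pre V))" and y: "y \<in> pre V"
  obtains b h where "frac_near (pre V) t y b h"
proof -
  have preU: "pre V \<subseteq> U" by blast
  obtain g b h where "g \<in> carrier B" and y': "y \<in> D U g" and "D U g \<subseteq> pre V"
    and f: "\<forall>z\<in>D U g. frac_near (pre V) t z b h"
    using frac_near_exists[OF pre_open[OF V] preU t y] .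
  show ?thesis by (rule that[OF bspec[OF f y']])
qed

lemma psi_ext:
  assumes V: "zopen V" and s: "s \<in> extensional V"
    and eq: "\<And>y. y \<in> pre V \<Longrightarrow> \<psi> V t (pt U y) = s (pt U y)"
  shows "\<psi> V t = s"
proof (rule extensionalityI[of _ V])
  show "\<psi> V t \<in> extensional V" by (simp add: \<psi>_def)
  fix P assume "P \<in> V"
  then obtain y where "y \<in> pre V" "P = pt U y" using zopen_point[OF V] by blast
  then show "\<psi> V t P = s P" using eq by simp
qed (rule s)

text \<open>The uniform pair from \<open>frac_near_exists\<close> is the fixed fraction required
  locally.\<close>

lemma psi_section:
  assumes V: "zopen V" and t: "t \<in> carrier (\<O> (pre V))"
  shows "\<psi> V t \<in> spec_sections B V"
proof -
  have "\<exists>W. zopen W \<and> P \<in> W \<and> W \<subseteq> V \<and> (\<exists>a\<in>carrier B. \<exists>f\<in>carrier B. \<forall>Q\<in>W. f \<notin> Q \<and>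
      \<psi> V t Q = ring_frac B (carrier B - Q) a f)" if P: "P \<in> V" for P
  proof -
    obtain y where y: "y \<in> pre V" "P = pt U y" using zopen_point[OF V P] .
    have preU: "pre V \<subseteq> U" by blast
    obtain g b h where g: "g \<in> carrier B" "y \<in> D U g" "D U g \<subseteq> pre V"
      and f_all: "\<forall>z\<in>D U g. frac_near (pre V) t z b h"
      using frac_near_exists[OF pre_open[OF V] preU t y(1)] .
    note f = f_all[rule_format]
    have bh: "b \<in> carrier B" "h \<in> carrier B" using f[OF g(2)] unfolding frac_near_def by auto
    have "h \<notin> Q \<and> \<psi> V t Q = ring_frac B (carrier B - Q) b h" if Q: "Q \<in> pt U ` D U g" for Q
    proof -
      obtain z where z: "z \<in> D U g" "Q = pt U z" using Q by blast
      have zp: "z \<in> pre V" using z g by blast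
      have "z \<in> D U h" using f[OF z(1)] unfolding frac_near_def by blast
      then show ?thesis using psi_eq[OF V t zp f[OF z(1)]] z(2) pt_notin[OF bh(2)] by blast
    qed
    moreover have "zopen (pt U ` D U g)" by (rule image_zopen) auto
    moreover have "P \<in> pt U ` D U g" "pt U ` D U g \<subseteq> V" using y g by auto
    ultimately show ?thesis using bh by blast
  qed
  then show ?thesis unfolding spec_sections_def by (simp add: \<psi>_def)
qed

lemma frac_near_combine:
  assumes W: "opn W" "W \<subseteq> U" and t: "t \<in> carrier (\<O> W)" "t' \<in> carrier (\<O> W)"
    and f: "frac_near W t y b h" and f': "frac_near W t' y b' h'"
  shows "frac_near W (t \<otimes>\<^bsub>\<O> W\<^esub> t') y (b \<otimes>\<^bsub>B\<^esub> b') (h \<otimes>\<^bsub>B\<^esub> h')"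
    and "frac_near W (t \<oplus>\<^bsub>\<O> W\<^esub> t') y (h' \<otimes>\<^bsub>B\<^esub> b \<oplus>\<^bsub>B\<^esub> h \<otimes>\<^bsub>B\<^esub> b') (h \<otimes>\<^bsub>B\<^esub> h')"
proof -
  have c: "b \<in> carrier B" "h \<in> carrier B" "b' \<in> carrier B" "h' \<in> carrier B"
    and y: "y \<in> D U h" "y \<in> D U h'"
    using f f' unfolding frac_near_def by auto
  obtain E where E: "opn E" "y \<in> E" "E \<subseteq> W"
    and eq_all: "\<forall>E'. opn E' \<longrightarrow> E' \<subseteq> E \<longrightarrow> \<rho> U E' h \<otimes>\<^bsub>\<O> E'\<^esub> \<rho> W E' t = \<rho> U E' b"
    and "\<forall>E'. opn E' \<longrightarrow> E' \<subseteq> E \<longrightarrow> \<rho> U E' h \<in> Units (\<O> E')"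
    using frac_near_shrink[OF W t(1) f] .
  note eq = eq_all[rule_format]
  obtain E1 where E1: "opn E1" "y \<in> E1" "E1 \<subseteq> W"
    and eq1_all: "\<forall>E'. opn E' \<longrightarrow> E' \<subseteq> E1 \<longrightarrow> \<rho> U E' h' \<otimes>\<^bsub>\<O> E'\<^esub> \<rho> W E' t' = \<rho> U E' b'"
    and "\<forall>E'. opn E' \<longrightarrow> E' \<subseteq> E1 \<longrightarrow> \<rho> U E' h' \<in> Units (\<O> E')"
    using frac_near_shrink[OF W t(2) f'] .
  note eq1 = eq1_all[rule_format]
  let ?F = "E \<inter> E1"
  have F: "opn ?F" "?F \<subseteq> U" "?F \<subseteq> W" "?F \<subseteq> E" "?F \<subseteq> E1" "y \<in> ?F" using E E1 W by auto
  interpret F: cring "\<O> ?F" by (rule cring_O[OF F(1)])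
  interpret OW: cring "\<O> W" by (rule cring_O[OF W(1)])
  have cc: "\<rho> U ?F h \<in> carrier (\<O> ?F)" "\<rho> U ?F h' \<in> carrier (\<O> ?F)"
    "\<rho> W ?F t \<in> carrier (\<O> ?F)" "\<rho> W ?F t' \<in> carrier (\<O> ?F)"
    using F Uo c W t by auto
  have yh: "y \<in> D U (h \<otimes>\<^bsub>B\<^esub> h')" using D_mult[OF Uo c(2,4)] y by blast
  have "\<rho> U ?F (h \<otimes>\<^bsub>B\<^esub> h') \<otimes>\<^bsub>\<O> ?F\<^esub> \<rho> W ?F (t \<otimes>\<^bsub>\<O> W\<^esub> t') = \<rho> U ?F (b \<otimes>\<^bsub>B\<^esub> b')"
    using F Uo W t c cc eq[OF F(1,4), symmetric] eq1[OF F(1,5), symmetric] by (simp add: F.m_ac)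
  then show "frac_near W (t \<otimes>\<^bsub>\<O> W\<^esub> t') y (b \<otimes>\<^bsub>B\<^esub> b') (h \<otimes>\<^bsub>B\<^esub> h')"
    unfolding frac_near_def using c yh F by blast
  have "\<rho> U ?F (h \<otimes>\<^bsub>B\<^esub> h') \<otimes>\<^bsub>\<O> ?F\<^esub> \<rho> W ?F (t \<oplus>\<^bsub>\<O> W\<^esub> t') =
      \<rho> U ?F (h' \<otimes>\<^bsub>B\<^esub> b \<oplus>\<^bsub>B\<^esub> h \<otimes>\<^bsub>B\<^esub> b')"
    using F Uo W t c cc eq[OF F(1,4), symmetric] eq1[OF F(1,5), symmetric] by (simp add: F.m_ac F.r_distr)
  moreover have "h' \<otimes>\<^bsub>B\<^esub> b \<oplus>\<^bsub>B\<^esub> h \<otimes>\<^bsub>B\<^esub> b' \<in> carrier B" "h \<otimes>\<^bsub>B\<^esub> h' \<in> carrier B" using c by auto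
  ultimately show "frac_near W (t \<oplus>\<^bsub>\<O> W\<^esub> t') y (h' \<otimes>\<^bsub>B\<^esub> b \<oplus>\<^bsub>B\<^esub> h \<otimes>\<^bsub>B\<^esub> b') (h \<otimes>\<^bsub>B\<^esub> h')"
    unfolding frac_near_def using yh F by blast
qed

text \<open>Sections are determined by their germs, which gives injectivity. For surjectivity the
  local fractions of a section of the spectrum are realized as quotients in \<open>X\<close> and
  glued.\<close>

lemma psi_iso:
  assumes V: "zopen V"
  shows "\<psi> V \<in> ring_iso (\<O> (pre V)) (rsec (Spec B) V)"
proof (rule ring_iso_memI)
  let ?W = "pre V"
  note W = pre_open[OF V]
  have WU: "?W \<subseteq> U" by blast
  interpret OW: cring "\<O> ?W" by (rule cring_O[OF W])
  have pt_iff: "b \<in> carrier B - pt U y" if "frac_near ?W t y c b" for t y c b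
    using that pt_notin unfolding frac_near_def by blast
  show "\<psi> V t \<in> carrier (rsec (Spec B) V)" if "t \<in> carrier (\<O> ?W)" for t
    using psi_section[OF V that] by (simp add: Spec_def)
  { fix t t' assume t: "t \<in> carrier (\<O> ?W)" and t': "t' \<in> carrier (\<O> ?W)"
    have tt: "t \<otimes>\<^bsub>\<O> ?W\<^esub> t' \<in> carrier (\<O> ?W)" "t \<oplus>\<^bsub>\<O> ?W\<^esub> t' \<in> carrier (\<O> ?W)" using t t' by auto
    show "\<psi> V (t \<otimes>\<^bsub>\<O> ?W\<^esub> t') = \<psi> V t \<otimes>\<^bsub>rsec (Spec B) V\<^esub> \<psi> V t'"
    proof (rule psi_ext[OF V])
      fix y assume y: "y \<in> ?W"
      then have yU: "y \<in> U" and yV: "pt U y \<in> V" by auto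
      interpret multiplicative_subset B "self_module B" "carrier B - pt U y" by (rule pt_fractions[OF yU])
      obtain b h where f: "frac_near ?W t y b h" using frac_near_at[OF V t y] .
      obtain b' h' where f': "frac_near ?W t' y b' h'" using frac_near_at[OF V t' y] .
      have b: "b \<in> carrier B" "b' \<in> carrier B" using f f' unfolding frac_near_def by auto
      show "\<psi> V (t \<otimes>\<^bsub>\<O> ?W\<^esub> t') (pt U y) = (\<psi> V t \<otimes>\<^bsub>rsec (Spec B) V\<^esub> \<psi> V t') (pt U y)"
        using psi_eq[OF V tt(1) y frac_near_combine(1)[OF W WU t t' f f']]
          psi_eq[OF V t y f] psi_eq[OF V t' y f'] yV b
          module_loc_smult[of b b' h h'] pt_iff[OF f] pt_iff[OF f']
        by (simp add: Spec_def ring_loc_mult_eq ring_frac_eq_module_frac)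
    qed (simp add: Spec_def)
    show "\<psi> V (t \<oplus>\<^bsub>\<O> ?W\<^esub> t') = \<psi> V t \<oplus>\<^bsub>rsec (Spec B) V\<^esub> \<psi> V t'"
    proof (rule psi_ext[OF V])
      fix y assume y: "y \<in> ?W"
      then have yU: "y \<in> U" and yV: "pt U y \<in> V" by auto
      interpret multiplicative_subset B "self_module B" "carrier B - pt U y" by (rule pt_fractions[OF yU])
      obtain b h where f: "frac_near ?W t y b h" using frac_near_at[OF V t y] .
      obtain b' h' where f': "frac_near ?W t' y b' h'" using frac_near_at[OF V t' y] .
      have b: "b \<in> carrier B" "b' \<in> carrier B" using f f' unfolding frac_near_def by auto
      show "\<psi> V (t \<oplus>\<^bsub>\<O> ?W\<^esub> t') (pt U y) = (\<psi> V t \<oplus>\<^bsub>rsec (Spec B) V\<^esub> \<psi> V t') (pt U y)"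
        using psi_eq[OF V tt(2) y frac_near_combine(2)[OF W WU t t' f f']]
          psi_eq[OF V t y f] psi_eq[OF V t' y f'] yV b
          module_loc_add[of b b' h h'] pt_iff[OF f] pt_iff[OF f']
        by (simp add: Spec_def ring_loc_add_eq ring_frac_eq_module_frac)
    qed (simp add: Spec_def)
  }
  show "\<psi> V \<one>\<^bsub>\<O> ?W\<^esub> = \<one>\<^bsub>rsec (Spec B) V\<^esub>"
  proof (rule psi_ext[OF V])
    fix y assume y: "y \<in> ?W"
    have "frac_near ?W \<one>\<^bsub>\<O> ?W\<^esub> y \<one>\<^bsub>B\<^esub> \<one>\<^bsub>B\<^esub>"
      unfolding frac_near_def using y W WU Uo D_one[OF Uo] by (intro conjI exI[of _ ?W]) auto
    then show "\<psi> V \<one>\<^bsub>\<O> ?W\<^esub> (pt U y) = \<one>\<^bsub>rsec (Spec B) V\<^esub> (pt U y)"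
      using psi_eq[OF V _ y] y by (simp add: Spec_def ring_loc_def)
  qed (simp add: Spec_def)
  show "bij_betw (\<psi> V) (carrier (\<O> ?W)) (carrier (rsec (Spec B) V))"
  proof (rule bij_betw_imageI)
    show "inj_on (\<psi> V) (carrier (\<O> ?W))"
    proof (rule inj_onI)
      fix t t' assume t: "t \<in> carrier (\<O> ?W)" and t': "t' \<in> carrier (\<O> ?W)" and eq: "\<psi> V t = \<psi> V t'"
      show "t = t'"
      proof (rule O_eqI[OF t t'])
        fix y assume y: "y \<in> ?W"
        obtain b h where f: "frac_near ?W t y b h" using frac_near_at[OF V t y] .
        \<comment> \<open>As sets of representing pairs, equal values share the pair
          \<open>(b, h)\<close>.\<close>
        have "fr ?W t y = fr ?W t' y" using fun_cong[OF eq, of "pt U y"] psi_at[OF y] by simp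
        then have f': "frac_near ?W t' y b h" using f unfolding fr_def by blast
        have c: "b \<in> carrier B" "h \<in> carrier B" using f unfolding frac_near_def by auto
        obtain E where E: "opn E" "y \<in> E" "E \<subseteq> ?W"
          and e_all: "\<forall>E'. opn E' \<longrightarrow> E' \<subseteq> E \<longrightarrow> \<rho> U E' h \<otimes>\<^bsub>\<O> E'\<^esub> \<rho> ?W E' t = \<rho> U E' b"
          and un_all: "\<forall>E'. opn E' \<longrightarrow> E' \<subseteq> E \<longrightarrow> \<rho> U E' h \<in> Units (\<O> E')"
          using frac_near_shrink[OF W WU t f] .
        note e = e_all[rule_format]
        note un = un_all[rule_format]
        obtain E1 where E1: "opn E1" "y \<in> E1" "E1 \<subseteq> ?W"
          and e1_all: "\<forall>E'. opn E' \<longrightarrow> E' \<subseteq> E1 \<longrightarrow> \<rho> U E' h \<otimes>\<^bsub>\<O> E'\<^esub> \<rho> ?W E' t' = \<rho> U E' b"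
          and "\<forall>E'. opn E' \<longrightarrow> E' \<subseteq> E1 \<longrightarrow> \<rho> U E' h \<in> Units (\<O> E')"
          using frac_near_shrink[OF W WU t' f'] .
        note e1 = e1_all[rule_format]
        let ?F = "E \<inter> E1"
        have F: "opn ?F" "?F \<subseteq> ?W" "?F \<subseteq> E" "?F \<subseteq> E1" "y \<in> ?F" using E E1 by auto
        interpret F: cring "\<O> ?F" by (rule cring_O[OF F(1)])
        have "\<rho> ?W ?F t = \<rho> ?W ?F t'"
        proof (rule F.unit_left_cancel[OF un[OF F(1,3)]])
          show "\<rho> ?W ?F t \<in> carrier (\<O> ?F)" "\<rho> ?W ?F t' \<in> carrier (\<O> ?F)"
            by (rule rho_closed[OF W F(1,2) t], rule rho_closed[OF W F(1,2) t'])
          show "\<rho> U ?F h \<otimes>\<^bsub>\<O> ?F\<^esub> \<rho> ?W ?F t = \<rho> U ?F h \<otimes>\<^bsub>\<O> ?F\<^esub> \<rho> ?W ?F t'"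
            unfolding e[OF F(1,3)] e1[OF F(1,4)] ..
        qed
        then show "\<exists>E. opn E \<and> y \<in> E \<and> E \<subseteq> ?W \<and> \<rho> ?W E t = \<rho> ?W E t'" using F by blast
      qed
    qed
    show "\<psi> V ` carrier (\<O> ?W) = carrier (rsec (Spec B) V)"
    proof (intro equalityI subsetI)
      fix s assume "s \<in> \<psi> V ` carrier (\<O> ?W)"
      then show "s \<in> carrier (rsec (Spec B) V)" using psi_section[OF V] by (auto simp: Spec_def)
    next
      fix s assume "s \<in> carrier (rsec (Spec B) V)"
      then have s: "s \<in> spec_sections B V" by (simp add: Spec_def)
      \<comment> \<open>The neighbourhood, numerator and denominator at a point are packed into one
        triple so that they can be chosen together.\<close>
      let ?G = "\<lambda>y (E, a, c). opn E \<and> y \<in> E \<and> E \<subseteq> ?W \<and> a \<in> carrier B \<and> c \<in> carrier B \<and>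
          (\<forall>z\<in>E. z \<in> D U c \<and> s (pt U z) = ring_frac B (carrier B - pt U z) a c)"
      have "\<forall>y\<in>?W. \<exists>p. ?G y p"
      proof
        fix y assume y: "y \<in> ?W"
        then have "\<exists>T. zopen T \<and> pt U y \<in> T \<and> T \<subseteq> V \<and> (\<exists>a\<in>carrier B. \<exists>c\<in>carrier B. \<forall>Q\<in>T. c \<notin> Q \<and>
            s Q = ring_frac B (carrier B - Q) a c)"
          using s unfolding spec_sections_def by blast
        then obtain T a c where T: "zopen T" "pt U y \<in> T" "T \<subseteq> V" and a: "a \<in> carrier B" and c: "c \<in> carrier B"
          and eq: "\<forall>Q\<in>T. c \<notin> Q \<and> s Q = ring_frac B (carrier B - Q) a c"
          by (elim exE conjE bexE)
        have "\<forall>z\<in>pre T. z \<in> D U c \<and> s (pt U z) = ring_frac B (carrier B - pt U z) a c"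
          using eq pt_notin[OF c] by blast
        moreover have "y \<in> pre T" "pre T \<subseteq> ?W" using T y by auto
        ultimately have "?G y (pre T, a, c)" using pre_open[OF T(1)] a c by simp
        then show "\<exists>p. ?G y p" by (rule exI)
      qed
      then obtain p where p: "\<forall>y\<in>?W. ?G y (p y)" by (rule bchoice[THEN exE])
      define E a c where "E y = fst (p y)" and "a y = fst (snd (p y))" and "c y = snd (snd (p y))" for y
      have G: "?G y (E y, a y, c y)" if "y \<in> ?W" for y
        using p that unfolding E_def a_def c_def by simp
      have E: "opn (E y) \<and> y \<in> E y \<and> E y \<subseteq> ?W" if "y \<in> ?W" for y using G[OF that] by simp
      have ac: "a y \<in> carrier B \<and> c y \<in> carrier B" if "y \<in> ?W" for y using G[OF that] by simp
      have sE: "z \<in> D U (c y) \<and> s (pt U z) = ring_frac B (carrier B - pt U z) (a y) (c y)"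
        if "y \<in> ?W" "z \<in> E y" for y z using G[OF that(1)] that(2) by simp
      have EU: "E y \<subseteq> U" if "y \<in> ?W" for y using E[OF that] WU by blast
      have cu: "\<rho> U E' (c y) \<in> Units (\<O> E')" if y: "y \<in> ?W" and E': "opn E'" "E' \<subseteq> E y" for y E'
      proof -
        have s: "E' \<subseteq> D U (c y)" using sE[OF y] E' by blast
        have "\<rho> (D U (c y)) E' (\<rho> U (D U (c y)) (c y)) \<in> Units (\<O> E')"
          using ac[OF y] by (intro rho_Units[OF D_open E'(1) s] D_unit[OF Uo]) blast
        then show ?thesis using s E' Uo ac[OF y] by simp
      qed
      \<comment> \<open>The quotient \<open>a / c\<close> as an actual section over
        \<open>E y\<close>, where \<open>c\<close> is invertible.\<close>
      define r where "r y = inv\<^bsub>\<O> (E y)\<^esub> (\<rho> U (E y) (c y)) \<otimes>\<^bsub>\<O> (E y)\<^esub> \<rho> U (E y) (a y)" for y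
      have r: "r y \<in> carrier (\<O> (E y))" "\<rho> U (E y) (c y) \<otimes>\<^bsub>\<O> (E y)\<^esub> r y = \<rho> U (E y) (a y)"
        if y: "y \<in> ?W" for y
      proof -
        have o: "opn (E y)" "E y \<subseteq> E y" using E[OF y] by auto
        interpret N: cring "\<O> (E y)" by (rule cring_O[OF o(1)])
        have u: "\<rho> U (E y) (c y) \<in> Units (\<O> (E y))" by (rule cu[OF y o])
        have aa: "\<rho> U (E y) (a y) \<in> carrier (\<O> (E y))" using o EU[OF y] Uo ac[OF y] by simp
        show "r y \<in> carrier (\<O> (E y))" unfolding r_def using u aa by simp
        show "\<rho> U (E y) (c y) \<otimes>\<^bsub>\<O> (E y)\<^esub> r y = \<rho> U (E y) (a y)"
          unfolding r_def using u aa N.Units_closed[OF u] by (simp add: N.m_assoc[symmetric])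
      qed
      have rr: "\<rho> U E' (c y) \<otimes>\<^bsub>\<O> E'\<^esub> \<rho> (E y) E' (r y) = \<rho> U E' (a y)" "\<rho> (E y) E' (r y) \<in> carrier (\<O> E')"
        if y: "y \<in> ?W" and E': "opn E'" "E' \<subseteq> E y" for y E'
      proof -
        have "\<rho> (E y) E' (\<rho> U (E y) (c y) \<otimes>\<^bsub>\<O> (E y)\<^esub> r y) = \<rho> (E y) E' (\<rho> U (E y) (a y))"
          using r(2)[OF y] by simp
        then show "\<rho> U E' (c y) \<otimes>\<^bsub>\<O> E'\<^esub> \<rho> (E y) E' (r y) = \<rho> U E' (a y)"
          using E[OF y] E' EU[OF y] Uo ac[OF y] r(1)[OF y] by simp
        show "\<rho> (E y) E' (r y) \<in> carrier (\<O> E')" using E[OF y] E' r(1)[OF y] by simp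
      qed
      have "\<exists>t\<in>carrier (\<O> ?W). \<forall>y\<in>?W. \<rho> ?W (E y) t = r y"
      proof (rule O_glue[OF E r(1)])
        fix x y assume xy: "x \<in> ?W" "y \<in> ?W"
        let ?G = "E x \<inter> E y"
        have G: "opn ?G" "?G \<subseteq> E x" "?G \<subseteq> E y" "?G \<subseteq> U" using E xy EU by auto
        show "\<rho> (E x) ?G (r x) = \<rho> (E y) ?G (r y)"
        proof (rule O_eqI[OF rr(2)[OF xy(1) G(1,2)] rr(2)[OF xy(2) G(1,3)]])
          fix z assume z: "z \<in> ?G"
          then have zU: "z \<in> U" using G by blast
          interpret multiplicative_subset B "self_module B" "carrier B - pt U z" by (rule pt_fractions[OF zU])
          have cz: "c x \<in> carrier B - pt U z" "c y \<in> carrier B - pt U z"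
            using sE[OF xy(1), of z] sE[OF xy(2), of z] z ac[OF xy(1)] ac[OF xy(2)] pt_notin by blast+
          \<comment> \<open>Equal fractions at the prime of \<open>z\<close> have, by
            \<open>germ_eq_iff\<close>, equal cross products near \<open>z\<close>; cancelling the
            units \<open>c x\<close> and \<open>c y\<close> identifies the two quotients
            there.\<close>
          have "ring_frac B (carrier B - pt U z) (a x) (c x) = ring_frac B (carrier B - pt U z) (a y) (c y)"
            using sE[OF xy(1), of z] sE[OF xy(2), of z] z by simp
          then have "\<exists>u\<in>carrier B - pt U z. u \<otimes>\<^bsub>B\<^esub> (c y \<otimes>\<^bsub>B\<^esub> a x) = u \<otimes>\<^bsub>B\<^esub> (c x \<otimes>\<^bsub>B\<^esub> a y)"
            using module_frac_eq_iff[of "a x" "a y", OF _ _ cz] ac xy by (simp add: ring_frac_eq_module_frac)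
          then obtain H where H: "opn H" "z \<in> H" "H \<subseteq> U" "\<rho> U H (c y \<otimes>\<^bsub>B\<^esub> a x) = \<rho> U H (c x \<otimes>\<^bsub>B\<^esub> a y)"
            using germ_eq_iff[of "c y \<otimes>\<^bsub>B\<^esub> a x" "c x \<otimes>\<^bsub>B\<^esub> a y" z] ac xy zU by auto
          let ?K = "H \<inter> ?G"
          have K: "opn ?K" "?K \<subseteq> H" "?K \<subseteq> ?G" "?K \<subseteq> E x" "?K \<subseteq> E y" "?K \<subseteq> U" "z \<in> ?K" using H G z by auto
          interpret K: cring "\<O> ?K" by (rule cring_O[OF K(1)])
          have cc: "c y \<in> carrier B" "c x \<in> carrier B" "a y \<in> carrier B" "a x \<in> carrier B"
            using ac[OF xy(1)] ac[OF xy(2)] by auto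
          have "\<rho> U ?K (c y \<otimes>\<^bsub>B\<^esub> a x) = \<rho> U ?K (c x \<otimes>\<^bsub>B\<^esub> a y)"
            by (rule rho_eq_restrict[OF H(4) Uo H(1,3) K(1,2)]) (use cc in simp_all)
          then have k: "\<rho> U ?K (c y) \<otimes>\<^bsub>\<O> ?K\<^esub> \<rho> U ?K (a x) = \<rho> U ?K (c x) \<otimes>\<^bsub>\<O> ?K\<^esub> \<rho> U ?K (a y)"
            using K(1,6) Uo cc by simp
          note ux = cu[OF xy(1) K(1,4)] and uy = cu[OF xy(2) K(1,5)]
          note rx = rr[OF xy(1) K(1,4)] and ry = rr[OF xy(2) K(1,5)]
          have "(\<rho> U ?K (c x) \<otimes>\<^bsub>\<O> ?K\<^esub> \<rho> U ?K (c y)) \<otimes>\<^bsub>\<O> ?K\<^esub> \<rho> (E x) ?K (r x) =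
              (\<rho> U ?K (c x) \<otimes>\<^bsub>\<O> ?K\<^esub> \<rho> U ?K (c y)) \<otimes>\<^bsub>\<O> ?K\<^esub> \<rho> (E y) ?K (r y)"
          proof -
            have "(\<rho> U ?K (c x) \<otimes>\<^bsub>\<O> ?K\<^esub> \<rho> U ?K (c y)) \<otimes>\<^bsub>\<O> ?K\<^esub> \<rho> (E x) ?K (r x) =
                \<rho> U ?K (c y) \<otimes>\<^bsub>\<O> ?K\<^esub> (\<rho> U ?K (c x) \<otimes>\<^bsub>\<O> ?K\<^esub> \<rho> (E x) ?K (r x))"
              using K.Units_closed[OF ux] K.Units_closed[OF uy] rx(2) by (simp add: K.m_ac)
            also have "\<dots> = \<rho> U ?K (c x) \<otimes>\<^bsub>\<O> ?K\<^esub> (\<rho> U ?K (c y) \<otimes>\<^bsub>\<O> ?K\<^esub> \<rho> (E y) ?K (r y))"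
              unfolding rx(1) ry(1) by (rule k)
            also have "\<dots> = (\<rho> U ?K (c x) \<otimes>\<^bsub>\<O> ?K\<^esub> \<rho> U ?K (c y)) \<otimes>\<^bsub>\<O> ?K\<^esub> \<rho> (E y) ?K (r y)"
              using K.Units_closed[OF ux] K.Units_closed[OF uy] ry(2) by (simp add: K.m_assoc)
            finally show ?thesis .
          qed
          then have "\<rho> (E x) ?K (r x) = \<rho> (E y) ?K (r y)"
            by (rule K.unit_left_cancel[OF K.Units_m_closed[OF ux uy] rx(2) ry(2)])
          then have "\<rho> ?G ?K (\<rho> (E x) ?G (r x)) = \<rho> ?G ?K (\<rho> (E y) ?G (r y))"
            using E[OF xy(1)] E[OF xy(2)] G K r(1)[OF xy(1)] r(1)[OF xy(2)] by simp
          then show "\<exists>V. opn V \<and> z \<in> V \<and> V \<subseteq> ?G \<and> \<rho> ?G V (\<rho> (E x) ?G (r x)) = \<rho> ?G V (\<rho> (E y) ?G (r y))"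
            using K by blast
        qed
      qed
      then obtain t where t: "t \<in> carrier (\<O> ?W)" "\<And>y. y \<in> ?W \<Longrightarrow> \<rho> ?W (E y) t = r y" by blast
      have "\<psi> V t = s"
      proof (rule psi_ext[OF V])
        show "s \<in> extensional V" using s by (simp add: spec_sections_def)
        fix y assume y: "y \<in> ?W"
        have yE: "y \<in> E y" "opn (E y)" "E y \<subseteq> ?W" using E[OF y] by auto
        have "frac_near ?W t y (a y) (c y)"
          unfolding frac_near_def
          using ac[OF y] sE[OF y yE(1)] yE t(2)[OF y] r(2)[OF y] by (intro conjI exI[of _ "E y"]) auto
        then show "\<psi> V t (pt U y) = s (pt U y)"
          using psi_eq[OF V t(1) y] sE[OF y yE(1)] by simp
      qed
      then show "s \<in> \<psi> V ` carrier (\<O> ?W)" using t(1) by blast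
    qed
  qed
qed

text \<open>A pair that represents the germ of \<open>t\<close> also represents the germ of its
  restriction.\<close>

lemma psi_restrict:
  assumes V: "zopen V" and W: "zopen W" "W \<subseteq> V" and t: "t \<in> carrier (\<O> (pre V))"
  shows "\<psi> W (\<rho> (pre V) (pre W) t) = restrict (\<psi> V t) W"
proof (rule psi_ext[OF W(1)])
  fix y assume y: "y \<in> pre W"
  then have yV: "y \<in> pre V" using W by blast
  note oV = pre_open[OF V] and oW = pre_open[OF W(1)]
  have WV: "pre W \<subseteq> pre V" using W by blast
  obtain b h where f: "frac_near (pre V) t y b h" using frac_near_at[OF V t yV] .
  have preU: "pre V \<subseteq> U" by blast
  obtain E where E: "opn E" "y \<in> E" "E \<subseteq> pre V"
    and e_all: "\<forall>E'. opn E' \<longrightarrow> E' \<subseteq> E \<longrightarrow> \<rho> U E' h \<otimes>\<^bsub>\<O> E'\<^esub> \<rho> (pre V) E' t = \<rho> U E' b"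
    and "\<forall>E'. opn E' \<longrightarrow> E' \<subseteq> E \<longrightarrow> \<rho> U E' h \<in> Units (\<O> E')"
    using frac_near_shrink[OF oV preU t f] .
  note e = e_all[rule_format]
  let ?F = "E \<inter> pre W"
  have F: "opn ?F" "?F \<subseteq> E" "?F \<subseteq> pre W" using E oW by auto
  have "\<rho> (pre W) ?F (\<rho> (pre V) (pre W) t) = \<rho> (pre V) ?F t"
    by (rule rho_trans[OF oV oW F(1,3) WV t])
  then have "frac_near (pre W) (\<rho> (pre V) (pre W) t) y b h"
  proof -
    have "opn ?F \<and> y \<in> ?F \<and> ?F \<subseteq> pre W \<and>
        \<rho> U ?F h \<otimes>\<^bsub>\<O> ?F\<^esub> \<rho> (pre W) ?F (\<rho> (pre V) (pre W) t) = \<rho> U ?F b"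
      if "\<rho> (pre W) ?F (\<rho> (pre V) (pre W) t) = \<rho> (pre V) ?F t"
      unfolding that using e[OF F(1,2)] F E(2) y by blast
    then show ?thesis using \<open>\<rho> (pre W) ?F (\<rho> (pre V) (pre W) t) = \<rho> (pre V) ?F t\<close> f
      unfolding frac_near_def by blast
  qed
  then show "\<psi> W (\<rho> (pre V) (pre W) t) (pt U y) = restrict (\<psi> V t) W (pt U y)"
    using psi_eq[OF W(1) rho_closed[OF oV oW WV t] y] psi_eq[OF V t yV f] y by simp
qed simp

lemma affine_open_U: "affine_open X U"
  unfolding affine_open_def
proof (intro exI)
  \<comment> \<open>Charts map sections of the spectrum to sections over \<open>X\<close>, so the
    inverses of \<open>\<psi>\<close> are used.\<close>
  let ?\<phi> = "\<lambda>V. inv_into (carrier (\<O> (pre V))) (\<psi> V)"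
  have img: "inv_img (open_subspace X U) (pt U) V = pre V" for V
    using U_top by (auto simp: inv_img_def open_subspace_def)
  have "ringed_space_iso (open_subspace X U) (Spec B) (pt U) ?\<phi>"
    unfolding ringed_space_iso_def img
  proof (intro conjI allI impI ballI)
    show "homeomorphic_map (space_top (open_subspace X U)) (space_top (Spec B)) (pt U)"
      using homeo by (simp add: open_subspace_def Spec_def)
    fix V assume "openin (space_top (Spec B)) V"
    then have V: "zopen V" by (simp add: Spec_def)
    show "?\<phi> V \<in> ring_iso (rsec (Spec B) V) (rsec (open_subspace X U) (pre V))"
      using ring_iso_set_sym[OF _ psi_iso[OF V]] cring_O[OF pre_open[OF V]]
      by (simp add: open_subspace_def cring.axioms(1))
  next
    fix V W s
    assume a: "openin (space_top (Spec B)) V \<and> openin (space_top (Spec B)) W \<and> W \<subseteq> V"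
      and s: "s \<in> carrier (rsec (Spec B) V)"
    then have V: "zopen V" and W: "zopen W" "W \<subseteq> V" by (auto simp: Spec_def)
    note bV = ring_iso_memE(5)[OF psi_iso[OF V]] and bW = ring_iso_memE(5)[OF psi_iso[OF W(1)]]
    have "s \<in> \<psi> V ` carrier (\<O> (pre V))" using s bij_betw_imp_surj_on[OF bV] by simp
    then obtain t where t: "t \<in> carrier (\<O> (pre V))" "s = \<psi> V t" by blast
    have rt: "\<rho> (pre V) (pre W) t \<in> carrier (\<O> (pre W))"
      using pre_open[OF V] pre_open[OF W(1)] W t by (intro rho_closed) auto
    have "?\<phi> V s = t" unfolding t(2) by (rule inv_into_f_f[OF bij_betw_imp_inj_on[OF bV] t(1)])
    moreover have "?\<phi> W (restrict s W) = \<rho> (pre V) (pre W) t"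
      unfolding t(2) psi_restrict[OF V W t(1), symmetric]
      by (rule inv_into_f_f[OF bij_betw_imp_inj_on[OF bW] rt])
    ultimately show "rres (open_subspace X U) (pre V) (pre W) (?\<phi> V s) = ?\<phi> W (rres (Spec B) V W s)"
      by (simp add: open_subspace_def Spec_def)
  qed
  then show "affine_chart X U B (pt U) ?\<phi>"
    unfolding affine_chart_def using Uo B.is_cring by blast
qed

end

text \<open>In particular \<open>aff_D\<close> now says that basic open sets of affine open sets are
  affine in the sense of charts.\<close>

lemma (in ringed) affine_open_iff_aff: "affine_open X U \<longleftrightarrow> aff U"
  using affine_open_imp_aff affine_part.affine_open_U
  by (metis affine_part.intro affine_part_axioms.intro ringed_axioms)

section \<open>Base change to a basic open set\<close>

lemma free_Abelian_group_carrier_induct [consumes 1, case_names zero diff frag]: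
  assumes "c \<in> carrier (free_Abelian_group T)" "Q 0"
    "\<And>x y. \<lbrakk>x \<in> carrier (free_Abelian_group T); y \<in> carrier (free_Abelian_group T); Q x; Q y\<rbrakk> \<Longrightarrow> Q (x - y)"
    "\<And>t. t \<in> T \<Longrightarrow> Q (frag_of t)"
  shows "Q c"
  by (rule free_Abelian_group_induct[of c T Q]) (use assms in simp_all)

lemma diff_in_free_Abelian_group:
  "\<lbrakk>c \<in> carrier (free_Abelian_group T); d \<in> carrier (free_Abelian_group T)\<rbrakk> \<Longrightarrow>
    c - d \<in> carrier (free_Abelian_group T)"
  using keys_diff[of c d] by auto

text \<open>The situation of restriction to a basic open set in abstract form: \<open>r\<close>
  exhibits \<open>N\<close> as a localization of \<open>M\<close> at \<open>g\<close>. The aim is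
  the isomorphism from the concrete base change to \<open>N\<close>.\<close>

locale localization_base_change =
  R: cring R + S: cring S + M: module R M + N: module S N
  for R :: "'r ring" and S :: "'s ring" and M :: "('r, 'm) module" and N :: "('s, 'n) module" +
  fixes \<phi> :: "'r \<Rightarrow> 's" and r :: "'m \<Rightarrow> 'n" and g :: 'r
  assumes phi: "\<phi> \<in> ring_hom R S"
    and r_closed: "m \<in> carrier M \<Longrightarrow> r m \<in> carrier N"
    and r_add: "\<lbrakk>m \<in> carrier M; m' \<in> carrier M\<rbrakk> \<Longrightarrow> r (m \<oplus>\<^bsub>M\<^esub> m') = r m \<oplus>\<^bsub>N\<^esub> r m'"
    and r_smult: "\<lbrakk>a \<in> carrier R; m \<in> carrier M\<rbrakk> \<Longrightarrow> r (a \<odot>\<^bsub>M\<^esub> m) = \<phi> a \<odot>\<^bsub>N\<^esub> r m"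
    and g: "g \<in> carrier R" and g_unit: "\<phi> g \<in> Units S"
    and lift: "n \<in> carrier N \<Longrightarrow> \<exists>k::nat. \<exists>m\<in>carrier M. r m = \<phi> g [^]\<^bsub>S\<^esub> k \<odot>\<^bsub>N\<^esub> n"
    and kill: "\<lbrakk>m \<in> carrier M; r m = \<zero>\<^bsub>N\<^esub>\<rbrakk> \<Longrightarrow> \<exists>k::nat. g [^]\<^bsub>R\<^esub> k \<odot>\<^bsub>M\<^esub> m = \<zero>\<^bsub>M\<^esub>"
    and lift_ring: "s \<in> carrier S \<Longrightarrow> \<exists>k::nat. \<exists>a\<in>carrier R. \<phi> a = \<phi> g [^]\<^bsub>S\<^esub> k \<otimes>\<^bsub>S\<^esub> s"
begin

abbreviation F :: "(('m \<times> 's) \<Rightarrow>\<^sub>0 int) set" where "F \<equiv> carrier (tensor_free M S)"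
abbreviation K :: "(('m \<times> 's) \<Rightarrow>\<^sub>0 int) set" where "K \<equiv> tensor_kernel R M S \<phi>"
abbreviation cls :: "(('m \<times> 's) \<Rightarrow>\<^sub>0 int) \<Rightarrow> (('m \<times> 's) \<Rightarrow>\<^sub>0 int) set" where
  "cls \<equiv> tensor_class R M S \<phi>"

interpretation phi: ring_hom_cring R S \<phi>
  by (intro ring_hom_cring.intro ring_hom_cring_axioms.intro R.is_cring S.is_cring phi)

lemma phi_pow: "a \<in> carrier R \<Longrightarrow> \<phi> (a [^]\<^bsub>R\<^esub> (k::nat)) = \<phi> a [^]\<^bsub>S\<^esub> k"
  by (induction k) simp_all

lemma F_iff: "c \<in> F \<longleftrightarrow> Poly_Mapping.keys c \<subseteq> carrier M \<times> carrier S"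
  by (simp add: tensor_free_def)

lemma F_mult: "x \<otimes>\<^bsub>tensor_free M S\<^esub> y = x + y"
  by (simp add: tensor_free_def)

lemma F_comm_group: "comm_group (tensor_free M S)"
  unfolding tensor_free_def by (rule abelian_free_Abelian_group)

lemma F_group: "group (tensor_free M S)"
  unfolding tensor_free_def by simp

lemma F_frag: "frag_of (m, s) \<in> F \<longleftrightarrow> m \<in> carrier M \<and> s \<in> carrier S"
  by (simp add: tensor_free_def)

lemma F_add: "\<lbrakk>c \<in> F; d \<in> F\<rbrakk> \<Longrightarrow> c + d \<in> F"
  unfolding F_iff using keys_add[of c d] by blast

lemma F_diff: "\<lbrakk>c \<in> F; d \<in> F\<rbrakk> \<Longrightarrow> c - d \<in> F"
  unfolding F_iff using keys_diff[of c d] by blast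

lemma F_induct [consumes 1, case_names zero diff frag]:
  assumes "c \<in> F" "P 0" "\<And>x y. \<lbrakk>x \<in> F; y \<in> F; P x; P y\<rbrakk> \<Longrightarrow> P (x - y)"
    "\<And>m s. \<lbrakk>m \<in> carrier M; s \<in> carrier S\<rbrakk> \<Longrightarrow> P (frag_of (m, s))"
  shows "P c"
  using assms(1) unfolding tensor_free_def
  by (rule free_Abelian_group_carrier_induct) (use assms(2-4) in \<open>auto simp: tensor_free_def\<close>)

lemma relators_F: "tensor_relators R M S \<phi> \<subseteq> F"
  unfolding tensor_relators_def by (auto intro!: F_diff simp: F_frag)

lemma K_subgroup: "subgroup K (tensor_free M S)"
  unfolding tensor_kernel_def by (rule group.generate_is_subgroup[OF F_group relators_F])

lemma K_F: "c \<in> K \<Longrightarrow> c \<in> F"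
  using subgroup.subset[OF K_subgroup] by blast

lemma F_inv: "c \<in> F \<Longrightarrow> inv\<^bsub>tensor_free M S\<^esub> c = - c"
  unfolding tensor_free_def by simp

lemma K_add: "\<lbrakk>c \<in> K; d \<in> K\<rbrakk> \<Longrightarrow> c + d \<in> K"
  using subgroup.m_closed[OF K_subgroup] unfolding F_mult .

lemma K_minus: "c \<in> K \<Longrightarrow> - c \<in> K"
  using subgroup.m_inv_closed[OF K_subgroup, of c] F_inv[OF K_F, of c] by simp

lemma K_diff: "\<lbrakk>c \<in> K; d \<in> K\<rbrakk> \<Longrightarrow> c - d \<in> K"
  using K_add[OF _ K_minus, of c d] by simp

lemma K_relator: "c \<in> tensor_relators R M S \<phi> \<Longrightarrow> c \<in> K"
  unfolding tensor_kernel_def by (rule generate.incl)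

lemma K_add_left: "\<lbrakk>m \<in> carrier M; m' \<in> carrier M; s \<in> carrier S\<rbrakk> \<Longrightarrow>
    frag_of (m \<oplus>\<^bsub>M\<^esub> m', s) - frag_of (m, s) - frag_of (m', s) \<in> K"
  by (rule K_relator) (auto simp: tensor_relators_def)

lemma K_scalar: "\<lbrakk>a \<in> carrier R; m \<in> carrier M; s \<in> carrier S\<rbrakk> \<Longrightarrow>
    frag_of (a \<odot>\<^bsub>M\<^esub> m, s) - frag_of (m, \<phi> a \<otimes>\<^bsub>S\<^esub> s) \<in> K"
  by (rule K_relator) (auto simp: tensor_relators_def)

text \<open>The left additivity relator at zero and zero is minus this element.\<close>

lemma K_zero_left:
  assumes s: "s \<in> carrier S"
  shows "frag_of (\<zero>\<^bsub>M\<^esub>, s) \<in> K"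
proof -
  have "- (frag_of (\<zero>\<^bsub>M\<^esub> \<oplus>\<^bsub>M\<^esub> \<zero>\<^bsub>M\<^esub>, s) - frag_of (\<zero>\<^bsub>M\<^esub>, s) - frag_of (\<zero>\<^bsub>M\<^esub>, s)) \<in> K"
    by (intro K_minus K_add_left s M.M.zero_closed)
  then show ?thesis by simp
qed

definition i :: 's where "i = inv\<^bsub>S\<^esub> \<phi> g"

lemma i_closed [simp]: "i \<in> carrier S" and i_unit: "i \<in> Units S"
  and i_left: "i \<otimes>\<^bsub>S\<^esub> \<phi> g = \<one>\<^bsub>S\<^esub>"
  unfolding i_def using g_unit by auto

lemma ipow_cancel: "i [^]\<^bsub>S\<^esub> (k::nat) \<otimes>\<^bsub>S\<^esub> \<phi> g [^]\<^bsub>S\<^esub> k = \<one>\<^bsub>S\<^esub>"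
proof -
  have "i [^]\<^bsub>S\<^esub> k \<otimes>\<^bsub>S\<^esub> \<phi> g [^]\<^bsub>S\<^esub> k = (i \<otimes>\<^bsub>S\<^esub> \<phi> g) [^]\<^bsub>S\<^esub> k"
    using g by (simp add: S.nat_pow_distrib)
  then show ?thesis by (simp add: i_left)
qed

text \<open>A factor \<open>g^k\<close> moved across the tensor cancels \<open>i^k\<close>, where
  \<open>i\<close> is the inverse of the image of \<open>g\<close>.\<close>

lemma raise_denominator:
  assumes m: "m \<in> carrier M"
  shows "frag_of (m, i [^]\<^bsub>S\<^esub> (j::nat)) - frag_of (g [^]\<^bsub>R\<^esub> (k::nat) \<odot>\<^bsub>M\<^esub> m, i [^]\<^bsub>S\<^esub> (j + k)) \<in> K"
proof -
  have "\<phi> (g [^]\<^bsub>R\<^esub> k) \<otimes>\<^bsub>S\<^esub> i [^]\<^bsub>S\<^esub> (j + k) = i [^]\<^bsub>S\<^esub> j \<otimes>\<^bsub>S\<^esub> (i [^]\<^bsub>S\<^esub> k \<otimes>\<^bsub>S\<^esub> \<phi> g [^]\<^bsub>S\<^esub> k)"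
    using g by (simp add: phi_pow S.nat_pow_mult[symmetric] S.m_ac)
  then have "\<phi> (g [^]\<^bsub>R\<^esub> k) \<otimes>\<^bsub>S\<^esub> i [^]\<^bsub>S\<^esub> (j + k) = i [^]\<^bsub>S\<^esub> j" by (simp add: ipow_cancel)
  then show ?thesis
    using K_minus[OF K_scalar[of "g [^]\<^bsub>R\<^esub> k" m "i [^]\<^bsub>S\<^esub> (j + k)"]] g m by simp
qed

lemma K_trans: "\<lbrakk>c - d \<in> K; d - e \<in> K\<rbrakk> \<Longrightarrow> c - e \<in> K"
  using K_add[of "c - d" "d - e"] by simp

text \<open>Modulo the relations every formal sum is a single tensor with a power of
  \<open>i\<close> on the right, because scalars are fractions and several fractions have a common
  denominator.\<close>

lemma normal_form:
  assumes "c \<in> F"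
  shows "\<exists>m\<in>carrier M. \<exists>j::nat. c - frag_of (m, i [^]\<^bsub>S\<^esub> j) \<in> K"
  using assms
proof (induction rule: F_induct)
  case zero
  have "0 - frag_of (\<zero>\<^bsub>M\<^esub>, i [^]\<^bsub>S\<^esub> (0::nat)) \<in> K"
    using K_minus[OF K_zero_left[of "i [^]\<^bsub>S\<^esub> (0::nat)"]] by simp
  then show ?case by blast
next
  case (frag m s)
  \<comment> \<open>The scalar \<open>s\<close> is the fraction \<open>a / g^k\<close>, and its
    numerator moves to the left factor.\<close>
  obtain k :: nat and a where a: "a \<in> carrier R" "\<phi> a = \<phi> g [^]\<^bsub>S\<^esub> k \<otimes>\<^bsub>S\<^esub> s"
    using lift_ring[OF frag(2)] by blast
  have "\<phi> a \<otimes>\<^bsub>S\<^esub> i [^]\<^bsub>S\<^esub> k = (i [^]\<^bsub>S\<^esub> k \<otimes>\<^bsub>S\<^esub> \<phi> g [^]\<^bsub>S\<^esub> k) \<otimes>\<^bsub>S\<^esub> s"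
    unfolding a(2) using g frag(2) by (simp add: S.m_ac)
  then have "\<phi> a \<otimes>\<^bsub>S\<^esub> i [^]\<^bsub>S\<^esub> k = s" using frag(2) by (simp add: ipow_cancel)
  then have "frag_of (m, s) - frag_of (a \<odot>\<^bsub>M\<^esub> m, i [^]\<^bsub>S\<^esub> k) \<in> K"
    using K_minus[OF K_scalar[of a m "i [^]\<^bsub>S\<^esub> k"]] a(1) frag(1) by simp
  then show ?case using a(1) frag(1) by blast
next
  case (diff x y)
  obtain m and j :: nat where m: "m \<in> carrier M" "x - frag_of (m, i [^]\<^bsub>S\<^esub> j) \<in> K" using diff.IH(1) by blast
  obtain m' and j' :: nat where m': "m' \<in> carrier M" "y - frag_of (m', i [^]\<^bsub>S\<^esub> j') \<in> K" using diff.IH(2) by blast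
  \<comment> \<open>Both tensors are brought to the common denominator with exponent
    \<open>j + j'\<close>.\<close>
  let ?s = "i [^]\<^bsub>S\<^esub> (j + j')" and ?a = "g [^]\<^bsub>R\<^esub> j' \<odot>\<^bsub>M\<^esub> m" and ?b = "g [^]\<^bsub>R\<^esub> j \<odot>\<^bsub>M\<^esub> m'"
  have ab: "?a \<in> carrier M" "?b \<in> carrier M" using g m m' by auto
  have x: "x - frag_of (?a, ?s) \<in> K" by (rule K_trans[OF m(2) raise_denominator[OF m(1)]])
  have y: "y - frag_of (?b, ?s) \<in> K"
    using K_trans[OF m'(2) raise_denominator[OF m'(1), of j' j]] by (simp add: add.commute)
  have "?a \<ominus>\<^bsub>M\<^esub> ?b \<oplus>\<^bsub>M\<^esub> ?b = ?a" using ab by (simp add: a_minus_def M.M.a_assoc M.M.l_neg)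
  then have d: "frag_of (?a, ?s) - frag_of (?a \<ominus>\<^bsub>M\<^esub> ?b, ?s) - frag_of (?b, ?s) \<in> K"
    using K_add_left[of "?a \<ominus>\<^bsub>M\<^esub> ?b" ?b ?s] ab by simp
  have "(x - frag_of (?a, ?s)) - (y - frag_of (?b, ?s)) +
      (frag_of (?a, ?s) - frag_of (?a \<ominus>\<^bsub>M\<^esub> ?b, ?s) - frag_of (?b, ?s)) \<in> K"
    by (rule K_add[OF K_diff[OF x y] d])
  then have "(x - y) - frag_of (?a \<ominus>\<^bsub>M\<^esub> ?b, ?s) \<in> K" by (simp add: algebra_simps)
  moreover have "?a \<ominus>\<^bsub>M\<^esub> ?b \<in> carrier M" using ab by simp
  ultimately show ?case by blast
qed

lemma r_zero: "r \<zero>\<^bsub>M\<^esub> = \<zero>\<^bsub>N\<^esub>"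
  using r_smult[of "\<zero>\<^bsub>R\<^esub>" "\<zero>\<^bsub>M\<^esub>"] r_closed[of "\<zero>\<^bsub>M\<^esub>"] by simp

text \<open>The map on formal sums induced by sending \<open>(m, s)\<close> to \<open>s\<close>
  times \<open>r m\<close>. The universal property of the free group only asserts existence, hence
  the choice.\<close>

definition H :: "(('m \<times> 's) \<Rightarrow>\<^sub>0 int) \<Rightarrow> 'n" where
  "H = (SOME h. h \<in> hom (tensor_free M S) (add_monoid N) \<and>
    (\<forall>m\<in>carrier M. \<forall>s\<in>carrier S. h (frag_of (m, s)) = s \<odot>\<^bsub>N\<^esub> r m))"

lemma H: "H \<in> hom (tensor_free M S) (add_monoid N)"
  and H_frag: "\<lbrakk>m \<in> carrier M; s \<in> carrier S\<rbrakk> \<Longrightarrow> H (frag_of (m, s)) = s \<odot>\<^bsub>N\<^esub> r m"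
proof -
  have "(\<lambda>(m, s). s \<odot>\<^bsub>N\<^esub> r m) ` (carrier M \<times> carrier S) \<subseteq> carrier (add_monoid N)"
    using r_closed by auto
  then obtain h where "h \<in> hom (free_Abelian_group (carrier M \<times> carrier S)) (add_monoid N)"
    "\<And>x. x \<in> carrier M \<times> carrier S \<Longrightarrow> h (frag_of x) = (\<lambda>(m, s). s \<odot>\<^bsub>N\<^esub> r m) x"
    using comm_group.free_Abelian_group_universal[OF N.M.a_comm_group] by blast
  then have "\<exists>h. h \<in> hom (tensor_free M S) (add_monoid N) \<and>
      (\<forall>m\<in>carrier M. \<forall>s\<in>carrier S. h (frag_of (m, s)) = s \<odot>\<^bsub>N\<^esub> r m)"
    unfolding tensor_free_def by (intro exI[of _ h]) auto
  from someI_ex[OF this] show "H \<in> hom (tensor_free M S) (add_monoid N)"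
    "\<lbrakk>m \<in> carrier M; s \<in> carrier S\<rbrakk> \<Longrightarrow> H (frag_of (m, s)) = s \<odot>\<^bsub>N\<^esub> r m"
    unfolding H_def by blast+
qed

lemma H_closed: "c \<in> F \<Longrightarrow> H c \<in> carrier N"
  using hom_carrier[OF H] by auto

lemma H_add: "\<lbrakk>c \<in> F; d \<in> F\<rbrakk> \<Longrightarrow> H (c + d) = H c \<oplus>\<^bsub>N\<^esub> H d"
  using hom_mult[OF H, of c d] by (simp add: F_mult)

lemma H_zero: "H 0 = \<zero>\<^bsub>N\<^esub>"
proof -
  have "0 \<in> F" by (simp add: F_iff)
  then have "H 0 \<oplus>\<^bsub>N\<^esub> H 0 = H 0" "H 0 \<in> carrier N" using H_add[of 0 0] H_closed by auto
  then show ?thesis by (metis N.M.add.r_cancel_one')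
qed

lemma H_diff: "\<lbrakk>c \<in> F; d \<in> F\<rbrakk> \<Longrightarrow> H (c - d) = H c \<ominus>\<^bsub>N\<^esub> H d"
proof -
  assume cd: "c \<in> F" "d \<in> F"
  have "H (c - d) \<oplus>\<^bsub>N\<^esub> H d = H c" using H_add[OF F_diff[OF cd] cd(2)] by simp
  then show ?thesis
    using H_closed[OF F_diff[OF cd]] H_closed[OF cd(2)]
    by (metis N.M.add.inv_solve_right a_minus_def N.M.a_closed)
qed

lemma H_diff_zero_iff: "\<lbrakk>c \<in> F; d \<in> F\<rbrakk> \<Longrightarrow> H (c - d) = \<zero>\<^bsub>N\<^esub> \<longleftrightarrow> H c = H d"
  by (simp add: H_diff N.M.diff_eq_zero_iff H_closed)

lemma H_relator:
  assumes "c \<in> tensor_relators R M S \<phi>"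
  shows "H c = \<zero>\<^bsub>N\<^esub>"
proof -
  consider (a) m m' s where "c = frag_of (m \<oplus>\<^bsub>M\<^esub> m', s) - frag_of (m, s) - frag_of (m', s)"
      "m \<in> carrier M" "m' \<in> carrier M" "s \<in> carrier S"
    | (b) m s s' where "c = frag_of (m, s \<oplus>\<^bsub>S\<^esub> s') - frag_of (m, s) - frag_of (m, s')"
      "m \<in> carrier M" "s \<in> carrier S" "s' \<in> carrier S"
    | (c) a m s where "c = frag_of (a \<odot>\<^bsub>M\<^esub> m, s) - frag_of (m, \<phi> a \<otimes>\<^bsub>S\<^esub> s)"
      "a \<in> carrier R" "m \<in> carrier M" "s \<in> carrier S"
    using assms unfolding tensor_relators_def by blast
  then show ?thesis
  proof cases
    case a
    have "H (frag_of (m, s) + frag_of (m', s)) = H (frag_of (m \<oplus>\<^bsub>M\<^esub> m', s))"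
      using a(2-4) by (simp add: H_add F_frag H_frag r_add r_closed N.smult_r_distr)
    then show ?thesis using a(2-4)
      unfolding a(1) diff_diff_eq by (subst H_diff_zero_iff) (auto simp: F_frag intro: F_add)
  next
    case b
    have "H (frag_of (m, s) + frag_of (m, s')) = H (frag_of (m, s \<oplus>\<^bsub>S\<^esub> s'))"
      using b(2-4) by (simp add: H_add F_frag H_frag r_closed N.smult_l_distr)
    then show ?thesis using b(2-4)
      unfolding b(1) diff_diff_eq by (subst H_diff_zero_iff) (auto simp: F_frag intro: F_add)
  next
    case c
    have "s \<odot>\<^bsub>N\<^esub> (\<phi> a \<odot>\<^bsub>N\<^esub> r m) = (\<phi> a \<otimes>\<^bsub>S\<^esub> s) \<odot>\<^bsub>N\<^esub> r m"
      using c(2-4) r_closed by (simp add: N.smult_assoc1[symmetric] S.m_comm)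
    then have "H (frag_of (a \<odot>\<^bsub>M\<^esub> m, s)) = H (frag_of (m, \<phi> a \<otimes>\<^bsub>S\<^esub> s))"
      using c(2-4) by (simp add: H_frag r_smult)
    then show ?thesis using c(2-4)
      unfolding c(1) by (subst H_diff_zero_iff) (auto simp: F_frag)
  qed
qed

lemma H_K: "c \<in> K \<Longrightarrow> H c = \<zero>\<^bsub>N\<^esub>"
proof -
  interpret h: group_hom "tensor_free M S" "add_monoid N" H
    by (intro group_hom.intro group_hom_axioms.intro F_group N.M.a_group H)
  have "tensor_relators R M S \<phi> \<subseteq> kernel (tensor_free M S) (add_monoid N) H"
    using H_relator relators_F by (auto simp: kernel_def)
  then have "K \<subseteq> kernel (tensor_free M S) (add_monoid N) H"
    unfolding tensor_kernel_def by (rule group.generate_subgroup_incl[OF F_group _ h.subgroup_kernel])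
  then show "c \<in> K \<Longrightarrow> H c = \<zero>\<^bsub>N\<^esub>" by (auto simp: kernel_def)
qed

text \<open>Injectivity of the induced map: by \<open>normal_form\<close> only single tensors
  matter. If \<open>H\<close> kills one, then \<open>r m\<close> is zero, a power of
  \<open>g\<close> kills \<open>m\<close>, and raising the denominator makes the tensor
  zero.\<close>

lemma K_iff: "c \<in> K \<longleftrightarrow> c \<in> F \<and> H c = \<zero>\<^bsub>N\<^esub>"
proof (intro iffI)
  assume c: "c \<in> F \<and> H c = \<zero>\<^bsub>N\<^esub>"
  obtain m and j :: nat where m: "m \<in> carrier M" "c - frag_of (m, i [^]\<^bsub>S\<^esub> j) \<in> K"
    using normal_form c by blast
  have fr: "frag_of (m, i [^]\<^bsub>S\<^esub> j) \<in> F" using m by (simp add: F_frag)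
  have "H (frag_of (m, i [^]\<^bsub>S\<^esub> j)) = \<zero>\<^bsub>N\<^esub>"
    using H_K[OF m(2)] H_diff_zero_iff[OF _ fr] c by simp
  then have "i [^]\<^bsub>S\<^esub> j \<odot>\<^bsub>N\<^esub> r m = i [^]\<^bsub>S\<^esub> j \<odot>\<^bsub>N\<^esub> \<zero>\<^bsub>N\<^esub>" using m(1) by (simp add: H_frag)
  then have "r m = \<zero>\<^bsub>N\<^esub>"
    using N.unit_smult_cancel[OF S.Units_pow_closed[OF i_unit]] r_closed[OF m(1)] by blast
  then obtain k :: nat where "g [^]\<^bsub>R\<^esub> k \<odot>\<^bsub>M\<^esub> m = \<zero>\<^bsub>M\<^esub>" using kill[OF m(1)] by blast
  then have "frag_of (m, i [^]\<^bsub>S\<^esub> j) - frag_of (\<zero>\<^bsub>M\<^esub>, i [^]\<^bsub>S\<^esub> (j + k)) \<in> K"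
    using raise_denominator[OF m(1), of j k] by simp
  then have "c - frag_of (\<zero>\<^bsub>M\<^esub>, i [^]\<^bsub>S\<^esub> (j + k)) \<in> K" by (rule K_trans[OF m(2)])
  moreover have "frag_of (\<zero>\<^bsub>M\<^esub>, i [^]\<^bsub>S\<^esub> (j + k)) \<in> K" by (intro K_zero_left) simp
  ultimately show "c \<in> K" using K_add by fastforce
qed (use H_K K_F in blast)

text \<open>Cosets of the relations are the fibres of \<open>H\<close>, so computations in the base
  change can be made in \<open>N\<close>.\<close>

lemma cls_eq:
  assumes c: "c \<in> F"
  shows "cls c = {d \<in> F. H d = H c}"
proof (intro equalityI subsetI)
  fix d assume "d \<in> cls c"
  then obtain k where k: "k \<in> K" "d = k + c"
    unfolding tensor_class_def r_coset_def F_mult by blast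
  then have "d \<in> F" "d - c \<in> K" using F_add[OF K_F c] by auto
  then show "d \<in> {d \<in> F. H d = H c}" using H_K H_diff_zero_iff[OF _ c] by blast
next
  fix d assume d: "d \<in> {d \<in> F. H d = H c}"
  then have "d - c \<in> K" unfolding K_iff using H_diff_zero_iff[OF _ c] F_diff[OF _ c] by blast
  then show "d \<in> cls c" unfolding tensor_class_def r_coset_def F_mult by force
qed

abbreviation BC :: "('s, (('m \<times> 's) \<Rightarrow>\<^sub>0 int) set) module" where
  "BC \<equiv> base_change R M S \<phi>"

lemma BC_carrier: "carrier BC = cls ` F"
  unfolding base_change_def Let_def FactGroup_def RCOSETS_def tensor_class_def by auto

lemma BC_add: "\<lbrakk>c \<in> F; d \<in> F\<rbrakk> \<Longrightarrow> cls c \<oplus>\<^bsub>BC\<^esub> cls d = cls (c + d)"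
proof -
  assume cd: "c \<in> F" "d \<in> F"
  have "K \<lhd> tensor_free M S"
    by (rule comm_group.subgroup_imp_normal[OF F_comm_group K_subgroup])
  from normal.rcos_sum[OF this cd] show ?thesis
    unfolding base_change_def Let_def FactGroup_def tensor_class_def F_mult by simp
qed

definition ext :: "'s \<Rightarrow> (('m \<times> 's) \<Rightarrow>\<^sub>0 int) \<Rightarrow> (('m \<times> 's) \<Rightarrow>\<^sub>0 int)" where
  "ext a = frag_extend (\<lambda>(m, s). frag_of (m, a \<otimes>\<^bsub>S\<^esub> s))"

lemma ext_F_H:
  assumes a: "a \<in> carrier S" and c: "c \<in> F"
  shows "ext a c \<in> F \<and> H (ext a c) = a \<odot>\<^bsub>N\<^esub> H c"
  using c
proof (induction rule: F_induct)
  case zero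
  then show ?case using a by (simp add: ext_def F_iff H_zero)
next
  case (diff x y)
  then show ?case
    using a F_diff[of "ext a x" "ext a y"]
    by (simp add: ext_def frag_extend_diff H_diff N.smult_r_diff H_closed)
next
  case (frag m s)
  then show ?case using a by (simp add: ext_def F_frag H_frag N.smult_assoc1 r_closed)
qed

text \<open>The scalar action is a union over representatives; they all give the same coset because
  \<open>H (ext a d)\<close> depends only on \<open>H d\<close>.\<close>

lemma BC_smult:
  assumes a: "a \<in> carrier S" and c: "c \<in> F"
  shows "a \<odot>\<^bsub>BC\<^esub> cls c = cls (ext a c)"
proof -
  have same: "cls (ext a d) = cls (ext a c)" if "d \<in> cls c" for d
  proof -
    have d: "d \<in> F" "H d = H c" using that unfolding cls_eq[OF c] by auto
    note xd = ext_F_H[OF a d(1)] and xc = ext_F_H[OF a c]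
    show ?thesis unfolding cls_eq[OF conjunct1[OF xd]] cls_eq[OF conjunct1[OF xc]] using xd xc d(2) by simp
  qed
  have "c \<in> cls c" unfolding cls_eq[OF c] using c by simp
  have "a \<odot>\<^bsub>BC\<^esub> cls c = (\<Union>d\<in>cls c. cls (ext a d))"
    unfolding base_change_def Let_def ext_def by simp
  also have "\<dots> = (\<Union>d\<in>cls c. cls (ext a c))" by (rule SUP_cong[OF refl same])
  also have "\<dots> = cls (ext a c)" using \<open>c \<in> cls c\<close> by (intro cSUP_const) blast
  finally show ?thesis .
qed

definition bc_iso :: "(('m \<times> 's) \<Rightarrow>\<^sub>0 int) set \<Rightarrow> 'n" where
  "bc_iso C = H (SOME c. c \<in> C)"

lemma bc_iso_cls:
  assumes c: "c \<in> F"
  shows "bc_iso (cls c) = H c"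
proof -
  have "c \<in> cls c" unfolding cls_eq[OF c] using c by simp
  then have "(SOME d. d \<in> cls c) \<in> cls c" by (rule someI[of "\<lambda>d. d \<in> cls c"])
  then have "(SOME d. d \<in> cls c) \<in> {d \<in> F. H d = H c}" unfolding cls_eq[OF c, symmetric] .
  then show ?thesis unfolding bc_iso_def by blast
qed

lemma bc_iso_linear_iso: "bc_iso \<in> linear_iso S BC N"
  unfolding linear_iso_def semilinear_iso_def BC_carrier
proof (intro CollectI conjI ballI)
  show "bij_betw bc_iso (cls ` F) (carrier N)"
  proof (rule bij_betw_imageI)
    show "inj_on bc_iso (cls ` F)"
    proof (rule inj_onI)
      fix C C' assume "C \<in> cls ` F" "C' \<in> cls ` F" and eq: "bc_iso C = bc_iso C'"
      then obtain c c' where c: "c \<in> F" "C = cls c" "c' \<in> F" "C' = cls c'" by blast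
      then have "H c = H c'" using eq by (simp add: bc_iso_cls)
      then show "C = C'" using c by (simp add: cls_eq)
    qed
    show "bc_iso ` cls ` F = carrier N"
    proof (intro equalityI subsetI)
      fix n assume "n \<in> bc_iso ` cls ` F"
      then show "n \<in> carrier N" using H_closed by (auto simp: bc_iso_cls)
    next
      fix n assume n: "n \<in> carrier N"
      obtain k :: nat and m where m: "m \<in> carrier M" "r m = \<phi> g [^]\<^bsub>S\<^esub> k \<odot>\<^bsub>N\<^esub> n"
        using lift[OF n] by blast
      have f: "frag_of (m, i [^]\<^bsub>S\<^esub> k) \<in> F" using m by (simp add: F_frag)
      have "H (frag_of (m, i [^]\<^bsub>S\<^esub> k)) = (i [^]\<^bsub>S\<^esub> k \<otimes>\<^bsub>S\<^esub> \<phi> g [^]\<^bsub>S\<^esub> k) \<odot>\<^bsub>N\<^esub> n"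
        using m n g by (simp add: H_frag N.smult_assoc1)
      then have "n = bc_iso (cls (frag_of (m, i [^]\<^bsub>S\<^esub> k)))"
        using n f by (simp add: ipow_cancel bc_iso_cls)
      then show "n \<in> bc_iso ` cls ` F" using f by blast
    qed
  qed
next
  fix C C' assume "C \<in> cls ` F" "C' \<in> cls ` F"
  then obtain c c' where c: "c \<in> F" "C = cls c" "c' \<in> F" "C' = cls c'" by blast
  show "bc_iso (C \<oplus>\<^bsub>BC\<^esub> C') = bc_iso C \<oplus>\<^bsub>N\<^esub> bc_iso C'"
    unfolding c(2,4) BC_add[OF c(1,3)] using c(1,3) by (simp add: bc_iso_cls F_add H_add)
next
  fix a C assume a: "a \<in> carrier S" and "C \<in> cls ` F"
  then obtain c where c: "c \<in> F" "C = cls c" by blast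
  show "bc_iso (a \<odot>\<^bsub>BC\<^esub> C) = a \<odot>\<^bsub>N\<^esub> bc_iso C"
    unfolding c(2) BC_smult[OF a c(1)] using ext_F_H[OF a c(1)] c(1) by (simp add: bc_iso_cls)
qed

lemma bc_iso_pure: "\<lbrakk>m \<in> carrier M; s \<in> carrier S\<rbrakk> \<Longrightarrow> bc_iso (pure_tensor R M S \<phi> m s) = s \<odot>\<^bsub>N\<^esub> r m"
  unfolding pure_tensor_def by (simp add: bc_iso_cls F_frag H_frag)

text \<open>The image of \<open>LS\<close> consists of the values of \<open>H\<close> on formal sums
  over \<open>L\<close>. The second part says that it is the least submodule containing the image of
  \<open>L\<close>, the form in which monotonicity of the closure uses it.\<close>

lemma bc_iso_extended:
  assumes L: "submodule L R M"
  shows "submodule (bc_iso ` extended_submodule R M S \<phi> L) S N"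
    and "\<lbrakk>submodule Q S N; r ` L \<subseteq> Q\<rbrakk> \<Longrightarrow> bc_iso ` extended_submodule R M S \<phi> L \<subseteq> Q"
proof -
  let ?G = "carrier (free_Abelian_group (L \<times> carrier S))"
  have LM: "L \<subseteq> carrier M" using M.submoduleE(1)[OF L] .
  have GF: "?G \<subseteq> F"
  proof
    fix c assume "c \<in> ?G"
    then have "Poly_Mapping.keys c \<subseteq> L \<times> carrier S" by simp
    then show "c \<in> F" unfolding F_iff using LM by blast
  qed
  have eq: "bc_iso ` extended_submodule R M S \<phi> L = H ` ?G"
    unfolding extended_submodule_def image_image by (rule image_cong[OF refl bc_iso_cls]) (use GF in blast)
  have ext_G: "ext a c \<in> ?G" if a: "a \<in> carrier S" and c: "c \<in> ?G" for a c
    using c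
  proof (induction rule: free_Abelian_group_carrier_induct)
    case (diff x y)
    then show ?case using diff_in_free_Abelian_group[of "ext a x" _ "ext a y"] by (simp only: ext_def frag_extend_diff)
  qed (use a in \<open>auto simp: ext_def\<close>)
  have diffG: "c - d \<in> ?G" if "c \<in> ?G" "d \<in> ?G" for c d by (rule diff_in_free_Abelian_group[OF that])
  have zG: "0 \<in> ?G" by simp
  show "submodule (bc_iso ` extended_submodule R M S \<phi> L) S N"
    unfolding eq
  proof (rule N.submoduleI)
    show "H ` ?G \<subseteq> carrier N" using GF H_closed by blast
    show "\<zero>\<^bsub>N\<^esub> \<in> H ` ?G" using H_zero zG by (metis imageI)
    have neg: "\<ominus>\<^bsub>N\<^esub> H c = H (0 - c)" if "c \<in> ?G" for c
      using that GF zG H_diff[of 0 c] H_zero H_closed by (auto simp: a_minus_def subset_iff)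
    then show "\<ominus>\<^bsub>N\<^esub> n \<in> H ` ?G" if "n \<in> H ` ?G" for n
      using that diffG[OF zG] by (auto simp del: carrier_free_Abelian_group_iff diff_0)
    show "n \<oplus>\<^bsub>N\<^esub> n' \<in> H ` ?G" if n: "n \<in> H ` ?G" "n' \<in> H ` ?G" for n n'
    proof -
      obtain c d where c: "c \<in> ?G" "n = H c" "d \<in> ?G" "n' = H d" using n by blast
      have "c + d \<in> ?G" using diffG[OF c(1) diffG[OF zG c(3)]] by (simp del: carrier_free_Abelian_group_iff)
      moreover have "H (c + d) = n \<oplus>\<^bsub>N\<^esub> n'" unfolding c(2,4) using c(1,3) GF by (intro H_add) blast+
      ultimately show ?thesis by (metis imageI)
    qed
    show "a \<odot>\<^bsub>N\<^esub> n \<in> H ` ?G" if a: "a \<in> carrier S" and n: "n \<in> H ` ?G" for a n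
    proof -
      obtain c where c: "c \<in> ?G" "n = H c" using n by blast
      have "a \<odot>\<^bsub>N\<^esub> n = H (ext a c)" unfolding c(2) using ext_F_H[OF a subsetD[OF GF c(1)]] by simp
      then show ?thesis using ext_G[OF a c(1)] by blast
    qed
  qed
  assume Q: "submodule Q S N" and rQ: "r ` L \<subseteq> Q"
  interpret Q: submodule Q S N by (rule Q)
  have "H c \<in> Q" if "c \<in> ?G" for c
    using that
  proof (induction rule: free_Abelian_group_carrier_induct)
    case zero
    show ?case unfolding H_zero using Q.one_closed by simp
  next
    case (diff x y)
    then have "x \<in> F" "y \<in> F" using GF by blast+
    then show ?case using diff N.submoduleE(3,5)[OF Q] by (simp add: H_diff a_minus_def)
  next
    case (frag p)
    then obtain l s where "p = (l, s)" "l \<in> L" "s \<in> carrier S" by blast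
    moreover then have "l \<in> carrier M" "r l \<in> Q" using LM rQ by auto
    ultimately show ?case using Q.smult_closed by (simp add: H_frag)
  qed
  then show "bc_iso ` extended_submodule R M S \<phi> L \<subseteq> Q" unfolding eq by blast
qed

end

section \<open>Quasi-coherent modules over arbitrary affine open sets, and persistence of
  closures\<close>

context sheaf_of_modules
begin

lemma tilde_on_chart_imp:
  assumes "affine_chart X U A f \<phi>" "tilde_on_chart X M U A f \<phi> N"
  obtains \<psi> where "tilde_chart X M U A f \<phi> N \<psi>"
proof -
  obtain \<psi> where "\<forall>V. openin (zariski A) V \<longrightarrow>
       \<psi> V \<in> semilinear_iso (rsec (Spec A) V) (\<phi> V) (msec (tilde A N) V) (msec M (inv_img (open_subspace X U) f V))"
    "\<forall>V W. openin (zariski A) V \<and> openin (zariski A) W \<and> W \<subseteq> V \<longrightarrow>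
       (\<forall>s\<in>carrier (msec (tilde A N) V).
         mres M (inv_img (open_subspace X U) f V) (inv_img (open_subspace X U) f W) (\<psi> V s) =
         \<psi> W (mres (tilde A N) V W s))" and N: "Module.module A N"
    using assms(2) unfolding tilde_on_chart_def Let_def by blast
  then have "tilde_chart X M U A f \<phi> N \<psi>"
    by (intro tilde_chart.intro tilde_chart_axioms.intro sheaf_of_modules_axioms assms(1) N)
      (auto simp: tilde_def)
  then show ?thesis by (rule that)
qed

text \<open>First a set \<open>?E\<close> basic in \<open>V\<close> is chosen inside the three open
  sets, then \<open>D U g\<close> inside \<open>?E\<close>. It is also basic in \<open>?E\<close>,
  hence by \<open>D_shrink\<close> in \<open>V\<close>. No affineness of the intersection is
  used.\<close>

lemma common_basic_open:
  assumes U: "aff U" and V: "aff V" and W: "opn W" and x: "x \<in> U" "x \<in> V" "x \<in> W"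
  obtains g h where "g \<in> carrier (\<O> U)" "h \<in> carrier (\<O> V)" "D U g = D V h" "x \<in> D U g" "D U g \<subseteq> W"
proof -
  have "opn (U \<inter> V \<inter> W)" using aff_open[OF U] aff_open[OF V] W by blast
  then obtain h0 where h0: "h0 \<in> carrier (\<O> V)" "x \<in> D V h0" "D V h0 \<subseteq> U \<inter> V \<inter> W"
    using aff_basis[OF V, of "U \<inter> V \<inter> W" x] x by blast
  let ?E = "D V h0"
  have EU: "?E \<subseteq> U" "?E \<subseteq> W" using h0 by auto
  obtain g where g: "g \<in> carrier (\<O> U)" "x \<in> D U g" "D U g \<subseteq> ?E"
    using aff_basis[OF U D_open EU(1) h0(2)] .
  have e: "\<rho> U ?E g \<in> carrier (\<O> ?E)" by (rule rho_closed[OF aff_open[OF U] D_open EU(1) g(1)])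
  obtain w v where w: "w \<in> carrier (\<O> V)" and "v \<in> Units (\<O> ?E)"
    and "\<rho> V ?E w = v \<otimes>\<^bsub>\<O> ?E\<^esub> \<rho> U ?E g" and Dw: "D V w = D ?E (\<rho> U ?E g)"
    using D_shrink[OF aff_open[OF V] aff_localizes[OF V] h0(1) e] .
  have "D U g = D V w" unfolding Dw D_restrict[OF aff_open[OF U] D_open EU(1) g(1)] using g(3) by blast
  then show ?thesis using that[OF g(1) w _ g(2)] g(3) EU(2) by blast
qed

text \<open>The case of the zero section in the ideal argument below; all sections over the empty
  set are equal.\<close>

lemma localizes_empty: "localizes X M {}"
proof (rule localizesI)
  have e: "opn {}" by simp
  interpret M0: module "\<O> {}" "\<M> {}" by (rule module_M[OF e])
  have eq: "s = t" if "s \<in> carrier (\<M> {})" "t \<in> carrier (\<M> {})" for s t by (rule M_eqI[OF that]) blast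
  have D0: "D {} g = {}" for g using D_subset by blast
  show "\<exists>k::nat. \<exists>m\<in>carrier (\<M> {}). \<mu> {} (D {} g) m = \<rho> {} (D {} g) g [^]\<^bsub>\<O> (D {} g)\<^esub> k \<odot>\<^bsub>\<M> (D {} g)\<^esub> t"
    if "g \<in> carrier (\<O> {})" "t \<in> carrier (\<M> (D {} g))" for g t
    using that e unfolding D0 by (intro exI[of _ "0::nat"] bexI[of _ t]) simp_all
  show "\<exists>k::nat. g [^]\<^bsub>\<O> {}\<^esub> k \<odot>\<^bsub>\<M> {}\<^esub> m = \<zero>\<^bsub>\<M> {}\<^esub>"
    if "g \<in> carrier (\<O> {})" "m \<in> carrier (\<M> {})" for g m
    using that eq by (intro exI[of _ "0::nat"]) simp
qed

text \<open>The sections \<open>h\<close> such that \<open>M\<close> localizes over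
  \<open>D V h\<close> form an ideal of the ring over \<open>V\<close>, and charts put such an
  \<open>h\<close> outside every prime; so \<open>\<one>\<close> is among them.\<close>

lemma quasi_coherent_localizes:
  assumes qc: "quasi_coherent X M" and V: "aff V"
  shows "localizes X M V"
proof -
  note Vo = aff_open[OF V]
  interpret OV: cring "\<O> V" by (rule cring_O[OF Vo])
  \<comment> \<open>Serves both for multiples and for the two pieces covering the basic open set of
    a sum.\<close>
  have shrink: "localizes X M (D V x \<inter> D V c)"
    if x: "x \<in> carrier (\<O> V)" "localizes X M (D V x)" and c: "c \<in> carrier (\<O> V)" for x c
  proof -
    have "localizes X M (D (D V x) (\<rho> V (D V x) c))"
      by (rule localizes_D[OF D_open aff_localizes[OF aff_D[OF V x(1)]] x(2)]) (use Vo c in simp)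
    then show ?thesis unfolding D_restrict[OF Vo D_open D_subset c] by (simp add: Int_commute)
  qed
  obtain k :: nat where "localizes X M (D V (\<one>\<^bsub>\<O> V\<^esub> [^]\<^bsub>\<O> V\<^esub> k))"
  proof (rule OV.local_imp_power_mem[where Q = "\<lambda>h. localizes X M (D V h)" and a = "\<one>\<^bsub>\<O> V\<^esub>"])
    show "localizes X M (D V \<zero>\<^bsub>\<O> V\<^esub>)" unfolding D_zero_aff[OF V] by (rule localizes_empty)
    show "localizes X M (D V (c \<otimes>\<^bsub>\<O> V\<^esub> x))"
      if "c \<in> carrier (\<O> V)" "x \<in> carrier (\<O> V)" "localizes X M (D V x)" for c x
      using shrink[OF that(2,3,1)] D_mult[OF Vo that(1,2)] by (simp add: Int_commute)
    show "localizes X M (D V (x \<oplus>\<^bsub>\<O> V\<^esub> y))"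
      if x: "x \<in> carrier (\<O> V)" "y \<in> carrier (\<O> V)" "localizes X M (D V x)" "localizes X M (D V y)" for x y
    proof -
      \<comment> \<open>The basic open set of the sum is covered by its parts in
        \<open>D V x\<close> and \<open>D V y\<close>, so the gluing of localizations applies over
        it.\<close>
      let ?W = "D V (x \<oplus>\<^bsub>\<O> V\<^esub> y)"
      have xy: "x \<oplus>\<^bsub>\<O> V\<^esub> y \<in> carrier (\<O> V)" using x by simp
      have W: "aff ?W" by (rule aff_D[OF V xy])
      have rx: "\<rho> V ?W x \<in> carrier (\<O> ?W)" and ry: "\<rho> V ?W y \<in> carrier (\<O> ?W)" using Vo x by auto
      note Dx = D_restrict[OF Vo D_open D_subset x(1)] and Dy = D_restrict[OF Vo D_open D_subset x(2)]
      show ?thesis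
      proof (rule localizes_glue[OF D_open rx ry])
        show "?W \<subseteq> D ?W (\<rho> V ?W x) \<union> D ?W (\<rho> V ?W y)"
          unfolding Dx Dy using D_add_aff[OF V x(1,2)] by blast
        show "localizes X M (D ?W (\<rho> V ?W x))" unfolding Dx by (rule shrink[OF x(1,3) xy])
        show "localizes X M (D ?W (\<rho> V ?W y))" unfolding Dy by (rule shrink[OF x(2,4) xy])
        show "localizes X (self_sheaf X) (D ?W (\<rho> V ?W x))" by (rule aff_localizes[OF aff_D[OF W rx]])
      qed
    qed
    \<comment> \<open>The prime belongs to a point \<open>x\<close>; a chart around \<open>x\<close>
      shares with \<open>V\<close> a basic open set containing \<open>x\<close>, over which
      \<open>M\<close> localizes.\<close>
    fix P assume "primeideal P (\<O> V)"
    then have "P \<in> pt V ` V" using bij_betw_imp_surj_on[OF aff_pt_bij[OF V]] by blast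
    then obtain x where x: "x \<in> V" "P = pt V x" by blast
    then have "x \<in> topspace (space_top X)" using openin_subset[OF Vo] by blast
    then obtain U A f \<phi> N where ch: "affine_chart X U A f \<phi>" and xU: "x \<in> U"
      and til: "tilde_on_chart X M U A f \<phi> N"
      using qc unfolding quasi_coherent_def by blast
    obtain \<psi> where "tilde_chart X M U A f \<phi> N \<psi>" using tilde_on_chart_imp[OF ch til] .
    then interpret C: tilde_chart X M U A f \<phi> N \<psi> .
    obtain g h where g: "g \<in> carrier (\<O> U)" and h: "h \<in> carrier (\<O> V)" and eq: "D U g = D V h" and "x \<in> D U g" "D U g \<subseteq> V"
      using common_basic_open[OF C.aff_U V Vo xU x(1) x(1)] .
    have "localizes X M (D V h)"
      unfolding eq[symmetric] by (rule localizes_D[OF C.U_open aff_localizes[OF C.aff_U] C.localizes_U g])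
    moreover have "h \<notin> P" unfolding x(2) mem_pt using \<open>x \<in> D U g\<close> eq by simp
    ultimately show "\<exists>h\<in>carrier (\<O> V). h \<notin> P \<and> localizes X M (D V h)" using h by blast
  qed simp
  then show ?thesis by (simp add: D_one[OF Vo])
qed

lemma base_change_basic_open:
  assumes V: "aff V" and loc: "localizes X M V" and g: "g \<in> carrier (\<O> V)"
  shows "localization_base_change (\<O> V) (\<O> (D V g)) (\<M> V) (\<M> (D V g)) (\<rho> V (D V g)) (\<mu> V (D V g)) g"
proof (intro localization_base_change.intro localization_base_change_axioms.intro
    cring_O module_M D_open aff_open[OF V])
  note Vo = aff_open[OF V]
  show "\<rho> V (D V g) \<in> ring_hom (\<O> V) (\<O> (D V g))" by (rule rho_hom[OF Vo D_open D_subset])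
  show "\<rho> V (D V g) g \<in> Units (\<O> (D V g))" by (rule D_unit[OF Vo g])
  show "\<exists>k::nat. \<exists>a\<in>carrier (\<O> V). \<rho> V (D V g) a = \<rho> V (D V g) g [^]\<^bsub>\<O> (D V g)\<^esub> k \<otimes>\<^bsub>\<O> (D V g)\<^esub> s"
    if "s \<in> carrier (\<O> (D V g))" for s
    using localizes_self_lift[OF aff_localizes[OF V] g that] by metis
  show "\<exists>k::nat. \<exists>m\<in>carrier (\<M> V). \<mu> V (D V g) m = \<rho> V (D V g) g [^]\<^bsub>\<O> (D V g)\<^esub> k \<odot>\<^bsub>\<M> (D V g)\<^esub> n"
    if "n \<in> carrier (\<M> (D V g))" for n
    using localizes_lift[OF loc g that] by metis
  show "\<exists>k::nat. g [^]\<^bsub>\<O> V\<^esub> k \<odot>\<^bsub>\<M> V\<^esub> m = \<zero>\<^bsub>\<M> V\<^esub>"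
    if "m \<in> carrier (\<M> V)" "\<mu> V (D V g) m = \<zero>\<^bsub>\<M> (D V g)\<^esub>" for m
    using localizes_kill[OF loc g that] by metis
qed (use aff_open[OF V] g in simp_all)

lemma cl_submodule:
  assumes "preclosure_on_modules X cl" "aff V" "submodule L (\<O> V) (\<M> V)"
  shows "submodule (cl V (\<M> V) L) (\<O> V) (\<M> V)" "L \<subseteq> cl V (\<M> V) L"
    "\<lbrakk>submodule L' (\<O> V) (\<M> V); L \<subseteq> L'\<rbrakk> \<Longrightarrow> cl V (\<M> V) L \<subseteq> cl V (\<M> V) L'"
proof -
  have "affine_open X V" using assms(2) affine_open_iff_aff by blast
  then have pc: "preclosure_operation {L. submodule L (\<O> V) (\<M> V)} (\<subseteq>) (cl V (\<M> V))"
    using assms(1) module_M[OF aff_open[OF assms(2)]] unfolding preclosure_on_modules_def by blast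
  then show "submodule (cl V (\<M> V) L) (\<O> V) (\<M> V)" "L \<subseteq> cl V (\<M> V) L"
    using assms(3) funcset_mem[of "cl V (\<M> V)" "{L. submodule L (\<O> V) (\<M> V)}" _ L]
    unfolding preclosure_operation_def by auto
  show "\<lbrakk>submodule L' (\<O> V) (\<M> V); L \<subseteq> L'\<rbrakk> \<Longrightarrow> cl V (\<M> V) L \<subseteq> cl V (\<M> V) L'"
    using pc assms(3) unfolding preclosure_operation_def by simp
qed

text \<open>Open persistence speaks about the submodule generated by the image of \<open>L\<close>;
  monotonicity replaces it by any \<open>Q\<close> containing this image. Later \<open>Q\<close> is
  either the sections of the subsheaf or a closure.\<close>

lemma closure_persists:
  assumes pre: "preclosure_on_modules X cl" and pers: "openly_persistent X cl"
    and V: "aff V" and loc: "localizes X M V" and g: "g \<in> carrier (\<O> V)"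
    and L: "submodule L (\<O> V) (\<M> V)" and Q: "submodule Q (\<O> (D V g)) (\<M> (D V g))"
    and LQ: "\<mu> V (D V g) ` L \<subseteq> Q" and x: "x \<in> cl V (\<M> V) L"
  shows "\<mu> V (D V g) x \<in> cl (D V g) (\<M> (D V g)) Q"
proof -
  let ?W = "D V g"
  note Vo = aff_open[OF V]
  interpret B: localization_base_change "\<O> V" "\<O> ?W" "\<M> V" "\<M> ?W" "\<rho> V ?W" "\<mu> V ?W" g
    by (rule base_change_basic_open[OF V loc g])
  have W: "aff ?W" by (rule aff_D[OF V g])
  have xc: "x \<in> carrier (\<M> V)" using B.M.submoduleE(1)[OF cl_submodule(1)[OF pre V L]] x by blast
  have ao: "affine_open X V \<and> affine_open X ?W \<and> ?W \<subseteq> V"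
    using V W affine_open_iff_aff by simp
  have "B.bc_iso (pure_tensor (\<O> V) (\<M> V) (\<O> ?W) (\<rho> V ?W) x \<one>\<^bsub>\<O> ?W\<^esub>) \<in>
      cl ?W (\<M> ?W) (B.bc_iso ` extended_submodule (\<O> V) (\<M> V) (\<O> ?W) (\<rho> V ?W) L)"
    using pers[unfolded openly_persistent_def Let_def, rule_format, OF ao]
      module_M[OF Vo] L x module_M[OF D_open] B.bc_iso_linear_iso by blast
  moreover have "B.bc_iso (pure_tensor (\<O> V) (\<M> V) (\<O> ?W) (\<rho> V ?W) x \<one>\<^bsub>\<O> ?W\<^esub>) = \<mu> V ?W x"
    using B.bc_iso_pure[OF xc] Vo xc by simp
  moreover have "cl ?W (\<M> ?W) (B.bc_iso ` extended_submodule (\<O> V) (\<M> V) (\<O> ?W) (\<rho> V ?W) L) \<subseteq> cl ?W (\<M> ?W) Q"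
    by (rule cl_submodule(3)[OF pre W B.bc_iso_extended(1)[OF L] Q B.bc_iso_extended(2)[OF L Q LQ]])
  ultimately show ?thesis by auto
qed

end

section \<open>Noetherian modules and the closure of a sheaf of submodules\<close>

text \<open>Finite generation of a submodule, stated as minimality among submodules containing
  \<open>F\<close>; this avoids finite sums and passes easily along restriction maps.\<close>

definition noetherian_module :: "('r, 'k) ring_scheme \<Rightarrow> ('r, 'm) module \<Rightarrow> bool" where
  "noetherian_module R M \<longleftrightarrow> (\<forall>P. submodule P R M \<longrightarrow>
    (\<exists>F. finite F \<and> F \<subseteq> P \<and> (\<forall>Q. submodule Q R M \<and> F \<subseteq> Q \<longrightarrow> P \<subseteq> Q)))"

definition fg_module :: "('r, 'k) ring_scheme \<Rightarrow> ('r, 'm) module \<Rightarrow> bool" where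
  "fg_module R M \<longleftrightarrow> (\<exists>F. finite F \<and> F \<subseteq> carrier M \<and>
    (\<forall>Q. submodule Q R M \<and> F \<subseteq> Q \<longrightarrow> carrier M \<subseteq> Q))"

lemma submodule_self_imp_ideal:
  assumes R: "cring R" and P: "submodule P R (self_module R)"
  shows "ideal P R"
proof -
  interpret cring R by (rule R)
  interpret M: module R "self_module R" by (rule module_self[OF R])
  interpret P: submodule P R "self_module R" by (rule P)
  have sub: "P \<subseteq> carrier R" using P.subset by simp
  show ?thesis
  proof (rule idealI[OF ring_axioms])
    show "subgroup P (add_monoid R)"
      using P.subgroup_axioms by (simp add: subgroup_def m_inv_def)
    show "x \<otimes>\<^bsub>R\<^esub> a \<in> P" if "a \<in> P" "x \<in> carrier R" for a x using P.smult_closed that by simp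
    then show "a \<otimes>\<^bsub>R\<^esub> x \<in> P" if "a \<in> P" "x \<in> carrier R" for a x using that sub m_comm by (metis subsetD)
  qed
qed

section \<open>Finitely generated modules over a Noetherian ring\<close>

context plain_module
begin

definition span :: "'m set \<Rightarrow> 'm set" where
  "span F = \<Inter>{Q. submodule Q R M \<and> F \<subseteq> Q}"

lemma span_least: "\<lbrakk>submodule Q R M; F \<subseteq> Q\<rbrakk> \<Longrightarrow> span F \<subseteq> Q"
  unfolding span_def by blast

lemma span_superset: "F \<subseteq> span F"
  unfolding span_def by blast

lemma submodule_span:
  assumes "F \<subseteq> carrier M"
  shows "submodule (span F) R M"
proof (rule submoduleI)
  show "span F \<subseteq> carrier M" using span_least[OF carrier_is_submodule assms] .
  show "\<zero>\<^bsub>M\<^esub> \<in> span F"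
    unfolding span_def using subgroup.one_closed[OF submodule.axioms(1)] by fastforce
  show "\<ominus>\<^bsub>M\<^esub> a \<in> span F" if "a \<in> span F" for a
    using that submoduleE(3) unfolding span_def by blast
  show "a \<oplus>\<^bsub>M\<^esub> b \<in> span F" if "a \<in> span F" "b \<in> span F" for a b
    using that submoduleE(5) unfolding span_def by blast
  show "a \<odot>\<^bsub>M\<^esub> x \<in> span F" if "a \<in> carrier R" "x \<in> span F" for a x
    using that submoduleE(4) unfolding span_def by blast
qed

lemma submodule_zero_closed: "submodule Q R M \<Longrightarrow> \<zero>\<^bsub>M\<^esub> \<in> Q"
  using subgroup.one_closed[OF submodule.axioms(1)] by fastforce

lemma submodule_Int: "\<lbrakk>submodule P R M; submodule Q R M\<rbrakk> \<Longrightarrow> submodule (P \<inter> Q) R M"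
proof (rule submoduleI)
  assume P: "submodule P R M" and Q: "submodule Q R M"
  show "P \<inter> Q \<subseteq> carrier M" using submoduleE(1)[OF P] by blast
  show "\<zero>\<^bsub>M\<^esub> \<in> P \<inter> Q" using submodule_zero_closed P Q by blast
  show "\<ominus>\<^bsub>M\<^esub> a \<in> P \<inter> Q" if "a \<in> P \<inter> Q" for a
    using that submoduleE(3)[OF P] submoduleE(3)[OF Q] by blast
  show "a \<oplus>\<^bsub>M\<^esub> b \<in> P \<inter> Q" if "a \<in> P \<inter> Q" "b \<in> P \<inter> Q" for a b
    using that submoduleE(5)[OF P] submoduleE(5)[OF Q] by blast
  show "a \<odot>\<^bsub>M\<^esub> x \<in> P \<inter> Q" if "a \<in> carrier R" "x \<in> P \<inter> Q" for a x
    using that submoduleE(4)[OF P] submoduleE(4)[OF Q] by blast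
qed

lemma span_insert:
  assumes x: "x \<in> carrier M" and F: "F \<subseteq> carrier M" and p: "p \<in> span (insert x F)"
  obtains a m where "a \<in> carrier R" "m \<in> span F" "p = a \<odot>\<^bsub>M\<^esub> x \<oplus>\<^bsub>M\<^esub> m"
proof -
  let ?Q = "{a \<odot>\<^bsub>M\<^esub> x \<oplus>\<^bsub>M\<^esub> m | a m. a \<in> carrier R \<and> m \<in> span F}"
  note S = submodule_span[OF F]
  have sc: "m \<in> carrier M" if "m \<in> span F" for m using that submoduleE(1)[OF S] by blast
  have Q: "submodule ?Q R M"
  proof (rule submoduleI)
    show "?Q \<subseteq> carrier M" using x sc by auto
    show "\<zero>\<^bsub>M\<^esub> \<in> ?Q"
      using x submodule_zero_closed[OF S] by (intro CollectI exI[of _ "\<zero>"] exI[of _ "\<zero>\<^bsub>M\<^esub>"]) simp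
    show "\<ominus>\<^bsub>M\<^esub> q \<in> ?Q" if q: "q \<in> ?Q" for q
    proof -
      obtain a m where a: "a \<in> carrier R" "m \<in> span F" "q = a \<odot>\<^bsub>M\<^esub> x \<oplus>\<^bsub>M\<^esub> m" using q by blast
      have "\<ominus>\<^bsub>M\<^esub> q = (\<ominus> a) \<odot>\<^bsub>M\<^esub> x \<oplus>\<^bsub>M\<^esub> \<ominus>\<^bsub>M\<^esub> m"
        using a x sc by (simp add: smult_l_minus M.minus_add)
      then show ?thesis using a submoduleE(3)[OF S] by blast
    qed
    show "q \<oplus>\<^bsub>M\<^esub> q' \<in> ?Q" if q: "q \<in> ?Q" "q' \<in> ?Q" for q q'
    proof -
      obtain a m where a: "a \<in> carrier R" "m \<in> span F" "q = a \<odot>\<^bsub>M\<^esub> x \<oplus>\<^bsub>M\<^esub> m" using q by blast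
      obtain a' m' where a': "a' \<in> carrier R" "m' \<in> span F" "q' = a' \<odot>\<^bsub>M\<^esub> x \<oplus>\<^bsub>M\<^esub> m'" using q by blast
      have "q \<oplus>\<^bsub>M\<^esub> q' = (a \<oplus> a') \<odot>\<^bsub>M\<^esub> x \<oplus>\<^bsub>M\<^esub> (m \<oplus>\<^bsub>M\<^esub> m')"
        using a a' x sc by (simp add: smult_l_distr M.a_ac)
      then show ?thesis using a a' submoduleE(5)[OF S] by blast
    qed
    show "b \<odot>\<^bsub>M\<^esub> q \<in> ?Q" if b: "b \<in> carrier R" and q: "q \<in> ?Q" for b q
    proof -
      obtain a m where a: "a \<in> carrier R" "m \<in> span F" "q = a \<odot>\<^bsub>M\<^esub> x \<oplus>\<^bsub>M\<^esub> m" using q by blast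
      have "b \<odot>\<^bsub>M\<^esub> q = (b \<otimes> a) \<odot>\<^bsub>M\<^esub> x \<oplus>\<^bsub>M\<^esub> b \<odot>\<^bsub>M\<^esub> m"
        using a b x sc by (simp add: smult_r_distr smult_assoc1)
      then show ?thesis using a b submoduleE(4)[OF S] by blast
    qed
  qed
  have "f \<in> ?Q" if f: "f \<in> insert x F" for f
  proof (cases "f = x")
    case True
    then show ?thesis
      using x submodule_zero_closed[OF S] by (intro CollectI exI[of _ "\<one>"] exI[of _ "\<zero>\<^bsub>M\<^esub>"]) simp
  next
    case False
    then have "f \<in> span F" using f span_superset by blast
    then show ?thesis
      using x sc by (intro CollectI exI[of _ "\<zero>"] exI[of _ f]) simp
  qed
  then have "span (insert x F) \<subseteq> ?Q" by (intro span_least[OF Q]) blast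
  then show ?thesis using p that by blast
qed

text \<open>The classical induction on generators: the ideal of possible coefficients of the last
  generator is finitely generated, and what remains lies in the span of the others.\<close>

lemma noetherian_Int_span:
  assumes noeth: "noetherian_module R (self_module R)" and "finite F"
  shows "\<lbrakk>F \<subseteq> carrier M; submodule P R M\<rbrakk> \<Longrightarrow>
    \<exists>G. finite G \<and> G \<subseteq> P \<and> (\<forall>Q. submodule Q R M \<and> G \<subseteq> Q \<longrightarrow> P \<inter> span F \<subseteq> Q)"
  using \<open>finite F\<close>
proof (induction F)
  case empty
  have "submodule {\<zero>\<^bsub>M\<^esub>} R M" by (rule submoduleI) auto
  then have "span {} \<subseteq> {\<zero>\<^bsub>M\<^esub>}" by (intro span_least) auto
  then have "\<forall>Q. submodule Q R M \<and> {} \<subseteq> Q \<longrightarrow> P \<inter> span {} \<subseteq> Q"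
    using submodule_zero_closed by blast
  then show ?case by blast
next
  case (insert x F)
  interpret self: plain_module R "self_module R"
    by (intro plain_module.intro module_self R.is_cring)
  have x: "x \<in> carrier M" and F: "F \<subseteq> carrier M" using insert.prems by auto
  note P = insert.prems(2)
  note S = submodule_span[OF F]
  have sc: "m \<in> carrier M" if "m \<in> span F" for m using that submoduleE(1)[OF S] by blast
  obtain G where G: "finite G" "G \<subseteq> P"
    and Gs: "\<forall>Q. submodule Q R M \<and> G \<subseteq> Q \<longrightarrow> P \<inter> span F \<subseteq> Q"
    using insert.IH[OF F P] by blast
  \<comment> \<open>The ideal of coefficients of \<open>x\<close> in elements of \<open>Q\<close>
    that are a multiple of \<open>x\<close> plus an element of \<open>span F\<close>.\<close>
  define I where "I Q = {a \<in> carrier R. \<exists>m\<in>span F. a \<odot>\<^bsub>M\<^esub> x \<oplus>\<^bsub>M\<^esub> m \<in> Q}" for Q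
  have I: "submodule (I Q) R (self_module R)" if Q: "submodule Q R M" for Q
  proof (rule self.submoduleI)
    show "I Q \<subseteq> carrier (self_module R)" unfolding I_def by auto
    show "\<zero>\<^bsub>self_module R\<^esub> \<in> I Q"
      unfolding I_def using x submodule_zero_closed[OF S] submodule_zero_closed[OF Q]
      by (auto intro!: bexI[of _ "\<zero>\<^bsub>M\<^esub>"])
    show sm: "b \<odot>\<^bsub>self_module R\<^esub> a \<in> I Q" if b: "b \<in> carrier R" and a: "a \<in> I Q" for b a
    proof -
      obtain m where m: "a \<in> carrier R" "m \<in> span F" "a \<odot>\<^bsub>M\<^esub> x \<oplus>\<^bsub>M\<^esub> m \<in> Q" using a unfolding I_def by blast
      have "b \<odot>\<^bsub>M\<^esub> (a \<odot>\<^bsub>M\<^esub> x \<oplus>\<^bsub>M\<^esub> m) = (b \<otimes> a) \<odot>\<^bsub>M\<^esub> x \<oplus>\<^bsub>M\<^esub> b \<odot>\<^bsub>M\<^esub> m"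
        using m b x sc by (simp add: smult_r_distr smult_assoc1)
      moreover have "b \<odot>\<^bsub>M\<^esub> (a \<odot>\<^bsub>M\<^esub> x \<oplus>\<^bsub>M\<^esub> m) \<in> Q" by (rule submoduleE(4)[OF Q b m(3)])
      ultimately show ?thesis
        unfolding I_def using b m submoduleE(4)[OF S b m(2)] by auto
    qed
    show "\<ominus>\<^bsub>self_module R\<^esub> a \<in> I Q" if a: "a \<in> I Q" for a
    proof -
      have ac: "a \<in> carrier R" using a unfolding I_def by blast
      have "\<ominus>\<^bsub>self_module R\<^esub> a = (\<ominus> \<one>) \<odot>\<^bsub>self_module R\<^esub> a"
        using ac self.smult_l_minus[of \<one> a] by simp
      then show ?thesis using sm[OF _ a, of "\<ominus> \<one>"] by simp
    qed
    show "a \<oplus>\<^bsub>self_module R\<^esub> b \<in> I Q" if a: "a \<in> I Q" "b \<in> I Q" for a b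
    proof -
      obtain m where m: "a \<in> carrier R" "m \<in> span F" "a \<odot>\<^bsub>M\<^esub> x \<oplus>\<^bsub>M\<^esub> m \<in> Q" using a unfolding I_def by blast
      obtain n where n: "b \<in> carrier R" "n \<in> span F" "b \<odot>\<^bsub>M\<^esub> x \<oplus>\<^bsub>M\<^esub> n \<in> Q" using a unfolding I_def by blast
      have "(a \<odot>\<^bsub>M\<^esub> x \<oplus>\<^bsub>M\<^esub> m) \<oplus>\<^bsub>M\<^esub> (b \<odot>\<^bsub>M\<^esub> x \<oplus>\<^bsub>M\<^esub> n) = (a \<oplus> b) \<odot>\<^bsub>M\<^esub> x \<oplus>\<^bsub>M\<^esub> (m \<oplus>\<^bsub>M\<^esub> n)"
        using m n x sc by (simp add: smult_l_distr M.a_ac)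
      moreover have "(a \<odot>\<^bsub>M\<^esub> x \<oplus>\<^bsub>M\<^esub> m) \<oplus>\<^bsub>M\<^esub> (b \<odot>\<^bsub>M\<^esub> x \<oplus>\<^bsub>M\<^esub> n) \<in> Q" by (rule submoduleE(5)[OF Q m(3) n(3)])
      ultimately show ?thesis
        unfolding I_def using m n submoduleE(5)[OF S m(2) n(2)] by auto
    qed
  qed
  obtain J where J: "finite J" "J \<subseteq> I P"
    and Js: "\<forall>K. submodule K R (self_module R) \<and> J \<subseteq> K \<longrightarrow> I P \<subseteq> K"
    using noeth[unfolded noetherian_module_def, rule_format, OF I[OF P]] by blast
  have "\<forall>a\<in>J. \<exists>m. m \<in> span F \<and> a \<odot>\<^bsub>M\<^esub> x \<oplus>\<^bsub>M\<^esub> m \<in> P" using J(2) unfolding I_def by blast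
  then obtain w where w: "\<forall>a\<in>J. w a \<in> span F \<and> a \<odot>\<^bsub>M\<^esub> x \<oplus>\<^bsub>M\<^esub> w a \<in> P" by (rule bchoice[THEN exE])
  \<comment> \<open>Elements of \<open>P\<close> realizing the generators of \<open>I P\<close>,
    together with generators of \<open>P \<inter> span F\<close>.\<close>
  let ?G = "(\<lambda>a. a \<odot>\<^bsub>M\<^esub> x \<oplus>\<^bsub>M\<^esub> w a) ` J \<union> G"
  have "P \<inter> span (insert x F) \<subseteq> Q" if Q: "submodule Q R M" and GQ: "?G \<subseteq> Q" for Q
  proof
    fix p assume p: "p \<in> P \<inter> span (insert x F)"
    then obtain a m where a: "a \<in> carrier R" "m \<in> span F" "p = a \<odot>\<^bsub>M\<^esub> x \<oplus>\<^bsub>M\<^esub> m"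
      using span_insert[OF x F] by blast
    have "a \<in> I P" unfolding I_def using a p by blast
    moreover have "J \<subseteq> I (P \<inter> Q)"
    proof
      fix b assume b: "b \<in> J"
      then have "w b \<in> span F" "b \<odot>\<^bsub>M\<^esub> x \<oplus>\<^bsub>M\<^esub> w b \<in> P \<inter> Q" "b \<in> carrier R"
        using w GQ J(2) unfolding I_def by auto
      then show "b \<in> I (P \<inter> Q)" unfolding I_def by blast
    qed
    \<comment> \<open>Using \<open>P \<inter> Q\<close> instead of \<open>Q\<close> provides an
      element with coefficient \<open>a\<close> that lies in both.\<close>
    ultimately have "a \<in> I (P \<inter> Q)" using Js I[OF submodule_Int[OF P Q]] by blast
    then obtain n where n: "n \<in> span F" "a \<odot>\<^bsub>M\<^esub> x \<oplus>\<^bsub>M\<^esub> n \<in> P" "a \<odot>\<^bsub>M\<^esub> x \<oplus>\<^bsub>M\<^esub> n \<in> Q"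
      unfolding I_def by blast
    \<comment> \<open>The difference of \<open>p\<close> and \<open>?q\<close> lies in
      \<open>P\<close> and, as the multiples of \<open>x\<close> cancel, in \<open>span F\<close>;
      so it lies in \<open>Q\<close>, and hence does \<open>p\<close>.\<close>
    let ?q = "a \<odot>\<^bsub>M\<^esub> x \<oplus>\<^bsub>M\<^esub> n"
    have c: "?q \<in> carrier M" "p \<in> carrier M" using a n x sc by auto
    have eq: "p \<oplus>\<^bsub>M\<^esub> \<ominus>\<^bsub>M\<^esub> ?q = m \<oplus>\<^bsub>M\<^esub> \<ominus>\<^bsub>M\<^esub> n"
    proof -
      have "p \<oplus>\<^bsub>M\<^esub> \<ominus>\<^bsub>M\<^esub> ?q = (a \<odot>\<^bsub>M\<^esub> x \<oplus>\<^bsub>M\<^esub> \<ominus>\<^bsub>M\<^esub> (a \<odot>\<^bsub>M\<^esub> x)) \<oplus>\<^bsub>M\<^esub> (m \<oplus>\<^bsub>M\<^esub> \<ominus>\<^bsub>M\<^esub> n)"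
        unfolding a(3) using a(1,2) n x sc by (simp add: M.minus_add M.a_ac)
      then show ?thesis using a(1,2) n x sc by (simp add: M.r_neg)
    qed
    have "p \<oplus>\<^bsub>M\<^esub> \<ominus>\<^bsub>M\<^esub> ?q \<in> P" using p submoduleE(5)[OF P _ submoduleE(3)[OF P n(2)]] by blast
    moreover have "m \<oplus>\<^bsub>M\<^esub> \<ominus>\<^bsub>M\<^esub> n \<in> span F" by (rule submoduleE(5)[OF S a(2) submoduleE(3)[OF S n(1)]])
    moreover have "P \<inter> span F \<subseteq> Q" using Gs Q GQ by blast
    ultimately have "p \<oplus>\<^bsub>M\<^esub> \<ominus>\<^bsub>M\<^esub> ?q \<in> Q" unfolding eq by blast
    then have "(p \<oplus>\<^bsub>M\<^esub> \<ominus>\<^bsub>M\<^esub> ?q) \<oplus>\<^bsub>M\<^esub> ?q \<in> Q" by (rule submoduleE(5)[OF Q _ n(3)])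
    then show "p \<in> Q" using c by (simp only: M.a_assoc M.a_inv_closed M.l_neg M.r_zero)
  qed
  then have all: "\<forall>Q. submodule Q R M \<and> ?G \<subseteq> Q \<longrightarrow> P \<inter> span (insert x F) \<subseteq> Q"
    by (intro allI impI) (elim conjE)
  have "finite ?G" "?G \<subseteq> P" using J(1) G w by auto
  then show ?case using all by (intro exI[of _ ?G] conjI)
qed

lemma fg_imp_noetherian:
  assumes "noetherian_module R (self_module R)" "fg_module R M"
  shows "noetherian_module R M"
  unfolding noetherian_module_def
proof (intro allI impI)
  fix P assume P: "submodule P R M"
  obtain F where F: "finite F" "F \<subseteq> carrier M" "\<forall>Q. submodule Q R M \<and> F \<subseteq> Q \<longrightarrow> carrier M \<subseteq> Q"
    using assms(2) unfolding fg_module_def by blast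
  have "P \<subseteq> span F" using F(3) submodule_span[OF F(2)] span_superset submoduleE(1)[OF P] by blast
  then have "P \<inter> span F = P" by blast
  then show "\<exists>F. finite F \<and> F \<subseteq> P \<and> (\<forall>Q. submodule Q R M \<and> F \<subseteq> Q \<longrightarrow> P \<subseteq> Q)"
    using noetherian_Int_span[OF assms(1) F(1,2) P] by simp
qed

end

context tilde_chart
begin

text \<open>\<open>\<tau>\<close> is additive, \<open>\<sigma>\<close>-linear and onto, so linear
  combinations of generators of \<open>N\<close> go to linear combinations of their images.\<close>

lemma fg_chart:
  assumes "finitely_generated_module A N"
  shows "fg_module (\<O> U) (\<M> U)"
proof -
  interpret MU: module "\<O> U" "\<M> U" by (rule module_M[OF U_open])
  obtain F where F: "finite F" "F \<subseteq> carrier N"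
    "\<forall>m\<in>carrier N. \<exists>c\<in>F \<rightarrow> carrier A. m = (\<Oplus>\<^bsub>N\<^esub>x\<in>F. c x \<odot>\<^bsub>N\<^esub> x)"
    using assms unfolding finitely_generated_module_def by blast
  have "carrier (\<M> U) \<subseteq> Q" if Q: "submodule Q (\<O> U) (\<M> U)" and FQ: "\<tau> ` F \<subseteq> Q" for Q
  proof
    fix m assume "m \<in> carrier (\<M> U)"
    then obtain n where n: "n \<in> carrier N" "m = \<tau> n" by (rule tau_surj)
    obtain c where c: "c \<in> F \<rightarrow> carrier A" "n = (\<Oplus>\<^bsub>N\<^esub>x\<in>F. c x \<odot>\<^bsub>N\<^esub> x)" using F(3) n(1) by blast
    have "\<tau> (\<Oplus>\<^bsub>N\<^esub>x\<in>G. c x \<odot>\<^bsub>N\<^esub> x) \<in> Q" if "finite G" "G \<subseteq> F" for G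
      using that
    proof (induction G)
      case empty
      show ?case using subgroup.one_closed[OF submodule.axioms(1)[OF Q]] by (simp add: tau_zero)
    next
      case (insert x G)
      have xc: "c x \<in> carrier A" "x \<in> carrier N" "x \<in> F" using insert.prems c(1) F(2) by auto
      have G: "(\<lambda>x. c x \<odot>\<^bsub>N\<^esub> x) \<in> G \<rightarrow> carrier N" using insert.prems c(1) F(2) by (auto simp: Pi_iff subset_iff)
      have sum: "(\<Oplus>\<^bsub>N\<^esub>x\<in>insert x G. c x \<odot>\<^bsub>N\<^esub> x) = c x \<odot>\<^bsub>N\<^esub> x \<oplus>\<^bsub>N\<^esub> (\<Oplus>\<^bsub>N\<^esub>x\<in>G. c x \<odot>\<^bsub>N\<^esub> x)"
        by (rule N.M.finsum_insert[OF insert.hyps G]) (use xc in simp)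
      have "\<tau> (c x \<odot>\<^bsub>N\<^esub> x) \<in> Q"
        unfolding tau_smult[OF xc(1,2)] using FQ xc(3) by (intro MU.submoduleE(4)[OF Q sigma_closed[OF xc(1)]]) blast
      moreover have "\<tau> (\<Oplus>\<^bsub>N\<^esub>x\<in>G. c x \<odot>\<^bsub>N\<^esub> x) \<in> Q" using insert by blast
      ultimately show ?case
        unfolding sum using tau_add[OF _ N.M.finsum_closed[OF G], of "c x \<odot>\<^bsub>N\<^esub> x"] xc MU.submoduleE(5)[OF Q] by simp
    qed
    from this[OF F(1) subset_refl] show "m \<in> Q" unfolding n(2) c(2) .
  qed
  moreover have "\<tau> ` F \<subseteq> carrier (\<M> U)" using F(2) tau_closed by blast
  ultimately show ?thesis unfolding fg_module_def using F(1) by (intro exI[of _ "\<tau> ` F"]) blast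
qed

text \<open>A submodule of the ring is an ideal; its preimage under \<open>\<sigma>\<close> is
  finitely generated in \<open>A\<close>, and the images of the generators generate it.\<close>

lemma noetherian_chart:
  assumes A: "noetherian_ring A"
  shows "noetherian_module (\<O> U) (self_module (\<O> U))"
  unfolding noetherian_module_def
proof (intro allI impI)
  note OU = cring_O[OF U_open]
  interpret h: ring_hom_ring A "\<O> U" \<sigma>
    by (intro ring_hom_ringI2 N.R.ring_axioms cring.axioms(1)[OF OU] sigma_hom)
  fix P assume P: "submodule P (\<O> U) (self_module (\<O> U))"
  let ?I = "\<lambda>Q. {a \<in> carrier A. \<sigma> a \<in> Q}"
  have I: "ideal (?I Q) A" if "submodule Q (\<O> U) (self_module (\<O> U))" for Q
    by (rule h.ideal_vimage[OF submodule_self_imp_ideal[OF OU that]])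
  obtain G where G: "G \<subseteq> carrier A" "finite G" "?I P = Idl\<^bsub>A\<^esub> G"
    using noetherian_ring.finetely_gen[OF A I[OF P]] by blast
  have "G \<subseteq> ?I P" unfolding G(3) by (rule N.R.genideal_self[OF G(1)])
  moreover have "P \<subseteq> Q" if Q: "submodule Q (\<O> U) (self_module (\<O> U))" and GQ: "\<sigma> ` G \<subseteq> Q" for Q
  proof
    fix p assume p: "p \<in> P"
    interpret PI: ideal P "\<O> U" by (rule submodule_self_imp_ideal[OF OU P])
    obtain a where a: "a \<in> carrier A" "p = \<sigma> a" using sigma_surj[OF PI.a_Hcarr[OF p]] .
    have "?I P \<subseteq> ?I Q" unfolding G(3) by (rule N.R.genideal_minimal[OF I[OF Q]]) (use G(1) GQ in blast)
    then show "p \<in> Q" using a p by blast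
  qed
  ultimately show "\<exists>F. finite F \<and> F \<subseteq> P \<and> (\<forall>Q. submodule Q (\<O> U) (self_module (\<O> U)) \<and> F \<subseteq> Q \<longrightarrow> P \<subseteq> Q)"
    using G(2) by (intro exI[of _ "\<sigma> ` G"]) blast
qed

end

context sheaf_of_modules
begin

lemma submodule_preimage:
  assumes V: "opn V" and W: "opn W" "W \<subseteq> V" and Q: "submodule Q (\<O> W) (\<M> W)"
  shows "submodule {m \<in> carrier (\<M> V). \<mu> V W m \<in> Q} (\<O> V) (\<M> V)"
proof -
  interpret MV: module "\<O> V" "\<M> V" by (rule module_M[OF V])
  interpret MW: module "\<O> W" "\<M> W" by (rule module_M[OF W(1)])
  show ?thesis
  proof (rule MV.submoduleI)
    show "\<zero>\<^bsub>\<M> V\<^esub> \<in> {m \<in> carrier (\<M> V). \<mu> V W m \<in> Q}"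
      using V W subgroup.one_closed[OF submodule.axioms(1)[OF Q]] by simp
  qed (use V W MW.submoduleE(3,4,5)[OF Q] in auto)
qed

text \<open>Up to a power of \<open>g\<close>, a unit on \<open>D U g\<close>, the section
  \<open>n\<close> is the restriction of a section over \<open>U\<close>; so membership in
  \<open>Q\<close> can be tested on restrictions.\<close>

lemma basic_open_generated:
  assumes U: "opn U" and loc: "localizes X M U" and g: "g \<in> carrier (\<O> U)"
    and Q: "submodule Q (\<O> (D U g)) (\<M> (D U g))" and n: "n \<in> carrier (\<M> (D U g))"
    and img: "\<And>m k. \<lbrakk>m \<in> carrier (\<M> U); \<mu> U (D U g) m =
      \<rho> U (D U g) g [^]\<^bsub>\<O> (D U g)\<^esub> (k::nat) \<odot>\<^bsub>\<M> (D U g)\<^esub> n\<rbrakk> \<Longrightarrow> \<mu> U (D U g) m \<in> Q"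
  shows "n \<in> Q"
proof -
  let ?W = "D U g"
  interpret MW: module "\<O> ?W" "\<M> ?W" by (rule module_M[OF D_open])
  obtain k :: nat and m where m: "m \<in> carrier (\<M> U)"
    "\<mu> U ?W m = \<rho> U ?W g [^]\<^bsub>\<O> ?W\<^esub> k \<odot>\<^bsub>\<M> ?W\<^esub> n" using localizes_lift[OF loc g n] .
  let ?u = "\<rho> U ?W g [^]\<^bsub>\<O> ?W\<^esub> k"
  have u: "?u \<in> Units (\<O> ?W)" by (rule MW.R.Units_pow_closed[OF D_unit[OF U g]])
  have "inv\<^bsub>\<O> ?W\<^esub> ?u \<odot>\<^bsub>\<M> ?W\<^esub> (?u \<odot>\<^bsub>\<M> ?W\<^esub> n) \<in> Q"
    using img[OF m] unfolding m(2) by (rule MW.submoduleE(4)[OF Q MW.R.Units_inv_closed[OF u]])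
  moreover have "inv\<^bsub>\<O> ?W\<^esub> ?u \<odot>\<^bsub>\<M> ?W\<^esub> (?u \<odot>\<^bsub>\<M> ?W\<^esub> n) = (inv\<^bsub>\<O> ?W\<^esub> ?u \<otimes>\<^bsub>\<O> ?W\<^esub> ?u) \<odot>\<^bsub>\<M> ?W\<^esub> n"
    using u n MW.R.Units_closed[OF u] by (simp only: MW.smult_assoc1 MW.R.Units_inv_closed)
  ultimately show ?thesis using n by (simp only: MW.R.Units_l_inv[OF u] MW.smult_one)
qed

text \<open>A submodule over \<open>D U g\<close> is recovered from its preimage over
  \<open>U\<close>, whose finitely many generators restrict to generators.\<close>

lemma noetherian_D:
  assumes U: "opn U" and loc: "localizes X M U" and g: "g \<in> carrier (\<O> U)"
    and noeth: "noetherian_module (\<O> U) (\<M> U)"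
  shows "noetherian_module (\<O> (D U g)) (\<M> (D U g))"
  unfolding noetherian_module_def
proof (intro allI impI)
  let ?W = "D U g"
  interpret MW: module "\<O> ?W" "\<M> ?W" by (rule module_M[OF D_open])
  fix P assume P: "submodule P (\<O> ?W) (\<M> ?W)"
  let ?I = "\<lambda>Q. {m \<in> carrier (\<M> U). \<mu> U ?W m \<in> Q}"
  note I = submodule_preimage[OF U D_open D_subset]
  obtain G where G: "finite G" "G \<subseteq> ?I P" "\<forall>Q. submodule Q (\<O> U) (\<M> U) \<and> G \<subseteq> Q \<longrightarrow> ?I P \<subseteq> Q"
    using noeth[unfolded noetherian_module_def, rule_format, OF I[OF P]] by blast
  have "P \<subseteq> Q" if Q: "submodule Q (\<O> ?W) (\<M> ?W)" and GQ: "\<mu> U ?W ` G \<subseteq> Q" for Q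
  proof
    fix p assume p: "p \<in> P"
    have pc: "p \<in> carrier (\<M> ?W)" using MW.submoduleE(1)[OF P] p by blast
    have sub: "?I P \<subseteq> ?I Q" using G(2,3) I[OF Q] GQ by blast
    show "p \<in> Q"
    proof (rule basic_open_generated[OF U loc g Q pc])
      fix m and k :: nat
      assume m: "m \<in> carrier (\<M> U)" "\<mu> U ?W m = \<rho> U ?W g [^]\<^bsub>\<O> ?W\<^esub> k \<odot>\<^bsub>\<M> ?W\<^esub> p"
      have "\<mu> U ?W m \<in> P" unfolding m(2) using U g by (intro MW.submoduleE(4)[OF P _ p]) simp
      then show "\<mu> U ?W m \<in> Q" using sub m(1) by blast
    qed
  qed
  moreover have "\<mu> U ?W ` G \<subseteq> P" using G(2) by blast
  ultimately show "\<exists>F. finite F \<and> F \<subseteq> P \<and> (\<forall>Q. submodule Q (\<O> ?W) (\<M> ?W) \<and> F \<subseteq> Q \<longrightarrow> P \<subseteq> Q)"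
    using G(1) by (intro exI[of _ "\<mu> U ?W ` G"]) blast
qed

lemma fg_D:
  assumes U: "opn U" and loc: "localizes X M U" and g: "g \<in> carrier (\<O> U)"
    and fg: "fg_module (\<O> U) (\<M> U)"
  shows "fg_module (\<O> (D U g)) (\<M> (D U g))"
proof -
  let ?W = "D U g"
  obtain F where F: "finite F" "F \<subseteq> carrier (\<M> U)"
    "\<forall>Q. submodule Q (\<O> U) (\<M> U) \<and> F \<subseteq> Q \<longrightarrow> carrier (\<M> U) \<subseteq> Q"
    using fg unfolding fg_module_def by blast
  have "carrier (\<M> ?W) \<subseteq> Q" if Q: "submodule Q (\<O> ?W) (\<M> ?W)" and FQ: "\<mu> U ?W ` F \<subseteq> Q" for Q
  proof
    fix n assume n: "n \<in> carrier (\<M> ?W)"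
    have "carrier (\<M> U) \<subseteq> {m \<in> carrier (\<M> U). \<mu> U ?W m \<in> Q}"
      using F(2,3) submodule_preimage[OF U D_open D_subset Q] FQ by blast
    then show "n \<in> Q" by (intro basic_open_generated[OF U loc g Q n]) blast
  qed
  moreover have "\<mu> U ?W ` F \<subseteq> carrier (\<M> ?W)" using F(2) U by auto
  ultimately show ?thesis unfolding fg_module_def using F(1) by (intro exI[of _ "\<mu> U ?W ` F"]) blast
qed

text \<open>One chart witnesses that the ring is Noetherian and another that the module is finitely
  generated. Two successive basic restrictions starting from \<open>V\<close> reach a set that is
  basic in suitable sets for both, and each step is of the kind along which closures
  persist.\<close>

lemma noetherian_neighbourhood:
  assumes ns: "noetherian_scheme X" and coh: "coherent X M" and V: "aff V" and x: "x \<in> V"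
  obtains E g E' g' where "g \<in> carrier (\<O> V)" "E = D V g" "g' \<in> carrier (\<O> E)" "E' = D E g'"
    "x \<in> E'" "noetherian_module (\<O> E') (\<M> E')"
proof -
  note Vo = aff_open[OF V]
  have xt: "x \<in> topspace (space_top X)" using openin_subset[OF Vo] x by blast
  obtain U A f \<phi> where ch: "affine_chart X U A f \<phi>" and xU: "x \<in> U" and A: "noetherian_ring A"
    using ns xt unfolding noetherian_scheme_def by blast
  interpret S: tilde_chart X "self_sheaf X" U A f \<phi> "self_module A" \<phi> by (rule tilde_chart_self[OF ch])
  obtain U2 A2 f2 \<phi>2 N2 where ch2: "affine_chart X U2 A2 f2 \<phi>2" and xU2: "x \<in> U2"
    and til: "tilde_on_chart X M U2 A2 f2 \<phi>2 N2" and fgN: "finitely_generated_module A2 N2"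
    using coh xt unfolding coherent_def by blast
  obtain \<psi> where "tilde_chart X M U2 A2 f2 \<phi>2 N2 \<psi>" using tilde_on_chart_imp[OF ch2 til] .
  then interpret C: tilde_chart X M U2 A2 f2 \<phi>2 N2 \<psi> .
  have U: "aff U" and U2: "aff U2" by (rule S.aff_U, rule C.aff_U)
  obtain g1 g where g1: "g1 \<in> carrier (\<O> U)" and g: "g \<in> carrier (\<O> V)" and eq1: "D U g1 = D V g"
    and x1: "x \<in> D U g1" and "D U g1 \<subseteq> V"
    using common_basic_open[OF U V Vo xU x x] .
  let ?E = "D V g"
  have E: "aff ?E" by (rule aff_D[OF V g])
  have n1: "noetherian_module (\<O> ?E) (self_module (\<O> ?E))"
    using S.noetherian_D[OF S.U_open aff_localizes[OF U] g1] S.noetherian_chart[OF A]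
    unfolding eq1 by simp
  have xE: "x \<in> ?E" using x1 eq1 by simp
  obtain g2 g' where g2: "g2 \<in> carrier (\<O> U2)" and g': "g' \<in> carrier (\<O> ?E)" and eq2: "D U2 g2 = D ?E g'"
    and x2: "x \<in> D U2 g2" and "D U2 g2 \<subseteq> ?E"
    using common_basic_open[OF U2 E D_open xU2 xE xE] .
  let ?E' = "D ?E g'"
  have n2: "noetherian_module (\<O> ?E') (self_module (\<O> ?E'))"
    using S.noetherian_D[OF D_open aff_localizes[OF E] g'] n1 by simp
  have fg: "fg_module (\<O> ?E') (\<M> ?E')"
    using fg_D[OF C.U_open C.localizes_U g2 C.fg_chart[OF fgN]] unfolding eq2 .
  interpret P: plain_module "\<O> ?E'" "\<M> ?E'" by (intro plain_module.intro module_M D_open)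
  show ?thesis using that[OF g refl g' refl] x2 eq2 P.fg_imp_noetherian[OF n2 fg] by simp
qed

end

section \<open>The closure of a sheaf of submodules\<close>

locale closure_sheaf = sheaf_of_modules X M
  for X :: "('x, 'r) ringed_space" and M :: "('x, 'r, 'm) sheaf_module" +
  fixes cl :: "('x, 'r, 'm) module_operation"
  assumes scheme: "scheme X" and preclosure: "preclosure_on_modules X cl"
    and persistent: "openly_persistent X cl" and qc: "quasi_coherent X M"
begin

abbreviation C :: "('x set \<Rightarrow> 'm set) \<Rightarrow> 'x set \<Rightarrow> 'm set" where "C \<equiv> sheaf_closure X cl M"

lemma aff_neighbourhood:
  assumes "opn W" "x \<in> W"
  obtains V where "aff V" "x \<in> V" "V \<subseteq> W"
proof -
  have "x \<in> topspace (space_top X)" using openin_subset[OF assms(1)] assms(2) by blast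
  then obtain U where "affine_open X U" and xU: "x \<in> U" using scheme unfolding scheme_def by blast
  then have U: "aff U" using affine_open_iff_aff by blast
  have UW: "opn (U \<inter> W)" using aff_open[OF U] assms(1) by blast
  have "x \<in> U \<inter> W" using xU assms(2) by blast
  then obtain g where g: "g \<in> carrier (\<O> U)" "x \<in> D U g" "D U g \<subseteq> U \<inter> W"
    using aff_basis[OF U UW Int_lower1] by blast
  then show ?thesis using that[OF aff_D[OF U g(1)] g(2)] by blast
qed

lemma mem_C: "s \<in> C L U \<longleftrightarrow> s \<in> carrier (\<M> U) \<and>
    (\<forall>x\<in>U. \<exists>V. aff V \<and> x \<in> V \<and> V \<subseteq> U \<and> \<mu> U V s \<in> cl V (\<M> V) (L V))"
  unfolding sheaf_closure_def affine_open_iff_aff by blast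

lemma sub_L: "\<lbrakk>submodule_sheaf X M L; opn U\<rbrakk> \<Longrightarrow> submodule (L U) (\<O> U) (\<M> U)"
  unfolding submodule_sheaf_def by blast

lemma res_L: "\<lbrakk>submodule_sheaf X M L; opn U; opn V; V \<subseteq> U; s \<in> L U\<rbrakk> \<Longrightarrow> \<mu> U V s \<in> L V"
  unfolding submodule_sheaf_def by (elim conjE) (rule sheaf_on_restrict)

lemma closure_restrict:
  assumes L: "submodule_sheaf X M L" and V: "aff V" and g: "g \<in> carrier (\<O> V)"
    and s: "s \<in> cl V (\<M> V) (L V)"
  shows "\<mu> V (D V g) s \<in> cl (D V g) (\<M> (D V g)) (L (D V g))"
  by (rule closure_persists[OF preclosure persistent V quasi_coherent_localizes[OF qc V] g
        sub_L[OF L aff_open[OF V]] sub_L[OF L D_open] _ s])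
    (use res_L[OF L aff_open[OF V] D_open D_subset] in blast)

lemma closure_restrict_from:
  assumes L: "submodule_sheaf X M L" and U: "opn U" and V: "aff V" "V \<subseteq> U" and g: "g \<in> carrier (\<O> V)"
    and s: "s \<in> carrier (\<M> U)" "\<mu> U V s \<in> cl V (\<M> V) (L V)"
  shows "\<mu> U (D V g) s \<in> cl (D V g) (\<M> (D V g)) (L (D V g))"
proof -
  have "\<mu> V (D V g) (\<mu> U V s) = \<mu> U (D V g) s"
    by (rule mu_trans[OF U aff_open[OF V(1)] D_open D_subset V(2) s(1)])
  then show ?thesis using closure_restrict[OF L V(1) g s(2)] by simp
qed

text \<open>Zero, negatives and multiples are tested on one neighbourhood, since closures are
  submodules. Only the sum involves two neighbourhoods and hence persistence.\<close>

lemma submodule_C: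
  assumes L: "submodule_sheaf X M L" and U: "opn U"
  shows "submodule (C L U) (\<O> U) (\<M> U)"
proof -
  interpret MU: module "\<O> U" "\<M> U" by (rule module_M[OF U])
  have cls: "submodule (cl V (\<M> V) (L V)) (\<O> V) (\<M> V)" if "aff V" for V
    by (rule cl_submodule(1)[OF preclosure that sub_L[OF L aff_open[OF that]]])
  show ?thesis
  proof (rule MU.submoduleI)
    show "C L U \<subseteq> carrier (\<M> U)" using mem_C by blast
    show "\<zero>\<^bsub>\<M> U\<^esub> \<in> C L U"
      unfolding mem_C
    proof (intro conjI ballI)
      fix x assume "x \<in> U"
      then obtain V where V: "aff V" "x \<in> V" "V \<subseteq> U" using aff_neighbourhood[OF U] by blast
      have "\<mu> U V \<zero>\<^bsub>\<M> U\<^esub> \<in> cl V (\<M> V) (L V)"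
        using mu_zero[OF U aff_open[OF V(1)] V(3)] subgroup.one_closed[OF submodule.axioms(1)[OF cls[OF V(1)]]]
        by simp
      then show "\<exists>V. aff V \<and> x \<in> V \<and> V \<subseteq> U \<and> \<mu> U V \<zero>\<^bsub>\<M> U\<^esub> \<in> cl V (\<M> V) (L V)" using V by blast
    qed simp
    show "\<ominus>\<^bsub>\<M> U\<^esub> s \<in> C L U" if s: "s \<in> C L U" for s
      unfolding mem_C
    proof (intro conjI ballI)
      have sc: "s \<in> carrier (\<M> U)" using s mem_C by blast
      then show "\<ominus>\<^bsub>\<M> U\<^esub> s \<in> carrier (\<M> U)" by simp
      fix x assume "x \<in> U"
      then obtain V where V: "aff V" "x \<in> V" "V \<subseteq> U" "\<mu> U V s \<in> cl V (\<M> V) (L V)"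
        using s unfolding mem_C by blast
      then have "\<mu> U V (\<ominus>\<^bsub>\<M> U\<^esub> s) \<in> cl V (\<M> V) (L V)"
        unfolding mu_minus[OF U aff_open[OF V(1)] V(3) sc]
        by (intro module.submoduleE(3)[OF module_M[OF aff_open[OF V(1)]] cls[OF V(1)]])
      then show "\<exists>V. aff V \<and> x \<in> V \<and> V \<subseteq> U \<and> \<mu> U V (\<ominus>\<^bsub>\<M> U\<^esub> s) \<in> cl V (\<M> V) (L V)" using V by blast
    qed
    show "s \<oplus>\<^bsub>\<M> U\<^esub> t \<in> C L U" if s: "s \<in> C L U" and t: "t \<in> C L U" for s t
      unfolding mem_C
    proof (intro conjI ballI)
      have sc: "s \<in> carrier (\<M> U)" "t \<in> carrier (\<M> U)" using s t mem_C by blast+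
      then show "s \<oplus>\<^bsub>\<M> U\<^esub> t \<in> carrier (\<M> U)" by simp
      fix x assume x: "x \<in> U"
      obtain V where V: "aff V" "x \<in> V" "V \<subseteq> U" "\<mu> U V s \<in> cl V (\<M> V) (L V)"
        using s x unfolding mem_C by blast
      obtain W where W: "aff W" "x \<in> W" "W \<subseteq> U" "\<mu> U W t \<in> cl W (\<M> W) (L W)"
        using t x unfolding mem_C by blast
      \<comment> \<open>A set basic in both neighbourhoods, to which both memberships
        persist.\<close>
      obtain g h where g: "g \<in> carrier (\<O> V)" and h: "h \<in> carrier (\<O> W)" and eq: "D V g = D W h"
        and xD: "x \<in> D V g" and DU: "D V g \<subseteq> U"
        using common_basic_open[OF V(1) W(1) U V(2) W(2) x] .
      have D: "aff (D V g)" by (rule aff_D[OF V(1) g])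
      have "\<mu> U (D V g) s \<in> cl (D V g) (\<M> (D V g)) (L (D V g))"
        by (rule closure_restrict_from[OF L U V(1,3) g sc(1) V(4)])
      moreover have "\<mu> U (D V g) t \<in> cl (D V g) (\<M> (D V g)) (L (D V g))"
        unfolding eq by (rule closure_restrict_from[OF L U W(1,3) h sc(2) W(4)])
      ultimately have "\<mu> U (D V g) (s \<oplus>\<^bsub>\<M> U\<^esub> t) \<in> cl (D V g) (\<M> (D V g)) (L (D V g))"
        unfolding mu_add[OF U D_open DU sc] by (rule module.submoduleE(5)[OF module_M[OF D_open] cls[OF D]])
      then show "\<exists>V. aff V \<and> x \<in> V \<and> V \<subseteq> U \<and> \<mu> U V (s \<oplus>\<^bsub>\<M> U\<^esub> t) \<in> cl V (\<M> V) (L V)"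
        using D xD DU by blast
    qed
    show "a \<odot>\<^bsub>\<M> U\<^esub> s \<in> C L U" if a: "a \<in> carrier (\<O> U)" and s: "s \<in> C L U" for a s
      unfolding mem_C
    proof (intro conjI ballI)
      have sc: "s \<in> carrier (\<M> U)" using s mem_C by blast
      then show "a \<odot>\<^bsub>\<M> U\<^esub> s \<in> carrier (\<M> U)" using a by simp
      fix x assume "x \<in> U"
      then obtain V where V: "aff V" "x \<in> V" "V \<subseteq> U" "\<mu> U V s \<in> cl V (\<M> V) (L V)"
        using s unfolding mem_C by blast
      then have "\<mu> U V (a \<odot>\<^bsub>\<M> U\<^esub> s) \<in> cl V (\<M> V) (L V)"
        unfolding mu_smult[OF U aff_open[OF V(1)] V(3) a sc]
        using rho_closed[OF U aff_open[OF V(1)] V(3) a]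
        by (intro module.submoduleE(4)[OF module_M[OF aff_open[OF V(1)]] cls[OF V(1)]])
      then show "\<exists>V. aff V \<and> x \<in> V \<and> V \<subseteq> U \<and> \<mu> U V (a \<odot>\<^bsub>\<M> U\<^esub> s) \<in> cl V (\<M> V) (L V)" using V by blast
    qed
  qed
qed

text \<open>The affine set witnessing membership near \<open>x\<close> may stick out of
  \<open>V\<close>; it is replaced by a basic open subset inside \<open>V\<close>.\<close>

lemma C_restrict:
  assumes L: "submodule_sheaf X M L" and U: "opn U" and V: "opn V" "V \<subseteq> U" and s: "s \<in> C L U"
  shows "\<mu> U V s \<in> C L V"
  unfolding mem_C
proof (intro conjI ballI)
  have sc: "s \<in> carrier (\<M> U)" using s mem_C by blast
  show "\<mu> U V s \<in> carrier (\<M> V)" by (rule mu_closed[OF U V sc])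
  fix x assume x: "x \<in> V"
  then obtain W where W: "aff W" "x \<in> W" "W \<subseteq> U" "\<mu> U W s \<in> cl W (\<M> W) (L W)"
    using s V(2) unfolding mem_C by blast
  have "opn (W \<inter> V)" "x \<in> W \<inter> V" using aff_open[OF W(1)] V(1) W(2) x by auto
  then obtain g where g: "g \<in> carrier (\<O> W)" "x \<in> D W g" "D W g \<subseteq> W \<inter> V"
    using aff_basis[OF W(1) _ Int_lower1] by blast
  have DV: "D W g \<subseteq> V" using g(3) by blast
  have "\<mu> V (D W g) (\<mu> U V s) \<in> cl (D W g) (\<M> (D W g)) (L (D W g))"
    unfolding mu_trans[OF U V(1) D_open DV V(2) sc]
    by (rule closure_restrict_from[OF L U W(1,3) g(1) sc W(4)])
  then show "\<exists>W. aff W \<and> x \<in> W \<and> W \<subseteq> V \<and> \<mu> V W (\<mu> U V s) \<in> cl W (\<M> W) (L W)"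
    using aff_D[OF W(1) g(1)] g(2) DV by blast
qed

text \<open>Membership in the closure is a local condition, so a section glued in \<open>M\<close>
  from sections of the closure belongs to it.\<close>

lemma submodule_sheaf_C:
  assumes L: "submodule_sheaf X M L"
  shows "submodule_sheaf X M (C L)"
  unfolding submodule_sheaf_def
proof (intro conjI allI impI)
  show "submodule (C L U) (\<O> U) (\<M> U)" if "opn U" for U by (rule submodule_C[OF L that])
  have CM: "s \<in> carrier (\<M> U)" if "s \<in> C L U" for s U using that mem_C by blast
  show "sheaf_on (space_top X) (C L) \<mu>"
    unfolding sheaf_on_def
  proof (intro conjI allI impI ballI)
    show "presheaf_on (space_top X) (C L) \<mu>"
      unfolding presheaf_on_def
    proof (intro conjI allI impI ballI)
      show "\<mu> U V \<in> C L U \<rightarrow> C L V" if "opn U \<and> opn V \<and> V \<subseteq> U" for U V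
        using C_restrict[OF L] that by blast
      show "\<mu> U U s = s" if "opn U" "s \<in> C L U" for U s by (rule mu_id[OF that(1) CM[OF that(2)]])
      show "\<mu> V W (\<mu> U V s) = \<mu> U W s" if "opn U \<and> opn V \<and> opn W \<and> W \<subseteq> V \<and> V \<subseteq> U" "s \<in> C L U" for U V W s
        using that CM[OF that(2)] by simp
    qed
    fix \<C> assume C: "\<forall>V\<in>\<C>. opn V"
    then have Uo: "opn (\<Union>\<C>)" by blast
    note M = conjunct2[OF sheaf_M[unfolded sheaf_on_def], THEN spec, THEN mp, OF C]
    show "s = t" if "s \<in> C L (\<Union>\<C>)" "t \<in> C L (\<Union>\<C>)" "\<forall>V\<in>\<C>. \<mu> (\<Union>\<C>) V s = \<mu> (\<Union>\<C>) V t" for s t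
      using conjunct1[OF M] CM[OF that(1)] CM[OF that(2)] that(3) by blast
    fix s assume s: "(\<forall>V\<in>\<C>. s V \<in> C L V) \<and> (\<forall>V\<in>\<C>. \<forall>W\<in>\<C>. \<mu> V (V \<inter> W) (s V) = \<mu> W (V \<inter> W) (s W))"
    then have "(\<forall>V\<in>\<C>. s V \<in> carrier (\<M> V)) \<and> (\<forall>V\<in>\<C>. \<forall>W\<in>\<C>. \<mu> V (V \<inter> W) (s V) = \<mu> W (V \<inter> W) (s W))"
      using CM by blast
    from conjunct2[OF M, THEN spec, THEN mp, OF this]
    obtain t where t: "t \<in> carrier (\<M> (\<Union>\<C>))" "\<forall>V\<in>\<C>. \<mu> (\<Union>\<C>) V t = s V" by blast
    have "t \<in> C L (\<Union>\<C>)"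
      unfolding mem_C
    proof (intro conjI ballI t(1))
      fix x assume "x \<in> \<Union>\<C>"
      then obtain V where V: "V \<in> \<C>" "x \<in> V" by blast
      then have "s V \<in> C L V" using s by blast
      then obtain W where W: "aff W" "x \<in> W" "W \<subseteq> V" "\<mu> V W (s V) \<in> cl W (\<M> W) (L W)"
        using V(2) unfolding mem_C by blast
      have VU: "V \<subseteq> \<Union>\<C>" using V(1) by blast
      have "\<mu> V W (\<mu> (\<Union>\<C>) V t) = \<mu> (\<Union>\<C>) W t"
        by (rule mu_trans[OF Uo _ aff_open[OF W(1)] W(3) VU t(1)]) (use C V(1) in blast)
      then have "\<mu> (\<Union>\<C>) W t \<in> cl W (\<M> W) (L W)" using t(2) V(1) W(4) by simp
      then show "\<exists>W. aff W \<and> x \<in> W \<and> W \<subseteq> \<Union>\<C> \<and> \<mu> (\<Union>\<C>) W t \<in> cl W (\<M> W) (L W)"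
        using W VU by blast
    qed
    then show "\<exists>t\<in>C L (\<Union>\<C>). \<forall>V\<in>\<C>. \<mu> (\<Union>\<C>) V t = s V" using t(2) by blast
  qed
qed

lemma C_extensive:
  assumes L: "submodule_sheaf X M L" and U: "opn U"
  shows "L U \<subseteq> C L U"
proof
  fix s assume s: "s \<in> L U"
  show "s \<in> C L U"
    unfolding mem_C
  proof (intro conjI ballI)
    show "s \<in> carrier (\<M> U)" using module.submoduleE(1)[OF module_M[OF U] sub_L[OF L U]] s by blast
    fix x assume "x \<in> U"
    then obtain V where V: "aff V" "x \<in> V" "V \<subseteq> U" using aff_neighbourhood[OF U] by blast
    have "\<mu> U V s \<in> cl V (\<M> V) (L V)"
      using res_L[OF L U aff_open[OF V(1)] V(3) s] cl_submodule(2)[OF preclosure V(1) sub_L[OF L aff_open[OF V(1)]]]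
      by blast
    then show "\<exists>V. aff V \<and> x \<in> V \<and> V \<subseteq> U \<and> \<mu> U V s \<in> cl V (\<M> V) (L V)" using V by blast
  qed
qed

lemma C_mono:
  assumes K: "submodule_sheaf X M K" and L: "submodule_sheaf X M L"
    and KL: "\<And>U. opn U \<Longrightarrow> K U \<subseteq> L U" and U: "opn U"
  shows "C K U \<subseteq> C L U"
proof
  fix s assume s: "s \<in> C K U"
  show "s \<in> C L U"
    unfolding mem_C
  proof (intro conjI ballI)
    show "s \<in> carrier (\<M> U)" using s mem_C by blast
    fix x assume "x \<in> U"
    then obtain V where V: "aff V" "x \<in> V" "V \<subseteq> U" "\<mu> U V s \<in> cl V (\<M> V) (K V)"
      using s unfolding mem_C by blast
    note Vo = aff_open[OF V(1)]
    show "\<exists>V. aff V \<and> x \<in> V \<and> V \<subseteq> U \<and> \<mu> U V s \<in> cl V (\<M> V) (L V)"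
      using V cl_submodule(3)[OF preclosure V(1) sub_L[OF K Vo] sub_L[OF L Vo] KL[OF Vo]] by blast
  qed
qed

text \<open>Each of finitely many sections has its own neighbourhood of \<open>x\<close> where it
  lies in the closure; the product of the defining sections gives one for all.\<close>

lemma finite_common_closure:
  assumes L: "submodule_sheaf X M L" and E: "aff E" and x: "x \<in> E" and F: "finite F"
  shows "F \<subseteq> C L E \<Longrightarrow> \<exists>g\<in>carrier (\<O> E). x \<in> D E g \<and>
    (\<forall>t\<in>F. \<mu> E (D E g) t \<in> cl (D E g) (\<M> (D E g)) (L (D E g)))"
  using F
proof (induction F)
  case empty
  interpret cring "\<O> E" by (rule cring_O[OF aff_open[OF E]])
  show ?case using x D_one[OF aff_open[OF E]] by (intro bexI[of _ "\<one>\<^bsub>\<O> E\<^esub>"]) auto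
next
  case (insert t F)
  note Eo = aff_open[OF E]
  interpret cring "\<O> E" by (rule cring_O[OF Eo])
  obtain g where g: "g \<in> carrier (\<O> E)" "x \<in> D E g"
    and gF: "\<forall>t\<in>F. \<mu> E (D E g) t \<in> cl (D E g) (\<M> (D E g)) (L (D E g))"
    using insert.IH insert.prems by blast
  have tC: "t \<in> C L E" and FC: "F \<subseteq> C L E" using insert.prems by auto
  have tc: "t \<in> carrier (\<M> E)" using tC mem_C by blast
  obtain V where V: "aff V" "x \<in> V" "V \<subseteq> E" "\<mu> E V t \<in> cl V (\<M> V) (L V)"
    using tC x unfolding mem_C by blast
  obtain h e where h: "h \<in> carrier (\<O> V)" and e: "e \<in> carrier (\<O> E)" and eq: "D V h = D E e"
    and xD: "x \<in> D V h" and "D V h \<subseteq> E"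
    using common_basic_open[OF V(1) E Eo V(2) x x] .
  have te: "\<mu> E (D E e) t \<in> cl (D E e) (\<M> (D E e)) (L (D E e))"
    unfolding eq[symmetric] by (rule closure_restrict_from[OF L Eo V(1,3) h tc V(4)])
  \<comment> \<open>The new set is basic in \<open>D E e\<close> and in \<open>D E g\<close>, so the
    closure condition persists to it both for \<open>t\<close> and for the members of
    \<open>F\<close>.\<close>
  have De: "D E (g \<otimes>\<^bsub>\<O> E\<^esub> e) = D (D E e) (\<rho> E (D E e) g)" "D E (g \<otimes>\<^bsub>\<O> E\<^esub> e) = D (D E g) (\<rho> E (D E g) e)"
    unfolding D_restrict[OF Eo D_open D_subset g(1)] D_restrict[OF Eo D_open D_subset e] D_mult[OF Eo g(1) e]
    by blast+
  have rc: "\<rho> E (D E e) g \<in> carrier (\<O> (D E e))" "\<rho> E (D E g) e \<in> carrier (\<O> (D E g))"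
    using Eo g e by auto
  let ?W = "D E (g \<otimes>\<^bsub>\<O> E\<^esub> e)"
  have "\<mu> E ?W t \<in> cl ?W (\<M> ?W) (L ?W)"
    unfolding De(1) by (rule closure_restrict_from[OF L Eo aff_D[OF E e] D_subset rc(1) tc te])
  moreover have "\<mu> E ?W t' \<in> cl ?W (\<M> ?W) (L ?W)" if t': "t' \<in> F" for t'
  proof -
    have "t' \<in> carrier (\<M> E)" using t' FC mem_C by blast
    then show ?thesis
      unfolding De(2) using closure_restrict_from[OF L Eo aff_D[OF E g(1)] D_subset rc(2)] gF t' by blast
  qed
  moreover have "x \<in> ?W" unfolding D_mult[OF Eo g(1) e] using g(2) xD eq by blast
  ultimately show ?case using g(1) e by (intro bexI[of _ "g \<otimes>\<^bsub>\<O> E\<^esub> e"]) auto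
qed

text \<open>The closure condition for the sections of \<open>C L\<close> holds on neighbourhoods
  that depend on the section. Finite generation over \<open>E\<close> provides one neighbourhood for
  all of them, over which idempotence for modules applies.\<close>

lemma C_idempotent:
  assumes L: "submodule_sheaf X M L" and ns: "noetherian_scheme X" and coh: "coherent X M"
    and clo: "closure_on_modules X cl" and U: "opn U"
  shows "C (C L) U = C L U"
proof (intro equalityI subsetI)
  note CL = submodule_sheaf_C[OF L]
  show "s \<in> C (C L) U" if "s \<in> C L U" for s using C_extensive[OF CL U] that by blast
  fix s assume s: "s \<in> C (C L) U"
  show "s \<in> C L U"
    unfolding mem_C
  proof (intro conjI ballI)
    show sc: "s \<in> carrier (\<M> U)" using s mem_C by blast
    fix x assume "x \<in> U"
    then obtain V where V: "aff V" "x \<in> V" "V \<subseteq> U" "\<mu> U V s \<in> cl V (\<M> V) (C L V)"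
      using s unfolding mem_C by blast
    obtain E0 g0 E g where g0: "g0 \<in> carrier (\<O> V)" and E0: "E0 = D V g0" and g: "g \<in> carrier (\<O> E0)"
      and E: "E = D E0 g" and xE: "x \<in> E" and noeth: "noetherian_module (\<O> E) (\<M> E)"
      using noetherian_neighbourhood[OF ns coh V(1,2)] .
    have aE0: "aff E0" unfolding E0 by (rule aff_D[OF V(1) g0])
    have aE: "aff E" unfolding E by (rule aff_D[OF aE0 g])
    note Eo = aff_open[OF aE]
    have E0U: "E0 \<subseteq> U" unfolding E0 using V(3) D_subset by blast
    have EU: "E \<subseteq> U" unfolding E using E0U D_subset by blast
    \<comment> \<open>Membership is carried to \<open>E\<close> in the two basic steps
      provided.\<close>
    have s0: "\<mu> U E0 s \<in> cl E0 (\<M> E0) (C L E0)"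
      unfolding E0 by (rule closure_restrict_from[OF CL U V(1,3) g0 sc V(4)])
    have sE: "\<mu> U E s \<in> cl E (\<M> E) (C L E)"
      unfolding E by (rule closure_restrict_from[OF CL U aE0 E0U g sc s0])
    note P = sub_L[OF CL Eo]
    obtain F where F: "finite F" "F \<subseteq> C L E"
      "\<forall>Q. submodule Q (\<O> E) (\<M> E) \<and> F \<subseteq> Q \<longrightarrow> C L E \<subseteq> Q"
      using noeth[unfolded noetherian_module_def, rule_format, OF P] by blast
    obtain e where e: "e \<in> carrier (\<O> E)" "x \<in> D E e"
      and eF: "\<forall>t\<in>F. \<mu> E (D E e) t \<in> cl (D E e) (\<M> (D E e)) (L (D E e))"
      using finite_common_closure[OF L aE xE F(1,2)] by blast
    let ?W = "D E e"
    have W: "aff ?W" by (rule aff_D[OF aE e(1)])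
    have clW: "submodule (cl ?W (\<M> ?W) (L ?W)) (\<O> ?W) (\<M> ?W)"
      by (rule cl_submodule(1)[OF preclosure W sub_L[OF L D_open]])
    \<comment> \<open>A submodule over \<open>E\<close> that contains the generators
      \<open>F\<close>, hence all of \<open>C L E\<close>.\<close>
    let ?Q = "{t \<in> carrier (\<M> E). \<mu> E ?W t \<in> cl ?W (\<M> ?W) (L ?W)}"
    have "submodule ?Q (\<O> E) (\<M> E)" by (rule submodule_preimage[OF Eo D_open D_subset clW])
    moreover have "F \<subseteq> ?Q" using F(2) eF mem_C by blast
    ultimately have "C L E \<subseteq> ?Q" using F(3) by blast
    then have "\<mu> E ?W ` C L E \<subseteq> cl ?W (\<M> ?W) (L ?W)" by blast
    \<comment> \<open>Persistence with the closure of \<open>L ?W\<close> as target: only the image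
      of \<open>C L E\<close> has to lie in it, not all of \<open>C L ?W\<close>.\<close>
    then have "\<mu> E ?W (\<mu> U E s) \<in> cl ?W (\<M> ?W) (cl ?W (\<M> ?W) (L ?W))"
      by (rule closure_persists[OF preclosure persistent aE quasi_coherent_localizes[OF qc aE] e(1) P clW _ sE])
    moreover have "cl ?W (\<M> ?W) (cl ?W (\<M> ?W) (L ?W)) = cl ?W (\<M> ?W) (L ?W)"
    proof -
      have "affine_open X ?W" using W affine_open_iff_aff by blast
      then have "closure_operation {L. submodule L (\<O> ?W) (\<M> ?W)} (\<subseteq>) (cl ?W (\<M> ?W))"
        using clo module_M[OF D_open] unfolding closure_on_modules_def by blast
      then show ?thesis using sub_L[OF L D_open] unfolding closure_operation_def by blast
    qed
    moreover have "\<mu> E ?W (\<mu> U E s) = \<mu> U ?W s" by (rule mu_trans[OF U Eo D_open D_subset EU sc])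
    ultimately have "\<mu> U ?W s \<in> cl ?W (\<M> ?W) (L ?W)" by simp
    moreover have "?W \<subseteq> U" using EU D_subset by blast
    ultimately show "\<exists>V. aff V \<and> x \<in> V \<and> V \<subseteq> U \<and> \<mu> U V s \<in> cl V (\<M> V) (L V)"
      using W e(2) by blast
  qed
qed

lemma mem_sheaf_closure_iff_cover:
  assumes s: "s \<in> carrier (\<M> U)"
  shows "s \<in> C L U \<longleftrightarrow> (\<exists>\<C>. (\<forall>V\<in>\<C>. affine_open X V \<and> V \<subseteq> U) \<and> U = \<Union>\<C> \<and>
    (\<forall>V\<in>\<C>. \<mu> U V s \<in> cl V (\<M> V) (L V)))" (is "?L \<longleftrightarrow> (\<exists>\<C>. ?R \<C>)")
proof
  assume ?L
  \<comment> \<open>The cover by all admissible affine open subsets.\<close>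
  let ?C = "{V. affine_open X V \<and> V \<subseteq> U \<and> \<mu> U V s \<in> cl V (\<M> V) (L V)}"
  have "U \<subseteq> \<Union>?C" using \<open>?L\<close> unfolding sheaf_closure_def by blast
  then have "U = \<Union>?C" by blast
  then have "?R ?C" by simp
  then show "\<exists>\<C>. ?R \<C>" by (rule exI[where x = ?C])
next
  assume "\<exists>\<C>. ?R \<C>"
  then obtain \<C> where C: "?R \<C>" ..
  show ?L unfolding sheaf_closure_def
  proof (intro CollectI conjI ballI s)
    fix x assume "x \<in> U"
    then obtain V where "V \<in> \<C>" "x \<in> V" using C by blast
    then show "\<exists>V. affine_open X V \<and> x \<in> V \<and> V \<subseteq> U \<and> \<mu> U V s \<in> cl V (\<M> V) (L V)" using C by blast
  qed
qed

end

theorem mainTheorem1: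
  fixes X :: "('x, 'r) ringed_space"
    and cl :: "('x, 'r, 'm) module_operation"
    and M :: "('x, 'r, 'm) sheaf_module"
  assumes "scheme X"
    and "preclosure_on_modules X cl"
    and "openly_persistent X cl"
    and "quasi_coherent X M"
  shows
    "(\<forall>L. submodule_sheaf X M L \<longrightarrow>
        (\<forall>U. openin (space_top X) U \<longrightarrow> (\<forall>s\<in>carrier (msec M U).
          s \<in> sheaf_closure X cl M L U \<longleftrightarrow>
          (\<exists>\<C>. (\<forall>V\<in>\<C>. affine_open X V \<and> V \<subseteq> U) \<and> U = \<Union>\<C> \<and>
               (\<forall>V\<in>\<C>. mres M U V s \<in> cl V (msec M V) (L V)))))) \<and>
     (\<forall>L. submodule_sheaf X M L \<longrightarrow> submodule_sheaf X M (sheaf_closure X cl M L)) \<and>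
     ((\<forall>L. submodule_sheaf X M L \<longrightarrow>
         (\<forall>U. openin (space_top X) U \<longrightarrow> L U \<subseteq> sheaf_closure X cl M L U)) \<and>
      (\<forall>K L. submodule_sheaf X M K \<and> submodule_sheaf X M L \<and>
         (\<forall>U. openin (space_top X) U \<longrightarrow> K U \<subseteq> L U) \<longrightarrow>
         (\<forall>U. openin (space_top X) U \<longrightarrow>
            sheaf_closure X cl M K U \<subseteq> sheaf_closure X cl M L U))) \<and>
     (noetherian_scheme X \<and> coherent X M \<and> closure_on_modules X cl \<longrightarrow>
       (\<forall>L. submodule_sheaf X M L \<longrightarrow>
         (\<forall>U. openin (space_top X) U \<longrightarrow>
            sheaf_closure X cl M (sheaf_closure X cl M L) U = sheaf_closure X cl M L U)))"
proof -
  have "ringed_space X" using assms(1) unfolding scheme_def locally_ringed_space_def by blast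
  moreover have "O_module X M" using assms(4) unfolding quasi_coherent_def by blast
  ultimately interpret closure_sheaf X M cl
    using assms by unfold_locales
  show ?thesis
  proof (intro conjI allI impI ballI)
    fix L U s
    assume "s \<in> carrier (\<M> U)"
    then show "s \<in> C L U \<longleftrightarrow> (\<exists>\<C>. (\<forall>V\<in>\<C>. affine_open X V \<and> V \<subseteq> U) \<and> U = \<Union>\<C> \<and>
        (\<forall>V\<in>\<C>. \<mu> U V s \<in> cl V (\<M> V) (L V)))"
      by (rule mem_sheaf_closure_iff_cover)
  next
    fix L assume "submodule_sheaf X M L"
    then show "submodule_sheaf X M (C L)" by (rule submodule_sheaf_C)
  next
    fix L U assume "submodule_sheaf X M L" "opn U"
    then show "L U \<subseteq> C L U" by (rule C_extensive)
  next
    fix K L U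
    assume "submodule_sheaf X M K \<and> submodule_sheaf X M L \<and> (\<forall>U. opn U \<longrightarrow> K U \<subseteq> L U)" and "opn U"
    then show "C K U \<subseteq> C L U" using C_mono by blast
  next
    fix L U
    assume "noetherian_scheme X \<and> coherent X M \<and> closure_on_modules X cl"
      and "submodule_sheaf X M L" "opn U"
    then show "C (C L) U = C L U" using C_idempotent by blast
  qed
qed

end
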